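(* There exists a cartesian 2-functor $p : \mathcal{D}\mathsf{bl}_{\bullet} \to \mathcal{N}\mathsf{iche}_r$ from the 2-category of pointed double categories to the 2-category of right niches which sends a pointed double category $d_\bullet : \bullet \to \mathbb{D}$ to the right niche consisting of the loose hom bimodule $\mathsf{Hom}^{l}(\mathbb{D}) : \mathbb{D} ⇸ \mathbb{D}$, the left leg $d_\bullet : \bullet \to \mathbb{D}$, and the right leg $\mathrm{id} : \mathbb{D} \to \mathbb{D}$.
   Context: All 2-categories are strict. A 2-category is cartesian if it has all finite (strict, $\mathsf{Cat}$-enriched) products; a 2-functor is cartesian if it preserves finite products. Double categories are pseudo double categories: tight morphisms compose strictly, loose morphisms (written $⇸$) compose up to coherent isomorphism. $\mathcal{D}\mathsf{bl}$ is the 2-category of double categories, pseudo double functors, and tight transformations (components are tight morphisms at objects and squares at loose morphisms). $\bullet$ is the terminal double category. Commuters: a square $f$ with tight sides $f_0 : x_0\to y_0$, $f_1 : x_1\to y_1$, loose top $x : x_0 ⇸ x_1$ and loose bottom $y : y_0 ⇸ y_1$ is a companion commuter cell if $f_0,f_1$ have companions $f_0^{>},f_1^{>}$ and the associated globular transpose $x\odot f_1^{>} \Rightarrow f_0^{>}\odot y$ is an isomorphism; it is a conjoint commuter cell if $f_0,f_1$ have conjoints $f_0^{<}, f_1^{<}$ and the associated globular transpose $f_0^{<}\odot x \Rightarrow y\odot f_1^{<}$ is an isomorphism. A tight transformation is a companion (conjoint) commuter transformation if all its tight components have companions (conjoints) and all its component squares are companion (conjoint) commuter cells. Loose bimodules: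 $\mathbb{L}\mathsf{oose}$ is the free strict double category on one loose arrow $0 ⇸ 1$. ${\ell}\mathcal{B}\mathsf{imod}$ is the strict slice 2-category $\mathcal{D}\mathsf{bl}\downarrow\mathbb{L}\mathsf{oose}$; its objects are loose bimodules $M : \mathbb{M}\to\mathbb{L}\mathsf{oose}$. The source $M_0$ and target $M_1$ are the pullbacks of $M$ along $0,1:\bullet\to\mathbb{L}\mathsf{oose}$; one writes $M : M_0 ⇸ M_1$. The loose hom bimodule $\mathsf{Hom}^{l}(\mathbb{D}) : \mathbb{D} ⇸ \mathbb{D}$ is the projection $\mathbb{D}\times\mathbb{L}\mathsf{oose}\to\mathbb{L}\mathsf{oose}$. Niches: the 2-category $\mathcal{N}\mathsf{iche}$ has as objects (niches) loose bimodules $M$ with double functors $F_0:\mathbb{E}_0\to M_0$ and $F_1:\mathbb{E}_1\to M_1$. A 1-cell $(M,F_0,F_1)\to(M',F_0',F_1')$ is a map $a:M\to M'$ of loose bimodules (restricting to $a_i:M_i\to M_i'$), double functors $f_i:\mathbb{E}_i\to\mathbb{E}_i'$, and tight transformations $\overline f_i : a_iF_i\Rightarrow F_i'f_i$, where $\overline f_0$ is a conjoint commuter transformation and $\overline f_1$ is a companion commuter transformation. A 2-cell is a 2-cell $\alpha:a\Rightarrow b$ of loose bimodules with tight transformations $\phi_i : f_i\Rightarrow g_i$ such that $\overline g_i\circ(\alpha_iF_i) = (F_i'\phi_i)\circ\overline f_i$. Pointed double categories: $\mathcal{D}\mathsf{bl}_{\bullet}$ has as objects double categories $\mathbb{D}$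 with an object $d_\bullet$, i.e. a double functor $d_\bullet:\bullet\to\mathbb{D}$; 1-cells $(\mathbb{D},d_\bullet)\to(\mathbb{D}',d'_\bullet)$ are double functors $f$ together with a tight isomorphism $f(d_\bullet)\to d'_\bullet$ which is a conjoint commuter (as a transformation $f d_\bullet\Rightarrow d'_\bullet$); 2-cells are tight transformations compatible with these isomorphisms. A right niche is a niche with $\mathbb{E}_0=\bullet$. The 2-category $\mathcal{N}\mathsf{iche}_r$ is obtained from $\mathcal{N}\mathsf{iche}$ by restricting to right niches, 1-cells whose component on the left leg is a 1-cell of $\mathcal{D}\mathsf{bl}_\bullet$, and all 2-cells between them. *)

theory Defs
  imports "HOL-Library.FuncSet" "HOL-Library.Infinite_Typeclass"
begin

section \<open>Strict 2-categories\<close>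

text \<open>Compositions are written in function order: \<open>cmp1 T g f\<close> is \<open>g\<close> after \<open>f\<close>,
  \<open>vcmp2 T b a\<close> is \<open>b\<close> after \<open>a\<close>, and \<open>hcmp2 T b a\<close> is the horizontal composite whose
  first factor is \<open>a\<close>.\<close>

record ('o, 'a, 'c) twocat =
  cells0 :: "'o set"
  cells1 :: "'a set"
  cells2 :: "'c set"
  dom1 :: "'a \<Rightarrow> 'o"
  cod1 :: "'a \<Rightarrow> 'o"
  src2 :: "'c \<Rightarrow> 'a"
  tgt2 :: "'c \<Rightarrow> 'a"
  id1 :: "'o \<Rightarrow> 'a"
  cmp1 :: "'a \<Rightarrow> 'a \<Rightarrow> 'a"
  id2 :: "'a \<Rightarrow> 'c"
  vcmp2 :: "'c \<Rightarrow> 'c \<Rightarrow> 'c"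
  hcmp2 :: "'c \<Rightarrow> 'c \<Rightarrow> 'c"

definition hom1 :: "('o, 'a, 'c) twocat \<Rightarrow> 'o \<Rightarrow> 'o \<Rightarrow> 'a set" where
  "hom1 T x y = {f \<in> cells1 T. dom1 T f = x \<and> cod1 T f = y}"

definition hom2 :: "('o, 'a, 'c) twocat \<Rightarrow> 'a \<Rightarrow> 'a \<Rightarrow> 'c set" where
  "hom2 T f g = {a \<in> cells2 T. src2 T a = f \<and> tgt2 T a = g}"

locale two_category =
  fixes T :: "('o, 'a, 'c) twocat"
  assumes dom1_in: "f \<in> cells1 T \<Longrightarrow> dom1 T f \<in> cells0 T"
    and cod1_in: "f \<in> cells1 T \<Longrightarrow> cod1 T f \<in> cells0 T"
    and id1_hom: "x \<in> cells0 T \<Longrightarrow> id1 T x \<in> hom1 T x x"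
    and cmp1_hom: "\<lbrakk>f \<in> hom1 T x y; g \<in> hom1 T y z\<rbrakk> \<Longrightarrow> cmp1 T g f \<in> hom1 T x z"
    and cmp1_id_left: "f \<in> hom1 T x y \<Longrightarrow> cmp1 T (id1 T y) f = f"
    and cmp1_id_right: "f \<in> hom1 T x y \<Longrightarrow> cmp1 T f (id1 T x) = f"
    and cmp1_assoc: "\<lbrakk>f \<in> hom1 T x y; g \<in> hom1 T y z; h \<in> hom1 T z w\<rbrakk>
        \<Longrightarrow> cmp1 T (cmp1 T h g) f = cmp1 T h (cmp1 T g f)"
    and src2_in: "a \<in> cells2 T \<Longrightarrow> src2 T a \<in> cells1 T"
    and tgt2_in: "a \<in> cells2 T \<Longrightarrow> tgt2 T a \<in> cells1 T"
    and parallel: "a \<in> cells2 T \<Longrightarrow> dom1 T (src2 T a) = dom1 T (tgt2 T a) \<and>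
        cod1 T (src2 T a) = cod1 T (tgt2 T a)"
    and id2_hom: "f \<in> cells1 T \<Longrightarrow> id2 T f \<in> hom2 T f f"
    and vcmp2_hom: "\<lbrakk>a \<in> hom2 T f g; b \<in> hom2 T g h\<rbrakk> \<Longrightarrow> vcmp2 T b a \<in> hom2 T f h"
    and vcmp2_id_left: "a \<in> hom2 T f g \<Longrightarrow> vcmp2 T (id2 T g) a = a"
    and vcmp2_id_right: "a \<in> hom2 T f g \<Longrightarrow> vcmp2 T a (id2 T f) = a"
    and vcmp2_assoc: "\<lbrakk>a \<in> hom2 T f g; b \<in> hom2 T g h; c \<in> hom2 T h k\<rbrakk>
        \<Longrightarrow> vcmp2 T (vcmp2 T c b) a = vcmp2 T c (vcmp2 T b a)"
    and hcmp2_hom: "\<lbrakk>a \<in> hom2 T f f'; b \<in> hom2 T g g'; cod1 T f = dom1 T g\<rbrakk>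
        \<Longrightarrow> hcmp2 T b a \<in> hom2 T (cmp1 T g f) (cmp1 T g' f')"
    and hcmp2_id: "\<lbrakk>f \<in> hom1 T x y; g \<in> hom1 T y z\<rbrakk>
        \<Longrightarrow> hcmp2 T (id2 T g) (id2 T f) = id2 T (cmp1 T g f)"
    and interchange: "\<lbrakk>a \<in> hom2 T f f'; a' \<in> hom2 T f' f''; b \<in> hom2 T g g'; b' \<in> hom2 T g' g'';
        cod1 T f = dom1 T g\<rbrakk>
        \<Longrightarrow> hcmp2 T (vcmp2 T b' b) (vcmp2 T a' a) = vcmp2 T (hcmp2 T b' a') (hcmp2 T b a)"
    and hcmp2_id_left: "\<lbrakk>a \<in> hom2 T f g; cod1 T f = y\<rbrakk> \<Longrightarrow> hcmp2 T (id2 T (id1 T y)) a = a"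
    and hcmp2_id_right: "\<lbrakk>a \<in> hom2 T f g; dom1 T f = x\<rbrakk> \<Longrightarrow> hcmp2 T a (id2 T (id1 T x)) = a"
    and hcmp2_assoc: "\<lbrakk>a \<in> hom2 T f f'; b \<in> hom2 T g g'; c \<in> hom2 T h h';
        cod1 T f = dom1 T g; cod1 T g = dom1 T h\<rbrakk>
        \<Longrightarrow> hcmp2 T (hcmp2 T c b) a = hcmp2 T c (hcmp2 T b a)"

record ('o, 'a, 'c, 'p, 'b, 'd) twofun =
  on0 :: "'o \<Rightarrow> 'p"
  on1 :: "'a \<Rightarrow> 'b"
  on2 :: "'c \<Rightarrow> 'd"

locale two_functor =
  S: two_category S + T: two_category T
  for S :: "('o, 'a, 'c) twocat" and T :: "('p, 'b, 'd) twocat"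
    and P :: "('o, 'a, 'c, 'p, 'b, 'd) twofun" +
  assumes on0_in: "x \<in> cells0 S \<Longrightarrow> on0 P x \<in> cells0 T"
    and on1_hom: "f \<in> hom1 S x y \<Longrightarrow> on1 P f \<in> hom1 T (on0 P x) (on0 P y)"
    and on2_hom: "a \<in> hom2 S f g \<Longrightarrow> on2 P a \<in> hom2 T (on1 P f) (on1 P g)"
    and on1_id: "x \<in> cells0 S \<Longrightarrow> on1 P (id1 S x) = id1 T (on0 P x)"
    and on1_cmp: "\<lbrakk>f \<in> hom1 S x y; g \<in> hom1 S y z\<rbrakk>
        \<Longrightarrow> on1 P (cmp1 S g f) = cmp1 T (on1 P g) (on1 P f)"
    and on2_id: "f \<in> cells1 S \<Longrightarrow> on2 P (id2 S f) = id2 T (on1 P f)"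
    and on2_vcmp: "\<lbrakk>a \<in> hom2 S f g; b \<in> hom2 S g h\<rbrakk>
        \<Longrightarrow> on2 P (vcmp2 S b a) = vcmp2 T (on2 P b) (on2 P a)"
    and on2_hcmp: "\<lbrakk>a \<in> hom2 S f f'; b \<in> hom2 S g g'; cod1 S f = dom1 S g\<rbrakk>
        \<Longrightarrow> on2 P (hcmp2 S b a) = hcmp2 T (on2 P b) (on2 P a)"

text \<open>A strict (\<open>Cat\<close>-enriched) product cone: for every \<open>z\<close>, composition with the projections
  is an isomorphism of categories from \<open>hom(z, y)\<close> to the product of the \<open>hom(z, X i)\<close>.
  The two uniqueness clauses are its bijectivity on objects and on morphisms.\<close>

definition is_product ::
  "('o, 'a, 'c) twocat \<Rightarrow> nat \<Rightarrow> (nat \<Rightarrow> 'o) \<Rightarrow> 'o \<Rightarrow> (nat \<Rightarrow> 'a) \<Rightarrow> bool" where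
  "is_product T n X y \<pi> \<longleftrightarrow>
     y \<in> cells0 T \<and> (\<forall>i<n. X i \<in> cells0 T \<and> \<pi> i \<in> hom1 T y (X i)) \<and>
     (\<forall>z \<in> cells0 T.
        (\<forall>f. (\<forall>i<n. f i \<in> hom1 T z (X i)) \<longrightarrow>
             (\<exists>!h. h \<in> hom1 T z y \<and> (\<forall>i<n. cmp1 T (\<pi> i) h = f i))) \<and>
        (\<forall>h \<in> hom1 T z y. \<forall>k \<in> hom1 T z y. \<forall>a.
             (\<forall>i<n. a i \<in> hom2 T (cmp1 T (\<pi> i) h) (cmp1 T (\<pi> i) k)) \<longrightarrow>
             (\<exists>!c. c \<in> hom2 T h k \<and> (\<forall>i<n. hcmp2 T (id2 T (\<pi> i)) c = a i))))"

definition cartesian_two_category :: "('o, 'a, 'c) twocat \<Rightarrow> bool" where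
  "cartesian_two_category T \<longleftrightarrow> two_category T \<and>
     (\<forall>n X. (\<forall>i<n. X i \<in> cells0 T) \<longrightarrow> (\<exists>y \<pi>. is_product T n X y \<pi>))"

definition cartesian_two_functor ::
  "('o, 'a, 'c) twocat \<Rightarrow> ('p, 'b, 'd) twocat \<Rightarrow> ('o, 'a, 'c, 'p, 'b, 'd) twofun \<Rightarrow> bool" where
  "cartesian_two_functor S T P \<longleftrightarrow>
     cartesian_two_category S \<and> cartesian_two_category T \<and> two_functor S T P \<and>
     (\<forall>n X y \<pi>. is_product S n X y \<pi> \<longrightarrow>
        is_product T n (on0 P \<circ> X) (on0 P y) (on1 P \<circ> \<pi>))"

text \<open>The strict slice of \<open>T\<close> over \<open>c\<close>. A 1-cell from \<open>m\<close> to \<open>n\<close> is a triple \<open>(m, n, f)\<close> with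
  \<open>n f = m\<close>; a 2-cell is a triple \<open>(m, n, a)\<close> such that whiskering \<open>a\<close> with \<open>n\<close> gives the
  identity of \<open>m\<close>.\<close>

definition slice ::
  "('o, 'a, 'c) twocat \<Rightarrow> 'o \<Rightarrow> ('a, 'a \<times> 'a \<times> 'a, 'a \<times> 'a \<times> 'c) twocat" where
  "slice T c =
    (let ob = {m \<in> cells1 T. cod1 T m = c};
         ar = {(m, n, f). m \<in> ob \<and> n \<in> ob \<and> f \<in> hom1 T (dom1 T m) (dom1 T n) \<and> cmp1 T n f = m}
     in \<lparr>cells0 = ob,
         cells1 = ar,
         cells2 = {(m, n, a). a \<in> cells2 T \<and> (m, n, src2 T a) \<in> ar \<and> (m, n, tgt2 T a) \<in> ar \<and>
                     hcmp2 T (id2 T n) a = id2 T m},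
         dom1 = (\<lambda>(m, n, f). m),
         cod1 = (\<lambda>(m, n, f). n),
         src2 = (\<lambda>(m, n, a). (m, n, src2 T a)),
         tgt2 = (\<lambda>(m, n, a). (m, n, tgt2 T a)),
         id1 = (\<lambda>m. (m, m, id1 T (dom1 T m))),
         cmp1 = (\<lambda>(n, k, g) (m, n', f). (m, k, cmp1 T g f)),
         id2 = (\<lambda>(m, n, f). (m, n, id2 T f)),
         vcmp2 = (\<lambda>(m', n', b) (m, n, a). (m, n, vcmp2 T b a)),
         hcmp2 = (\<lambda>(n, k, b) (m, n', a). (m, k, hcmp2 T b a))\<rparr>)"


section \<open>Pseudo double categories\<close>

text \<open>All cells of a double category are drawn from one type \<open>'u\<close>, which plays the role of the
  universe of small sets; where products are needed it is an infinite type, hence closed under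
  pairing.
  Tight composition \<open>g \<cdot> f\<close> and vertical composition \<open>b \<bullet> a\<close> of squares are in function
  order (\<open>a\<close> sits on top of \<open>b\<close>); loose composition \<open>x \<odot> y\<close> and horizontal composition
  \<open>a \<star> b\<close> of squares are in diagrammatic order. \<open>hid f\<close> is the loose identity square on
  a tight morphism \<open>f\<close>, and \<open>vid x\<close> the identity square on a loose morphism \<open>x\<close>.
  The operations are only meaningful on the carriers.\<close>

record 'u dbl =
  obs :: "'u set"
  tights :: "'u set"
  looses :: "'u set"
  squares :: "'u set"
  tdom :: "'u \<Rightarrow> 'u"
  tcod :: "'u \<Rightarrow> 'u"
  tid :: "'u \<Rightarrow> 'u"
  tcmp :: "'u \<Rightarrow> 'u \<Rightarrow> 'u" (infixl "\<cdot>\<index>" 75)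
  ldom :: "'u \<Rightarrow> 'u"
  lcod :: "'u \<Rightarrow> 'u"
  lid :: "'u \<Rightarrow> 'u"
  lcmp :: "'u \<Rightarrow> 'u \<Rightarrow> 'u" (infixl "\<odot>\<index>" 75)
  stop :: "'u \<Rightarrow> 'u"
  sbot :: "'u \<Rightarrow> 'u"
  sleft :: "'u \<Rightarrow> 'u"
  sright :: "'u \<Rightarrow> 'u"
  vid :: "'u \<Rightarrow> 'u"
  vcmp :: "'u \<Rightarrow> 'u \<Rightarrow> 'u" (infixl "\<bullet>\<index>" 70)
  hid :: "'u \<Rightarrow> 'u"
  hcmp :: "'u \<Rightarrow> 'u \<Rightarrow> 'u" (infixl "\<star>\<index>" 75)
  lassoc :: "'u \<Rightarrow> 'u \<Rightarrow> 'u \<Rightarrow> 'u"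
  lunit :: "'u \<Rightarrow> 'u"
  runit :: "'u \<Rightarrow> 'u"

definition tight_hom :: "'u dbl \<Rightarrow> 'u \<Rightarrow> 'u \<Rightarrow> 'u set" where
  "tight_hom D x y = {f \<in> tights D. tdom D f = x \<and> tcod D f = y}"

definition loose_hom :: "'u dbl \<Rightarrow> 'u \<Rightarrow> 'u \<Rightarrow> 'u set" where
  "loose_hom D x y = {l \<in> looses D. ldom D l = x \<and> lcod D l = y}"

definition sq_hom :: "'u dbl \<Rightarrow> 'u \<Rightarrow> 'u \<Rightarrow> 'u \<Rightarrow> 'u \<Rightarrow> 'u set" where
  "sq_hom D f g x y =
     {s \<in> squares D. sleft D s = f \<and> sright D s = g \<and> stop D s = x \<and> sbot D s = y}"

definition tight_iso :: "'u dbl \<Rightarrow> 'u \<Rightarrow> bool" where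
  "tight_iso D f \<longleftrightarrow> f \<in> tights D \<and>
     (\<exists>g \<in> tight_hom D (tcod D f) (tdom D f).
        tcmp D g f = tid D (tdom D f) \<and> tcmp D f g = tid D (tcod D f))"

definition is_sq_inverse :: "'u dbl \<Rightarrow> 'u \<Rightarrow> 'u \<Rightarrow> bool" where
  "is_sq_inverse D s t \<longleftrightarrow> s \<in> squares D \<and> t \<in> squares D \<and>
     stop D t = sbot D s \<and> sbot D t = stop D s \<and>
     vcmp D t s = vid D (stop D s) \<and> vcmp D s t = vid D (sbot D s)"

definition sq_iso :: "'u dbl \<Rightarrow> 'u \<Rightarrow> bool" where
  "sq_iso D s \<longleftrightarrow> (\<exists>t. is_sq_inverse D s t)"

definition sq_inv :: "'u dbl \<Rightarrow> 'u \<Rightarrow> 'u" where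
  "sq_inv D s = (THE t. is_sq_inverse D s t)"

text \<open>Invertible globular squares.\<close>

definition glob_iso :: "'u dbl \<Rightarrow> 'u \<Rightarrow> 'u \<Rightarrow> 'u set" where
  "glob_iso D x y = {s \<in> sq_hom D (tid D (ldom D x)) (tid D (lcod D x)) x y. sq_iso D s}"

locale double_category =
  fixes D :: "'u dbl" (structure)
  assumes tdom_in: "f \<in> tights D \<Longrightarrow> tdom D f \<in> obs D"
    and tcod_in: "f \<in> tights D \<Longrightarrow> tcod D f \<in> obs D"
    and tid_hom: "x \<in> obs D \<Longrightarrow> tid D x \<in> tight_hom D x x"
    and tcmp_hom: "\<lbrakk>f \<in> tight_hom D x y; g \<in> tight_hom D y z\<rbrakk> \<Longrightarrow> g \<cdot> f \<in> tight_hom D x z"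
    and tcmp_id_left: "f \<in> tight_hom D x y \<Longrightarrow> tid D y \<cdot> f = f"
    and tcmp_id_right: "f \<in> tight_hom D x y \<Longrightarrow> f \<cdot> tid D x = f"
    and tcmp_assoc: "\<lbrakk>f \<in> tight_hom D x y; g \<in> tight_hom D y z; h \<in> tight_hom D z w\<rbrakk>
        \<Longrightarrow> (h \<cdot> g) \<cdot> f = h \<cdot> (g \<cdot> f)"
    and ldom_in: "l \<in> looses D \<Longrightarrow> ldom D l \<in> obs D"
    and lcod_in: "l \<in> looses D \<Longrightarrow> lcod D l \<in> obs D"
    and lid_hom: "x \<in> obs D \<Longrightarrow> lid D x \<in> loose_hom D x x"
    and lcmp_hom: "\<lbrakk>l \<in> loose_hom D x y; m \<in> loose_hom D y z\<rbrakk> \<Longrightarrow> l \<odot> m \<in> loose_hom D x z"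
    and stop_in: "s \<in> squares D \<Longrightarrow> stop D s \<in> looses D"
    and sbot_in: "s \<in> squares D \<Longrightarrow> sbot D s \<in> looses D"
    and sleft_hom: "s \<in> squares D
        \<Longrightarrow> sleft D s \<in> tight_hom D (ldom D (stop D s)) (ldom D (sbot D s))"
    and sright_hom: "s \<in> squares D
        \<Longrightarrow> sright D s \<in> tight_hom D (lcod D (stop D s)) (lcod D (sbot D s))"
    and vid_hom: "l \<in> loose_hom D x y \<Longrightarrow> vid D l \<in> sq_hom D (tid D x) (tid D y) l l"
    and vcmp_hom: "\<lbrakk>s \<in> sq_hom D f g l m; t \<in> sq_hom D f' g' m n\<rbrakk>
        \<Longrightarrow> t \<bullet> s \<in> sq_hom D (f' \<cdot> f) (g' \<cdot> g) l n"
    and vcmp_id_left: "s \<in> sq_hom D f g l m \<Longrightarrow> vid D m \<bullet> s = s"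
    and vcmp_id_right: "s \<in> sq_hom D f g l m \<Longrightarrow> s \<bullet> vid D l = s"
    and vcmp_assoc: "\<lbrakk>s \<in> sq_hom D f g k l; t \<in> sq_hom D f' g' l m; u \<in> sq_hom D f'' g'' m n\<rbrakk>
        \<Longrightarrow> (u \<bullet> t) \<bullet> s = u \<bullet> (t \<bullet> s)"
    and hid_hom: "f \<in> tight_hom D x y \<Longrightarrow> hid D f \<in> sq_hom D f f (lid D x) (lid D y)"
    and hid_id: "x \<in> obs D \<Longrightarrow> hid D (tid D x) = vid D (lid D x)"
    and hid_cmp: "\<lbrakk>f \<in> tight_hom D x y; g \<in> tight_hom D y z\<rbrakk>
        \<Longrightarrow> hid D (g \<cdot> f) = hid D g \<bullet> hid D f"
    and hcmp_hom: "\<lbrakk>s \<in> sq_hom D f g l m; t \<in> sq_hom D g h l' m'\<rbrakk>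
        \<Longrightarrow> s \<star> t \<in> sq_hom D f h (l \<odot> l') (m \<odot> m')"
    and hcmp_id: "\<lbrakk>l \<in> loose_hom D x y; m \<in> loose_hom D y z\<rbrakk>
        \<Longrightarrow> vid D l \<star> vid D m = vid D (l \<odot> m)"
    and hcmp_vcmp: "\<lbrakk>s \<in> sq_hom D f g k l; s' \<in> sq_hom D f' g' l m;
        t \<in> sq_hom D g h k' l'; t' \<in> sq_hom D g' h' l' m'\<rbrakk>
        \<Longrightarrow> (s' \<bullet> s) \<star> (t' \<bullet> t) = (s' \<star> t') \<bullet> (s \<star> t)"
    and lassoc_iso: "\<lbrakk>k \<in> loose_hom D w x; l \<in> loose_hom D x y; m \<in> loose_hom D y z\<rbrakk>
        \<Longrightarrow> lassoc D k l m \<in> glob_iso D ((k \<odot> l) \<odot> m) (k \<odot> (l \<odot> m))"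
    and lunit_iso: "l \<in> loose_hom D x y \<Longrightarrow> lunit D l \<in> glob_iso D (lid D x \<odot> l) l"
    and runit_iso: "l \<in> loose_hom D x y \<Longrightarrow> runit D l \<in> glob_iso D (l \<odot> lid D y) l"
    and lassoc_natural: "\<lbrakk>r \<in> sq_hom D e f k k'; s \<in> sq_hom D f g l l'; t \<in> sq_hom D g h m m'\<rbrakk>
        \<Longrightarrow> lassoc D k' l' m' \<bullet> ((r \<star> s) \<star> t) = (r \<star> (s \<star> t)) \<bullet> lassoc D k l m"
    and lunit_natural: "s \<in> sq_hom D f g l m
        \<Longrightarrow> lunit D m \<bullet> (hid D f \<star> s) = s \<bullet> lunit D l"
    and runit_natural: "s \<in> sq_hom D f g l m
        \<Longrightarrow> runit D m \<bullet> (s \<star> hid D g) = s \<bullet> runit D l"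
    and pentagon: "\<lbrakk>j \<in> loose_hom D v w; k \<in> loose_hom D w x; l \<in> loose_hom D x y;
        m \<in> loose_hom D y z\<rbrakk>
        \<Longrightarrow> lassoc D j k (l \<odot> m) \<bullet> lassoc D (j \<odot> k) l m
          = (vid D j \<star> lassoc D k l m) \<bullet> (lassoc D j (k \<odot> l) m \<bullet> (lassoc D j k l \<star> vid D m))"
    and triangle: "\<lbrakk>l \<in> loose_hom D x y; m \<in> loose_hom D y z\<rbrakk>
        \<Longrightarrow> (vid D l \<star> lunit D m) \<bullet> lassoc D l (lid D y) m = runit D l \<star> vid D m"


section \<open>Double functors and tight transformations\<close>

text \<open>A double functor carries its domain and codomain, the strict actions on objects, tight
  morphisms, loose morphisms and squares, and the comparison squares
  \<open>fcomp x y : F x \<odot> F y \<Rightarrow> F (x \<odot> y)\<close> and \<open>funit x : id (F x) \<Rightarrow> F (id x)\<close>. All components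
  are \<open>undefined\<close> outside the domain, so that equality of records is equality of double functors.
  The same holds for transformations.\<close>

record 'u dfun =
  ddom :: "'u dbl"
  dcod :: "'u dbl"
  fob :: "'u \<Rightarrow> 'u"
  ftight :: "'u \<Rightarrow> 'u"
  floose :: "'u \<Rightarrow> 'u"
  fsq :: "'u \<Rightarrow> 'u"
  fcomp :: "'u \<Rightarrow> 'u \<Rightarrow> 'u"
  funit :: "'u \<Rightarrow> 'u"

definition composable :: "'u dbl \<Rightarrow> 'u \<Rightarrow> 'u \<Rightarrow> bool" where
  "composable D l m \<longleftrightarrow> l \<in> looses D \<and> m \<in> looses D \<and> lcod D l = ldom D m"

definition restrict_comp :: "'u dbl \<Rightarrow> ('u \<Rightarrow> 'u \<Rightarrow> 'u) \<Rightarrow> 'u \<Rightarrow> 'u \<Rightarrow> 'u" where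
  "restrict_comp D c = (\<lambda>l m. if composable D l m then c l m else undefined)"

locale double_functor =
  A: double_category A + B: double_category B
  for A :: "'u dbl" and B :: "'u dbl" and F :: "'u dfun" +
  assumes ddom: "ddom F = A" and dcod: "dcod F = B"
    and fob_ext: "fob F \<in> extensional (obs A)"
    and ftight_ext: "ftight F \<in> extensional (tights A)"
    and floose_ext: "floose F \<in> extensional (looses A)"
    and fsq_ext: "fsq F \<in> extensional (squares A)"
    and fcomp_ext: "restrict_comp A (fcomp F) = fcomp F"
    and funit_ext: "funit F \<in> extensional (obs A)"
    and fob_in: "x \<in> obs A \<Longrightarrow> fob F x \<in> obs B"
    and ftight_hom: "f \<in> tight_hom A x y \<Longrightarrow> ftight F f \<in> tight_hom B (fob F x) (fob F y)"
    and floose_hom: "l \<in> loose_hom A x y \<Longrightarrow> floose F l \<in> loose_hom B (fob F x) (fob F y)"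
    and fsq_hom: "s \<in> sq_hom A f g l m
        \<Longrightarrow> fsq F s \<in> sq_hom B (ftight F f) (ftight F g) (floose F l) (floose F m)"
    and ftight_id: "x \<in> obs A \<Longrightarrow> ftight F (tid A x) = tid B (fob F x)"
    and ftight_cmp: "\<lbrakk>f \<in> tight_hom A x y; g \<in> tight_hom A y z\<rbrakk>
        \<Longrightarrow> ftight F (g \<cdot>\<^bsub>A\<^esub> f) = ftight F g \<cdot>\<^bsub>B\<^esub> ftight F f"
    and fsq_id: "l \<in> looses A \<Longrightarrow> fsq F (vid A l) = vid B (floose F l)"
    and fsq_vcmp: "\<lbrakk>s \<in> sq_hom A f g l m; t \<in> sq_hom A f' g' m n\<rbrakk>
        \<Longrightarrow> fsq F (t \<bullet>\<^bsub>A\<^esub> s) = fsq F t \<bullet>\<^bsub>B\<^esub> fsq F s"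
    and fcomp_iso: "\<lbrakk>l \<in> loose_hom A x y; m \<in> loose_hom A y z\<rbrakk>
        \<Longrightarrow> fcomp F l m \<in> glob_iso B (floose F l \<odot>\<^bsub>B\<^esub> floose F m) (floose F (l \<odot>\<^bsub>A\<^esub> m))"
    and funit_iso: "x \<in> obs A \<Longrightarrow> funit F x \<in> glob_iso B (lid B (fob F x)) (floose F (lid A x))"
    and fcomp_natural: "\<lbrakk>s \<in> sq_hom A f g l m; t \<in> sq_hom A g h l' m'\<rbrakk>
        \<Longrightarrow> fsq F (s \<star>\<^bsub>A\<^esub> t) \<bullet>\<^bsub>B\<^esub> fcomp F l l' = fcomp F m m' \<bullet>\<^bsub>B\<^esub> (fsq F s \<star>\<^bsub>B\<^esub> fsq F t)"
    and funit_natural: "f \<in> tight_hom A x y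
        \<Longrightarrow> fsq F (hid A f) \<bullet>\<^bsub>B\<^esub> funit F x = funit F y \<bullet>\<^bsub>B\<^esub> hid B (ftight F f)"
    and fcomp_assoc: "\<lbrakk>k \<in> loose_hom A w x; l \<in> loose_hom A x y; m \<in> loose_hom A y z\<rbrakk>
        \<Longrightarrow> fsq F (lassoc A k l m) \<bullet>\<^bsub>B\<^esub>
              (fcomp F (k \<odot>\<^bsub>A\<^esub> l) m \<bullet>\<^bsub>B\<^esub> (fcomp F k l \<star>\<^bsub>B\<^esub> vid B (floose F m)))
          = fcomp F k (l \<odot>\<^bsub>A\<^esub> m) \<bullet>\<^bsub>B\<^esub> ((vid B (floose F k) \<star>\<^bsub>B\<^esub> fcomp F l m) \<bullet>\<^bsub>B\<^esub>
              lassoc B (floose F k) (floose F l) (floose F m))"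
    and funit_left: "l \<in> loose_hom A x y
        \<Longrightarrow> fsq F (lunit A l) \<bullet>\<^bsub>B\<^esub>
              (fcomp F (lid A x) l \<bullet>\<^bsub>B\<^esub> (funit F x \<star>\<^bsub>B\<^esub> vid B (floose F l)))
          = lunit B (floose F l)"
    and funit_right: "l \<in> loose_hom A x y
        \<Longrightarrow> fsq F (runit A l) \<bullet>\<^bsub>B\<^esub>
              (fcomp F l (lid A y) \<bullet>\<^bsub>B\<^esub> (vid B (floose F l) \<star>\<^bsub>B\<^esub> funit F y))
          = runit B (floose F l)"

text \<open>The double functor with given actions and identity comparison squares; it is used for
  assignments that preserve the loose structure strictly.\<close>

definition strict_dfun ::
  "'u dbl \<Rightarrow> 'u dbl \<Rightarrow> ('u \<Rightarrow> 'u) \<Rightarrow> ('u \<Rightarrow> 'u) \<Rightarrow> ('u \<Rightarrow> 'u) \<Rightarrow> ('u \<Rightarrow> 'u) \<Rightarrow> 'u dfun" where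
  "strict_dfun A B fo ft fl fs =
     \<lparr>ddom = A, dcod = B,
      fob = restrict fo (obs A),
      ftight = restrict ft (tights A),
      floose = restrict fl (looses A),
      fsq = restrict fs (squares A),
      fcomp = restrict_comp A (\<lambda>l m. vid B (fl (l \<odot>\<^bsub>A\<^esub> m))),
      funit = (\<lambda>x\<in>obs A. vid B (fl (lid A x)))\<rparr>"

definition dfun_id :: "'u dbl \<Rightarrow> 'u dfun" where
  "dfun_id A = strict_dfun A A (\<lambda>x. x) (\<lambda>f. f) (\<lambda>l. l) (\<lambda>s. s)"

definition dfun_cmp :: "'u dfun \<Rightarrow> 'u dfun \<Rightarrow> 'u dfun" where
  "dfun_cmp G F =
     \<lparr>ddom = ddom F, dcod = dcod G,
      fob = compose (obs (ddom F)) (fob G) (fob F),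
      ftight = compose (tights (ddom F)) (ftight G) (ftight F),
      floose = compose (looses (ddom F)) (floose G) (floose F),
      fsq = compose (squares (ddom F)) (fsq G) (fsq F),
      fcomp = restrict_comp (ddom F)
        (\<lambda>l m. fsq G (fcomp F l m) \<bullet>\<^bsub>dcod G\<^esub> fcomp G (floose F l) (floose F m)),
      funit = (\<lambda>x\<in>obs (ddom F). fsq G (funit F x) \<bullet>\<^bsub>dcod G\<^esub> funit G (fob F x))\<rparr>"

record 'u ttrans =
  tsrc :: "'u dfun"
  ttgt :: "'u dfun"
  tob :: "'u \<Rightarrow> 'u"
  tloose :: "'u \<Rightarrow> 'u"

locale tight_transformation =
  F: double_functor A B F + G: double_functor A B G
  for A :: "'u dbl" and B :: "'u dbl" and F :: "'u dfun" and G :: "'u dfun"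
    and t :: "'u ttrans" +
  assumes tsrc: "tsrc t = F" and ttgt: "ttgt t = G"
    and tob_ext: "tob t \<in> extensional (obs A)"
    and tloose_ext: "tloose t \<in> extensional (looses A)"
    and tob_hom: "x \<in> obs A \<Longrightarrow> tob t x \<in> tight_hom B (fob F x) (fob G x)"
    and tloose_hom: "l \<in> loose_hom A x y
        \<Longrightarrow> tloose t l \<in> sq_hom B (tob t x) (tob t y) (floose F l) (floose G l)"
    and tob_natural: "f \<in> tight_hom A x y
        \<Longrightarrow> ftight G f \<cdot>\<^bsub>B\<^esub> tob t x = tob t y \<cdot>\<^bsub>B\<^esub> ftight F f"
    and tloose_natural: "s \<in> sq_hom A f g l m
        \<Longrightarrow> fsq G s \<bullet>\<^bsub>B\<^esub> tloose t l = tloose t m \<bullet>\<^bsub>B\<^esub> fsq F s"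
    and tloose_cmp: "\<lbrakk>l \<in> loose_hom A x y; m \<in> loose_hom A y z\<rbrakk>
        \<Longrightarrow> tloose t (l \<odot>\<^bsub>A\<^esub> m) \<bullet>\<^bsub>B\<^esub> fcomp F l m
          = fcomp G l m \<bullet>\<^bsub>B\<^esub> (tloose t l \<star>\<^bsub>B\<^esub> tloose t m)"
    and tloose_id: "x \<in> obs A
        \<Longrightarrow> tloose t (lid A x) \<bullet>\<^bsub>B\<^esub> funit F x = funit G x \<bullet>\<^bsub>B\<^esub> hid B (tob t x)"

definition ttrans_id :: "'u dfun \<Rightarrow> 'u ttrans" where
  "ttrans_id F =
     \<lparr>tsrc = F, ttgt = F,
      tob = (\<lambda>x\<in>obs (ddom F). tid (dcod F) (fob F x)),
      tloose = (\<lambda>l\<in>looses (ddom F). vid (dcod F) (floose F l))\<rparr>"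

definition ttrans_vcmp :: "'u ttrans \<Rightarrow> 'u ttrans \<Rightarrow> 'u ttrans" where
  "ttrans_vcmp b a = (let A = ddom (tsrc a); B = dcod (tsrc a) in
     \<lparr>tsrc = tsrc a, ttgt = ttgt b,
      tob = (\<lambda>x\<in>obs A. tob b x \<cdot>\<^bsub>B\<^esub> tob a x),
      tloose = (\<lambda>l\<in>looses A. tloose b l \<bullet>\<^bsub>B\<^esub> tloose a l)\<rparr>)"

definition ttrans_hcmp :: "'u ttrans \<Rightarrow> 'u ttrans \<Rightarrow> 'u ttrans" where
  "ttrans_hcmp b a = (let A = ddom (tsrc a); C = dcod (tsrc b); G = tsrc b; F' = ttgt a in
     \<lparr>tsrc = dfun_cmp (tsrc b) (tsrc a), ttgt = dfun_cmp (ttgt b) (ttgt a),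
      tob = (\<lambda>x\<in>obs A. tob b (fob F' x) \<cdot>\<^bsub>C\<^esub> ftight G (tob a x)),
      tloose = (\<lambda>l\<in>looses A. tloose b (floose F' l) \<bullet>\<^bsub>C\<^esub> fsq G (tloose a l))\<rparr>)"

definition Dbl :: "('u dbl, 'u dfun, 'u ttrans) twocat" where
  "Dbl = \<lparr>cells0 = {D. double_category D},
          cells1 = {F. double_functor (ddom F) (dcod F) F},
          cells2 = {t. tight_transformation (ddom (tsrc t)) (dcod (tsrc t)) (tsrc t) (ttgt t) t},
          dom1 = ddom, cod1 = dcod, src2 = tsrc, tgt2 = ttgt,
          id1 = dfun_id, cmp1 = dfun_cmp,
          id2 = ttrans_id, vcmp2 = ttrans_vcmp, hcmp2 = ttrans_hcmp\<rparr>"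


section \<open>Companions, conjoints and commuters\<close>

text \<open>\<open>c : x \<Rightarrow> y\<close> loose, with binding squares \<open>\<eta> : id x \<Rightarrow> c\<close> over \<open>(id, f)\<close> and
  \<open>\<epsilon> : c \<Rightarrow> id y\<close> over \<open>(f, id)\<close>. The last equation is \<open>\<eta> \<star> \<epsilon> = id c\<close> up to unitors.\<close>

definition companion :: "'u dbl \<Rightarrow> 'u \<Rightarrow> 'u \<Rightarrow> 'u \<Rightarrow> 'u \<Rightarrow> bool" where
  "companion D f c \<eta> \<epsilon> \<longleftrightarrow> (let x = tdom D f; y = tcod D f in
     f \<in> tights D \<and> c \<in> loose_hom D x y \<and>
     \<eta> \<in> sq_hom D (tid D x) f (lid D x) c \<and>
     \<epsilon> \<in> sq_hom D f (tid D y) c (lid D y) \<and>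
     \<epsilon> \<bullet>\<^bsub>D\<^esub> \<eta> = hid D f \<and>
     runit D c \<bullet>\<^bsub>D\<^esub> (\<eta> \<star>\<^bsub>D\<^esub> \<epsilon>) = lunit D c)"

definition conjoint :: "'u dbl \<Rightarrow> 'u \<Rightarrow> 'u \<Rightarrow> 'u \<Rightarrow> 'u \<Rightarrow> bool" where
  "conjoint D f c \<eta> \<epsilon> \<longleftrightarrow> (let x = tdom D f; y = tcod D f in
     f \<in> tights D \<and> c \<in> loose_hom D y x \<and>
     \<eta> \<in> sq_hom D f (tid D x) (lid D x) c \<and>
     \<epsilon> \<in> sq_hom D (tid D y) f c (lid D y) \<and>
     \<epsilon> \<bullet>\<^bsub>D\<^esub> \<eta> = hid D f \<and>
     lunit D c \<bullet>\<^bsub>D\<^esub> (\<epsilon> \<star>\<^bsub>D\<^esub> \<eta>) = runit D c)"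

definition has_companion :: "'u dbl \<Rightarrow> 'u \<Rightarrow> bool" where
  "has_companion D f \<longleftrightarrow> (\<exists>c \<eta> \<epsilon>. companion D f c \<eta> \<epsilon>)"

definition has_conjoint :: "'u dbl \<Rightarrow> 'u \<Rightarrow> bool" where
  "has_conjoint D f \<longleftrightarrow> (\<exists>c \<eta> \<epsilon>. conjoint D f c \<eta> \<epsilon>)"

text \<open>For a square \<open>s\<close> with top \<open>x\<close>, bottom \<open>y\<close> and sides \<open>f\<^sub>0\<close>, \<open>f\<^sub>1\<close>, these are
  \<open>x \<odot> c\<^sub>1 \<cong> (id \<odot> x) \<odot> c\<^sub>1 \<Rightarrow> (c\<^sub>0 \<odot> y) \<odot> id \<cong> c\<^sub>0 \<odot> y\<close> for companions \<open>c\<^sub>i\<close> of \<open>f\<^sub>i\<close>, and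
  \<open>c\<^sub>0 \<odot> x \<cong> (c\<^sub>0 \<odot> x) \<odot> id \<Rightarrow> (id \<odot> y) \<odot> c\<^sub>1 \<cong> y \<odot> c\<^sub>1\<close> for conjoints \<open>c\<^sub>i\<close> of \<open>f\<^sub>i\<close>.\<close>

definition companion_transpose :: "'u dbl \<Rightarrow> 'u \<Rightarrow> 'u \<Rightarrow> 'u \<Rightarrow> 'u \<Rightarrow> 'u \<Rightarrow> 'u" where
  "companion_transpose D s c\<^sub>0 \<eta>\<^sub>0 c\<^sub>1 \<epsilon>\<^sub>1 =
     runit D (c\<^sub>0 \<odot>\<^bsub>D\<^esub> sbot D s) \<bullet>\<^bsub>D\<^esub>
     (((\<eta>\<^sub>0 \<star>\<^bsub>D\<^esub> s) \<star>\<^bsub>D\<^esub> \<epsilon>\<^sub>1) \<bullet>\<^bsub>D\<^esub> (sq_inv D (lunit D (stop D s)) \<star>\<^bsub>D\<^esub> vid D c\<^sub>1))"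

definition conjoint_transpose :: "'u dbl \<Rightarrow> 'u \<Rightarrow> 'u \<Rightarrow> 'u \<Rightarrow> 'u \<Rightarrow> 'u \<Rightarrow> 'u" where
  "conjoint_transpose D s c\<^sub>0 \<epsilon>\<^sub>0 c\<^sub>1 \<eta>\<^sub>1 =
     (lunit D (sbot D s) \<star>\<^bsub>D\<^esub> vid D c\<^sub>1) \<bullet>\<^bsub>D\<^esub>
     (((\<epsilon>\<^sub>0 \<star>\<^bsub>D\<^esub> s) \<star>\<^bsub>D\<^esub> \<eta>\<^sub>1) \<bullet>\<^bsub>D\<^esub> sq_inv D (runit D (c\<^sub>0 \<odot>\<^bsub>D\<^esub> stop D s)))"

definition companion_commuter :: "'u dbl \<Rightarrow> 'u \<Rightarrow> bool" where
  "companion_commuter D s \<longleftrightarrow> s \<in> squares D \<and>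
     (\<exists>c\<^sub>0 \<eta>\<^sub>0 \<epsilon>\<^sub>0 c\<^sub>1 \<eta>\<^sub>1 \<epsilon>\<^sub>1.
        companion D (sleft D s) c\<^sub>0 \<eta>\<^sub>0 \<epsilon>\<^sub>0 \<and> companion D (sright D s) c\<^sub>1 \<eta>\<^sub>1 \<epsilon>\<^sub>1 \<and>
        sq_iso D (companion_transpose D s c\<^sub>0 \<eta>\<^sub>0 c\<^sub>1 \<epsilon>\<^sub>1))"

definition conjoint_commuter :: "'u dbl \<Rightarrow> 'u \<Rightarrow> bool" where
  "conjoint_commuter D s \<longleftrightarrow> s \<in> squares D \<and>
     (\<exists>c\<^sub>0 \<eta>\<^sub>0 \<epsilon>\<^sub>0 c\<^sub>1 \<eta>\<^sub>1 \<epsilon>\<^sub>1.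
        conjoint D (sleft D s) c\<^sub>0 \<eta>\<^sub>0 \<epsilon>\<^sub>0 \<and> conjoint D (sright D s) c\<^sub>1 \<eta>\<^sub>1 \<epsilon>\<^sub>1 \<and>
        sq_iso D (conjoint_transpose D s c\<^sub>0 \<epsilon>\<^sub>0 c\<^sub>1 \<eta>\<^sub>1))"

definition companion_commuter_trans :: "'u ttrans \<Rightarrow> bool" where
  "companion_commuter_trans t \<longleftrightarrow> (let A = ddom (tsrc t); B = dcod (tsrc t) in
     (\<forall>x \<in> obs A. has_companion B (tob t x)) \<and>
     (\<forall>l \<in> looses A. companion_commuter B (tloose t l)))"

definition conjoint_commuter_trans :: "'u ttrans \<Rightarrow> bool" where
  "conjoint_commuter_trans t \<longleftrightarrow> (let A = ddom (tsrc t); B = dcod (tsrc t) in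
     (\<forall>x \<in> obs A. has_conjoint B (tob t x)) \<and>
     (\<forall>l \<in> looses A. conjoint_commuter B (tloose t l)))"


section \<open>Terminal double category, products, and the free loose arrow\<close>

text \<open>An infinite type contains a copy of the naturals and of its own square. The particular
  injections are irrelevant.\<close>

definition el :: "nat \<Rightarrow> 'u::infinite" where
  "el = (SOME f. inj f)"

definition pair :: "'u::infinite \<Rightarrow> 'u \<Rightarrow> 'u" where
  "pair x y = (SOME f :: 'u \<times> 'u \<Rightarrow> 'u. inj f) (x, y)"

definition pfst :: "'u::infinite \<Rightarrow> 'u" where
  "pfst z = (THE x. \<exists>y. z = pair x y)"

definition psnd :: "'u::infinite \<Rightarrow> 'u" where
  "psnd z = (THE y. \<exists>x. z = pair x y)"

lemma inj_el: "inj (el :: nat \<Rightarrow> 'u::infinite)"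
proof -
  have "\<exists>f :: nat \<Rightarrow> 'u. inj f"
    using infinite_UNIV infinite_countable_subset by blast
  then show ?thesis unfolding el_def by (rule someI_ex)
qed

lemma pair_eq_iff: "pair a b = pair c d \<longleftrightarrow> a = c \<and> b = (d :: 'u::infinite)"
proof -
  have "(card_of ((UNIV :: 'u set) \<times> (UNIV :: 'u set)), card_of (UNIV :: 'u set)) \<in> ordIso"
    by (rule card_of_Times_same_infinite) (rule infinite_UNIV)
  then have "(card_of (UNIV :: ('u \<times> 'u) set), card_of (UNIV :: 'u set)) \<in> ordLeq"
    by (simp add: ordIso_iff_ordLeq)
  then have "\<exists>f :: 'u \<times> 'u \<Rightarrow> 'u. inj f"
    by (simp flip: card_of_ordLeq)
  then have "inj (SOME f :: 'u \<times> 'u \<Rightarrow> 'u. inj f)" by (rule someI_ex)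
  then show ?thesis unfolding pair_def by (auto dest: injD)
qed

lemma pfst_pair [simp]: "pfst (pair x y) = x"
  unfolding pfst_def by (auto simp: pair_eq_iff)

lemma psnd_pair [simp]: "psnd (pair x y) = y"
  unfolding psnd_def by (auto simp: pair_eq_iff)

text \<open>The terminal double category \<open>\<bullet>\<close>: one cell of each kind.\<close>

definition Pt :: "'u::infinite dbl" where
  "Pt = (let p = el 0 in
     \<lparr>obs = {p}, tights = {p}, looses = {p}, squares = {p},
      tdom = (\<lambda>_. p), tcod = (\<lambda>_. p), tid = (\<lambda>_. p), tcmp = (\<lambda>_ _. p),
      ldom = (\<lambda>_. p), lcod = (\<lambda>_. p), lid = (\<lambda>_. p), lcmp = (\<lambda>_ _. p),
      stop = (\<lambda>_. p), sbot = (\<lambda>_. p), sleft = (\<lambda>_. p), sright = (\<lambda>_. p),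
      vid = (\<lambda>_. p), vcmp = (\<lambda>_ _. p), hid = (\<lambda>_. p), hcmp = (\<lambda>_ _. p),
      lassoc = (\<lambda>_ _ _. p), lunit = (\<lambda>_. p), runit = (\<lambda>_. p)\<rparr>)"

text \<open>The free strict double category on one loose arrow has two objects \<open>0\<close>, \<open>1\<close>, three loose
  arrows \<open>id 0\<close>, \<open>id 1\<close> and the generator \<open>g : 0 \<Rightarrow> 1\<close>, and only identity tight arrows and vertical
  identity squares. An object, its tight identity, its loose identity and the square on it are
  coded by the same element, as are \<open>g\<close> and its identity square.\<close>

definition Loose :: "'u::infinite dbl" where
  "Loose = (let z = el 0; w = el 1; g = el 2 in
     \<lparr>obs = {z, w}, tights = {z, w}, looses = {z, w, g}, squares = {z, w, g},
      tdom = (\<lambda>f. f), tcod = (\<lambda>f. f), tid = (\<lambda>x. x), tcmp = (\<lambda>f f'. f),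
      ldom = (\<lambda>l. if l = w then w else z), lcod = (\<lambda>l. if l = z then z else w),
      lid = (\<lambda>x. x), lcmp = (\<lambda>l m. if l = g then g else m),
      stop = (\<lambda>s. s), sbot = (\<lambda>s. s),
      sleft = (\<lambda>s. if s = w then w else z), sright = (\<lambda>s. if s = z then z else w),
      vid = (\<lambda>l. l), vcmp = (\<lambda>s t. s),
      hid = (\<lambda>f. f), hcmp = (\<lambda>s t. if s = g then g else t),
      lassoc = (\<lambda>k l m. if k = g \<or> l = g then g else m),
      lunit = (\<lambda>l. l), runit = (\<lambda>l. l)\<rparr>)"

abbreviation ob0 :: "'u::infinite" where "ob0 \<equiv> el 0"
abbreviation ob1 :: "'u::infinite" where "ob1 \<equiv> el 1"

definition pair_set :: "'u::infinite set \<Rightarrow> 'u set \<Rightarrow> 'u set" where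
  "pair_set A B = {pair a b | a b. a \<in> A \<and> b \<in> B}"

definition map1 :: "('u::infinite \<Rightarrow> 'u) \<Rightarrow> ('u \<Rightarrow> 'u) \<Rightarrow> 'u \<Rightarrow> 'u" where
  "map1 f g u = pair (f (pfst u)) (g (psnd u))"

definition map2 :: "('u::infinite \<Rightarrow> 'u \<Rightarrow> 'u) \<Rightarrow> ('u \<Rightarrow> 'u \<Rightarrow> 'u) \<Rightarrow> 'u \<Rightarrow> 'u \<Rightarrow> 'u" where
  "map2 f g u v = pair (f (pfst u) (pfst v)) (g (psnd u) (psnd v))"

definition map3 :: "('u::infinite \<Rightarrow> 'u \<Rightarrow> 'u \<Rightarrow> 'u) \<Rightarrow> ('u \<Rightarrow> 'u \<Rightarrow> 'u \<Rightarrow> 'u) \<Rightarrow> 'u \<Rightarrow> 'u \<Rightarrow> 'u \<Rightarrow> 'u"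
  where "map3 f g u v w = pair (f (pfst u) (pfst v) (pfst w)) (g (psnd u) (psnd v) (psnd w))"

definition prod_dbl :: "'u::infinite dbl \<Rightarrow> 'u dbl \<Rightarrow> 'u dbl" where
  "prod_dbl D E =
     \<lparr>obs = pair_set (obs D) (obs E), tights = pair_set (tights D) (tights E),
      looses = pair_set (looses D) (looses E), squares = pair_set (squares D) (squares E),
      tdom = map1 (tdom D) (tdom E), tcod = map1 (tcod D) (tcod E),
      tid = map1 (tid D) (tid E), tcmp = map2 (tcmp D) (tcmp E),
      ldom = map1 (ldom D) (ldom E), lcod = map1 (lcod D) (lcod E),
      lid = map1 (lid D) (lid E), lcmp = map2 (lcmp D) (lcmp E),
      stop = map1 (stop D) (stop E), sbot = map1 (sbot D) (sbot E),
      sleft = map1 (sleft D) (sleft E), sright = map1 (sright D) (sright E),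
      vid = map1 (vid D) (vid E), vcmp = map2 (vcmp D) (vcmp E),
      hid = map1 (hid D) (hid E), hcmp = map2 (hcmp D) (hcmp E),
      lassoc = map3 (lassoc D) (lassoc E), lunit = map1 (lunit D) (lunit E),
      runit = map1 (runit D) (runit E)\<rparr>"


section \<open>Loose bimodules\<close>

definition LBimod :: "('u::infinite dfun, 'u dfun \<times> 'u dfun \<times> 'u dfun,
    'u dfun \<times> 'u dfun \<times> 'u ttrans) twocat" where
  "LBimod = slice Dbl Loose"

text \<open>The pullback of \<open>M\<close> along the object \<open>i : \<bullet> \<rightarrow> Loose\<close> (\<open>ob0\<close> or \<open>ob1\<close>), realised as the
  sub-double category of cells lying over the identities of \<open>i\<close>. It is closed under loose
  composition because \<open>Loose\<close> has only identity squares, so that \<open>M\<close> preserves loose composites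
  and identities on the nose.\<close>

definition fibre :: "'u::infinite dfun \<Rightarrow> 'u \<Rightarrow> 'u dbl" where
  "fibre M i = (ddom M)
     \<lparr>obs := {x \<in> obs (ddom M). fob M x = i},
      tights := {f \<in> tights (ddom M). ftight M f = tid Loose i},
      looses := {l \<in> looses (ddom M). floose M l = lid Loose i},
      squares := {s \<in> squares (ddom M). fsq M s = vid Loose (lid Loose i)}\<rparr>"

definition dfun_restrict :: "'u dfun \<Rightarrow> 'u dbl \<Rightarrow> 'u dbl \<Rightarrow> 'u dfun" where
  "dfun_restrict F A B =
     \<lparr>ddom = A, dcod = B,
      fob = restrict (fob F) (obs A), ftight = restrict (ftight F) (tights A),
      floose = restrict (floose F) (looses A), fsq = restrict (fsq F) (squares A),
      fcomp = restrict_comp A (fcomp F), funit = restrict (funit F) (obs A)\<rparr>"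

definition fibre_map :: "'u::infinite \<Rightarrow> 'u dfun \<times> 'u dfun \<times> 'u dfun \<Rightarrow> 'u dfun" where
  "fibre_map i = (\<lambda>(M, N, f). dfun_restrict f (fibre M i) (fibre N i))"

definition fibre_trans :: "'u::infinite \<Rightarrow> 'u dfun \<times> 'u dfun \<times> 'u ttrans \<Rightarrow> 'u ttrans" where
  "fibre_trans i = (\<lambda>(M, N, t).
     \<lparr>tsrc = fibre_map i (M, N, tsrc t), ttgt = fibre_map i (M, N, ttgt t),
      tob = restrict (tob t) (obs (fibre M i)), tloose = restrict (tloose t) (looses (fibre M i))\<rparr>)"

definition HomL :: "'u::infinite dbl \<Rightarrow> 'u dfun" where
  "HomL D = strict_dfun (prod_dbl D Loose) Loose psnd psnd psnd psnd"

text \<open>The canonical isomorphism from \<open>D\<close> to the source (\<open>i = ob0\<close>) or target (\<open>i = ob1\<close>) of its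
  loose hom bimodule, through which these are identified with \<open>D\<close>.\<close>

definition HomL_leg :: "'u::infinite \<Rightarrow> 'u dbl \<Rightarrow> 'u dfun" where
  "HomL_leg i D = strict_dfun D (fibre (HomL D) i)
     (\<lambda>x. pair x i) (\<lambda>f. pair f (tid Loose i)) (\<lambda>l. pair l (lid Loose i))
     (\<lambda>s. pair s (vid Loose (lid Loose i)))"


section \<open>Niches\<close>

record 'u niche =
  nbimod :: "'u dfun"
  nleg0 :: "'u dfun"
  nleg1 :: "'u dfun"

definition is_niche :: "'u::infinite niche \<Rightarrow> bool" where
  "is_niche N \<longleftrightarrow> nbimod N \<in> cells0 LBimod \<and>
     nleg0 N \<in> cells1 Dbl \<and> dcod (nleg0 N) = fibre (nbimod N) ob0 \<and>
     nleg1 N \<in> cells1 Dbl \<and> dcod (nleg1 N) = fibre (nbimod N) ob1"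

record 'u niche_map =
  ndom :: "'u niche"
  ncod :: "'u niche"
  nmap :: "'u dfun \<times> 'u dfun \<times> 'u dfun"
  nf0 :: "'u dfun"
  nf1 :: "'u dfun"
  nt0 :: "'u ttrans"
  nt1 :: "'u ttrans"

definition is_niche_map :: "'u::infinite niche_map \<Rightarrow> bool" where
  "is_niche_map m \<longleftrightarrow> (let N = ndom m; N' = ncod m in
     is_niche N \<and> is_niche N' \<and>
     nmap m \<in> hom1 LBimod (nbimod N) (nbimod N') \<and>
     nf0 m \<in> hom1 Dbl (ddom (nleg0 N)) (ddom (nleg0 N')) \<and>
     nf1 m \<in> hom1 Dbl (ddom (nleg1 N)) (ddom (nleg1 N')) \<and>
     nt0 m \<in> hom2 Dbl (dfun_cmp (fibre_map ob0 (nmap m)) (nleg0 N)) (dfun_cmp (nleg0 N') (nf0 m)) \<and>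
     nt1 m \<in> hom2 Dbl (dfun_cmp (fibre_map ob1 (nmap m)) (nleg1 N)) (dfun_cmp (nleg1 N') (nf1 m)) \<and>
     conjoint_commuter_trans (nt0 m) \<and> companion_commuter_trans (nt1 m))"

record 'u niche_cell =
  nsrc :: "'u niche_map"
  ntgt :: "'u niche_map"
  ncell :: "'u dfun \<times> 'u dfun \<times> 'u ttrans"
  nc0 :: "'u ttrans"
  nc1 :: "'u ttrans"

definition is_niche_cell :: "'u::infinite niche_cell \<Rightarrow> bool" where
  "is_niche_cell c \<longleftrightarrow> (let m = nsrc c; m' = ntgt c; N = ndom m; N' = ncod m in
     is_niche_map m \<and> is_niche_map m' \<and> ndom m' = N \<and> ncod m' = N' \<and>
     ncell c \<in> hom2 LBimod (nmap m) (nmap m') \<and>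
     nc0 c \<in> hom2 Dbl (nf0 m) (nf0 m') \<and>
     nc1 c \<in> hom2 Dbl (nf1 m) (nf1 m') \<and>
     ttrans_vcmp (nt0 m') (ttrans_hcmp (fibre_trans ob0 (ncell c)) (ttrans_id (nleg0 N)))
       = ttrans_vcmp (ttrans_hcmp (ttrans_id (nleg0 N')) (nc0 c)) (nt0 m) \<and>
     ttrans_vcmp (nt1 m') (ttrans_hcmp (fibre_trans ob1 (ncell c)) (ttrans_id (nleg1 N)))
       = ttrans_vcmp (ttrans_hcmp (ttrans_id (nleg1 N')) (nc1 c)) (nt1 m))"

text \<open>The structure transformation of a composite of 1-cells is the pasting
  \<open>b a F \<Rightarrow> b F' f \<Rightarrow> F'' g f\<close>.\<close>

definition paste :: "'u ttrans \<Rightarrow> 'u dfun \<Rightarrow> 'u dfun \<Rightarrow> 'u ttrans \<Rightarrow> 'u ttrans" where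
  "paste t' b f t = ttrans_vcmp (ttrans_hcmp t' (ttrans_id f)) (ttrans_hcmp (ttrans_id b) t)"

definition niche_cmp :: "'u::infinite niche_map \<Rightarrow> 'u niche_map \<Rightarrow> 'u niche_map" where
  "niche_cmp m' m =
     \<lparr>ndom = ndom m, ncod = ncod m', nmap = cmp1 LBimod (nmap m') (nmap m),
      nf0 = dfun_cmp (nf0 m') (nf0 m), nf1 = dfun_cmp (nf1 m') (nf1 m),
      nt0 = paste (nt0 m') (fibre_map ob0 (nmap m')) (nf0 m) (nt0 m),
      nt1 = paste (nt1 m') (fibre_map ob1 (nmap m')) (nf1 m) (nt1 m)\<rparr>"

definition Niche :: "('u::infinite niche, 'u niche_map, 'u niche_cell) twocat" where
  "Niche =
     \<lparr>cells0 = {N. is_niche N},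
      cells1 = {m. is_niche_map m},
      cells2 = {c. is_niche_cell c},
      dom1 = ndom, cod1 = ncod, src2 = nsrc, tgt2 = ntgt,
      id1 = (\<lambda>N. \<lparr>ndom = N, ncod = N, nmap = id1 LBimod (nbimod N),
                   nf0 = dfun_id (ddom (nleg0 N)), nf1 = dfun_id (ddom (nleg1 N)),
                   nt0 = ttrans_id (nleg0 N), nt1 = ttrans_id (nleg1 N)\<rparr>),
      cmp1 = niche_cmp,
      id2 = (\<lambda>m. \<lparr>nsrc = m, ntgt = m, ncell = id2 LBimod (nmap m),
                   nc0 = ttrans_id (nf0 m), nc1 = ttrans_id (nf1 m)\<rparr>),
      vcmp2 = (\<lambda>d c. \<lparr>nsrc = nsrc c, ntgt = ntgt d,
                       ncell = vcmp2 LBimod (ncell d) (ncell c),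
                       nc0 = ttrans_vcmp (nc0 d) (nc0 c), nc1 = ttrans_vcmp (nc1 d) (nc1 c)\<rparr>),
      hcmp2 = (\<lambda>d c. \<lparr>nsrc = niche_cmp (nsrc d) (nsrc c), ntgt = niche_cmp (ntgt d) (ntgt c),
                       ncell = hcmp2 LBimod (ncell d) (ncell c),
                       nc0 = ttrans_hcmp (nc0 d) (nc0 c), nc1 = ttrans_hcmp (nc1 d) (nc1 c)\<rparr>)\<rparr>"


section \<open>Pointed double categories\<close>

text \<open>A pointed double category is a double functor \<open>d : \<bullet> \<rightarrow> D\<close>. Such a \<open>d\<close> is an object of \<open>D\<close>
  together with a loose endomorphism coherently isomorphic to its loose identity. Points in this
  sense are closed under composition with double functors, which need not be strictly unital.\<close>

definition is_pointed :: "'u::infinite dfun \<Rightarrow> bool" where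
  "is_pointed d \<longleftrightarrow> d \<in> cells1 Dbl \<and> ddom d = Pt"

record 'u point_map =
  pdom :: "'u dfun"
  pcod :: "'u dfun"
  pmap :: "'u dfun"
  piso :: "'u ttrans"

definition is_point_map :: "'u::infinite point_map \<Rightarrow> bool" where
  "is_point_map m \<longleftrightarrow> is_pointed (pdom m) \<and> is_pointed (pcod m) \<and>
     pmap m \<in> hom1 Dbl (dcod (pdom m)) (dcod (pcod m)) \<and>
     piso m \<in> hom2 Dbl (dfun_cmp (pmap m) (pdom m)) (pcod m) \<and>
     (\<forall>x \<in> obs Pt. tight_iso (dcod (pcod m)) (tob (piso m) x)) \<and>
     conjoint_commuter_trans (piso m)"

record 'u point_cell =
  psrc :: "'u point_map"
  ptgt :: "'u point_map"
  pcell :: "'u ttrans"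

definition is_point_cell :: "'u::infinite point_cell \<Rightarrow> bool" where
  "is_point_cell c \<longleftrightarrow> (let m = psrc c; m' = ptgt c in
     is_point_map m \<and> is_point_map m' \<and> pdom m' = pdom m \<and> pcod m' = pcod m \<and>
     pcell c \<in> hom2 Dbl (pmap m) (pmap m') \<and>
     ttrans_vcmp (piso m') (ttrans_hcmp (pcell c) (ttrans_id (pdom m))) = piso m)"

definition point_cmp :: "'u::infinite point_map \<Rightarrow> 'u point_map \<Rightarrow> 'u point_map" where
  "point_cmp m' m =
     \<lparr>pdom = pdom m, pcod = pcod m', pmap = dfun_cmp (pmap m') (pmap m),
      piso = ttrans_vcmp (piso m') (ttrans_hcmp (ttrans_id (pmap m')) (piso m))\<rparr>"

definition Dbl_pt :: "('u::infinite dfun, 'u point_map, 'u point_cell) twocat" where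
  "Dbl_pt =
     \<lparr>cells0 = {d. is_pointed d},
      cells1 = {m. is_point_map m},
      cells2 = {c. is_point_cell c},
      dom1 = pdom, cod1 = pcod, src2 = psrc, tgt2 = ptgt,
      id1 = (\<lambda>d. \<lparr>pdom = d, pcod = d, pmap = dfun_id (dcod d), piso = ttrans_id d\<rparr>),
      cmp1 = point_cmp,
      id2 = (\<lambda>m. \<lparr>psrc = m, ptgt = m, pcell = ttrans_id (pmap m)\<rparr>),
      vcmp2 = (\<lambda>d c. \<lparr>psrc = psrc c, ptgt = ptgt d, pcell = ttrans_vcmp (pcell d) (pcell c)\<rparr>),
      hcmp2 = (\<lambda>d c. \<lparr>psrc = point_cmp (psrc d) (psrc c), ptgt = point_cmp (ptgt d) (ptgt c),
                       pcell = ttrans_hcmp (pcell d) (pcell c)\<rparr>)\<rparr>"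


section \<open>Right niches\<close>

definition is_right_niche :: "'u::infinite niche \<Rightarrow> bool" where
  "is_right_niche N \<longleftrightarrow> is_niche N \<and> ddom (nleg0 N) = Pt"

text \<open>The left component of a niche map between right niches is the map of sources with the
  transformation \<open>nt0\<close>, whose target is the left leg of the codomain itself, since \<open>nf0\<close> can only
  be the identity of \<open>\<bullet>\<close>.\<close>

definition is_right_niche_map :: "'u::infinite niche_map \<Rightarrow> bool" where
  "is_right_niche_map m \<longleftrightarrow> is_niche_map m \<and>
     is_right_niche (ndom m) \<and> is_right_niche (ncod m) \<and>
     \<lparr>pdom = nleg0 (ndom m), pcod = nleg0 (ncod m),
      pmap = fibre_map ob0 (nmap m), piso = nt0 m\<rparr> \<in> cells1 Dbl_pt"

definition RNiche :: "('u::infinite niche, 'u niche_map, 'u niche_cell) twocat" where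
  "RNiche = Niche
     \<lparr>cells0 := {N. is_right_niche N},
      cells1 := {m. is_right_niche_map m},
      cells2 := {c. is_niche_cell c \<and> is_right_niche_map (nsrc c) \<and> is_right_niche_map (ntgt c)}\<rparr>"

definition hom_niche :: "'u::infinite dfun \<Rightarrow> 'u niche" where
  "hom_niche d = (let D = dcod d in
     \<lparr>nbimod = HomL D,
      nleg0 = dfun_cmp (HomL_leg ob0 D) d,
      nleg1 = dfun_cmp (HomL_leg ob1 D) (dfun_id D)\<rparr>)"

end

(*
The target category of the projection HomL(D) = D x Loose -> Loose has D itself as its fibre over
either object, so D |-> HomL(D), with legs the point d and the identity, is functorial: a pointed
functor (f, i) acts by f x Loose, by i whiskered with the identification of D with the source fibre,
and by an identity 2-cell on the right leg, which is trivially a companion commuter.  Conjoint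
commuters survive because tight isomorphisms with conjoints are preserved by double functors and
because a transformation between points is a conjoint commuter as soon as its component is one.

For products: limits in all the 2-categories are computed on underlying double categories.  A family
of pointed double categories (or of right niches) has a product cone whose structure 2-cells are all
identities; it is a product because fibres and HomL preserve products and because product projections
jointly reflect companions, conjoints and commuter cells.  The functor sends such a strict cone to a
strict cone, and every product cone is isomorphic to a strict one.
*)
theory Submission
  imports Defs
begin

text \<open>A companion commuter is given by some choice of companions, and a vertical composite of
  commuters comes with composite companions, so a direct proof would have to compare transposes
  through coherence squares. A universal property replaces the transposes: given companions of its
  sides, the transpose of \<open>s\<close> is invertible exactly if \<open>s \<star> p1\<close> is
  cartesian, where \<open>p1\<close> is the counit on the right side. Cartesian squares compose and
  cancel, and this carries the stability of commuters under pasting. Conjoint commuters occur only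
  at points. A double functor out of \<open>Pt\<close> is pseudo and picks a loose arrow isomorphic
  to a loose identity, so the loose component of a transformation of points is the loose identity
  square on its tight component, conjugated by two unit comparisons; the transpose of such a square
  consists of coherence cells. Reflection along an abstract product cone is possible because the
  classes of cells concerned are preserved by double functors, hence by the isomorphism with an
  iterated binary product. All squares of \<open>Loose\<close> are identities, so functors into it
  are determined by objects and loose arrows, and fibres and pullbacks over it are sub-double
  categories.\<close>

notation dfun_cmp (infixr "oo" 75)

abbreviation whisker_left (infixr "*>" 70) where "F *> s \<equiv> ttrans_hcmp (ttrans_id F) s"

abbreviation whisker_right (infixl "<*" 70) where "s <* F \<equiv> ttrans_hcmp s (ttrans_id F)"

section \<open>Calculus in one double category: boundaries, inverse squares, globular
  isomorphisms\<close>

lemmas hom_defs = tight_hom_def loose_hom_def sq_hom_def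

lemma tight_isoI:
  "\<lbrakk>f \<in> tights D; g \<in> tights D; tdom D g = tcod D f; tcod D g = tdom D f;
    tcmp D g f = tid D (tdom D f); tcmp D f g = tid D (tcod D f)\<rbrakk> \<Longrightarrow> tight_iso D f"
  by (auto simp: tight_iso_def tight_hom_def)

lemma tight_isoE:
  assumes "tight_iso D f"
  obtains g where "f \<in> tights D" "g \<in> tights D" "tdom D g = tcod D f" "tcod D g = tdom D f"
    "tcmp D g f = tid D (tdom D f)" "tcmp D f g = tid D (tcod D f)"
  using assms by (auto simp: tight_iso_def tight_hom_def)

context double_category
begin

lemma tid_simps [simp]:
  assumes "x \<in> obs D"
  shows "tid D x \<in> tights D" "tdom D (tid D x) = x" "tcod D (tid D x) = x"
  using tid_hom[OF assms] by (auto simp: tight_hom_def)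

lemmas ends_in [simp] = tdom_in tcod_in ldom_in lcod_in stop_in sbot_in

lemma tcmp_simps [simp]:
  assumes "f \<in> tights D" "g \<in> tights D" "tdom D g = tcod D f"
  shows "g \<cdot> f \<in> tights D" "tdom D (g \<cdot> f) = tdom D f" "tcod D (g \<cdot> f) = tcod D g"
  using tcmp_hom[of f "tdom D f" "tcod D f" g "tcod D g"] assms by (auto simp: tight_hom_def)

lemma tcmp_tid [simp]:
  "\<lbrakk>f \<in> tights D; tcod D f = y\<rbrakk> \<Longrightarrow> tid D y \<cdot> f = f"
  "\<lbrakk>f \<in> tights D; tdom D f = x\<rbrakk> \<Longrightarrow> f \<cdot> tid D x = f"
  using tcmp_id_left[of f x y] tcmp_id_left tcmp_id_right by (auto simp: tight_hom_def)

lemma tcmp_assoc' [simp]: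
  "\<lbrakk>f \<in> tights D; g \<in> tights D; h \<in> tights D; tdom D g = tcod D f; tdom D h = tcod D g\<rbrakk>
    \<Longrightarrow> (h \<cdot> g) \<cdot> f = h \<cdot> (g \<cdot> f)"
  using tcmp_assoc[of f "tdom D f" "tcod D f" g "tcod D g" h "tcod D h"] by (auto simp: tight_hom_def)

lemma lid_simps [simp]:
  assumes "x \<in> obs D"
  shows "lid D x \<in> looses D" "ldom D (lid D x) = x" "lcod D (lid D x) = x"
  using lid_hom[OF assms] by (auto simp: loose_hom_def)

lemma lcmp_simps [simp]:
  assumes "l \<in> looses D" "m \<in> looses D" "lcod D l = ldom D m"
  shows "l \<odot> m \<in> looses D" "ldom D (l \<odot> m) = ldom D l" "lcod D (l \<odot> m) = lcod D m"
  using lcmp_hom[of l "ldom D l" "lcod D l" m "lcod D m"] assms by (auto simp: loose_hom_def)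

lemma side_simps [simp]:
  assumes "s \<in> squares D"
  shows "sleft D s \<in> tights D" "sright D s \<in> tights D"
    "tdom D (sleft D s) = ldom D (stop D s)" "tcod D (sleft D s) = ldom D (sbot D s)"
    "tdom D (sright D s) = lcod D (stop D s)" "tcod D (sright D s) = lcod D (sbot D s)"
  using sleft_hom[OF assms] sright_hom[OF assms] by (auto simp: tight_hom_def)

lemma vid_simps [simp]:
  assumes "l \<in> looses D"
  shows "vid D l \<in> squares D" "stop D (vid D l) = l" "sbot D (vid D l) = l"
    "sleft D (vid D l) = tid D (ldom D l)" "sright D (vid D l) = tid D (lcod D l)"
  using vid_hom[of l "ldom D l" "lcod D l"] assms by (auto simp: hom_defs)

lemma vcmp_simps [simp]:
  assumes "s \<in> squares D" "t \<in> squares D" "stop D t = sbot D s"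
  shows "t \<bullet> s \<in> squares D" "stop D (t \<bullet> s) = stop D s" "sbot D (t \<bullet> s) = sbot D t"
    "sleft D (t \<bullet> s) = sleft D t \<cdot> sleft D s" "sright D (t \<bullet> s) = sright D t \<cdot> sright D s"
  using vcmp_hom[of s "sleft D s" "sright D s" "stop D s" "sbot D s" t "sleft D t" "sright D t" "sbot D t"]
    assms by (auto simp: hom_defs)

lemma vcmp_vid [simp]:
  "\<lbrakk>s \<in> squares D; sbot D s = m\<rbrakk> \<Longrightarrow> vid D m \<bullet> s = s"
  "\<lbrakk>s \<in> squares D; stop D s = l\<rbrakk> \<Longrightarrow> s \<bullet> vid D l = s"
  using vcmp_id_left[of s _ _ l m] vcmp_id_left vcmp_id_right by (auto simp: hom_defs)

lemma vcmp_assoc':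
  "\<lbrakk>s \<in> squares D; t \<in> squares D; u \<in> squares D; stop D t = sbot D s; stop D u = sbot D t\<rbrakk>
    \<Longrightarrow> (u \<bullet> t) \<bullet> s = u \<bullet> (t \<bullet> s)"
  using vcmp_assoc[of s "sleft D s" "sright D s" "stop D s" "sbot D s" t "sleft D t" "sright D t"
      "sbot D t" u "sleft D u" "sright D u" "sbot D u"] by (auto simp: hom_defs)

lemma hid_simps [simp]:
  assumes "f \<in> tights D"
  shows "hid D f \<in> squares D" "stop D (hid D f) = lid D (tdom D f)" "sbot D (hid D f) = lid D (tcod D f)"
    "sleft D (hid D f) = f" "sright D (hid D f) = f"
  using hid_hom[of f "tdom D f" "tcod D f"] assms by (auto simp: hom_defs)

lemma hid_tcmp:
  "\<lbrakk>f \<in> tights D; g \<in> tights D; tdom D g = tcod D f\<rbrakk> \<Longrightarrow> hid D (g \<cdot> f) = hid D g \<bullet> hid D f"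
  using hid_cmp[of f "tdom D f" "tcod D f" g "tcod D g"] by (auto simp: hom_defs)

lemma hcmp_simps [simp]:
  assumes "s \<in> squares D" "t \<in> squares D" "sright D s = sleft D t"
  shows "s \<star> t \<in> squares D" "stop D (s \<star> t) = stop D s \<odot> stop D t" "sbot D (s \<star> t) = sbot D s \<odot> sbot D t"
    "sleft D (s \<star> t) = sleft D s" "sright D (s \<star> t) = sright D t"
  using hcmp_hom[of s "sleft D s" "sright D s" "stop D s" "sbot D s" t "sright D t" "stop D t" "sbot D t"]
    assms by (auto simp: hom_defs)

text \<open>Horizontal composability of squares is stated by equality of their sides; taking domains
  and codomains of the common side makes the loose boundaries composable as well.\<close>

lemma adjacent:
  assumes "s \<in> squares D" "t \<in> squares D" "sright D s = sleft D t"
  shows "lcod D (stop D s) = ldom D (stop D t)" "lcod D (sbot D s) = ldom D (sbot D t)"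
  using assms side_simps by metis+

lemma hcmp_vid:
  "\<lbrakk>l \<in> looses D; m \<in> looses D; lcod D l = ldom D m\<rbrakk> \<Longrightarrow> vid D l \<star> vid D m = vid D (l \<odot> m)"
  using hcmp_id[of l "ldom D l" "lcod D l" m "lcod D m"] by (auto simp: hom_defs)

lemma interchange:
  "\<lbrakk>s \<in> squares D; s' \<in> squares D; t \<in> squares D; t' \<in> squares D; stop D s' = sbot D s;
     stop D t' = sbot D t; sright D s = sleft D t; sright D s' = sleft D t'\<rbrakk>
    \<Longrightarrow> (s' \<bullet> s) \<star> (t' \<bullet> t) = (s' \<star> t') \<bullet> (s \<star> t)"
  using hcmp_vcmp[of s "sleft D s" "sright D s" "stop D s" "sbot D s" s' "sleft D s'" "sright D s'" "sbot D s'"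
      t "sright D t" "stop D t" "sbot D t" t' "sright D t'" "sbot D t'"] by (auto simp: hom_defs)

text \<open>Both identities are taken at the ends of the top. That the bottom has the same ends is a
  consequence, recorded in \<open>globD\<close>, since it is forced by the codomains of the
  sides.\<close>

definition glob :: "'u \<Rightarrow> bool" where
  "glob s \<longleftrightarrow> s \<in> squares D \<and> sleft D s = tid D (ldom D (stop D s)) \<and> sright D s = tid D (lcod D (stop D s))"

lemma globD:
  assumes "glob s"
  shows "s \<in> squares D" "sleft D s = tid D (ldom D (stop D s))" "sright D s = tid D (lcod D (stop D s))"
    "ldom D (sbot D s) = ldom D (stop D s)" "lcod D (sbot D s) = lcod D (stop D s)"
proof -
  show s: "s \<in> squares D" "sleft D s = tid D (ldom D (stop D s))" "sright D s = tid D (lcod D (stop D s))"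
    using assms by (auto simp: glob_def)
  have "tcod D (sleft D s) = ldom D (stop D s)" "tcod D (sright D s) = lcod D (stop D s)"
    using s by simp_all
  then show "ldom D (sbot D s) = ldom D (stop D s)" "lcod D (sbot D s) = lcod D (stop D s)"
    using s(1) by simp_all
qed

text \<open>The usual argument \<open>t = t \<bullet> (s \<bullet> t') = t'\<close>. An inverse is
  specified through tops and bottoms alone, which is all that vertical associativity asks for;
  uniqueness is what makes the definite description \<open>sq_inv\<close> usable.\<close>

lemma is_sq_inverse_unique:
  assumes "is_sq_inverse D s t" "is_sq_inverse D s t'"
  shows "t = t'"
proof -
  note a = assms[unfolded is_sq_inverse_def]
  have "(t \<bullet> s) \<bullet> t' = t \<bullet> (s \<bullet> t')" by (rule vcmp_assoc') (use a in simp_all)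
  then show ?thesis using a by simp
qed

lemma sq_inv_is_inverse: "sq_iso D s \<Longrightarrow> is_sq_inverse D s (sq_inv D s)"
  unfolding sq_iso_def sq_inv_def by (rule theI') (use is_sq_inverse_unique in blast)

lemma sq_isoD: "sq_iso D s \<Longrightarrow> s \<in> squares D"
  by (auto simp: sq_iso_def is_sq_inverse_def)

lemma sq_inv_simps [simp]:
  assumes "sq_iso D s"
  shows "sq_inv D s \<in> squares D" "stop D (sq_inv D s) = sbot D s" "sbot D (sq_inv D s) = stop D s"
    "sq_inv D s \<bullet> s = vid D (stop D s)" "s \<bullet> sq_inv D s = vid D (sbot D s)"
  using sq_inv_is_inverse[OF assms] by (auto simp: is_sq_inverse_def)

lemma sq_isoI:
  "\<lbrakk>s \<in> squares D; t \<in> squares D; stop D t = sbot D s; sbot D t = stop D s;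
    t \<bullet> s = vid D (stop D s); s \<bullet> t = vid D (sbot D s)\<rbrakk> \<Longrightarrow> sq_iso D s"
  unfolding sq_iso_def is_sq_inverse_def by blast

lemma sq_iso_inv: "sq_iso D s \<Longrightarrow> sq_iso D (sq_inv D s)"
  by (rule sq_isoI[of _ s]) (simp_all add: sq_isoD)

lemma sq_iso_vid [simp]: "l \<in> looses D \<Longrightarrow> sq_iso D (vid D l)"
  by (rule sq_isoI[of _ "vid D l"]) simp_all

lemma sq_inv_cancel:
  assumes "sq_iso D s"
  shows "\<lbrakk>t \<in> squares D; sbot D t = stop D s\<rbrakk> \<Longrightarrow> sq_inv D s \<bullet> (s \<bullet> t) = t"
    "\<lbrakk>t \<in> squares D; sbot D t = sbot D s\<rbrakk> \<Longrightarrow> s \<bullet> (sq_inv D s \<bullet> t) = t"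
    "\<lbrakk>t \<in> squares D; stop D t = sbot D s\<rbrakk> \<Longrightarrow> (t \<bullet> s) \<bullet> sq_inv D s = t"
    "\<lbrakk>t \<in> squares D; stop D t = stop D s\<rbrakk> \<Longrightarrow> (t \<bullet> sq_inv D s) \<bullet> s = t"
  using assms sq_isoD[OF assms] by (simp_all add: vcmp_assoc'[symmetric]) (simp_all add: vcmp_assoc')

lemma sq_iso_vcmp:
  assumes "sq_iso D s" "sq_iso D t" "stop D t = sbot D s"
  shows "sq_iso D (t \<bullet> s)"
  by (rule sq_isoI[of _ "sq_inv D s \<bullet> sq_inv D t"])
    (use assms sq_isoD in \<open>simp_all add: vcmp_assoc' sq_inv_cancel\<close>)

text \<open>The sides of the inverse are read off from \<open>sq_inv D s \<bullet> s\<close>: this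
  composite is a vertical identity, and the sides of \<open>s\<close> are identities too.\<close>

lemma glob_sq_inv:
  assumes "glob s" "sq_iso D s"
  shows "glob (sq_inv D s)"
proof -
  have "sleft D (sq_inv D s \<bullet> s) = tid D (ldom D (stop D s))" "sright D (sq_inv D s \<bullet> s) = tid D (lcod D (stop D s))"
    using assms globD[OF assms(1)] by simp_all
  then show ?thesis
    using assms globD[OF assms(1)] side_simps[of "sq_inv D s"]
    unfolding glob_def by (simp del: sq_inv_simps(4,5))
qed

lemma glob_hcmp: "\<lbrakk>glob s; glob t; lcod D (stop D s) = ldom D (stop D t)\<rbrakk> \<Longrightarrow> glob (s \<star> t)"
  by (simp add: glob_def)

lemma glob_vcmp: "\<lbrakk>glob s; glob t; stop D t = sbot D s\<rbrakk> \<Longrightarrow> glob (t \<bullet> s)"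
  using globD(4,5)[of s] by (simp add: glob_def)

lemma glob_vid: "l \<in> looses D \<Longrightarrow> glob (vid D l)"
  by (simp add: glob_def)

lemma sq_iso_hcmp:
  assumes "glob s" "glob t" "sq_iso D s" "sq_iso D t" "lcod D (stop D s) = ldom D (stop D t)"
  shows "sq_iso D (s \<star> t)"
proof -
  have "glob (sq_inv D s)" "glob (sq_inv D t)" using assms by (simp_all add: glob_sq_inv)
  note g = globD[OF this(1)] globD[OF this(2)] globD[OF assms(1)] globD[OF assms(2)]
  show ?thesis
    by (rule sq_isoI[of _ "sq_inv D s \<star> sq_inv D t"])
      (use assms g in \<open>simp_all add: interchange[symmetric] hcmp_vid\<close>)
qed

text \<open>All coherence cells are of this kind. In contrast to \<open>glob_iso\<close> the top and
  bottom stay implicit, so that \<open>giso_intros\<close> can prove long composites of coherence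
  cells invertible without naming their boundaries.\<close>

definition giso :: "'u \<Rightarrow> bool" where
  "giso s \<longleftrightarrow> glob s \<and> sq_iso D s"

lemma gisoD:
  assumes "giso s"
  shows "glob s" "sq_iso D s" "s \<in> squares D" "sleft D s = tid D (ldom D (stop D s))"
    "sright D s = tid D (lcod D (stop D s))" "ldom D (sbot D s) = ldom D (stop D s)"
    "lcod D (sbot D s) = lcod D (stop D s)"
  using assms globD[of s] by (auto simp: giso_def)

lemma giso_intros:
  "l \<in> looses D \<Longrightarrow> giso (vid D l)"
  "giso s \<Longrightarrow> giso (sq_inv D s)"
  "\<lbrakk>giso s; giso t; stop D t = sbot D s\<rbrakk> \<Longrightarrow> giso (t \<bullet> s)"
  "\<lbrakk>giso s; giso t; lcod D (stop D s) = ldom D (stop D t)\<rbrakk> \<Longrightarrow> giso (s \<star> t)"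
  by (simp_all add: giso_def sq_iso_inv glob_vid glob_sq_inv sq_iso_vcmp glob_vcmp sq_iso_hcmp glob_hcmp)

lemma giso_sq_inv_simps:
  assumes "giso s"
  shows "sleft D (sq_inv D s) = tid D (ldom D (stop D s))" "sright D (sq_inv D s) = tid D (lcod D (stop D s))"
  using gisoD[OF giso_intros(2)[OF assms]] gisoD[OF assms] by simp_all

lemma glob_iso_iff: "s \<in> glob_iso D x y \<longleftrightarrow> giso s \<and> stop D s = x \<and> sbot D s = y"
  by (auto simp: glob_iso_def giso_def glob_def sq_hom_def)

lemma lassoc_simps [simp]:
  assumes "k \<in> looses D" "l \<in> looses D" "m \<in> looses D" "lcod D k = ldom D l" "lcod D l = ldom D m"
  shows "giso (lassoc D k l m)" "stop D (lassoc D k l m) = (k \<odot> l) \<odot> m" "sbot D (lassoc D k l m) = k \<odot> (l \<odot> m)"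
    "lassoc D k l m \<in> squares D" "sq_iso D (lassoc D k l m)"
    "sleft D (lassoc D k l m) = tid D (ldom D k)" "sright D (lassoc D k l m) = tid D (lcod D m)"
proof -
  show *: "giso (lassoc D k l m)" "stop D (lassoc D k l m) = (k \<odot> l) \<odot> m" "sbot D (lassoc D k l m) = k \<odot> (l \<odot> m)"
    using lassoc_iso[of k "ldom D k" "lcod D k" l "lcod D l" m "lcod D m"] assms
    by (auto simp: glob_iso_iff loose_hom_def)
  then show "lassoc D k l m \<in> squares D" "sq_iso D (lassoc D k l m)"
    "sleft D (lassoc D k l m) = tid D (ldom D k)" "sright D (lassoc D k l m) = tid D (lcod D m)"
    using gisoD[OF *(1)] assms by simp_all
qed

lemma lunit_simps [simp]:
  assumes "l \<in> looses D"
  shows "giso (lunit D l)" "stop D (lunit D l) = lid D (ldom D l) \<odot> l" "sbot D (lunit D l) = l"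
    "lunit D l \<in> squares D" "sq_iso D (lunit D l)"
    "sleft D (lunit D l) = tid D (ldom D l)" "sright D (lunit D l) = tid D (lcod D l)"
proof -
  show *: "giso (lunit D l)" "stop D (lunit D l) = lid D (ldom D l) \<odot> l" "sbot D (lunit D l) = l"
    using lunit_iso[of l "ldom D l" "lcod D l"] assms by (auto simp: glob_iso_iff loose_hom_def)
  then show "lunit D l \<in> squares D" "sq_iso D (lunit D l)"
    "sleft D (lunit D l) = tid D (ldom D l)" "sright D (lunit D l) = tid D (lcod D l)"
    using gisoD[OF *(1)] assms by simp_all
qed

lemma runit_simps [simp]:
  assumes "l \<in> looses D"
  shows "giso (runit D l)" "stop D (runit D l) = l \<odot> lid D (lcod D l)" "sbot D (runit D l) = l"
    "runit D l \<in> squares D" "sq_iso D (runit D l)"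
    "sleft D (runit D l) = tid D (ldom D l)" "sright D (runit D l) = tid D (lcod D l)"
proof -
  show *: "giso (runit D l)" "stop D (runit D l) = l \<odot> lid D (lcod D l)" "sbot D (runit D l) = l"
    using runit_iso[of l "ldom D l" "lcod D l"] assms by (auto simp: glob_iso_iff loose_hom_def)
  then show "runit D l \<in> squares D" "sq_iso D (runit D l)"
    "sleft D (runit D l) = tid D (ldom D l)" "sright D (runit D l) = tid D (lcod D l)"
    using gisoD[OF *(1)] assms by simp_all
qed

lemma lassoc_nat:
  assumes "r \<in> squares D" "s \<in> squares D" "t \<in> squares D" "sright D r = sleft D s" "sright D s = sleft D t"
  shows "lassoc D (sbot D r) (sbot D s) (sbot D t) \<bullet> ((r \<star> s) \<star> t)
    = (r \<star> (s \<star> t)) \<bullet> lassoc D (stop D r) (stop D s) (stop D t)"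
  using lassoc_natural[of r "sleft D r" "sright D r" "stop D r" "sbot D r" s "sright D s" "stop D s" "sbot D s"
      t "sright D t" "stop D t" "sbot D t"] assms by (auto simp: hom_defs)

lemma lunit_nat: "s \<in> squares D \<Longrightarrow> lunit D (sbot D s) \<bullet> (hid D (sleft D s) \<star> s) = s \<bullet> lunit D (stop D s)"
  using lunit_natural[of s "sleft D s" "sright D s" "stop D s" "sbot D s"] by (auto simp: hom_defs)

lemma runit_nat: "s \<in> squares D \<Longrightarrow> runit D (sbot D s) \<bullet> (s \<star> hid D (sright D s)) = s \<bullet> runit D (stop D s)"
  using runit_natural[of s "sleft D s" "sright D s" "stop D s" "sbot D s"] by (auto simp: hom_defs)

lemma pentagon':
  assumes "j \<in> looses D" "k \<in> looses D" "l \<in> looses D" "m \<in> looses D"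
    "lcod D j = ldom D k" "lcod D k = ldom D l" "lcod D l = ldom D m"
  shows "lassoc D j k (l \<odot> m) \<bullet> lassoc D (j \<odot> k) l m
    = (vid D j \<star> lassoc D k l m) \<bullet> (lassoc D j (k \<odot> l) m \<bullet> (lassoc D j k l \<star> vid D m))"
  using pentagon[of j "ldom D j" "lcod D j" k "lcod D k" l "lcod D l" m "lcod D m"] assms
  by (auto simp: loose_hom_def)

lemma triangle':
  assumes "l \<in> looses D" "m \<in> looses D" "lcod D l = ldom D m" "y = ldom D m"
  shows "(vid D l \<star> lunit D m) \<bullet> lassoc D l (lid D y) m = runit D l \<star> vid D m"
  using triangle[of l "ldom D l" "lcod D l" m "lcod D m"] assms by (auto simp: loose_hom_def)

lemma tight_iso_tid [simp]: "x \<in> obs D \<Longrightarrow> tight_iso D (tid D x)"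
  by (rule tight_isoI[of _ _ "tid D x"]) simp_all

lemma tight_iso_tcmp:
  assumes "tight_iso D f" "tight_iso D g" "tdom D g = tcod D f"
  shows "tight_iso D (g \<cdot> f)"
proof -
  obtain f' where f': "f \<in> tights D" "f' \<in> tights D" "tdom D f' = tcod D f" "tcod D f' = tdom D f"
    "f' \<cdot> f = tid D (tdom D f)" "f \<cdot> f' = tid D (tcod D f)"
    using assms(1) by (rule tight_isoE)
  obtain g' where g': "g \<in> tights D" "g' \<in> tights D" "tdom D g' = tcod D g" "tcod D g' = tdom D g"
    "g' \<cdot> g = tid D (tdom D g)" "g \<cdot> g' = tid D (tcod D g)"
    using assms(2) by (rule tight_isoE)
  have "g' \<cdot> (g \<cdot> f) = f" "f \<cdot> (f' \<cdot> g') = g'"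
    using f' g' assms(3) by (simp_all add: tcmp_assoc'[symmetric] del: tcmp_assoc')
  then show ?thesis
    using f' g' assms(3) by (intro tight_isoI[of _ _ "f' \<cdot> g'"]) simp_all
qed

end

section \<open>Calculus of double functors and tight transformations\<close>

context double_functor
begin

abbreviation vcmp_B (infixl "\<bullet>''" 70) where "t \<bullet>' s \<equiv> t \<bullet>\<^bsub>B\<^esub> s"

abbreviation hcmp_B (infixl "\<star>''" 75) where "s \<star>' t \<equiv> s \<star>\<^bsub>B\<^esub> t"

lemma ftight_simps [simp]:
  assumes "f \<in> tights A"
  shows "ftight F f \<in> tights B" "tdom B (ftight F f) = fob F (tdom A f)" "tcod B (ftight F f) = fob F (tcod A f)"
  using ftight_hom[of f "tdom A f" "tcod A f"] assms by (auto simp: hom_defs)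

lemma floose_simps [simp]:
  assumes "l \<in> looses A"
  shows "floose F l \<in> looses B" "ldom B (floose F l) = fob F (ldom A l)" "lcod B (floose F l) = fob F (lcod A l)"
  using floose_hom[of l "ldom A l" "lcod A l"] assms by (auto simp: hom_defs)

lemma fsq_simps [simp]:
  assumes "s \<in> squares A"
  shows "fsq F s \<in> squares B" "sleft B (fsq F s) = ftight F (sleft A s)" "sright B (fsq F s) = ftight F (sright A s)"
    "stop B (fsq F s) = floose F (stop A s)" "sbot B (fsq F s) = floose F (sbot A s)"
  using fsq_hom[of s "sleft A s" "sright A s" "stop A s" "sbot A s"] assms by (auto simp: hom_defs)

declare fob_in [simp] ftight_id [simp] fsq_id [simp]

lemma ftight_tcmp [simp]:
  "\<lbrakk>f \<in> tights A; g \<in> tights A; tdom A g = tcod A f\<rbrakk>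
    \<Longrightarrow> ftight F (g \<cdot>\<^bsub>A\<^esub> f) = ftight F g \<cdot>\<^bsub>B\<^esub> ftight F f"
  using ftight_cmp[of f "tdom A f" "tcod A f" g "tcod A g"] by (auto simp: hom_defs)

lemma fsq_vcmp' [simp]:
  "\<lbrakk>s \<in> squares A; t \<in> squares A; stop A t = sbot A s\<rbrakk>
    \<Longrightarrow> fsq F (t \<bullet>\<^bsub>A\<^esub> s) = fsq F t \<bullet>' fsq F s"
  using fsq_vcmp[of s "sleft A s" "sright A s" "stop A s" "sbot A s" t "sleft A t" "sright A t" "sbot A t"]
  by (auto simp: hom_defs)

lemma fcomp_simps [simp]:
  assumes "l \<in> looses A" "m \<in> looses A" "lcod A l = ldom A m"
  shows "B.giso (fcomp F l m)" "stop B (fcomp F l m) = floose F l \<odot>\<^bsub>B\<^esub> floose F m"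
    "sbot B (fcomp F l m) = floose F (l \<odot>\<^bsub>A\<^esub> m)"
    "fcomp F l m \<in> squares B" "sq_iso B (fcomp F l m)"
    "sleft B (fcomp F l m) = tid B (fob F (ldom A l))" "sright B (fcomp F l m) = tid B (fob F (lcod A m))"
proof -
  show *: "B.giso (fcomp F l m)" "stop B (fcomp F l m) = floose F l \<odot>\<^bsub>B\<^esub> floose F m"
    "sbot B (fcomp F l m) = floose F (l \<odot>\<^bsub>A\<^esub> m)"
    using fcomp_iso[of l "ldom A l" "lcod A l" m "lcod A m"] assms by (auto simp: B.glob_iso_iff hom_defs)
  then show "fcomp F l m \<in> squares B" "sq_iso B (fcomp F l m)"
    "sleft B (fcomp F l m) = tid B (fob F (ldom A l))" "sright B (fcomp F l m) = tid B (fob F (lcod A m))"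
    using B.gisoD[OF *(1)] assms by simp_all
qed

lemma funit_simps [simp]:
  assumes "x \<in> obs A"
  shows "B.giso (funit F x)" "stop B (funit F x) = lid B (fob F x)" "sbot B (funit F x) = floose F (lid A x)"
    "funit F x \<in> squares B" "sq_iso B (funit F x)"
    "sleft B (funit F x) = tid B (fob F x)" "sright B (funit F x) = tid B (fob F x)"
proof -
  show *: "B.giso (funit F x)" "stop B (funit F x) = lid B (fob F x)" "sbot B (funit F x) = floose F (lid A x)"
    using funit_iso[OF assms] by (auto simp: B.glob_iso_iff)
  then show "funit F x \<in> squares B" "sq_iso B (funit F x)"
    "sleft B (funit F x) = tid B (fob F x)" "sright B (funit F x) = tid B (fob F x)"
    using B.gisoD[OF *(1)] assms by simp_all
qed

lemma fcomp_nat: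
  "\<lbrakk>s \<in> squares A; t \<in> squares A; sright A s = sleft A t\<rbrakk>
    \<Longrightarrow> fsq F (s \<star>\<^bsub>A\<^esub> t) \<bullet>' fcomp F (stop A s) (stop A t)
      = fcomp F (sbot A s) (sbot A t) \<bullet>' (fsq F s \<star>' fsq F t)"
  using fcomp_natural[of s "sleft A s" "sright A s" "stop A s" "sbot A s" t "sright A t" "stop A t" "sbot A t"]
  by (auto simp: hom_defs)

lemma funit_nat:
  "f \<in> tights A \<Longrightarrow> fsq F (hid A f) \<bullet>' funit F (tdom A f) = funit F (tcod A f) \<bullet>' hid B (ftight F f)"
  using funit_natural[of f "tdom A f" "tcod A f"] by (auto simp: hom_defs)

lemma fsq_giso:
  assumes "A.giso s"
  shows "B.giso (fsq F s)"
proof -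
  note s = A.gisoD[OF assms]
  have "fsq F (sq_inv A s) \<bullet>' fsq F s = vid B (floose F (stop A s))"
    "fsq F s \<bullet>' fsq F (sq_inv A s) = vid B (floose F (sbot A s))"
    using s by (simp_all flip: fsq_vcmp')
  then have "sq_iso B (fsq F s)"
    using s by (intro B.sq_isoI[of _ "fsq F (sq_inv A s)"]) simp_all
  then show ?thesis using s unfolding B.giso_def B.glob_def by simp
qed

lemma fcomp_assoc':
  "\<lbrakk>k \<in> looses A; l \<in> looses A; m \<in> looses A; lcod A k = ldom A l; lcod A l = ldom A m\<rbrakk>
    \<Longrightarrow> fsq F (lassoc A k l m) \<bullet>'
          (fcomp F (k \<odot>\<^bsub>A\<^esub> l) m \<bullet>' (fcomp F k l \<star>' vid B (floose F m)))
      = fcomp F k (l \<odot>\<^bsub>A\<^esub> m) \<bullet>' ((vid B (floose F k) \<star>' fcomp F l m) \<bullet>'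
          lassoc B (floose F k) (floose F l) (floose F m))"
  using fcomp_assoc[of k "ldom A k" "lcod A k" l "lcod A l" m "lcod A m"] by (auto simp: hom_defs)

lemma funit_left':
  "l \<in> looses A \<Longrightarrow> fsq F (lunit A l) \<bullet>'
      (fcomp F (lid A (ldom A l)) l \<bullet>' (funit F (ldom A l) \<star>' vid B (floose F l)))
    = lunit B (floose F l)"
  using funit_left[of l "ldom A l" "lcod A l"] by (auto simp: hom_defs)

lemma funit_right':
  "l \<in> looses A \<Longrightarrow> fsq F (runit A l) \<bullet>'
      (fcomp F l (lid A (lcod A l)) \<bullet>' (vid B (floose F l) \<star>' funit F (lcod A l)))
    = runit B (floose F l)"
  using funit_right[of l "ldom A l" "lcod A l"] by (auto simp: hom_defs)

lemma tight_iso_ftight: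
  assumes "tight_iso A f"
  shows "tight_iso B (ftight F f)"
proof -
  obtain g where g: "f \<in> tights A" "g \<in> tights A" "tdom A g = tcod A f" "tcod A g = tdom A f"
    "g \<cdot>\<^bsub>A\<^esub> f = tid A (tdom A f)" "f \<cdot>\<^bsub>A\<^esub> g = tid A (tcod A f)"
    using assms by (rule tight_isoE)
  then have "ftight F g \<cdot>\<^bsub>B\<^esub> ftight F f = tid B (fob F (tdom A f))"
    "ftight F f \<cdot>\<^bsub>B\<^esub> ftight F g = tid B (fob F (tcod A f))"
    by (simp_all flip: ftight_tcmp)
  then show ?thesis
    using g by (intro tight_isoI[of _ _ "ftight F g"]) simp_all
qed

end

text \<open>Outside the carriers every component is \<open>undefined\<close>, so equality of the
  records comes down to values on actual cells; for \<open>fcomp\<close> these are the composable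
  pairs, singled out by \<open>restrict_comp\<close>.\<close>

lemma dfun_eqI:
  assumes "double_functor A B F" "double_functor A B G"
    and "\<And>x. x \<in> obs A \<Longrightarrow> fob F x = fob G x"
    and "\<And>f. f \<in> tights A \<Longrightarrow> ftight F f = ftight G f"
    and "\<And>l. l \<in> looses A \<Longrightarrow> floose F l = floose G l"
    and "\<And>s. s \<in> squares A \<Longrightarrow> fsq F s = fsq G s"
    and "\<And>l m. \<lbrakk>l \<in> looses A; m \<in> looses A; lcod A l = ldom A m\<rbrakk> \<Longrightarrow> fcomp F l m = fcomp G l m"
    and "\<And>x. x \<in> obs A \<Longrightarrow> funit F x = funit G x"
  shows "F = G"
proof -
  interpret F: double_functor A B F by fact
  interpret G: double_functor A B G by fact
  have "fcomp F = fcomp G"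
    by (subst F.fcomp_ext[symmetric], subst G.fcomp_ext[symmetric])
      (auto simp: restrict_comp_def composable_def fun_eq_iff assms(7))
  moreover have "fob F = fob G" using extensionalityI[OF F.fob_ext G.fob_ext] assms(3) by blast
  moreover have "ftight F = ftight G" using extensionalityI[OF F.ftight_ext G.ftight_ext] assms(4) by blast
  moreover have "floose F = floose G" using extensionalityI[OF F.floose_ext G.floose_ext] assms(5) by blast
  moreover have "fsq F = fsq G" using extensionalityI[OF F.fsq_ext G.fsq_ext] assms(6) by blast
  moreover have "funit F = funit G" using extensionalityI[OF F.funit_ext G.funit_ext] assms(8) by blast
  ultimately show ?thesis by (intro dfun.equality) (simp_all add: F.ddom G.ddom F.dcod G.dcod)
qed

context tight_transformation
begin

lemma tob_simps [simp]:
  assumes "x \<in> obs A"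
  shows "tob t x \<in> tights B" "tdom B (tob t x) = fob F x" "tcod B (tob t x) = fob G x"
  using tob_hom[OF assms] by (auto simp: hom_defs)

lemma tloose_simps [simp]:
  assumes "l \<in> looses A"
  shows "tloose t l \<in> squares B" "sleft B (tloose t l) = tob t (ldom A l)" "sright B (tloose t l) = tob t (lcod A l)"
    "stop B (tloose t l) = floose F l" "sbot B (tloose t l) = floose G l"
  using tloose_hom[of l "ldom A l" "lcod A l"] assms by (auto simp: hom_defs)

lemma tob_nat: "f \<in> tights A \<Longrightarrow> ftight G f \<cdot>\<^bsub>B\<^esub> tob t (tdom A f) = tob t (tcod A f) \<cdot>\<^bsub>B\<^esub> ftight F f"
  using tob_natural[of f "tdom A f" "tcod A f"] by (auto simp: hom_defs)

lemma tloose_nat: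
  "s \<in> squares A \<Longrightarrow> fsq G s \<bullet>\<^bsub>B\<^esub> tloose t (stop A s) = tloose t (sbot A s) \<bullet>\<^bsub>B\<^esub> fsq F s"
  using tloose_natural[of s "sleft A s" "sright A s" "stop A s" "sbot A s"] by (auto simp: hom_defs)

lemma tloose_lcmp:
  "\<lbrakk>l \<in> looses A; m \<in> looses A; lcod A l = ldom A m\<rbrakk>
    \<Longrightarrow> tloose t (l \<odot>\<^bsub>A\<^esub> m) \<bullet>\<^bsub>B\<^esub> fcomp F l m = fcomp G l m \<bullet>\<^bsub>B\<^esub> (tloose t l \<star>\<^bsub>B\<^esub> tloose t m)"
  using tloose_cmp[of l "ldom A l" "lcod A l" m "lcod A m"] by (auto simp: hom_defs)

end

lemma ttrans_eqI:
  assumes "tight_transformation A B F G s" "tight_transformation A B F G t"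
    and "\<And>x. x \<in> obs A \<Longrightarrow> tob s x = tob t x"
    and "\<And>l. l \<in> looses A \<Longrightarrow> tloose s l = tloose t l"
  shows "s = t"
proof -
  interpret s: tight_transformation A B F G s by fact
  interpret t: tight_transformation A B F G t by fact
  have "tob s = tob t" using extensionalityI[OF s.tob_ext t.tob_ext] assms(3) by blast
  moreover have "tloose s = tloose t" using extensionalityI[OF s.tloose_ext t.tloose_ext] assms(4) by blast
  ultimately show ?thesis by (intro ttrans.equality) (simp_all add: s.tsrc t.tsrc s.ttgt t.ttgt)
qed

section \<open>Strict double functors; composites of double functors and of transformations\<close>

lemma strict_dfun_simps [simp]:
  "ddom (strict_dfun A B fo ft fl fs) = A" "dcod (strict_dfun A B fo ft fl fs) = B"
  "x \<in> obs A \<Longrightarrow> fob (strict_dfun A B fo ft fl fs) x = fo x"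
  "f \<in> tights A \<Longrightarrow> ftight (strict_dfun A B fo ft fl fs) f = ft f"
  "l \<in> looses A \<Longrightarrow> floose (strict_dfun A B fo ft fl fs) l = fl l"
  "s \<in> squares A \<Longrightarrow> fsq (strict_dfun A B fo ft fl fs) s = fs s"
  "\<lbrakk>l \<in> looses A; m \<in> looses A; lcod A l = ldom A m\<rbrakk>
    \<Longrightarrow> fcomp (strict_dfun A B fo ft fl fs) l m = vid B (fl (l \<odot>\<^bsub>A\<^esub> m))"
  "x \<in> obs A \<Longrightarrow> funit (strict_dfun A B fo ft fl fs) x = vid B (fl (lid A x))"
  by (simp_all add: strict_dfun_def restrict_comp_def composable_def)

lemma restrict_comp_idem [simp]: "restrict_comp A (restrict_comp A c) = restrict_comp A c"
  by (simp add: restrict_comp_def fun_eq_iff)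

text \<open>The defining axioms in terms of the boundary maps rather than of hom sets.\<close>

lemma dfunI:
  assumes "double_category A" "double_category B" "ddom F = A" "dcod F = B"
    and "fob F \<in> extensional (obs A)" "ftight F \<in> extensional (tights A)"
      "floose F \<in> extensional (looses A)" "fsq F \<in> extensional (squares A)"
      "restrict_comp A (fcomp F) = fcomp F" "funit F \<in> extensional (obs A)"
    and "\<And>x. x \<in> obs A \<Longrightarrow> fob F x \<in> obs B"
    and "\<And>f. f \<in> tights A \<Longrightarrow> ftight F f \<in> tights B \<and>
      tdom B (ftight F f) = fob F (tdom A f) \<and> tcod B (ftight F f) = fob F (tcod A f)"
    and "\<And>l. l \<in> looses A \<Longrightarrow> floose F l \<in> looses B \<and>
      ldom B (floose F l) = fob F (ldom A l) \<and> lcod B (floose F l) = fob F (lcod A l)"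
    and "\<And>s. s \<in> squares A \<Longrightarrow> fsq F s \<in> squares B \<and>
      sleft B (fsq F s) = ftight F (sleft A s) \<and> sright B (fsq F s) = ftight F (sright A s) \<and>
      stop B (fsq F s) = floose F (stop A s) \<and> sbot B (fsq F s) = floose F (sbot A s)"
    and "\<And>x. x \<in> obs A \<Longrightarrow> ftight F (tid A x) = tid B (fob F x)"
    and "\<And>f g. \<lbrakk>f \<in> tights A; g \<in> tights A; tdom A g = tcod A f\<rbrakk>
      \<Longrightarrow> ftight F (g \<cdot>\<^bsub>A\<^esub> f) = ftight F g \<cdot>\<^bsub>B\<^esub> ftight F f"
    and "\<And>l. l \<in> looses A \<Longrightarrow> fsq F (vid A l) = vid B (floose F l)"
    and "\<And>s t. \<lbrakk>s \<in> squares A; t \<in> squares A; stop A t = sbot A s\<rbrakk>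
      \<Longrightarrow> fsq F (t \<bullet>\<^bsub>A\<^esub> s) = fsq F t \<bullet>\<^bsub>B\<^esub> fsq F s"
    and "\<And>l m. \<lbrakk>l \<in> looses A; m \<in> looses A; lcod A l = ldom A m\<rbrakk> \<Longrightarrow> double_category.giso B (fcomp F l m) \<and>
      stop B (fcomp F l m) = floose F l \<odot>\<^bsub>B\<^esub> floose F m \<and> sbot B (fcomp F l m) = floose F (l \<odot>\<^bsub>A\<^esub> m)"
    and "\<And>x. x \<in> obs A \<Longrightarrow> double_category.giso B (funit F x) \<and>
      stop B (funit F x) = lid B (fob F x) \<and> sbot B (funit F x) = floose F (lid A x)"
    and "\<And>s t. \<lbrakk>s \<in> squares A; t \<in> squares A; sright A s = sleft A t;
        lcod A (stop A s) = ldom A (stop A t); lcod A (sbot A s) = ldom A (sbot A t)\<rbrakk>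
      \<Longrightarrow> fsq F (s \<star>\<^bsub>A\<^esub> t) \<bullet>\<^bsub>B\<^esub> fcomp F (stop A s) (stop A t)
        = fcomp F (sbot A s) (sbot A t) \<bullet>\<^bsub>B\<^esub> (fsq F s \<star>\<^bsub>B\<^esub> fsq F t)"
    and "\<And>f. f \<in> tights A
      \<Longrightarrow> fsq F (hid A f) \<bullet>\<^bsub>B\<^esub> funit F (tdom A f) = funit F (tcod A f) \<bullet>\<^bsub>B\<^esub> hid B (ftight F f)"
    and "\<And>k l m. \<lbrakk>k \<in> looses A; l \<in> looses A; m \<in> looses A; lcod A k = ldom A l; lcod A l = ldom A m\<rbrakk>
      \<Longrightarrow> fsq F (lassoc A k l m) \<bullet>\<^bsub>B\<^esub>
            (fcomp F (k \<odot>\<^bsub>A\<^esub> l) m \<bullet>\<^bsub>B\<^esub> (fcomp F k l \<star>\<^bsub>B\<^esub> vid B (floose F m)))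
        = fcomp F k (l \<odot>\<^bsub>A\<^esub> m) \<bullet>\<^bsub>B\<^esub> ((vid B (floose F k) \<star>\<^bsub>B\<^esub> fcomp F l m) \<bullet>\<^bsub>B\<^esub>
            lassoc B (floose F k) (floose F l) (floose F m))"
    and "\<And>l. l \<in> looses A \<Longrightarrow> fsq F (lunit A l) \<bullet>\<^bsub>B\<^esub>
        (fcomp F (lid A (ldom A l)) l \<bullet>\<^bsub>B\<^esub> (funit F (ldom A l) \<star>\<^bsub>B\<^esub> vid B (floose F l)))
      = lunit B (floose F l)"
    and "\<And>l. l \<in> looses A \<Longrightarrow> fsq F (runit A l) \<bullet>\<^bsub>B\<^esub>
        (fcomp F l (lid A (lcod A l)) \<bullet>\<^bsub>B\<^esub> (vid B (floose F l) \<star>\<^bsub>B\<^esub> funit F (lcod A l)))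
      = runit B (floose F l)"
  shows "double_functor A B F"
proof -
  interpret A: double_category A by fact
  interpret B: double_category B by fact
  have hor: "fsq F (s \<star>\<^bsub>A\<^esub> t) \<bullet>\<^bsub>B\<^esub> fcomp F l l' = fcomp F m m' \<bullet>\<^bsub>B\<^esub> (fsq F s \<star>\<^bsub>B\<^esub> fsq F t)"
    if "s \<in> sq_hom A f g l m" "t \<in> sq_hom A g h l' m'" for s t f g h l l' m m'
    using assms(21)[of s t] A.adjacent[of s t] that by (auto simp: sq_hom_def)
  show ?thesis
    by unfold_locales (use assms hor in \<open>auto simp: hom_defs B.glob_iso_iff\<close>)
qed

text \<open>With vertical identities as comparison squares, the coherence axioms of a double functor
  become preservation of associators and unitors on the nose, and naturality of the comparisons
  becomes preservation of \<open>hid\<close> and of horizontal composites.\<close>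

lemma double_functor_strict:
  assumes "double_category A" "double_category B"
    and ob: "\<And>x. x \<in> obs A \<Longrightarrow> fo x \<in> obs B"
    and t: "\<And>f. f \<in> tights A \<Longrightarrow> ft f \<in> tights B \<and> tdom B (ft f) = fo (tdom A f) \<and> tcod B (ft f) = fo (tcod A f)"
    and l: "\<And>l. l \<in> looses A \<Longrightarrow> fl l \<in> looses B \<and> ldom B (fl l) = fo (ldom A l) \<and> lcod B (fl l) = fo (lcod A l)"
    and s: "\<And>s. s \<in> squares A \<Longrightarrow> fs s \<in> squares B \<and> sleft B (fs s) = ft (sleft A s) \<and>
      sright B (fs s) = ft (sright A s) \<and> stop B (fs s) = fl (stop A s) \<and> sbot B (fs s) = fl (sbot A s)"
    and "\<And>x. x \<in> obs A \<Longrightarrow> ft (tid A x) = tid B (fo x)"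
    and "\<And>f g. \<lbrakk>f \<in> tights A; g \<in> tights A; tdom A g = tcod A f\<rbrakk> \<Longrightarrow> ft (g \<cdot>\<^bsub>A\<^esub> f) = ft g \<cdot>\<^bsub>B\<^esub> ft f"
    and "\<And>x. x \<in> obs A \<Longrightarrow> fl (lid A x) = lid B (fo x)"
    and "\<And>l m. \<lbrakk>l \<in> looses A; m \<in> looses A; lcod A l = ldom A m\<rbrakk> \<Longrightarrow> fl (l \<odot>\<^bsub>A\<^esub> m) = fl l \<odot>\<^bsub>B\<^esub> fl m"
    and "\<And>l. l \<in> looses A \<Longrightarrow> fs (vid A l) = vid B (fl l)"
    and "\<And>s t. \<lbrakk>s \<in> squares A; t \<in> squares A; stop A t = sbot A s\<rbrakk> \<Longrightarrow> fs (t \<bullet>\<^bsub>A\<^esub> s) = fs t \<bullet>\<^bsub>B\<^esub> fs s"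
    and "\<And>f. f \<in> tights A \<Longrightarrow> fs (hid A f) = hid B (ft f)"
    and "\<And>s t. \<lbrakk>s \<in> squares A; t \<in> squares A; sright A s = sleft A t\<rbrakk> \<Longrightarrow> fs (s \<star>\<^bsub>A\<^esub> t) = fs s \<star>\<^bsub>B\<^esub> fs t"
    and "\<And>k l m. \<lbrakk>k \<in> looses A; l \<in> looses A; m \<in> looses A; lcod A k = ldom A l; lcod A l = ldom A m\<rbrakk>
      \<Longrightarrow> fs (lassoc A k l m) = lassoc B (fl k) (fl l) (fl m)"
    and "\<And>l. l \<in> looses A \<Longrightarrow> fs (lunit A l) = lunit B (fl l)"
    and "\<And>l. l \<in> looses A \<Longrightarrow> fs (runit A l) = runit B (fl l)"
  shows "double_functor A B (strict_dfun A B fo ft fl fs)"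
proof -
  interpret A: double_category A by fact
  interpret B: double_category B by fact
  show ?thesis
    by (rule dfunI)
      (use assms A.adjacent in \<open>simp_all add: B.giso_intros B.hcmp_vid,
        simp_all add: strict_dfun_def\<close>)
qed

lemma dfun_id_in: "double_category A \<Longrightarrow> double_functor A A (dfun_id A)"
proof -
  assume "double_category A"
  then interpret double_category A .
  show ?thesis unfolding dfun_id_def by (rule double_functor_strict) (simp_all add: double_category_axioms)
qed

lemma dfun_cmp_simps [simp]:
  "ddom (G oo F) = ddom F" "dcod (G oo F) = dcod G"
  by (simp_all add: dfun_cmp_def)

lemma dfun_cmp_apply:
  assumes "double_functor A B F"
  shows "x \<in> obs A \<Longrightarrow> fob (G oo F) x = fob G (fob F x)"
    "f \<in> tights A \<Longrightarrow> ftight (G oo F) f = ftight G (ftight F f)"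
    "l \<in> looses A \<Longrightarrow> floose (G oo F) l = floose G (floose F l)"
    "s \<in> squares A \<Longrightarrow> fsq (G oo F) s = fsq G (fsq F s)"
    "\<lbrakk>l \<in> looses A; m \<in> looses A; lcod A l = ldom A m\<rbrakk> \<Longrightarrow> fcomp (G oo F) l m
      = fsq G (fcomp F l m) \<bullet>\<^bsub>dcod G\<^esub> fcomp G (floose F l) (floose F m)"
    "x \<in> obs A \<Longrightarrow> funit (G oo F) x = fsq G (funit F x) \<bullet>\<^bsub>dcod G\<^esub> funit G (fob F x)"
  using double_functor.ddom[OF assms] by (simp_all add: dfun_cmp_def compose_def restrict_comp_def composable_def)

text \<open>Each coherence axiom of the composite is the image under \<open>G\<close> of the axiom
  for \<open>F\<close>, pasted with the axiom for \<open>G\<close>. Between the two, naturality of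
  the comparison squares of \<open>G\<close> at those of \<open>F\<close> exchanges the order of the
  factors.\<close>

lemma dfun_cmp_in:
  fixes C (structure)
  assumes "double_functor A B F" "double_functor B C G"
  shows "double_functor A C (G oo F)"
proof -
  interpret F: double_functor A B F by fact
  interpret G: double_functor B C G by fact
  note [simp] = dfun_cmp_apply[OF assms(1)] F.ddom F.dcod G.ddom G.dcod F.A.adjacent
  show ?thesis
  proof (rule dfunI, goal_cases)
    case (21 s t)
    have "fsq G (fsq F (s \<star>\<^bsub>A\<^esub> t) \<bullet>\<^bsub>B\<^esub> fcomp F (stop A s) (stop A t))
      = fsq G (fcomp F (sbot A s) (sbot A t) \<bullet>\<^bsub>B\<^esub> (fsq F s \<star>\<^bsub>B\<^esub> fsq F t))"
      using F.fcomp_nat[of s t] 21 by simp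
    then have "fsq G (fsq F (s \<star>\<^bsub>A\<^esub> t)) \<bullet> fsq G (fcomp F (stop A s) (stop A t))
      = fsq G (fcomp F (sbot A s) (sbot A t)) \<bullet> fsq G (fsq F s \<star>\<^bsub>B\<^esub> fsq F t)"
      using 21 by simp
    then show ?case
      using 21 G.fcomp_nat[of "fsq F s" "fsq F t"]
      by (simp add: G.B.vcmp_assoc' flip: G.B.vcmp_assoc'[of _ "fsq G (fcomp F (stop A s) (stop A t))"])
  next
    case (22 f)
    have "fsq G (fsq F (hid A f)  \<bullet>\<^bsub>B\<^esub> funit F (tdom A f))
      = fsq G (funit F (tcod A f) \<bullet>\<^bsub>B\<^esub> hid B (ftight F f))"
      using F.funit_nat[of f] 22 by simp
    then have "fsq G (fsq F (hid A f)) \<bullet> fsq G (funit F (tdom A f))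
      = fsq G (funit F (tcod A f)) \<bullet> fsq G (hid B (ftight F f))"
      using 22 by simp
    then show ?case
      using 22 G.funit_nat[of "ftight F f"]
      by (simp flip: G.B.vcmp_assoc') (simp add: G.B.vcmp_assoc')
  next
    case (23 k l m)
    let ?k = "floose F k" and ?l = "floose F l" and ?m = "floose F m"
    have 1: "fsq G (fcomp F k l) \<star> vid C (floose G ?m) = fsq G (fcomp F k l) \<star> fsq G (vid B ?m)"
      "vid C (floose G ?k) \<star> fsq G (fcomp F l m) = fsq G (vid B ?k) \<star> fsq G (fcomp F l m)"
      using 23 by simp_all
    have 2: "(fsq G (fcomp F k l) \<bullet> fcomp G ?k ?l) \<star> vid C (floose G ?m)
        = (fsq G (fcomp F k l) \<star> fsq G (vid B ?m)) \<bullet> (fcomp G ?k ?l \<star> vid C (floose G ?m))"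
      "vid C (floose G ?k) \<star> (fsq G (fcomp F l m) \<bullet> fcomp G ?l ?m)
        = (fsq G (vid B ?k) \<star> fsq G (fcomp F l m)) \<bullet> (vid C (floose G ?k) \<star> fcomp G ?l ?m)"
      using 23 G.B.interchange[of "fcomp G ?k ?l" "fsq G (fcomp F k l)" "vid C (floose G ?m)" "vid C (floose G ?m)"]
        G.B.interchange[of "vid C (floose G ?k)" "vid C (floose G ?k)" "fcomp G ?l ?m" "fsq G (fcomp F l m)"]
      by simp_all
    \<comment> \<open>Associativity in four moves: \<open>a\<close> and \<open>b\<close> slide
      \<open>fcomp G\<close> past the images of the comparison squares of \<open>F\<close>,
      \<open>c\<close> is the image of associativity for \<open>F\<close>, and \<open>d\<close> is
      associativity for \<open>G\<close>. The rest is rebracketing.\<close>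
    have a: "fcomp G (floose F (k \<odot>\<^bsub>A\<^esub> l)) ?m \<bullet> (fsq G (fcomp F k l) \<star> fsq G (vid B ?m))
      = fsq G (fcomp F k l \<star>\<^bsub>B\<^esub> vid B ?m) \<bullet> fcomp G (?k \<odot>\<^bsub>B\<^esub> ?l) ?m"
      using G.fcomp_nat[of "fcomp F k l" "vid B ?m"] 23 by simp
    have b: "fcomp G ?k (floose F (l \<odot>\<^bsub>A\<^esub> m)) \<bullet> (fsq G (vid B ?k) \<star> fsq G (fcomp F l m))
      = fsq G (vid B ?k \<star>\<^bsub>B\<^esub> fcomp F l m) \<bullet> fcomp G ?k (?l \<odot>\<^bsub>B\<^esub> ?m)"
      using G.fcomp_nat[of "vid B ?k" "fcomp F l m"] 23 by simp
    have c: "fsq G (fsq F (lassoc A k l m) \<bullet>\<^bsub>B\<^esub>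
              (fcomp F (k \<odot>\<^bsub>A\<^esub> l) m \<bullet>\<^bsub>B\<^esub> (fcomp F k l \<star>\<^bsub>B\<^esub> vid B ?m)))
          = fsq G (fcomp F k (l \<odot>\<^bsub>A\<^esub> m) \<bullet>\<^bsub>B\<^esub> ((vid B ?k \<star>\<^bsub>B\<^esub> fcomp F l m) \<bullet>\<^bsub>B\<^esub> lassoc B ?k ?l ?m))"
      using F.fcomp_assoc'[of k l m] 23 by simp
    have d: "fsq G (lassoc B ?k ?l ?m) \<bullet>
              (fcomp G (?k \<odot>\<^bsub>B\<^esub> ?l) ?m \<bullet> (fcomp G ?k ?l \<star> vid C (floose G ?m)))
      = fcomp G ?k (?l \<odot>\<^bsub>B\<^esub> ?m) \<bullet> ((vid C (floose G ?k) \<star> fcomp G ?l ?m) \<bullet>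
          lassoc C (floose G ?k) (floose G ?l) (floose G ?m))"
      using G.fcomp_assoc'[of ?k ?l ?m] 23 by simp
    let ?L = "fsq G (fsq F (lassoc A k l m))" and ?M = "fsq G (fcomp F (k \<odot>\<^bsub>A\<^esub> l) m)"
      and ?N = "fcomp G ?k ?l \<star> vid C (floose G ?m)" and ?P = "vid C (floose G ?k) \<star> fcomp G ?l ?m"
      and ?Q = "lassoc C (floose G ?k) (floose G ?l) (floose G ?m)"
    have "?L \<bullet> ((?M \<bullet> fcomp G (floose F (k \<odot>\<^bsub>A\<^esub> l)) ?m) \<bullet>
        ((fsq G (fcomp F k l) \<star> fsq G (vid B ?m)) \<bullet> ?N))
      = ?L \<bullet> (?M \<bullet> ((fcomp G (floose F (k \<odot>\<^bsub>A\<^esub> l)) ?m \<bullet>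
        (fsq G (fcomp F k l) \<star> fsq G (vid B ?m))) \<bullet> ?N))"
      using 23 by (simp add: G.B.vcmp_assoc')
    also have "... = (?L \<bullet> (?M \<bullet> fsq G (fcomp F k l \<star>\<^bsub>B\<^esub> vid B ?m))) \<bullet>
        (fcomp G (?k \<odot>\<^bsub>B\<^esub> ?l) ?m \<bullet> ?N)"
      unfolding a using 23 by (simp add: G.B.vcmp_assoc')
    also have "... = (fsq G (fcomp F k (l \<odot>\<^bsub>A\<^esub> m)) \<bullet> (fsq G (vid B ?k \<star>\<^bsub>B\<^esub> fcomp F l m) \<bullet>
        fsq G (lassoc B ?k ?l ?m))) \<bullet> (fcomp G (?k \<odot>\<^bsub>B\<^esub> ?l) ?m \<bullet> ?N)"
      using c 23 by simp
    also have "... = fsq G (fcomp F k (l \<odot>\<^bsub>A\<^esub> m)) \<bullet> (fsq G (vid B ?k \<star>\<^bsub>B\<^esub> fcomp F l m) \<bullet>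
        (fsq G (lassoc B ?k ?l ?m) \<bullet> (fcomp G (?k \<odot>\<^bsub>B\<^esub> ?l) ?m \<bullet> ?N)))"
      using 23 by (simp add: G.B.vcmp_assoc')
    also have "... = fsq G (fcomp F k (l \<odot>\<^bsub>A\<^esub> m)) \<bullet> ((fsq G (vid B ?k \<star>\<^bsub>B\<^esub> fcomp F l m) \<bullet>
        fcomp G ?k (?l \<odot>\<^bsub>B\<^esub> ?m)) \<bullet> (?P \<bullet> ?Q))"
      unfolding d using 23 by (simp add: G.B.vcmp_assoc')
    also have "... = (fsq G (fcomp F k (l \<odot>\<^bsub>A\<^esub> m)) \<bullet> fcomp G ?k (floose F (l \<odot>\<^bsub>A\<^esub> m))) \<bullet>
        (((fsq G (vid B ?k) \<star> fsq G (fcomp F l m)) \<bullet> ?P) \<bullet> ?Q)"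
      unfolding b[symmetric] using 23 by (simp add: G.B.vcmp_assoc')
    finally show ?case using 23 2 by simp
  next
    case (24 l)
    let ?l = "floose F l" and ?x = "fob F (ldom A l)"
    have 2: "(fsq G (funit F (ldom A l)) \<bullet> funit G ?x) \<star> vid C (floose G ?l)
        = (fsq G (funit F (ldom A l)) \<star> fsq G (vid B ?l)) \<bullet> (funit G ?x \<star> vid C (floose G ?l))"
      using 24 G.B.interchange[of "funit G ?x" "fsq G (funit F (ldom A l))" "vid C (floose G ?l)" "vid C (floose G ?l)"]
      by simp
    have a: "fcomp G (floose F (lid A (ldom A l))) ?l \<bullet> (fsq G (funit F (ldom A l)) \<star> fsq G (vid B ?l))
      = fsq G (funit F (ldom A l) \<star>\<^bsub>B\<^esub> vid B ?l) \<bullet> fcomp G (lid B ?x) ?l"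
      using G.fcomp_nat[of "funit F (ldom A l)" "vid B ?l"] 24 by simp
    have c: "fsq G (fsq F (lunit A l) \<bullet>\<^bsub>B\<^esub>
              (fcomp F (lid A (ldom A l)) l \<bullet>\<^bsub>B\<^esub> (funit F (ldom A l) \<star>\<^bsub>B\<^esub> vid B ?l))) = fsq G (lunit B ?l)"
      using F.funit_left'[of l] 24 by simp
    have d: "fsq G (lunit B ?l) \<bullet>
          (fcomp G (lid B ?x) ?l \<bullet> (funit G ?x \<star> vid C (floose G ?l))) = lunit C (floose G ?l)"
      using G.funit_left'[of ?l] 24 by simp
    let ?L = "fsq G (fsq F (lunit A l))" and ?M = "fsq G (fcomp F (lid A (ldom A l)) l)"
      and ?N = "funit G ?x \<star> vid C (floose G ?l)"
    have "?L \<bullet> ((?M \<bullet> fcomp G (floose F (lid A (ldom A l))) ?l) \<bullet>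
        ((fsq G (funit F (ldom A l)) \<star> fsq G (vid B ?l)) \<bullet> ?N))
      = ?L \<bullet> (?M \<bullet> ((fcomp G (floose F (lid A (ldom A l))) ?l \<bullet>
        (fsq G (funit F (ldom A l)) \<star> fsq G (vid B ?l))) \<bullet> ?N))"
      using 24 by (simp add: G.B.vcmp_assoc')
    also have "... = (?L \<bullet> (?M \<bullet> fsq G (funit F (ldom A l) \<star>\<^bsub>B\<^esub> vid B ?l))) \<bullet>
        (fcomp G (lid B ?x) ?l \<bullet> ?N)"
      unfolding a using 24 by (simp add: G.B.vcmp_assoc')
    also have "... = lunit C (floose G ?l)" using c d 24 by simp
    finally show ?case using 24 2 by simp
  next
    case (25 l)
    let ?l = "floose F l" and ?x = "fob F (lcod A l)"
    have 2: "vid C (floose G ?l) \<star> (fsq G (funit F (lcod A l)) \<bullet> funit G ?x)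
        = (fsq G (vid B ?l) \<star> fsq G (funit F (lcod A l))) \<bullet> (vid C (floose G ?l) \<star> funit G ?x)"
      using 25 G.B.interchange[of "vid C (floose G ?l)" "vid C (floose G ?l)" "funit G ?x" "fsq G (funit F (lcod A l))"]
      by simp
    have a: "fcomp G ?l (floose F (lid A (lcod A l))) \<bullet> (fsq G (vid B ?l) \<star> fsq G (funit F (lcod A l)))
      = fsq G (vid B ?l \<star>\<^bsub>B\<^esub> funit F (lcod A l)) \<bullet> fcomp G ?l (lid B ?x)"
      using G.fcomp_nat[of "vid B ?l" "funit F (lcod A l)"] 25 by simp
    have c: "fsq G (fsq F (runit A l) \<bullet>\<^bsub>B\<^esub>
              (fcomp F l (lid A (lcod A l)) \<bullet>\<^bsub>B\<^esub> (vid B ?l \<star>\<^bsub>B\<^esub> funit F (lcod A l)))) = fsq G (runit B ?l)"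
      using F.funit_right'[of l] 25 by simp
    have d: "fsq G (runit B ?l) \<bullet>
          (fcomp G ?l (lid B ?x) \<bullet> (vid C (floose G ?l) \<star> funit G ?x)) = runit C (floose G ?l)"
      using G.funit_right'[of ?l] 25 by simp
    let ?L = "fsq G (fsq F (runit A l))" and ?M = "fsq G (fcomp F l (lid A (lcod A l)))"
      and ?N = "vid C (floose G ?l) \<star> funit G ?x"
    have "?L \<bullet> ((?M \<bullet> fcomp G ?l (floose F (lid A (lcod A l)))) \<bullet>
        ((fsq G (vid B ?l) \<star> fsq G (funit F (lcod A l))) \<bullet> ?N))
      = ?L \<bullet> (?M \<bullet> ((fcomp G ?l (floose F (lid A (lcod A l))) \<bullet>
        (fsq G (vid B ?l) \<star> fsq G (funit F (lcod A l)))) \<bullet> ?N))"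
      using 25 by (simp add: G.B.vcmp_assoc')
    also have "... = (?L \<bullet> (?M \<bullet> fsq G (vid B ?l \<star>\<^bsub>B\<^esub> funit F (lcod A l)))) \<bullet>
        (fcomp G ?l (lid B ?x) \<bullet> ?N)"
      unfolding a using 25 by (simp add: G.B.vcmp_assoc')
    also have "... = runit C (floose G ?l)" using c d 25 by simp
    finally show ?case using 25 2 by simp
  qed (simp_all add: dfun_cmp_def compose_def restrict_comp_def composable_def G.B.giso_intros G.fsq_giso
      F.A.double_category_axioms G.B.double_category_axioms cong: if_cong)
qed

lemma ttransI:
  assumes "double_functor A B F" "double_functor A B G" "tsrc t = F" "ttgt t = G"
    and "tob t \<in> extensional (obs A)" "tloose t \<in> extensional (looses A)"
    and "\<And>x. x \<in> obs A \<Longrightarrow> tob t x \<in> tights B \<and> tdom B (tob t x) = fob F x \<and> tcod B (tob t x) = fob G x"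
    and "\<And>l. l \<in> looses A \<Longrightarrow> tloose t l \<in> squares B \<and> sleft B (tloose t l) = tob t (ldom A l) \<and>
      sright B (tloose t l) = tob t (lcod A l) \<and> stop B (tloose t l) = floose F l \<and> sbot B (tloose t l) = floose G l"
    and "\<And>f. f \<in> tights A
      \<Longrightarrow> ftight G f \<cdot>\<^bsub>B\<^esub> tob t (tdom A f) = tob t (tcod A f) \<cdot>\<^bsub>B\<^esub> ftight F f"
    and "\<And>s. s \<in> squares A
      \<Longrightarrow> fsq G s \<bullet>\<^bsub>B\<^esub> tloose t (stop A s) = tloose t (sbot A s) \<bullet>\<^bsub>B\<^esub> fsq F s"
    and "\<And>l m. \<lbrakk>l \<in> looses A; m \<in> looses A; lcod A l = ldom A m\<rbrakk>
      \<Longrightarrow> tloose t (l \<odot>\<^bsub>A\<^esub> m) \<bullet>\<^bsub>B\<^esub> fcomp F l m = fcomp G l m \<bullet>\<^bsub>B\<^esub> (tloose t l \<star>\<^bsub>B\<^esub> tloose t m)"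
    and "\<And>x. x \<in> obs A \<Longrightarrow> tloose t (lid A x) \<bullet>\<^bsub>B\<^esub> funit F x = funit G x \<bullet>\<^bsub>B\<^esub> hid B (tob t x)"
  shows "tight_transformation A B F G t"
proof -
  interpret F: double_functor A B F by fact
  interpret G: double_functor A B G by fact
  show ?thesis by unfold_locales (use assms in \<open>auto simp: hom_defs\<close>)
qed

lemma ttrans_id_in:
  assumes "double_functor A B F"
  shows "tight_transformation A B F F (ttrans_id F)"
proof -
  interpret double_functor A B F by fact
  show ?thesis
    by (rule ttransI) (simp_all add: assms ttrans_id_def ddom dcod B.hcmp_vid B.hid_id)
qed

lemma ttrans_vcmp_in:
  assumes "tight_transformation A B F G s" "tight_transformation A B G H t"
  shows "tight_transformation A B F H (ttrans_vcmp t s)"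
proof -
  interpret s: tight_transformation A B F G s by fact
  interpret t: tight_transformation A B G H t by fact
  note B = s.F.B.vcmp_assoc'
  show ?thesis
  proof (rule ttransI, goal_cases)
    case (9 f)
    then show ?case
      using s.tob_nat[of f] t.tob_nat[of f]
      by (simp add: ttrans_vcmp_def Let_def s.tsrc s.F.ddom s.F.dcod flip: s.F.B.tcmp_assoc')
        (simp add: s.F.B.tcmp_assoc')
  next
    case (10 x)
    then show ?case
      using s.tloose_nat[of x] t.tloose_nat[of x]
      by (simp add: ttrans_vcmp_def Let_def s.tsrc s.F.ddom s.F.dcod flip: B) (simp add: B)
  next
    case (11 l m)
    then show ?case
      using s.tloose_lcmp[of l m] t.tloose_lcmp[of l m]
      by (simp add: ttrans_vcmp_def Let_def s.tsrc s.F.ddom s.F.dcod s.F.B.interchange B) (simp flip: B)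
  next
    case (12 x)
    then show ?case
      using s.tloose_id[of x] t.tloose_id[of x]
      by (simp add: ttrans_vcmp_def Let_def s.tsrc s.F.ddom s.F.dcod s.F.B.hid_tcmp B) (simp flip: B)
  qed (simp_all add: s.F.double_functor_axioms t.G.double_functor_axioms,
      simp_all add: ttrans_vcmp_def Let_def s.tsrc t.ttgt s.F.ddom s.F.dcod)
qed

text \<open>The composite is \<open>t\<close> at \<open>F'\<close> after \<open>G\<close> applied to
  \<open>s\<close>. Compatibility with comparison squares therefore combines naturality of the
  comparisons of \<open>G\<close> at the components of \<open>s\<close> with naturality of
  \<open>t\<close> at the comparison squares of \<open>F'\<close>.\<close>

lemma ttrans_hcmp_in:
  fixes C (structure)
  assumes "tight_transformation A B F F' s" "tight_transformation B C G G' t"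
  shows "tight_transformation A C (G oo F) (G' oo F') (ttrans_hcmp t s)"
proof -
  interpret s: tight_transformation A B F F' s by fact
  interpret t: tight_transformation B C G G' t by fact
  note B = t.F.B.vcmp_assoc'
  note [simp] = dfun_cmp_apply[OF s.F.double_functor_axioms] dfun_cmp_apply[OF s.G.double_functor_axioms]
    t.F.dcod t.F.ddom t.G.dcod s.F.ddom
  have e: "tsrc (ttrans_hcmp t s) = G oo F" "ttgt (ttrans_hcmp t s) = G' oo F'"
    "tob (ttrans_hcmp t s) = (\<lambda>x\<in>obs A. tob t (fob F' x) \<cdot> ftight G (tob s x))"
    "tloose (ttrans_hcmp t s) = (\<lambda>l\<in>looses A. tloose t (floose F' l) \<bullet> fsq G (tloose s l))"
    by (simp_all add: ttrans_hcmp_def Let_def s.tsrc t.tsrc s.ttgt t.ttgt)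
  show ?thesis
  proof (rule ttransI, goal_cases)
    case (9 f)
    have "ftight G (ftight F' f) \<cdot> ftight G (tob s (tdom A f)) =
      ftight G (tob s (tcod A f)) \<cdot> ftight G (ftight F f)"
      using s.tob_nat[of f] 9 by (simp flip: t.F.ftight_tcmp)
    then show ?case
      using 9 t.tob_nat[of "ftight F' f"]
      by (simp add: e flip: t.F.B.tcmp_assoc') (simp add: t.F.B.tcmp_assoc')
  next
    case (10 x)
    have "fsq G (fsq F' x) \<bullet> fsq G (tloose s (stop A x)) = fsq G (tloose s (sbot A x)) \<bullet> fsq G (fsq F x)"
      using s.tloose_nat[of x] 10 by (simp flip: t.F.fsq_vcmp')
    then show ?case
      using 10 t.tloose_nat[of "fsq F' x"]
      by (simp add: e flip: B) (simp add: B)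
  next
    case (11 l m)
    let ?l = "floose F l" and ?m = "floose F m" and ?l' = "floose F' l" and ?m' = "floose F' m"
    have a: "fsq G (tloose s (l \<odot>\<^bsub>A\<^esub> m)) \<bullet> fsq G (fcomp F l m)
        = fsq G (fcomp F' l m) \<bullet> fsq G (tloose s l \<star>\<^bsub>B\<^esub> tloose s m)"
      using s.tloose_lcmp[of l m] 11 by (simp flip: t.F.fsq_vcmp')
    have b: "fsq G (tloose s l \<star>\<^bsub>B\<^esub> tloose s m) \<bullet> fcomp G ?l ?m
        = fcomp G ?l' ?m' \<bullet> (fsq G (tloose s l) \<star> fsq G (tloose s m))"
      using t.F.fcomp_nat[of "tloose s l" "tloose s m"] 11 by simp
    have c: "tloose t (floose F' (l \<odot>\<^bsub>A\<^esub> m)) \<bullet> fsq G (fcomp F' l m)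
        = fsq G' (fcomp F' l m) \<bullet> tloose t (?l' \<odot>\<^bsub>B\<^esub> ?m')"
      using t.tloose_nat[of "fcomp F' l m"] 11 by simp
    have d: "tloose t (?l' \<odot>\<^bsub>B\<^esub> ?m') \<bullet> fcomp G ?l' ?m'
        = fcomp G' ?l' ?m' \<bullet> (tloose t ?l' \<star> tloose t ?m')"
      using t.tloose_lcmp[of ?l' ?m'] 11 by simp
    have "(tloose t (floose F' (l \<odot>\<^bsub>A\<^esub> m)) \<bullet> fsq G (tloose s (l \<odot>\<^bsub>A\<^esub> m))) \<bullet>
        (fsq G (fcomp F l m) \<bullet> fcomp G ?l ?m)
      = tloose t (floose F' (l \<odot>\<^bsub>A\<^esub> m)) \<bullet> ((fsq G (tloose s (l \<odot>\<^bsub>A\<^esub> m)) \<bullet>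
        fsq G (fcomp F l m)) \<bullet> fcomp G ?l ?m)"
      using 11 by (simp add: B)
    also have "... = (tloose t (floose F' (l \<odot>\<^bsub>A\<^esub> m)) \<bullet> fsq G (fcomp F' l m)) \<bullet>
        (fsq G (tloose s l \<star>\<^bsub>B\<^esub> tloose s m) \<bullet> fcomp G ?l ?m)"
      unfolding a using 11 by (simp add: B)
    also have "... = fsq G' (fcomp F' l m) \<bullet> ((tloose t (?l' \<odot>\<^bsub>B\<^esub> ?m') \<bullet> fcomp G ?l' ?m') \<bullet>
        (fsq G (tloose s l) \<star> fsq G (tloose s m)))"
      unfolding b c using 11 by (simp add: B)
    also have "... = (fsq G' (fcomp F' l m) \<bullet> fcomp G' ?l' ?m') \<bullet>
        ((tloose t ?l' \<star> tloose t ?m') \<bullet> (fsq G (tloose s l) \<star> fsq G (tloose s m)))"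
      unfolding d using 11 by (simp add: B)
    finally show ?case using 11 by (simp add: e t.F.B.interchange)
  next
    case (12 x)
    let ?x = "fob F x" and ?x' = "fob F' x"
    have a: "fsq G (tloose s (lid A x)) \<bullet> fsq G (funit F x)
        = fsq G (funit F' x) \<bullet> fsq G (hid B (tob s x))"
      using s.tloose_id[of x] 12 by (simp flip: t.F.fsq_vcmp')
    have b: "fsq G (hid B (tob s x)) \<bullet> funit G ?x = funit G ?x' \<bullet> hid C (ftight G (tob s x))"
      using t.F.funit_nat[of "tob s x"] 12 by simp
    have c: "tloose t (floose F' (lid A x)) \<bullet> fsq G (funit F' x)
        = fsq G' (funit F' x) \<bullet> tloose t (lid B ?x')"
      using t.tloose_nat[of "funit F' x"] 12 by simp
    have d: "tloose t (lid B ?x') \<bullet> funit G ?x' = funit G' ?x' \<bullet> hid C (tob t ?x')"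
      using t.tloose_id[of ?x'] 12 by simp
    have "(tloose t (floose F' (lid A x)) \<bullet> fsq G (tloose s (lid A x))) \<bullet>
        (fsq G (funit F x) \<bullet> funit G ?x)
      = tloose t (floose F' (lid A x)) \<bullet> ((fsq G (tloose s (lid A x)) \<bullet>
        fsq G (funit F x)) \<bullet> funit G ?x)"
      using 12 by (simp add: B)
    also have "... = (tloose t (floose F' (lid A x)) \<bullet> fsq G (funit F' x)) \<bullet>
        (fsq G (hid B (tob s x)) \<bullet> funit G ?x)"
      unfolding a using 12 by (simp add: B)
    also have "... = fsq G' (funit F' x) \<bullet> ((tloose t (lid B ?x') \<bullet> funit G ?x') \<bullet>
        hid C (ftight G (tob s x)))"
      unfolding b c using 12 by (simp add: B)
    also have "... = (fsq G' (funit F' x) \<bullet> funit G' ?x') \<bullet>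
        (hid C (tob t ?x') \<bullet> hid C (ftight G (tob s x)))"
      unfolding d using 12 by (simp add: B)
    finally show ?case using 12 by (simp add: e t.F.B.hid_tcmp)
  qed (rule dfun_cmp_in s.F.double_functor_axioms s.G.double_functor_axioms
      t.F.double_functor_axioms t.G.double_functor_axioms | simp add: e)+
qed

section \<open>The strict 2-category of double categories\<close>

lemma Dbl_simps [simp]:
  "cells0 Dbl = {D. double_category D}" "dom1 Dbl = ddom" "cod1 Dbl = dcod" "src2 Dbl = tsrc" "tgt2 Dbl = ttgt"
  "id1 Dbl = dfun_id" "cmp1 Dbl = dfun_cmp" "id2 Dbl = ttrans_id" "vcmp2 Dbl = ttrans_vcmp" "hcmp2 Dbl = ttrans_hcmp"
  by (simp_all add: Dbl_def)

lemma hom1_Dbl: "F \<in> hom1 Dbl A B \<longleftrightarrow> double_functor A B F"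
  by (simp add: hom1_def Dbl_def) (metis double_functor.ddom double_functor.dcod)

lemma cells1_Dbl: "F \<in> cells1 Dbl \<longleftrightarrow> double_functor (ddom F) (dcod F) F"
  by (simp add: Dbl_def)

lemma ttrans_ends:
  assumes "tight_transformation A B F G t"
  shows "double_functor A B F" "double_functor A B G" "tsrc t = F" "ttgt t = G"
    "ddom F = A" "dcod F = B" "ddom G = A" "dcod G = B"
proof -
  interpret tight_transformation A B F G t by fact
  show "double_functor A B F" "double_functor A B G" "tsrc t = F" "ttgt t = G"
    "ddom F = A" "dcod F = B" "ddom G = A" "dcod G = B"
    using F.double_functor_axioms G.double_functor_axioms tsrc ttgt F.ddom F.dcod G.ddom G.dcod by auto
qed

lemma hom2_Dbl: "t \<in> hom2 Dbl F G \<longleftrightarrow> tight_transformation (ddom F) (dcod F) F G t"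
  using ttrans_ends[of "ddom F" "dcod F" F G t] by (auto simp: hom2_def Dbl_def)

lemma ttrans_vcmp_simps:
  assumes "tight_transformation A B F G s"
  shows "x \<in> obs A \<Longrightarrow> tob (ttrans_vcmp t s) x = tob t x \<cdot>\<^bsub>B\<^esub> tob s x"
    "l \<in> looses A \<Longrightarrow> tloose (ttrans_vcmp t s) l = tloose t l \<bullet>\<^bsub>B\<^esub> tloose s l"
  using ttrans_ends[OF assms] by (simp_all add: ttrans_vcmp_def Let_def)

lemma ttrans_hcmp_simps:
  assumes "tight_transformation A B F F' s" "tight_transformation B C G G' t"
  shows "x \<in> obs A \<Longrightarrow> tob (ttrans_hcmp t s) x = tob t (fob F' x) \<cdot>\<^bsub>C\<^esub> ftight G (tob s x)"
    "l \<in> looses A \<Longrightarrow> tloose (ttrans_hcmp t s) l = tloose t (floose F' l) \<bullet>\<^bsub>C\<^esub> fsq G (tloose s l)"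
  using ttrans_ends[OF assms(1)] ttrans_ends[OF assms(2)]
  by (simp_all add: ttrans_hcmp_def Let_def)

lemma ttrans_id_simps:
  assumes "double_functor A B F"
  shows "x \<in> obs A \<Longrightarrow> tob (ttrans_id F) x = tid B (fob F x)"
    "l \<in> looses A \<Longrightarrow> tloose (ttrans_id F) l = vid B (floose F l)"
  using double_functor.ddom[OF assms] double_functor.dcod[OF assms] by (simp_all add: ttrans_id_def)

lemma dfun_id_apply [simp]:
  "ddom (dfun_id A) = A" "dcod (dfun_id A) = A"
  "x \<in> obs A \<Longrightarrow> fob (dfun_id A) x = x" "f \<in> tights A \<Longrightarrow> ftight (dfun_id A) f = f"
  "l \<in> looses A \<Longrightarrow> floose (dfun_id A) l = l" "s \<in> squares A \<Longrightarrow> fsq (dfun_id A) s = s"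
  "\<lbrakk>l \<in> looses A; m \<in> looses A; lcod A l = ldom A m\<rbrakk> \<Longrightarrow> fcomp (dfun_id A) l m = vid A (l \<odot>\<^bsub>A\<^esub> m)"
  "x \<in> obs A \<Longrightarrow> funit (dfun_id A) x = vid A (lid A x)"
  by (simp_all add: dfun_id_def)

lemma dfun_cats:
  assumes "double_functor A B F"
  shows "double_category A" "double_category B" "ddom F = A" "dcod F = B"
proof -
  interpret double_functor A B F by fact
  show "double_category A" "double_category B" "ddom F = A" "dcod F = B"
    using A.double_category_axioms B.double_category_axioms ddom dcod by auto
qed

lemma dfun_cmp_id_left:
  assumes "double_functor A B F"
  shows "dfun_id B oo F = F"
proof (rule dfun_eqI[OF dfun_cmp_in[OF assms dfun_id_in] assms])
  interpret double_functor A B F by fact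
  show "double_category B" by (rule B.double_category_axioms)
qed (use double_functor.axioms(1,2)[OF assms] in \<open>simp_all add: dfun_cmp_apply[OF assms]
    double_functor.fob_in[OF assms] double_functor.ftight_simps[OF assms] double_functor.floose_simps[OF assms]
    double_functor.fsq_simps[OF assms] double_functor.fcomp_simps[OF assms] double_functor.funit_simps[OF assms]
    double_category.vcmp_vid double_category.lid_simps double_category.ends_in double_category.lcmp_simps\<close>)

lemma dfun_cmp_id_right:
  assumes "double_functor A B F"
  shows "F oo dfun_id A = F"
proof -
  interpret double_functor A B F by fact
  note id = dfun_id_in[OF A.double_category_axioms]
  show ?thesis
    by (rule dfun_eqI[OF dfun_cmp_in[OF id assms] assms]) (simp_all add: dfun_cmp_apply[OF id] dcod)
qed

lemma dfun_cmp_assoc: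
  assumes "double_functor A B F" "double_functor B C G" "double_functor C D H"
  shows "(H oo G) oo F = H oo G oo F"
proof -
  interpret F: double_functor A B F by fact
  interpret G: double_functor B C G by fact
  interpret H: double_functor C D H by fact
  note GF = dfun_cmp_in[OF assms(1,2)] and HG = dfun_cmp_in[OF assms(2,3)]
  show ?thesis
    by (rule dfun_eqI[OF dfun_cmp_in[OF assms(1) HG] dfun_cmp_in[OF GF assms(3)]])
      (simp_all add: dfun_cmp_apply[OF assms(1)] dfun_cmp_apply[OF GF] dfun_cmp_apply[OF assms(2)]
        G.dcod H.dcod H.B.vcmp_assoc')
qed

lemma two_category_Dbl: "two_category Dbl"
proof (rule two_category.intro, goal_cases)
  case (1 f) then show ?case using dfun_cats by (auto simp: cells1_Dbl)
next
  case (2 f) then show ?case using dfun_cats by (auto simp: cells1_Dbl)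
next
  case (3 x) then show ?case by (simp add: hom1_Dbl dfun_id_in)
next
  case (4 f x y g z) then show ?case by (simp add: hom1_Dbl dfun_cmp_in)
next
  case (5 f x y) then show ?case by (simp add: hom1_Dbl dfun_cmp_id_left)
next
  case (6 f x y) then show ?case by (simp add: hom1_Dbl dfun_cmp_id_right)
next
  case (7 f x y g z h w) then show ?case by (simp add: hom1_Dbl dfun_cmp_assoc)
next
  case (8 a) then show ?case
    using ttrans_ends by (auto simp: cells1_Dbl) (simp add: Dbl_def, blast)
next
  case (9 a)
  then have "tight_transformation (ddom (tsrc a)) (dcod (tsrc a)) (tsrc a) (ttgt a) a" by (simp add: Dbl_def)
  note ttrans_ends[OF this]
  then show ?case by (simp add: cells1_Dbl)
next
  case (10 a)
  then have "tight_transformation (ddom (tsrc a)) (dcod (tsrc a)) (tsrc a) (ttgt a) a" by (simp add: Dbl_def)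
  note ttrans_ends[OF this]
  then show ?case by simp
next
  case (11 f) then show ?case by (simp add: cells1_Dbl hom2_Dbl ttrans_id_in)
next
  case (12 a f g b h)
  then have a: "tight_transformation (ddom f) (dcod f) f g a" by (simp add: hom2_Dbl)
  with 12 show ?case using ttrans_ends[OF a]
    by (auto simp add: hom2_Dbl intro: ttrans_vcmp_in)
next
  case (13 a f g)
  then interpret a: tight_transformation "ddom f" "dcod f" f g a by (simp add: hom2_Dbl)
  note ids = ttrans_id_in[OF a.G.double_functor_axioms]
  show ?case
    using ttrans_eqI[OF ttrans_vcmp_in[OF a.tight_transformation_axioms ids] a.tight_transformation_axioms]
    by (simp add: ttrans_vcmp_simps[OF a.tight_transformation_axioms] ttrans_id_simps[OF a.G.double_functor_axioms])
next
  case (14 a f g)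
  then interpret a: tight_transformation "ddom f" "dcod f" f g a by (simp add: hom2_Dbl)
  note ids = ttrans_id_in[OF a.F.double_functor_axioms]
  show ?case
    using ttrans_eqI[OF ttrans_vcmp_in[OF ids a.tight_transformation_axioms] a.tight_transformation_axioms]
    by (simp add: ttrans_vcmp_simps[OF ids] ttrans_id_simps[OF a.F.double_functor_axioms])
next
  case (15 a f g b h c k)
  then interpret a: tight_transformation "ddom f" "dcod f" f g a by (simp add: hom2_Dbl)
  interpret b: tight_transformation "ddom f" "dcod f" g h b using 15 by (simp add: hom2_Dbl a.G.ddom a.G.dcod)
  interpret c: tight_transformation "ddom f" "dcod f" h k c using 15 by (simp add: hom2_Dbl b.G.ddom b.G.dcod)
  note t = a.tight_transformation_axioms b.tight_transformation_axioms c.tight_transformation_axioms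
  note cb = ttrans_vcmp_in[OF t(2,3)] and ba = ttrans_vcmp_in[OF t(1,2)]
  show ?case
    using ttrans_eqI[OF ttrans_vcmp_in[OF t(1) cb] ttrans_vcmp_in[OF ba t(3)]]
    by (simp add: ttrans_vcmp_simps[OF t(1)] ttrans_vcmp_simps[OF ba] ttrans_vcmp_simps[OF t(2)] a.F.B.vcmp_assoc')
next
  case (16 a f f' b g g')
  then show ?case using ttrans_hcmp_in[of "ddom f" "dcod f" f f' a "dcod g" g g' b]
    by (simp add: hom2_Dbl)
next
  case (17 f x y g z)
  then interpret f: double_functor x y f by (simp add: hom1_Dbl)
  interpret g: double_functor y z g using 17 by (simp add: hom1_Dbl)
  note d = f.double_functor_axioms g.double_functor_axioms
  note i = ttrans_id_in[OF d(1)] ttrans_id_in[OF d(2)]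
  show ?case
    using ttrans_eqI[OF ttrans_hcmp_in[OF i] ttrans_id_in[OF dfun_cmp_in[OF d]]]
    by (simp add: ttrans_hcmp_simps[OF i] ttrans_id_simps[OF dfun_cmp_in[OF d]]
        ttrans_id_simps[OF d(1)] ttrans_id_simps[OF d(2)] dfun_cmp_apply[OF d(1)])
next
  case (18 a f f' a' f'' b g g' b' g'')
  then interpret a: tight_transformation "ddom f" "dcod f" f f' a by (simp add: hom2_Dbl)
  interpret a': tight_transformation "ddom f" "dcod f" f' f'' a' using 18 by (simp add: hom2_Dbl a.G.ddom a.G.dcod)
  interpret b: tight_transformation "dcod f" "dcod g" g g' b using 18 by (simp add: hom2_Dbl)
  interpret b': tight_transformation "dcod f" "dcod g" g' g'' b' using 18 by (simp add: hom2_Dbl b.G.ddom b.G.dcod)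
  note t = a.tight_transformation_axioms a'.tight_transformation_axioms
    b.tight_transformation_axioms b'.tight_transformation_axioms
  note va = ttrans_vcmp_in[OF t(1,2)] and vb = ttrans_vcmp_in[OF t(3,4)]
  note h = ttrans_hcmp_in[OF t(1,3)] and h' = ttrans_hcmp_in[OF t(2,4)]
  \<comment> \<open>Interchange comes down to naturality of \<open>b\<close> at the components of
    \<open>a'\<close>. The equations \<open>r\<close> and \<open>r'\<close> are the same facts with
    one more factor on the right, in the shape that occurs in right-nested composites.\<close>
  have n: "tob b (fob f'' x) \<cdot>\<^bsub>dcod g\<^esub> ftight g (tob a' x) = ftight g' (tob a' x) \<cdot>\<^bsub>dcod g\<^esub> tob b (fob f' x)"
    if "x \<in> obs (ddom f)" for x
    using b.tob_nat[of "tob a' x"] that by simp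
  have n': "tloose b (floose f'' x) \<bullet>\<^bsub>dcod g\<^esub> fsq g (tloose a' x) = fsq g' (tloose a' x) \<bullet>\<^bsub>dcod g\<^esub> tloose b (floose f' x)"
    if "x \<in> looses (ddom f)" for x
    using b.tloose_nat[of "tloose a' x"] that by simp
  have r: "tob b (fob f'' x) \<cdot>\<^bsub>dcod g\<^esub> (ftight g (tob a' x) \<cdot>\<^bsub>dcod g\<^esub> z)
    = ftight g' (tob a' x) \<cdot>\<^bsub>dcod g\<^esub> (tob b (fob f' x) \<cdot>\<^bsub>dcod g\<^esub> z)"
    if "x \<in> obs (ddom f)" "z \<in> tights (dcod g)" "tcod (dcod g) z = fob g (fob f' x)" for x z
    using n[OF that(1)] that by (simp flip: b.F.B.tcmp_assoc')
  have r': "tloose b (floose f'' x) \<bullet>\<^bsub>dcod g\<^esub> (fsq g (tloose a' x) \<bullet>\<^bsub>dcod g\<^esub> z)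
    = fsq g' (tloose a' x) \<bullet>\<^bsub>dcod g\<^esub> (tloose b (floose f' x) \<bullet>\<^bsub>dcod g\<^esub> z)"
    if "x \<in> looses (ddom f)" "z \<in> squares (dcod g)" "sbot (dcod g) z = floose g (floose f' x)" for x z
    using n'[OF that(1)] that by (simp flip: b.F.B.vcmp_assoc')
  show ?case
    using ttrans_eqI[OF ttrans_hcmp_in[OF va vb] ttrans_vcmp_in[OF h h']] 18(5)
    by (simp add: ttrans_hcmp_simps[OF va vb] ttrans_vcmp_simps[OF h] ttrans_hcmp_simps[OF t(1,3)]
        ttrans_hcmp_simps[OF t(2,4)] ttrans_vcmp_simps[OF t(1)] ttrans_vcmp_simps[OF t(3)] b.F.B.vcmp_assoc' r r')
next
  case (19 a f g y)
  then interpret a: tight_transformation "ddom f" y f g a by (simp add: hom2_Dbl)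
  note id = dfun_id_in[OF a.F.B.double_category_axioms]
  note ids = ttrans_id_in[OF id] and t = a.tight_transformation_axioms
  note h = ttrans_hcmp_in[OF t ids]
  note eq = dfun_cmp_id_left[OF a.F.double_functor_axioms] dfun_cmp_id_left[OF a.G.double_functor_axioms]
  show ?case
    using ttrans_eqI[OF h[unfolded eq] t]
    by (simp add: ttrans_hcmp_simps[OF t ids] ttrans_id_simps[OF id])
next
  case (20 a f g x)
  then interpret a: tight_transformation x "dcod f" f g a by (simp add: hom2_Dbl)
  note id = dfun_id_in[OF a.F.A.double_category_axioms]
  note ids = ttrans_id_in[OF id] and t = a.tight_transformation_axioms
  note h = ttrans_hcmp_in[OF ids t]
  note eq = dfun_cmp_id_right[OF a.F.double_functor_axioms] dfun_cmp_id_right[OF a.G.double_functor_axioms]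
  show ?case
    using ttrans_eqI[OF h[unfolded eq] t]
    by (simp add: ttrans_hcmp_simps[OF ids t] ttrans_id_simps[OF id])
next
  case (21 a f f' b g g' c h h')
  then interpret a: tight_transformation "ddom f" "dcod f" f f' a by (simp add: hom2_Dbl)
  interpret b: tight_transformation "dcod f" "dcod g" g g' b using 21 by (simp add: hom2_Dbl)
  interpret c: tight_transformation "dcod g" "dcod h" h h' c using 21 by (simp add: hom2_Dbl)
  note t = a.tight_transformation_axioms b.tight_transformation_axioms c.tight_transformation_axioms
  note d = a.F.double_functor_axioms b.F.double_functor_axioms c.F.double_functor_axioms
  note d' = a.G.double_functor_axioms b.G.double_functor_axioms c.G.double_functor_axioms
  note cb = ttrans_hcmp_in[OF t(2,3)] and ba = ttrans_hcmp_in[OF t(1,2)]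
  show ?case
    using ttrans_eqI[OF ttrans_hcmp_in[OF t(1) cb, unfolded dfun_cmp_assoc[OF d] dfun_cmp_assoc[OF d']]
        ttrans_hcmp_in[OF ba t(3)]]
    by (simp add: ttrans_hcmp_simps[OF t(1) cb] ttrans_hcmp_simps[OF ba t(3)] ttrans_hcmp_simps[OF t(1,2)]
        ttrans_hcmp_simps[OF t(2,3)] dfun_cmp_apply[OF d'(1)] dfun_cmp_apply[OF d(2)] c.F.B.vcmp_assoc')
qed

section \<open>Coherence of units, cartesian squares, and the universal property of companions and
  conjoints\<close>

context double_category
begin

lemma iso_epi:
  assumes "sq_iso D i" "s \<in> squares D" "t \<in> squares D" "stop D s = sbot D i" "stop D t = sbot D i"
    "s \<bullet> i = t \<bullet> i"
  shows "s = t"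
  using sq_inv_cancel(3)[OF assms(1)] assms(2-6) by metis

lemma iso_mono:
  assumes "sq_iso D i" "s \<in> squares D" "t \<in> squares D" "sbot D s = stop D i" "sbot D t = stop D i"
    "i \<bullet> s = i \<bullet> t"
  shows "s = t"
  using sq_inv_cancel(1)[OF assms(1)] assms(2-6) by metis

text \<open>Naturality of the left unitor expresses \<open>s\<close> through
  \<open>vid D (lid D x) \<star> s\<close> up to invertible cells, so whiskering with a loose
  identity is faithful. This permits coherence equations to be proved after tensoring with a
  unit.\<close>

lemma vid_lid_cancel:
  assumes "s \<in> squares D" "t \<in> squares D" "stop D s = stop D t" "sbot D s = sbot D t"
    "sleft D s = tid D x" "sleft D t = tid D x" "x \<in> obs D" "vid D (lid D x) \<star> s = vid D (lid D x) \<star> t"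
  shows "s = t"
  by (rule iso_epi[of "lunit D (stop D s)"]) (use lunit_nat[of s] lunit_nat[of t] assms in \<open>simp_all add: hid_id\<close>)

lemma cancel_vid_lid:
  assumes "s \<in> squares D" "t \<in> squares D" "stop D s = stop D t" "sbot D s = sbot D t"
    "sright D s = tid D x" "sright D t = tid D x" "x \<in> obs D" "s \<star> vid D (lid D x) = t \<star> vid D (lid D x)"
  shows "s = t"
  by (rule iso_epi[of "runit D (stop D s)"]) (use runit_nat[of s] runit_nat[of t] assms in \<open>simp_all add: hid_id\<close>)

lemma vid_interchange:
  "\<lbrakk>l \<in> looses D; s \<in> squares D; t \<in> squares D; stop D t = sbot D s; sleft D s = tid D (lcod D l);
    sleft D t = tid D (lcod D l)\<rbrakk> \<Longrightarrow> vid D l \<star> (t \<bullet> s) = (vid D l \<star> t) \<bullet> (vid D l \<star> s)"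
  "\<lbrakk>l \<in> looses D; s \<in> squares D; t \<in> squares D; stop D t = sbot D s; sright D s = tid D (ldom D l);
    sright D t = tid D (ldom D l)\<rbrakk> \<Longrightarrow> (t \<bullet> s) \<star> vid D l = (t \<star> vid D l) \<bullet> (s \<star> vid D l)"
  using interchange[of "vid D l" "vid D l" s t] interchange[of s t "vid D l" "vid D l"] by auto

text \<open>Kelly's consequences of the pentagon and triangle axioms.\<close>

lemma lunit_lcmp:
  assumes [simp]: "c \<in> looses D" "y \<in> looses D" "lcod D c = ldom D y"
  shows "lunit D (c \<odot> y) \<bullet> lassoc D (lid D (ldom D c)) c y = lunit D c \<star> vid D y"
proof (rule vid_lid_cancel[where x = "ldom D c"])
  let ?I = "lid D (ldom D c)"
  let ?a = "lassoc D ?I (?I \<odot> c) y" and ?b = "lassoc D ?I ?I c \<star> vid D y"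
  let ?L = "lunit D (c \<odot> y) \<bullet> lassoc D ?I c y" and ?R = "lunit D c \<star> vid D y"
  show "vid D ?I \<star> ?L = vid D ?I \<star> ?R"
  \<comment> \<open>\<open>?a \<bullet> ?b\<close> consists of two edges of the pentagon on
    \<open>?I\<close>, \<open>?I\<close>, \<open>c\<close>, \<open>y\<close>. Precomposed with them,
    both sides can be compared by pentagon, triangle and naturality; being invertible, they may be
    cancelled again.\<close>
  proof (rule iso_epi[of "?a \<bullet> ?b"])
    have "(vid D ?I \<star> ?L) \<bullet> (?a \<bullet> ?b)
      = (vid D ?I \<star> lunit D (c \<odot> y)) \<bullet> ((vid D ?I \<star> lassoc D ?I c y) \<bullet> (?a \<bullet> ?b))"
      by (simp add: vid_interchange vcmp_assoc')
    also have "... = (vid D ?I \<star> lunit D (c \<odot> y)) \<bullet> (lassoc D ?I ?I (c \<odot> y) \<bullet> lassoc D (?I \<odot> ?I) c y)"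
      by (simp add: pentagon')
    also have "... = (runit D ?I \<star> (vid D c \<star> vid D y)) \<bullet> lassoc D (?I \<odot> ?I) c y"
      by (simp add: triangle' hcmp_vid flip: vcmp_assoc')
    also have "... = lassoc D ?I c y \<bullet> ((runit D ?I \<star> vid D c) \<star> vid D y)"
      using lassoc_nat[of "runit D ?I" "vid D c" "vid D y"] by simp
    also have "... = lassoc D ?I c y \<bullet> (((vid D ?I \<star> lunit D c) \<bullet> lassoc D ?I ?I c) \<star> vid D y)"
      by (simp add: triangle')
    also have "... = (lassoc D ?I c y \<bullet> ((vid D ?I \<star> lunit D c) \<star> vid D y)) \<bullet> ?b"
      by (simp add: vid_interchange vcmp_assoc')
    also have "... = (vid D ?I \<star> ?R) \<bullet> (?a \<bullet> ?b)"
      using lassoc_nat[of "vid D ?I" "lunit D c" "vid D y"] by (simp add: vcmp_assoc')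
    finally show "(vid D ?I \<star> ?L) \<bullet> (?a \<bullet> ?b) = (vid D ?I \<star> ?R) \<bullet> (?a \<bullet> ?b)" .
    show "sq_iso D (?a \<bullet> ?b)" by (intro gisoD(2) giso_intros) simp_all
  qed simp_all
qed simp_all

lemma runit_lcmp:
  assumes [simp]: "x \<in> looses D" "y \<in> looses D" "lcod D x = ldom D y"
  shows "(vid D x \<star> runit D y) \<bullet> lassoc D x y (lid D (lcod D y)) = runit D (x \<odot> y)"
proof (rule cancel_vid_lid[where x = "lcod D y"])
  let ?I = "lid D (lcod D y)"
  let ?L = "(vid D x \<star> runit D y) \<bullet> lassoc D x y ?I" and ?R = "runit D (x \<odot> y)"
  show "?L \<star> vid D ?I = ?R \<star> vid D ?I"
  proof (rule iso_mono[of "lassoc D x y ?I"])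
    have "lassoc D x y ?I \<bullet> (?L \<star> vid D ?I)
      = (lassoc D x y ?I \<bullet> ((vid D x \<star> runit D y) \<star> vid D ?I)) \<bullet> (lassoc D x y ?I \<star> vid D ?I)"
      by (simp add: vid_interchange vcmp_assoc')
    also have "... = (vid D x \<star> (runit D y \<star> vid D ?I)) \<bullet> (lassoc D x (y \<odot> ?I) ?I \<bullet> (lassoc D x y ?I \<star> vid D ?I))"
      using lassoc_nat[of "vid D x" "runit D y" "vid D ?I"] by (simp add: vcmp_assoc')
    also have "... = (vid D x \<star> (vid D y \<star> lunit D ?I)) \<bullet> ((vid D x \<star> lassoc D y ?I ?I) \<bullet>
        (lassoc D x (y \<odot> ?I) ?I \<bullet> (lassoc D x y ?I \<star> vid D ?I)))"
      using triangle'[of y ?I "lcod D y"] by (simp add: vid_interchange vcmp_assoc' flip: triangle'[of y ?I "lcod D y"])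
    also have "... = ((vid D x \<star> (vid D y \<star> lunit D ?I)) \<bullet> lassoc D x y (?I \<odot> ?I)) \<bullet> lassoc D (x \<odot> y) ?I ?I"
      by (simp add: pentagon' vcmp_assoc')
    also have "... = (lassoc D x y ?I \<bullet> (vid D (x \<odot> y) \<star> lunit D ?I)) \<bullet> lassoc D (x \<odot> y) ?I ?I"
      using lassoc_nat[of "vid D x" "vid D y" "lunit D ?I"] by (simp add: hcmp_vid)
    also have "... = lassoc D x y ?I \<bullet> (?R \<star> vid D ?I)"
      by (simp add: vcmp_assoc' triangle')
    finally show "lassoc D x y ?I \<bullet> (?L \<star> vid D ?I) = lassoc D x y ?I \<bullet> (?R \<star> vid D ?I)" .
  qed simp_all
qed simp_all

lemma lunit_lid:
  assumes [simp]: "x \<in> obs D"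
  shows "lunit D (lid D x) = runit D (lid D x)"
proof (rule cancel_vid_lid[where x = x])
  let ?I = "lid D x"
  \<comment> \<open>Naturality of the left unitor at itself, with the invertible unitor cancelled on
    the left.\<close>
  have *: "lunit D (?I \<odot> ?I) = vid D ?I \<star> lunit D ?I"
    by (rule iso_mono[of "lunit D ?I"]) (use lunit_nat[of "lunit D ?I"] in \<open>simp_all add: hid_id\<close>)
  have "lunit D ?I \<star> vid D ?I = lunit D (?I \<odot> ?I) \<bullet> lassoc D ?I ?I ?I"
    using lunit_lcmp[of ?I ?I] by simp
  also have "... = runit D ?I \<star> vid D ?I" unfolding * by (simp add: triangle')
  finally show "lunit D ?I \<star> vid D ?I = runit D ?I \<star> vid D ?I" .
qed simp_all

text \<open>This says that \<open>u\<close> is a cartesian arrow for the functor that sends squares,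
  under vertical composition, to their pairs of sides. The property refers to no choice of
  companions, which is why it can take the place of the transposes.\<close>

definition cart :: "'u \<Rightarrow> bool" where
  "cart u \<longleftrightarrow> u \<in> squares D \<and> (\<forall>v h k. v \<in> squares D \<longrightarrow> h \<in> tights D \<longrightarrow> k \<in> tights D \<longrightarrow>
     tcod D h = ldom D (stop D u) \<longrightarrow> tcod D k = lcod D (stop D u) \<longrightarrow> sbot D v = sbot D u \<longrightarrow>
     sleft D v = sleft D u \<cdot> h \<longrightarrow> sright D v = sright D u \<cdot> k \<longrightarrow>
     (\<exists>!w. w \<in> squares D \<and> sbot D w = stop D u \<and> sleft D w = h \<and> sright D w = k \<and> u \<bullet> w = v))"

lemma cartI:
  assumes "u \<in> squares D"
    and "\<And>v h k. \<lbrakk>v \<in> squares D; h \<in> tights D; k \<in> tights D; tcod D h = ldom D (stop D u);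
      tcod D k = lcod D (stop D u); sbot D v = sbot D u; sleft D v = sleft D u \<cdot> h; sright D v = sright D u \<cdot> k\<rbrakk>
      \<Longrightarrow> \<exists>w. w \<in> squares D \<and> sbot D w = stop D u \<and> sleft D w = h \<and> sright D w = k \<and> u \<bullet> w = v"
    and "\<And>w w'. \<lbrakk>w \<in> squares D; w' \<in> squares D; sbot D w = stop D u; sbot D w' = stop D u;
      sleft D w = sleft D w'; sright D w = sright D w'; u \<bullet> w = u \<bullet> w'\<rbrakk> \<Longrightarrow> w = w'"
  shows "cart u"
  unfolding cart_def
proof (intro conjI allI impI, goal_cases)
  case (2 v h k)
  from assms(2)[OF 2] obtain w where
    w: "w \<in> squares D \<and> sbot D w = stop D u \<and> sleft D w = h \<and> sright D w = k \<and> u \<bullet> w = v" by blast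
  with assms(3)[of _ w] show ?case by (intro ex1I[of _ w]) auto
qed fact

lemma cart_square: "cart u \<Longrightarrow> u \<in> squares D"
  by (simp add: cart_def)

lemma cart_factor:
  assumes "cart u" "v \<in> squares D" "h \<in> tights D" "k \<in> tights D" "tcod D h = ldom D (stop D u)"
    "tcod D k = lcod D (stop D u)" "sbot D v = sbot D u" "sleft D v = sleft D u \<cdot> h" "sright D v = sright D u \<cdot> k"
  obtains w where "w \<in> squares D" "sbot D w = stop D u" "sleft D w = h" "sright D w = k" "u \<bullet> w = v"
    "stop D w = stop D v"
proof -
  from assms obtain w where w: "w \<in> squares D" "sbot D w = stop D u" "sleft D w = h" "sright D w = k" "u \<bullet> w = v"
    unfolding cart_def by blast
  then have "stop D w = stop D v" using cart_square[OF assms(1)] by auto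
  with w that show thesis by blast
qed

lemma cart_unique:
  assumes "cart u" "w \<in> squares D" "w' \<in> squares D" "sbot D w = stop D u" "sbot D w' = stop D u"
    "sleft D w = sleft D w'" "sright D w = sright D w'" "u \<bullet> w = u \<bullet> w'"
  shows "w = w'"
proof -
  have u: "u \<in> squares D" using assms(1) by (rule cart_square)
  have "\<exists>!z. z \<in> squares D \<and> sbot D z = stop D u \<and> sleft D z = sleft D w \<and> sright D z = sright D w \<and>
    u \<bullet> z = u \<bullet> w"
    using assms(1)[unfolded cart_def, THEN conjunct2, rule_format, of "u \<bullet> w" "sleft D w" "sright D w"] assms(2-5) u
    by simp
  with assms show ?thesis by metis
qed

lemma giso_cart:
  assumes "giso s"
  shows "cart s"
proof (rule cartI)
  note s = gisoD[OF assms] giso_sq_inv_simps[OF assms]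
  show "s \<in> squares D" by (rule s)
  fix v h k assume v: "v \<in> squares D" "h \<in> tights D" "k \<in> tights D" "tcod D h = ldom D (stop D s)"
    "tcod D k = lcod D (stop D s)" "sbot D v = sbot D s" "sleft D v = sleft D s \<cdot> h" "sright D v = sright D s \<cdot> k"
  then show "\<exists>w. w \<in> squares D \<and> sbot D w = stop D s \<and> sleft D w = h \<and> sright D w = k \<and> s \<bullet> w = v"
    using s by (intro exI[of _ "sq_inv D s \<bullet> v"]) (simp add: sq_inv_cancel)
next
  fix w w' assume "w \<in> squares D" "w' \<in> squares D" "sbot D w = stop D s" "sbot D w' = stop D s" "s \<bullet> w = s \<bullet> w'"
  then show "w = w'" using iso_mono[OF gisoD(2)[OF assms]] by blast
qed

lemma cart_vcmp:
  assumes u: "cart u" and u': "cart u'" and e: "stop D u' = sbot D u"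
  shows "cart (u' \<bullet> u)"
proof (rule cartI)
  note [simp] = cart_square[OF u] cart_square[OF u'] e
  show "u' \<bullet> u \<in> squares D" by simp
  fix v h k assume v: "v \<in> squares D" "h \<in> tights D" "k \<in> tights D" "tcod D h = ldom D (stop D (u' \<bullet> u))"
    "tcod D k = lcod D (stop D (u' \<bullet> u))" "sbot D v = sbot D (u' \<bullet> u)" "sleft D v = sleft D (u' \<bullet> u) \<cdot> h"
    "sright D v = sright D (u' \<bullet> u) \<cdot> k"
  from v obtain z where z: "z \<in> squares D" "sbot D z = stop D u'" "sleft D z = sleft D u \<cdot> h"
    "sright D z = sright D u \<cdot> k" "u' \<bullet> z = v" "stop D z = stop D v"
    by (elim cart_factor[OF u', of v "sleft D u \<cdot> h" "sright D u \<cdot> k"]) simp_all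
  from z v obtain w where w: "w \<in> squares D" "sbot D w = stop D u" "sleft D w = h" "sright D w = k" "u \<bullet> w = z"
    by (elim cart_factor[OF u, of z h k]) simp_all
  then have "(u' \<bullet> u) \<bullet> w = v" using z by (simp add: vcmp_assoc')
  with w show "\<exists>w. w \<in> squares D \<and> sbot D w = stop D (u' \<bullet> u) \<and> sleft D w = h \<and> sright D w = k \<and> (u' \<bullet> u) \<bullet> w = v"
    by auto
next
  note [simp] = cart_square[OF u] cart_square[OF u'] e
  fix w w' assume w: "w \<in> squares D" "w' \<in> squares D" "sbot D w = stop D (u' \<bullet> u)" "sbot D w' = stop D (u' \<bullet> u)"
    "sleft D w = sleft D w'" "sright D w = sright D w'" "(u' \<bullet> u) \<bullet> w = (u' \<bullet> u) \<bullet> w'"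
  have "u \<bullet> w = u \<bullet> w'" by (rule cart_unique[OF u']) (use w in \<open>simp_all add: vcmp_assoc'\<close>)
  with w show "w = w'" using cart_unique[OF u, of w w'] by simp
qed

text \<open>The second half of the pasting law for cartesian arrows: a factorisation of
  \<open>u' \<bullet> v\<close> through the composite is one of \<open>v\<close> through
  \<open>u\<close>, since squares into the top of \<open>u'\<close> are determined by their
  composite with \<open>u'\<close>.\<close>

lemma cart_cancel:
  assumes u': "cart u'" and c: "cart (u' \<bullet> u)" and e: "stop D u' = sbot D u" and u: "u \<in> squares D"
  shows "cart u"
proof (rule cartI)
  note [simp] = cart_square[OF u'] e u
  fix v h k assume v: "v \<in> squares D" "h \<in> tights D" "k \<in> tights D" "tcod D h = ldom D (stop D u)"
    "tcod D k = lcod D (stop D u)" "sbot D v = sbot D u" "sleft D v = sleft D u \<cdot> h" "sright D v = sright D u \<cdot> k"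
  obtain w where w: "w \<in> squares D" "sbot D w = stop D u" "sleft D w = h" "sright D w = k"
    "(u' \<bullet> u) \<bullet> w = u' \<bullet> v"
    by (rule cart_factor[OF c, of "u' \<bullet> v" h k]) (use v in simp_all)
  have "u \<bullet> w = v" by (rule cart_unique[OF u']) (use v w in \<open>simp_all add: vcmp_assoc'\<close>)
  with w show "\<exists>w. w \<in> squares D \<and> sbot D w = stop D u \<and> sleft D w = h \<and> sright D w = k \<and> u \<bullet> w = v"
    by auto
next
  note [simp] = cart_square[OF u'] e u
  fix w w' assume w: "w \<in> squares D" "w' \<in> squares D" "sbot D w = stop D u" "sbot D w' = stop D u"
    "sleft D w = sleft D w'" "sright D w = sright D w'" "u \<bullet> w = u \<bullet> w'"
  show "w = w'" by (rule cart_unique[OF c]) (use w in \<open>simp_all add: vcmp_assoc'\<close>)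
qed (rule u)

text \<open>Factoring the vertical identity on the bottom through \<open>w\<close> gives a right
  inverse; uniqueness of factorisations, applied to \<open>v \<bullet> w\<close> and the identity on
  the top, makes it two-sided.\<close>

lemma glob_cart_iso:
  assumes "glob w" "cart w"
  shows "sq_iso D w"
proof -
  note w = globD[OF assms(1)]
  have *: "stop D w \<in> looses D" "sbot D w \<in> looses D" using w by simp_all
  obtain v where v: "v \<in> squares D" "sbot D v = stop D w" "sleft D v = tid D (ldom D (stop D w))"
    "sright D v = tid D (lcod D (stop D w))" "w \<bullet> v = vid D (sbot D w)" "stop D v = sbot D w"
    by (rule cart_factor[OF assms(2), of "vid D (sbot D w)" "tid D (ldom D (stop D w))" "tid D (lcod D (stop D w))"])
      (use w in simp_all)
  have "w \<bullet> (v \<bullet> w) = w \<bullet> vid D (stop D w)"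
    using v w by (simp flip: vcmp_assoc')
  with v w have "v \<bullet> w = vid D (stop D w)"
    using cart_unique[OF assms(2), of "v \<bullet> w" "vid D (stop D w)"] by simp
  then show ?thesis using v w by (intro sq_isoI[of _ v]) simp_all
qed

text \<open>Globular isomorphisms are cartesian, so they can be added by composition and removed by
  cancellation. Coherence cells thus never affect whether a square is cartesian.\<close>

lemma cart_giso_iff:
  assumes "giso i" "giso j" "u \<in> squares D" "stop D u = sbot D i" "stop D j = sbot D u"
  shows "cart (j \<bullet> (u \<bullet> i)) \<longleftrightarrow> cart u"
proof
  note [simp] = assms gisoD[OF assms(1)] gisoD[OF assms(2)]
  assume "cart u"
  then show "cart (j \<bullet> (u \<bullet> i))" by (simp add: cart_vcmp giso_cart)
next
  note [simp] = assms gisoD[OF assms(1)] gisoD[OF assms(2)]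
  assume c: "cart (j \<bullet> (u \<bullet> i))"
  have "cart (u \<bullet> i)" by (rule cart_cancel[OF giso_cart[OF assms(2)]]) (use c in simp_all)
  then have "cart ((u \<bullet> i) \<bullet> sq_inv D i)"
    by (simp add: cart_vcmp giso_cart giso_intros)
  then show "cart u" by (simp add: sq_inv_cancel)
qed

text \<open>The factorisation of a square \<open>v\<close> with left side \<open>f h\<close> through \<open>p \<star> id\<close> is
  \<open>(b \<bullet> id\<^sub>h) \<star> v\<close>, up to unitors.\<close>

lemma companionD:
  assumes "companion D f c b p"
  shows "f \<in> tights D" "c \<in> looses D" "ldom D c = tdom D f" "lcod D c = tcod D f"
    "b \<in> squares D" "sleft D b = tid D (tdom D f)" "sright D b = f" "stop D b = lid D (tdom D f)" "sbot D b = c"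
    "p \<in> squares D" "sleft D p = f" "sright D p = tid D (tcod D f)" "stop D p = c" "sbot D p = lid D (tcod D f)"
    "p \<bullet> b = hid D f" "runit D c \<bullet> (b \<star> p) = lunit D c"
  using assms by (auto simp: companion_def Let_def hom_defs)

lemma conjointD:
  assumes "conjoint D f c b p"
  shows "f \<in> tights D" "c \<in> looses D" "ldom D c = tcod D f" "lcod D c = tdom D f"
    "b \<in> squares D" "sleft D b = f" "sright D b = tid D (tdom D f)" "stop D b = lid D (tdom D f)" "sbot D b = c"
    "p \<in> squares D" "sleft D p = tid D (tcod D f)" "sright D p = f" "stop D p = c" "sbot D p = lid D (tcod D f)"
    "p \<bullet> b = hid D f" "lunit D c \<bullet> (p \<star> b) = runit D c"
  using assms by (auto simp: conjoint_def Let_def hom_defs)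

text \<open>A companion \<open>c\<close> of \<open>f\<close> makes \<open>c \<odot> y\<close> the
  restriction of \<open>y\<close> along \<open>f\<close>. The unit \<open>b\<close> builds the
  factorisations: the equation \<open>p \<bullet> b = hid f\<close> yields their existence, and the
  equation between \<open>b \<star> p\<close> and the unitors their uniqueness.\<close>

lemma companion_cart_vid:
  assumes c: "companion D f c b p" and y: "y \<in> looses D" "ldom D y = tcod D f"
  shows "cart (p \<star> vid D y)"
proof (rule cartI)
  note [simp] = companionD(1-14)[OF c] y
  let ?I = "lid D (tdom D f)" and ?u = "p \<star> vid D y"
  show "?u \<in> squares D" by simp
  \<comment> \<open>The second companion equation tensored with \<open>y\<close>. The associator and
    the triangle bring \<open>b\<close> and \<open>p\<close> together, and \<open>lunit_lcmp\<close>
    recognises the result as a unitor.\<close>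
  have split: "(b \<star> (lunit D y \<bullet> ?u)) = lunit D (c \<odot> y)"
  proof -
    have "b \<star> (lunit D y \<bullet> ?u) = (vid D c \<star> lunit D y) \<bullet> (b \<star> ?u)"
      using interchange[of b "vid D c" ?u "lunit D y"] by simp
    then have "(b \<star> (lunit D y \<bullet> ?u)) \<bullet> lassoc D ?I c y
        = (vid D c \<star> lunit D y) \<bullet> ((b \<star> ?u) \<bullet> lassoc D ?I c y)"
      by (simp add: vcmp_assoc')
    also have "... = ((vid D c \<star> lunit D y) \<bullet> lassoc D c (lid D (tcod D f)) y) \<bullet> ((b \<star> p) \<star> vid D y)"
      using lassoc_nat[of b p "vid D y"] by (simp add: vcmp_assoc')
    also have "... = (runit D c \<bullet> (b \<star> p)) \<star> vid D y"
      by (simp add: triangle' vid_interchange)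
    also have "... = lunit D (c \<odot> y) \<bullet> lassoc D ?I c y"
      using lunit_lcmp[of c y] companionD(16)[OF c] by simp
    finally show ?thesis by (rule iso_epi[rotated -1]) simp_all
  qed
  \<comment> \<open>A square into \<open>c \<odot> y\<close> is recovered from its composite with
    \<open>?u\<close>, so two squares with the same composite and the same left side agree.\<close>
  have fac: "((b \<bullet> hid D h) \<star> (lunit D y \<bullet> (?u \<bullet> w))) \<bullet> sq_inv D (lunit D (stop D w)) = w"
    if w: "w \<in> squares D" "sbot D w = c \<odot> y" "sleft D w = h" for w h
  proof -
    have h: "h \<in> tights D" "tcod D h = tdom D f" "tdom D h = ldom D (stop D w)" using w by auto
    have "(b \<bullet> hid D h) \<star> (lunit D y \<bullet> (?u \<bullet> w)) = (b \<star> (lunit D y \<bullet> ?u)) \<bullet> (hid D h \<star> w)"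
      using interchange[of "hid D h" b w "lunit D y \<bullet> ?u"] w h by (simp add: vcmp_assoc')
    also have "... = w \<bullet> lunit D (stop D w)"
      unfolding split using lunit_nat[of w] w by simp
    finally show ?thesis using w by (simp add: sq_inv_cancel)
  qed
  {
    fix v h k assume v: "v \<in> squares D" "h \<in> tights D" "k \<in> tights D" "tcod D h = ldom D (stop D ?u)"
      "tcod D k = lcod D (stop D ?u)" "sbot D v = sbot D ?u" "sleft D v = sleft D ?u \<cdot> h" "sright D v = sright D ?u \<cdot> k"
    have "tdom D (sleft D v) = tdom D h" "tdom D (sright D v) = tdom D k" using v by simp_all
    with v(1) have dh: "ldom D (stop D v) = tdom D h" "lcod D (stop D v) = tdom D k" by simp_all
    define w where "w = ((b \<bullet> hid D h) \<star> (lunit D y \<bullet> v)) \<bullet> sq_inv D (lunit D (stop D v))"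
    note i = giso_sq_inv_simps[OF lunit_simps(1)[of "stop D v"]]
    have w: "w \<in> squares D" "sbot D w = stop D ?u" "sleft D w = h" "sright D w = k"
      using v i by (simp_all add: w_def dh)
    have "?u \<bullet> ((b \<bullet> hid D h) \<star> (lunit D y \<bullet> v)) = (p \<bullet> (b \<bullet> hid D h)) \<star> (lunit D y \<bullet> v)"
      using v interchange[of "b \<bullet> hid D h" p "lunit D y \<bullet> v" "vid D y"] by (simp add: dh)
    also have "p \<bullet> (b \<bullet> hid D h) = hid D (f \<cdot> h)"
      using v companionD(15)[OF c] by (simp add: hid_tcmp dh flip: vcmp_assoc')
    also have "hid D (f \<cdot> h) \<star> (lunit D y \<bullet> v) = v \<bullet> lunit D (stop D v)"
    proof (rule iso_mono[of "lunit D y"])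
      show "lunit D y \<bullet> (hid D (f \<cdot> h) \<star> (lunit D y \<bullet> v)) = lunit D y \<bullet> (v \<bullet> lunit D (stop D v))"
        using v lunit_nat[of "lunit D y \<bullet> v"] by (simp add: vcmp_assoc' dh)
    qed (use v in \<open>simp_all add: dh\<close>)
    finally have "?u \<bullet> w = v" using v w by (simp add: w_def dh i sq_inv_cancel flip: vcmp_assoc')
    with w show "\<exists>w. w \<in> squares D \<and> sbot D w = stop D ?u \<and> sleft D w = h \<and> sright D w = k \<and> ?u \<bullet> w = v"
      by blast
  next
    fix w w' assume w: "w \<in> squares D" "w' \<in> squares D" "sbot D w = stop D ?u" "sbot D w' = stop D ?u"
      "sleft D w = sleft D w'" "sright D w = sright D w'" "?u \<bullet> w = ?u \<bullet> w'"
    have "stop D (?u \<bullet> w) = stop D (?u \<bullet> w')" using w(7) by simp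
    then have t: "stop D w = stop D w'" using w(1-4) by simp
    show "w = w'" using fac[of w "sleft D w"] fac[of w' "sleft D w"] w t by simp
  }
qed

text \<open>The mirror image of the argument for companions: a square \<open>v\<close> with right
  side \<open>f k\<close> factors as \<open>v\<close> followed horizontally by
  \<open>b \<bullet> hid D k\<close>, up to right unitors. The coherence needed is now
  \<open>runit_lcmp\<close>.\<close>

lemma conjoint_cart_vid:
  assumes c: "conjoint D f c b p" and y: "y \<in> looses D" "lcod D y = tcod D f"
  shows "cart (vid D y \<star> p)"
proof (rule cartI)
  note [simp] = conjointD(1-14)[OF c] y
  let ?I = "lid D (tdom D f)" and ?u = "vid D y \<star> p"
  show "?u \<in> squares D" by simp
  have split: "((runit D y \<bullet> ?u) \<star> b) = runit D (y \<odot> c)"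
  proof -
    have "(runit D y \<bullet> ?u) \<star> b = (runit D y \<star> vid D c) \<bullet> (?u \<star> b)"
      using interchange[of ?u "runit D y" b "vid D c"] by simp
    also have "... = (vid D y \<star> lunit D c) \<bullet> (lassoc D y (lid D (tcod D f)) c \<bullet> (?u \<star> b))"
      by (simp add: vcmp_assoc' flip: triangle'[of y c "tcod D f"])
    also have "... = (vid D y \<star> (lunit D c \<bullet> (p \<star> b))) \<bullet> lassoc D y c ?I"
      using lassoc_nat[of "vid D y" p b] by (simp add: vcmp_assoc' vid_interchange)
    also have "... = runit D (y \<odot> c)"
      using runit_lcmp[of y c] conjointD(16)[OF c] by simp
    finally show ?thesis .
  qed
  have fac: "((runit D y \<bullet> (?u \<bullet> w)) \<star> (b \<bullet> hid D k)) \<bullet> sq_inv D (runit D (stop D w)) = w"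
    if w: "w \<in> squares D" "sbot D w = y \<odot> c" "sright D w = k" for w k
  proof -
    have h: "k \<in> tights D" "tcod D k = tdom D f" "tdom D k = lcod D (stop D w)" using w by auto
    have "(runit D y \<bullet> (?u \<bullet> w)) \<star> (b \<bullet> hid D k) = ((runit D y \<bullet> ?u) \<star> b) \<bullet> (w \<star> hid D k)"
      using interchange[of w "runit D y \<bullet> ?u" "hid D k" b] w h by (simp add: vcmp_assoc')
    also have "... = w \<bullet> runit D (stop D w)"
      unfolding split using runit_nat[of w] w by simp
    finally show ?thesis using w by (simp add: sq_inv_cancel)
  qed
  {
    fix v h k assume v: "v \<in> squares D" "h \<in> tights D" "k \<in> tights D" "tcod D h = ldom D (stop D ?u)"
      "tcod D k = lcod D (stop D ?u)" "sbot D v = sbot D ?u" "sleft D v = sleft D ?u \<cdot> h" "sright D v = sright D ?u \<cdot> k"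
    have "tdom D (sleft D v) = tdom D h" "tdom D (sright D v) = tdom D k" using v by simp_all
    with v(1) have dk: "ldom D (stop D v) = tdom D h" "lcod D (stop D v) = tdom D k" by simp_all
    define w where "w = ((runit D y \<bullet> v) \<star> (b \<bullet> hid D k)) \<bullet> sq_inv D (runit D (stop D v))"
    note i = giso_sq_inv_simps[OF runit_simps(1)[of "stop D v"]]
    have w: "w \<in> squares D" "sbot D w = stop D ?u" "sleft D w = h" "sright D w = k"
      using v i by (simp_all add: w_def dk)
    have "?u \<bullet> ((runit D y \<bullet> v) \<star> (b \<bullet> hid D k)) = (runit D y \<bullet> v) \<star> (p \<bullet> (b \<bullet> hid D k))"
      using v interchange[of "runit D y \<bullet> v" "vid D y" "b \<bullet> hid D k" p] by (simp add: dk)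
    also have "p \<bullet> (b \<bullet> hid D k) = hid D (f \<cdot> k)"
      using v conjointD(15)[OF c] by (simp add: hid_tcmp dk flip: vcmp_assoc')
    also have "(runit D y \<bullet> v) \<star> hid D (f \<cdot> k) = v \<bullet> runit D (stop D v)"
    proof (rule iso_mono[of "runit D y"])
      show "runit D y \<bullet> ((runit D y \<bullet> v) \<star> hid D (f \<cdot> k)) = runit D y \<bullet> (v \<bullet> runit D (stop D v))"
        using v runit_nat[of "runit D y \<bullet> v"] by (simp add: vcmp_assoc' dk)
    qed (use v in \<open>simp_all add: dk\<close>)
    finally have "?u \<bullet> w = v" using v w by (simp add: w_def dk i sq_inv_cancel flip: vcmp_assoc')
    with w show "\<exists>w. w \<in> squares D \<and> sbot D w = stop D ?u \<and> sleft D w = h \<and> sright D w = k \<and> ?u \<bullet> w = v"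
      by blast
  next
    fix w w' assume w: "w \<in> squares D" "w' \<in> squares D" "sbot D w = stop D ?u" "sbot D w' = stop D ?u"
      "sleft D w = sleft D w'" "sright D w = sright D w'" "?u \<bullet> w = ?u \<bullet> w'"
    have "stop D (?u \<bullet> w) = stop D (?u \<bullet> w')" using w(7) by simp
    then have t: "stop D w = stop D w'" using w(1-4) by simp
    show "w = w'" using fac[of w "sright D w"] fac[of w' "sright D w"] w t by simp
  }
qed

end

section \<open>Companions, conjoints and commuter cells through cartesian squares\<close>

context double_category
begin

lemma cart_giso_left: "\<lbrakk>giso j; u \<in> squares D; stop D j = sbot D u\<rbrakk> \<Longrightarrow> cart (j \<bullet> u) \<longleftrightarrow> cart u"
  using cart_giso_iff[of "vid D (stop D u)" j u] by (simp add: giso_intros)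

lemma cart_giso_right: "\<lbrakk>giso i; u \<in> squares D; stop D u = sbot D i\<rbrakk> \<Longrightarrow> cart (u \<bullet> i) \<longleftrightarrow> cart u"
  using cart_giso_iff[of i "vid D (sbot D u)" u] gisoD[of i] by (simp add: giso_intros)

text \<open>The case of \<open>companion_cart_vid\<close> in which \<open>y\<close> is a loose
  identity; naturality of the right unitor removes that identity.\<close>

lemma companion_cart:
  assumes c: "companion D f c b p"
  shows "cart p"
proof -
  note [simp] = companionD(1-14)[OF c]
  have "cart (runit D (lid D (tcod D f)) \<bullet> (p \<star> vid D (lid D (tcod D f))))"
    by (intro cart_vcmp companion_cart_vid[OF c] giso_cart) simp_all
  then have "cart (p \<bullet> runit D c)" using runit_nat[of p] by (simp add: hid_id)
  then show ?thesis by (simp add: cart_giso_right)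
qed

lemma conjoint_cart:
  assumes c: "conjoint D f c b p"
  shows "cart p"
proof -
  note [simp] = conjointD(1-14)[OF c]
  have "cart (lunit D (lid D (tcod D f)) \<bullet> (vid D (lid D (tcod D f)) \<star> p))"
    by (intro cart_vcmp conjoint_cart_vid[OF c] giso_cart) simp_all
  then have "cart (p \<bullet> lunit D c)" using lunit_nat[of p] by (simp add: hid_id)
  then show ?thesis by (simp add: cart_giso_right)
qed

text \<open>A cartesian counit already determines a companion: factoring \<open>hid D f\<close>
  through \<open>p\<close> produces the unit, and the remaining equation may be tested after
  composing with \<open>p\<close>. There both unitors of a loose identity appear, whence
  \<open>lunit_lid\<close>.\<close>

lemma companion_of_cart:
  assumes [simp]: "f \<in> tights D" "p \<in> squares D" "sleft D p = f" "sright D p = tid D (tcod D f)"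
      "sbot D p = lid D (tcod D f)"
    and c: "cart p"
  obtains b where "companion D f (stop D p) b p"
proof -
  have "tdom D (sleft D p) = ldom D (stop D p)" "tdom D (sright D p) = lcod D (stop D p)"
    by (rule side_simps, simp)+
  then have [simp]: "ldom D (stop D p) = tdom D f" "lcod D (stop D p) = tcod D f" by simp_all
  obtain b where e [simp]: "b \<in> squares D" "sbot D b = stop D p" "sleft D b = tid D (tdom D f)" "sright D b = f"
    "stop D b = lid D (tdom D f)" and ee: "p \<bullet> b = hid D f"
    by (rule cart_factor[OF c, of "hid D f" "tid D (tdom D f)" f]) simp_all
  have "p \<bullet> (runit D (stop D p) \<bullet> (b \<star> p))
    = runit D (lid D (tcod D f)) \<bullet> ((p \<star> vid D (lid D (tcod D f))) \<bullet> (b \<star> p))"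
    using runit_nat[of p] by (simp add: hid_id flip: vcmp_assoc')
  also have "... = runit D (lid D (tcod D f)) \<bullet> (hid D f \<star> p)"
    using ee interchange[of b p p "vid D (lid D (tcod D f))"] by simp
  also have "... = p \<bullet> lunit D (stop D p)"
    using lunit_nat[of p] by (simp add: lunit_lid)
  finally have "runit D (stop D p) \<bullet> (b \<star> p) = lunit D (stop D p)"
    by (rule cart_unique[OF c, rotated -1]) simp_all
  then have "companion D f (stop D p) b p"
    using ee by (simp add: companion_def Let_def hom_defs)
  then show thesis by (rule that)
qed

lemma conjoint_of_cart:
  assumes [simp]: "f \<in> tights D" "p \<in> squares D" "sright D p = f" "sleft D p = tid D (tcod D f)"
      "sbot D p = lid D (tcod D f)"
    and c: "cart p"
  obtains b where "conjoint D f (stop D p) b p"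
proof -
  have "tdom D (sleft D p) = ldom D (stop D p)" "tdom D (sright D p) = lcod D (stop D p)"
    by (rule side_simps, simp)+
  then have [simp]: "ldom D (stop D p) = tcod D f" "lcod D (stop D p) = tdom D f" by simp_all
  obtain b where e [simp]: "b \<in> squares D" "sbot D b = stop D p" "sleft D b = f" "sright D b = tid D (tdom D f)"
    "stop D b = lid D (tdom D f)" and ee: "p \<bullet> b = hid D f"
    by (rule cart_factor[OF c, of "hid D f" f "tid D (tdom D f)"]) simp_all
  have "p \<bullet> (lunit D (stop D p) \<bullet> (p \<star> b))
    = lunit D (lid D (tcod D f)) \<bullet> ((vid D (lid D (tcod D f)) \<star> p) \<bullet> (p \<star> b))"
    using lunit_nat[of p] by (simp add: hid_id flip: vcmp_assoc')
  also have "... = lunit D (lid D (tcod D f)) \<bullet> (p \<star> hid D f)"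
    using ee interchange[of p "vid D (lid D (tcod D f))" b p] by simp
  also have "... = p \<bullet> runit D (stop D p)"
    using runit_nat[of p] by (simp add: lunit_lid)
  finally have "lunit D (stop D p) \<bullet> (p \<star> b) = runit D (stop D p)"
    by (rule cart_unique[OF c, rotated -1]) simp_all
  then have "conjoint D f (stop D p) b p"
    using ee by (simp add: conjoint_def Let_def hom_defs)
  then show thesis by (rule that)
qed

text \<open>Only the counit of the composite is written down. It is cartesian as a composite of
  cartesian squares, so \<open>companion_of_cart\<close> supplies the unit and both equations. The
  formula for the counit is part of the conclusion because commuters of vertical composites are
  tested against it.\<close>

lemma companion_tcmp:
  assumes c: "companion D f c b p" and d: "companion D g d b' p'" and e: "tdom D g = tcod D f"
  obtains b'' where "companion D (g \<cdot> f) (c \<odot> d) b'' (lunit D (lid D (tcod D g)) \<bullet> ((hid D g \<bullet> p) \<star> p'))"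
proof -
  note [simp] = companionD(1-14)[OF c] companionD(1-14)[OF d] e
  let ?e = "lunit D (lid D (tcod D g)) \<bullet> ((hid D g \<bullet> p) \<star> p')"
  have "?e = (lunit D (lid D (tcod D g)) \<bullet> (hid D g \<star> p')) \<bullet> (p \<star> vid D d)"
    using interchange[of p "hid D g" "vid D d" p'] by (simp add: vcmp_assoc')
  also have "... = (p' \<bullet> lunit D d) \<bullet> (p \<star> vid D d)"
    using lunit_nat[of p'] by simp
  finally have e: "cart ?e"
    by (simp add: cart_vcmp companion_cart[OF d] companion_cart_vid[OF c] giso_cart)
  obtain b'' where "companion D (g \<cdot> f) (stop D ?e) b'' ?e"
    by (rule companion_of_cart[OF _ _ _ _ _ e, of "g \<cdot> f"]) simp_all
  then show thesis using that by simp
qed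

lemma conjoint_tcmp:
  assumes c: "conjoint D f c b p" and d: "conjoint D g d b' p'" and e: "tdom D g = tcod D f"
  obtains b'' where "conjoint D (g \<cdot> f) (d \<odot> c) b'' (runit D (lid D (tcod D g)) \<bullet> (p' \<star> (hid D g \<bullet> p)))"
proof -
  note [simp] = conjointD(1-14)[OF c] conjointD(1-14)[OF d] e
  let ?e = "runit D (lid D (tcod D g)) \<bullet> (p' \<star> (hid D g \<bullet> p))"
  have "?e = (runit D (lid D (tcod D g)) \<bullet> (p' \<star> hid D g)) \<bullet> (vid D d \<star> p)"
    using interchange[of "vid D d" p' p "hid D g"] by (simp add: vcmp_assoc')
  also have "... = (p' \<bullet> runit D d) \<bullet> (vid D d \<star> p)"
    using runit_nat[of p'] by simp
  finally have e: "cart ?e"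
    by (simp add: cart_vcmp conjoint_cart[OF d] conjoint_cart_vid[OF c] giso_cart)
  obtain b'' where "conjoint D (g \<cdot> f) (stop D ?e) b'' ?e"
    by (rule conjoint_of_cart[OF _ _ _ _ _ e, of "g \<cdot> f"]) simp_all
  then show thesis using that by simp
qed

lemma companion_tid:
  assumes [simp]: "x \<in> obs D"
  obtains b where "companion D (tid D x) (lid D x) b (vid D (lid D x))"
  by (rule companion_of_cart[of "tid D x" "vid D (lid D x)"]) (simp_all add: giso_cart giso_intros)

lemma conjoint_tid:
  assumes [simp]: "x \<in> obs D"
  obtains b where "conjoint D (tid D x) (lid D x) b (vid D (lid D x))"
  by (rule conjoint_of_cart[of "tid D x" "vid D (lid D x)"]) (simp_all add: giso_cart giso_intros)

lemma has_companion_tid: "x \<in> obs D \<Longrightarrow> has_companion D (tid D x)"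
  unfolding has_companion_def using companion_tid by metis

lemma has_conjoint_tid: "x \<in> obs D \<Longrightarrow> has_conjoint D (tid D x)"
  unfolding has_conjoint_def using conjoint_tid by metis

lemma has_companion_tcmp:
  "\<lbrakk>has_companion D f; has_companion D g; tdom D g = tcod D f\<rbrakk> \<Longrightarrow> has_companion D (g \<cdot> f)"
  unfolding has_companion_def using companion_tcmp by metis

lemma has_conjoint_tcmp:
  "\<lbrakk>has_conjoint D f; has_conjoint D g; tdom D g = tcod D f\<rbrakk> \<Longrightarrow> has_conjoint D (g \<cdot> f)"
  unfolding has_conjoint_def using conjoint_tcmp by metis

text \<open>The transpose and \<open>(b0 \<star> s) \<star> p1\<close> differ by coherence
  isomorphisms. The latter square contains no inverses, which makes it the better form for images
  under double functors and for pairs in a product.\<close>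

lemma companion_transpose_iso:
  assumes [simp]: "s \<in> squares D"
    and c0: "companion D (sleft D s) c0 b0 p0" and c1: "companion D (sright D s) c1 b1 p1"
  shows "sq_iso D (companion_transpose D s c0 b0 c1 p1) \<longleftrightarrow> giso ((b0 \<star> s) \<star> p1)"
proof -
  note [simp] = companionD(2-14)[OF c0] companionD(2-14)[OF c1]
  let ?K = "(b0 \<star> s) \<star> p1" and ?r = "runit D (c0 \<odot> sbot D s)" and ?l = "sq_inv D (lunit D (stop D s)) \<star> vid D c1"
  have t: "companion_transpose D s c0 b0 c1 p1 = ?r \<bullet> (?K \<bullet> ?l)"
    by (simp add: companion_transpose_def)
  note i = giso_sq_inv_simps[OF lunit_simps(1)[of "stop D s"]]
  have r: "giso ?r" and l: "giso ?l"
    by (simp_all add: giso_intros i)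
  note [simp] = gisoD(2)[OF r] gisoD(2)[OF l]
  show ?thesis
  proof
    assume "giso ?K"
    then have "giso (?r \<bullet> (?K \<bullet> ?l))" using r l by (simp add: giso_intros(3) i)
    then show "sq_iso D (companion_transpose D s c0 b0 c1 p1)" unfolding t by (rule gisoD)
  next
    assume a: "sq_iso D (companion_transpose D s c0 b0 c1 p1)"
    have "?K = (sq_inv D ?r \<bullet> (?r \<bullet> (?K \<bullet> ?l))) \<bullet> sq_inv D ?l"
      by (simp add: sq_inv_cancel i)
    also have "sq_iso D ..."
      by (rule sq_iso_vcmp[OF sq_iso_inv sq_iso_vcmp[OF a[unfolded t] sq_iso_inv]])
        (simp_all add: i)
    finally show "giso ?K" by (simp add: giso_def glob_def)
  qed
qed

text \<open>Up to unitors, the transpose is the factorisation of \<open>s \<star> p1\<close> through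
  \<open>p0 \<star> vid D (sbot D s)\<close>. The unit \<open>b0\<close> contained in the transpose
  is absorbed by \<open>p0 \<bullet> b0 = hid f\<close>.\<close>

lemma companion_transpose_eq:
  assumes [simp]: "s \<in> squares D"
    and c0: "companion D (sleft D s) c0 b0 p0" and c1: "companion D (sright D s) c1 b1 p1"
  defines "t \<equiv> companion_transpose D s c0 b0 c1 p1"
  shows "(lunit D (sbot D s) \<bullet> (p0 \<star> vid D (sbot D s))) \<bullet> t = runit D (sbot D s) \<bullet> (s \<star> p1)"
    and "glob t" "stop D t = stop D s \<odot> c1" "sbot D t = c0 \<odot> sbot D s"
proof -
  note [simp] = companionD(2-14)[OF c0] companionD(2-14)[OF c1]
  let ?K = "(b0 \<star> s) \<star> p1" and ?r = "runit D (c0 \<odot> sbot D s)" and ?l = "sq_inv D (lunit D (stop D s)) \<star> vid D c1"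
  let ?q = "lunit D (sbot D s) \<bullet> (p0 \<star> vid D (sbot D s))"
  let ?I = "vid D (lid D (lcod D (sbot D s)))"
  have t: "t = ?r \<bullet> (?K \<bullet> ?l)"
    by (simp add: companion_transpose_def t_def)
  note [simp] = giso_sq_inv_simps[OF lunit_simps(1)[of "stop D s"]]
  show "glob t" "stop D t = stop D s \<odot> c1" "sbot D t = c0 \<odot> sbot D s"
    unfolding t by (simp_all add: glob_def)
  have q: "?q \<bullet> (b0 \<star> s) = s \<bullet> lunit D (stop D s)"
  proof -
    have "?q \<bullet> (b0 \<star> s) = lunit D (sbot D s) \<bullet> ((p0 \<bullet> b0) \<star> s)"
      using interchange[of b0 p0 s "vid D (sbot D s)"] by (simp add: vcmp_assoc')
    then show ?thesis using companionD(15)[OF c0] lunit_nat[of s] by simp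
  qed
  have "?q \<bullet> t = (?q \<bullet> ?r) \<bullet> (?K \<bullet> ?l)" unfolding t by (simp add: vcmp_assoc')
  also have "... = (runit D (sbot D s) \<bullet> (?q \<star> ?I)) \<bullet> (?K \<bullet> ?l)"
    using runit_nat[of ?q] by (simp add: hid_id)
  also have "... = runit D (sbot D s) \<bullet> (((?q \<star> ?I) \<bullet> ?K) \<bullet> ?l)" by (simp add: vcmp_assoc')
  also have "(?q \<star> ?I) \<bullet> ?K = (s \<bullet> lunit D (stop D s)) \<star> p1"
    using interchange[of "b0 \<star> s" ?q p1 ?I] q by simp
  also have "((s \<bullet> lunit D (stop D s)) \<star> p1) \<bullet> ?l = s \<star> p1"
    using interchange[of "sq_inv D (lunit D (stop D s))" "s \<bullet> lunit D (stop D s)" "vid D c1" p1]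
    by (simp add: sq_inv_cancel)
  finally show "?q \<bullet> t = runit D (sbot D s) \<bullet> (s \<star> p1)" .
qed

text \<open>A globular square is invertible exactly if it is cartesian, and by
  \<open>companion_transpose_eq\<close> the transpose followed by a cartesian square is
  \<open>s \<star> p1\<close> up to a unitor. The criterion obtained refers to the companion of the
  right side only.\<close>

lemma companion_commuter_cart:
  assumes [simp]: "s \<in> squares D"
    and c0: "companion D (sleft D s) c0 b0 p0" and c1: "companion D (sright D s) c1 b1 p1"
  shows "sq_iso D (companion_transpose D s c0 b0 c1 p1) \<longleftrightarrow> cart (s \<star> p1)"
proof -
  note [simp] = companionD(2-14)[OF c0] companionD(2-14)[OF c1]
  let ?t = "companion_transpose D s c0 b0 c1 p1"
  let ?q = "lunit D (sbot D s) \<bullet> (p0 \<star> vid D (sbot D s))"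
  note eq = companion_transpose_eq[OF assms]
  have q: "cart ?q" by (simp add: cart_vcmp companion_cart_vid[OF c0] giso_cart)
  have "sq_iso D ?t \<longleftrightarrow> cart ?t"
    using glob_cart_iso[OF eq(2)] giso_cart eq(2) by (auto simp: giso_def)
  also have "... \<longleftrightarrow> cart (?q \<bullet> ?t)"
  proof
    show "cart ?t \<Longrightarrow> cart (?q \<bullet> ?t)" by (rule cart_vcmp[OF _ q]) (simp_all add: eq)
    show "cart (?q \<bullet> ?t) \<Longrightarrow> cart ?t" by (rule cart_cancel[OF q]) (use eq globD[OF eq(2)] in simp_all)
  qed
  also have "... \<longleftrightarrow> cart (s \<star> p1)" unfolding eq by (simp add: cart_giso_left)
  finally show ?thesis .
qed

text \<open>In general cartesian squares need not stay cartesian after whiskering with a loose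
  arrow. Here \<open>s \<star> p1\<close> is, up to unitors, the invertible transpose followed by
  \<open>p0 \<star> vid D ?y\<close>; the first factor stays invertible, and the second reassociates
  to \<open>p0 \<star> vid D (?y \<odot> d)\<close>, which is again cartesian.\<close>

lemma companion_commuter_cart_vid:
  assumes [simp]: "s \<in> squares D"
    and c0: "companion D (sleft D s) c0 b0 p0" and c1: "companion D (sright D s) c1 b1 p1"
    and t: "sq_iso D (companion_transpose D s c0 b0 c1 p1)"
    and d [simp]: "d \<in> looses D" "ldom D d = lcod D (sbot D s)"
  shows "cart ((s \<star> p1) \<star> vid D d)"
proof -
  note [simp] = companionD(2-14)[OF c0] companionD(2-14)[OF c1]
  let ?t = "companion_transpose D s c0 b0 c1 p1" and ?y = "sbot D s"
  let ?q = "p0 \<star> vid D ?y"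
  note eq = companion_transpose_eq[OF assms(1-3)]
  note [simp] = eq(3,4) globD(1-3)[OF eq(2)]
  have "cart (lassoc D (lid D (ldom D ?y)) ?y d \<bullet> (?q \<star> vid D d))"
    using lassoc_nat[of p0 "vid D ?y" "vid D d"] companion_cart_vid[OF c0, of "?y \<odot> d"]
    by (simp add: hcmp_vid cart_giso_right)
  then have q: "cart (?q \<star> vid D d)" by (simp add: cart_giso_left)
  have "giso (?t \<star> vid D d)" using eq(2) t by (intro giso_intros) (simp_all add: giso_def glob_vid)
  then have "cart ((lunit D ?y \<star> vid D d) \<bullet> ((?q \<star> vid D d) \<bullet> (?t \<star> vid D d)))"
    using q by (intro cart_vcmp) (simp_all add: giso_cart giso_intros)
  also have "(lunit D ?y \<star> vid D d) \<bullet> ((?q \<star> vid D d) \<bullet> (?t \<star> vid D d)) = ((lunit D ?y \<bullet> ?q) \<bullet> ?t) \<star> vid D d"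
    by (simp add: vid_interchange vcmp_assoc')
  also have "... = (runit D ?y \<star> vid D d) \<bullet> ((s \<star> p1) \<star> vid D d)"
    unfolding eq(1) by (simp add: vid_interchange)
  finally show ?thesis by (simp add: cart_giso_left giso_intros)
qed

lemma companion_commuter_vid:
  assumes [simp]: "l \<in> looses D"
  shows "companion_commuter D (vid D l)"
proof -
  obtain b0 where c0: "companion D (tid D (ldom D l)) (lid D (ldom D l)) b0 (vid D (lid D (ldom D l)))"
    by (rule companion_tid[of "ldom D l"]) simp_all
  obtain b1 where c1: "companion D (tid D (lcod D l)) (lid D (lcod D l)) b1 (vid D (lid D (lcod D l)))"
    by (rule companion_tid[of "lcod D l"]) simp_all
  have "cart (vid D l \<star> vid D (lid D (lcod D l)))" by (simp add: hcmp_vid giso_cart giso_intros)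
  then show ?thesis
    using companion_commuter_cart[of "vid D l"] c0 c1 unfolding companion_commuter_def by fastforce
qed

text \<open>For the composite counit \<open>?e\<close>, the square
  \<open>(t \<bullet> s) \<star> ?e\<close> is, up to coherence,
  \<open>(s \<star> p1) \<star> vid D d1\<close> followed by
  \<open>(t \<star> ?h) \<star> \<delta>1\<close>. The first is cartesian because \<open>s\<close>
  is a commuter and its test square survives whiskering, the second because \<open>t\<close> is a
  commuter.\<close>

lemma companion_commuter_vcmp:
  assumes s: "companion_commuter D s" and t: "companion_commuter D t" and e [simp]: "stop D t = sbot D s"
  shows "companion_commuter D (t \<bullet> s)"
proof -
  from s obtain c0 b0 p0 c1 b1 p1 where [simp]: "s \<in> squares D"
    and c0: "companion D (sleft D s) c0 b0 p0" and c1: "companion D (sright D s) c1 b1 p1"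
    and si: "sq_iso D (companion_transpose D s c0 b0 c1 p1)" by (auto simp: companion_commuter_def)
  from t obtain d0 \<theta>0 \<delta>0 d1 \<theta>1 \<delta>1 where [simp]: "t \<in> squares D"
    and d0: "companion D (sleft D t) d0 \<theta>0 \<delta>0" and d1: "companion D (sright D t) d1 \<theta>1 \<delta>1"
    and ti: "sq_iso D (companion_transpose D t d0 \<theta>0 d1 \<delta>1)" by (auto simp: companion_commuter_def)
  note [simp] = companionD(2-14)[OF c0] companionD(2-14)[OF c1] companionD(2-14)[OF d0] companionD(2-14)[OF d1]
  let ?h = "hid D (sright D t)" and ?z = "sbot D t"
  let ?e = "lunit D (lid D (lcod D ?z)) \<bullet> ((?h \<bullet> p1) \<star> \<delta>1)"
  obtain b0' where e0: "companion D (sleft D (t \<bullet> s)) (c0 \<odot> d0) b0'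
      (lunit D (lid D (tcod D (sleft D t))) \<bullet> ((hid D (sleft D t) \<bullet> p0) \<star> \<delta>0))"
    using companion_tcmp[OF c0 d0] by auto
  obtain b1' where e1: "companion D (sright D (t \<bullet> s)) (c1 \<odot> d1) b1' ?e"
    using companion_tcmp[OF c1 d1] by auto
  \<comment> \<open>Naturality of the right unitor exchanges \<open>t \<star> ?h\<close> for
    \<open>t\<close>, so the second factor is compared with the square
    \<open>t \<star> \<delta>1\<close> that tests the commuter \<open>t\<close>.\<close>
  have "(runit D ?z \<star> vid D (lid D (lcod D ?z))) \<bullet> ((t \<star> ?h) \<star> \<delta>1) = (runit D ?z \<bullet> (t \<star> ?h)) \<star> \<delta>1"
    using interchange[of "t \<star> ?h" "runit D ?z" \<delta>1 "vid D (lid D (lcod D ?z))"] by simp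
  also have "runit D ?z \<bullet> (t \<star> ?h) = t \<bullet> runit D (stop D t)"
    using runit_nat[of t] by simp
  also have "(t \<bullet> runit D (stop D t)) \<star> \<delta>1 = (t \<star> \<delta>1) \<bullet> (runit D (stop D t) \<star> vid D d1)"
  proof -
    have "(t \<bullet> runit D (stop D t)) \<star> (\<delta>1 \<bullet> vid D d1) = (t \<star> \<delta>1) \<bullet> (runit D (stop D t) \<star> vid D d1)"
      by (rule interchange) simp_all
    then show ?thesis by simp
  qed
  finally have r: "(runit D ?z \<star> vid D (lid D (lcod D ?z))) \<bullet> ((t \<star> ?h) \<star> \<delta>1)
    = (t \<star> \<delta>1) \<bullet> (runit D (stop D t) \<star> vid D d1)" .
  have "cart (t \<star> \<delta>1)" using companion_commuter_cart[OF _ d0 d1] ti by simp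
  then have "cart ((t \<star> \<delta>1) \<bullet> (runit D (stop D t) \<star> vid D d1))"
    by (simp add: cart_vcmp giso_cart giso_intros)
  then have 1: "cart ((t \<star> ?h) \<star> \<delta>1)" unfolding r[symmetric] by (simp add: cart_giso_left giso_intros)
  have "cart ((s \<star> p1) \<star> vid D d1)" by (rule companion_commuter_cart_vid[OF _ c0 c1 si]) simp_all
  with 1 have "cart (((t \<star> ?h) \<star> \<delta>1) \<bullet> ((s \<star> p1) \<star> vid D d1))" by (intro cart_vcmp) simp_all
  also have "((t \<star> ?h) \<star> \<delta>1) \<bullet> ((s \<star> p1) \<star> vid D d1) = ((t \<bullet> s) \<star> (?h \<bullet> p1)) \<star> \<delta>1"
    by (simp flip: interchange)
  finally have "cart (lassoc D ?z (lid D (lcod D ?z)) (lid D (lcod D ?z)) \<bullet> (((t \<bullet> s) \<star> (?h \<bullet> p1)) \<star> \<delta>1))"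
    by (simp add: cart_giso_left)
  then have "cart ((t \<bullet> s) \<star> ((?h \<bullet> p1) \<star> \<delta>1))"
    using lassoc_nat[of "t \<bullet> s" "?h \<bullet> p1" \<delta>1] by (simp add: cart_giso_right)
  then have "cart ((vid D ?z \<star> lunit D (lid D (lcod D ?z))) \<bullet> ((t \<bullet> s) \<star> ((?h \<bullet> p1) \<star> \<delta>1)))"
    by (simp add: cart_giso_left giso_intros)
  also have "(vid D ?z \<star> lunit D (lid D (lcod D ?z))) \<bullet> ((t \<bullet> s) \<star> ((?h \<bullet> p1) \<star> \<delta>1)) = (t \<bullet> s) \<star> ?e"
    using interchange[of "t \<bullet> s" "vid D ?z" "(?h \<bullet> p1) \<star> \<delta>1" "lunit D (lid D (lcod D ?z))"] by simp
  finally have "sq_iso D (companion_transpose D (t \<bullet> s) (c0 \<odot> d0) b0' (c1 \<odot> d1) ?e)"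
    using companion_commuter_cart[OF _ e0 e1] by simp
  moreover have "t \<bullet> s \<in> squares D" by simp
  ultimately show ?thesis unfolding companion_commuter_def using e0 e1 by blast
qed

text \<open>For the loose identity square on \<open>f\<close> the same conjoint serves on both
  sides, and the conjoint equation writes \<open>p \<star> b\<close> through unitors. Hence the
  transpose is made of coherence cells and of \<open>u\<close> and \<open>v\<close>. The
  isomorphisms \<open>u\<close>, \<open>v\<close> are there because transformations between points
  produce squares of this form.\<close>

lemma conjoint_commuter_hid:
  assumes c: "conjoint D f c b p" and u: "giso u" "stop D u = lid D (tcod D f)"
    and v: "giso v" "sbot D v = lid D (tdom D f)"
  shows "conjoint_commuter D (u \<bullet> (hid D f \<bullet> v))"
proof -
  note [simp] = conjointD(1-14)[OF c] u v gisoD(3-5)[OF u(1)] gisoD(3-5)[OF v(1)]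
  have uv [simp]: "ldom D (sbot D u) = tcod D f" "lcod D (sbot D u) = tcod D f" "ldom D (stop D v) = tdom D f"
    "lcod D (stop D v) = tdom D f"
    using gisoD(6,7)[OF u(1)] gisoD(6,7)[OF v(1)] by simp_all
  let ?s = "u \<bullet> (hid D f \<bullet> v)" and ?I = "lid D (tdom D f)" and ?J = "lid D (tcod D f)"
  have "p \<star> b = sq_inv D (lunit D c) \<bullet> (lunit D c \<bullet> (p \<star> b))" by (simp add: sq_inv_cancel)
  then have en: "p \<star> b = sq_inv D (lunit D c) \<bullet> runit D c" using conjointD(16)[OF c] by simp
  note [simp] = giso_sq_inv_simps[OF runit_simps(1)[of ?J]]
  have "p \<star> hid D f = sq_inv D (runit D ?J) \<bullet> (runit D ?J \<bullet> (p \<star> hid D f))" by (simp add: sq_inv_cancel)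
  also have "... = sq_inv D (runit D ?J) \<bullet> (p \<bullet> runit D c)" using runit_nat[of p] by simp
  finally have eh: "p \<star> hid D f = sq_inv D (runit D ?J) \<bullet> (p \<bullet> runit D c)" .
  have "(p \<star> hid D f) \<star> b = (sq_inv D (runit D ?J) \<star> vid D c) \<bullet> ((p \<star> b) \<bullet> (runit D c \<star> vid D ?I))"
    unfolding eh using interchange[of "p \<bullet> runit D c" "sq_inv D (runit D ?J)" b "vid D c"]
      interchange[of "runit D c" p "vid D ?I" b] by simp
  then have 1: "giso ((p \<star> hid D f) \<star> b)" unfolding en by (simp add: giso_intros)
  have "p \<star> ?s = (vid D ?J \<star> u) \<bullet> ((p \<star> hid D f) \<bullet> (vid D c \<star> v))"
    using interchange[of "vid D c" p v "hid D f"] interchange[of p "vid D ?J" "hid D f \<bullet> v" u] by simp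
  then have "(p \<star> ?s) \<star> b = ((vid D ?J \<star> u) \<star> vid D c) \<bullet> (((p \<star> hid D f) \<star> b) \<bullet> ((vid D c \<star> v) \<star> vid D ?I))"
    using interchange[of "(p \<star> hid D f) \<bullet> (vid D c \<star> v)" "vid D ?J \<star> u" b "vid D c"]
      interchange[of "vid D c \<star> v" "p \<star> hid D f" "vid D ?I" b] by simp
  then have 2: "giso ((p \<star> ?s) \<star> b)" using 1 by (simp add: giso_intros)
  have "giso (lunit D (sbot D u) \<star> vid D c)" "giso (sq_inv D (runit D (c \<odot> stop D v)))"
    by (simp_all add: giso_intros)
  with 2 have "giso ((lunit D (sbot D u) \<star> vid D c) \<bullet> (((p \<star> ?s) \<star> b) \<bullet> sq_inv D (runit D (c \<odot> stop D v))))"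
    by (simp add: giso_intros(3))
  then have "sq_iso D (conjoint_transpose D ?s c p c b)"
    unfolding conjoint_transpose_def by (simp add: gisoD)
  then show ?thesis using c unfolding conjoint_commuter_def by simp blast
qed

end

section \<open>Preservation of companions, conjoints and companion commuters by double
  functors\<close>

context double_functor
begin

text \<open>The image of a loose identity is only isomorphic to a loose identity, so unit and counit
  are corrected by the unit comparison of \<open>F\<close> and its inverse. The unit laws of
  \<open>F\<close> translate the second companion equation.\<close>

lemma companion_fun:
  assumes c: "companion A f c b p"
  shows "companion B (ftight F f) (floose F c) (fsq F b \<bullet>' funit F (tdom A f))
    (sq_inv B (funit F (tcod A f)) \<bullet>' fsq F p)"
proof -
  note [simp] = A.companionD(1-14)[OF c]
  let ?u = "funit F (tdom A f)" and ?v = "funit F (tcod A f)" and ?c = "vid B (floose F c)"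
  note [simp] = B.giso_sq_inv_simps[OF funit_simps(1)[of "tcod A f"]]
  have "(sq_inv B ?v \<bullet>' fsq F p) \<bullet>' (fsq F b \<bullet>' ?u) = sq_inv B ?v \<bullet>' (fsq F (p \<bullet>\<^bsub>A\<^esub> b) \<bullet>' ?u)"
    by (simp add: B.vcmp_assoc')
  also have "... = hid B (ftight F f)"
    unfolding A.companionD(15)[OF c] by (simp add: funit_nat B.sq_inv_cancel)
  finally have 1: "(sq_inv B ?v \<bullet>' fsq F p) \<bullet>' (fsq F b \<bullet>' ?u) = hid B (ftight F f)" .
  let ?m = "fcomp F c (lid A (tcod A f))" and ?n = "fcomp F (lid A (tdom A f)) c"
  have r: "runit B (floose F c) \<bullet>' (?c \<star>' sq_inv B ?v) = fsq F (runit A c) \<bullet>' ?m"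
  proof -
    have "(?c \<star>' ?v) \<bullet>' (?c \<star>' sq_inv B ?v) = vid B (floose F c \<odot>\<^bsub>B\<^esub> floose F (lid A (tcod A f)))"
      by (simp add: B.hcmp_vid flip: B.vid_interchange)
    then show ?thesis using funit_right'[of c, symmetric] by (simp add: B.vcmp_assoc')
  qed
  have "(fsq F b \<bullet>' ?u) \<star>' (sq_inv B ?v \<bullet>' fsq F p)
      = (?c \<star>' sq_inv B ?v) \<bullet>' ((fsq F b \<star>' fsq F p) \<bullet>' (?u \<star>' ?c))"
    using B.interchange[of ?u "fsq F b" ?c "fsq F p"]
      B.interchange[of "fsq F b \<bullet>' ?u" ?c "fsq F p" "sq_inv B ?v"] by simp
  then have "runit B (floose F c) \<bullet>' ((fsq F b \<bullet>' ?u) \<star>' (sq_inv B ?v \<bullet>' fsq F p))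
      = (runit B (floose F c) \<bullet>' (?c \<star>' sq_inv B ?v)) \<bullet>' ((fsq F b \<star>' fsq F p) \<bullet>' (?u \<star>' ?c))"
    by (simp add: B.vcmp_assoc')
  also have "... = fsq F (runit A c) \<bullet>' ((?m \<bullet>' (fsq F b \<star>' fsq F p)) \<bullet>' (?u \<star>' ?c))"
    unfolding r by (simp add: B.vcmp_assoc')
  also have "?m \<bullet>' (fsq F b \<star>' fsq F p) = fsq F (b \<star>\<^bsub>A\<^esub> p) \<bullet>' ?n"
    using fcomp_nat[of b p] by simp
  also have "fsq F (runit A c) \<bullet>' ((fsq F (b \<star>\<^bsub>A\<^esub> p) \<bullet>' ?n) \<bullet>' (?u \<star>' ?c))
      = fsq F (runit A c \<bullet>\<^bsub>A\<^esub> (b \<star>\<^bsub>A\<^esub> p)) \<bullet>' (?n \<bullet>' (?u \<star>' ?c))"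
    by (simp add: B.vcmp_assoc')
  also have "... = lunit B (floose F c)"
    unfolding A.companionD(16)[OF c] using funit_left'[of c] by simp
  finally show ?thesis using 1 by (simp add: companion_def Let_def hom_defs)
qed

lemma conjoint_fun:
  assumes c: "conjoint A f c b p"
  shows "conjoint B (ftight F f) (floose F c) (fsq F b \<bullet>' funit F (tdom A f))
    (sq_inv B (funit F (tcod A f)) \<bullet>' fsq F p)"
proof -
  note [simp] = A.conjointD(1-14)[OF c]
  let ?u = "funit F (tdom A f)" and ?v = "funit F (tcod A f)" and ?c = "vid B (floose F c)"
  note [simp] = B.giso_sq_inv_simps[OF funit_simps(1)[of "tcod A f"]]
  have "(sq_inv B ?v \<bullet>' fsq F p) \<bullet>' (fsq F b \<bullet>' ?u) = sq_inv B ?v \<bullet>' (fsq F (p \<bullet>\<^bsub>A\<^esub> b) \<bullet>' ?u)"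
    by (simp add: B.vcmp_assoc')
  also have "... = hid B (ftight F f)"
    unfolding A.conjointD(15)[OF c] by (simp add: funit_nat B.sq_inv_cancel)
  finally have 1: "(sq_inv B ?v \<bullet>' fsq F p) \<bullet>' (fsq F b \<bullet>' ?u) = hid B (ftight F f)" .
  let ?n = "fcomp F c (lid A (tdom A f))" and ?m = "fcomp F (lid A (tcod A f)) c"
  have r: "lunit B (floose F c) \<bullet>' (sq_inv B ?v \<star>' ?c) = fsq F (lunit A c) \<bullet>' ?m"
  proof -
    have "(?v \<star>' ?c) \<bullet>' (sq_inv B ?v \<star>' ?c) = vid B (floose F (lid A (tcod A f)) \<odot>\<^bsub>B\<^esub> floose F c)"
      by (simp add: B.hcmp_vid flip: B.vid_interchange)
    then show ?thesis using funit_left'[of c, symmetric] by (simp add: B.vcmp_assoc')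
  qed
  have "(sq_inv B ?v \<bullet>' fsq F p) \<star>' (fsq F b \<bullet>' ?u)
      = (sq_inv B ?v \<star>' ?c) \<bullet>' ((fsq F p \<star>' fsq F b) \<bullet>' (?c \<star>' ?u))"
    using B.interchange[of ?c "fsq F p" ?u "fsq F b"]
      B.interchange[of "fsq F p" "sq_inv B ?v" "fsq F b \<bullet>' ?u" ?c] by simp
  then have "lunit B (floose F c) \<bullet>' ((sq_inv B ?v \<bullet>' fsq F p) \<star>' (fsq F b \<bullet>' ?u))
      = (lunit B (floose F c) \<bullet>' (sq_inv B ?v \<star>' ?c)) \<bullet>' ((fsq F p \<star>' fsq F b) \<bullet>' (?c \<star>' ?u))"
    by (simp add: B.vcmp_assoc')
  also have "... = fsq F (lunit A c) \<bullet>' ((?m \<bullet>' (fsq F p \<star>' fsq F b)) \<bullet>' (?c \<star>' ?u))"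
    unfolding r by (simp add: B.vcmp_assoc')
  also have "?m \<bullet>' (fsq F p \<star>' fsq F b) = fsq F (p \<star>\<^bsub>A\<^esub> b) \<bullet>' ?n"
    using fcomp_nat[of p b] by simp
  also have "fsq F (lunit A c) \<bullet>' ((fsq F (p \<star>\<^bsub>A\<^esub> b) \<bullet>' ?n) \<bullet>' (?c \<star>' ?u))
      = fsq F (lunit A c \<bullet>\<^bsub>A\<^esub> (p \<star>\<^bsub>A\<^esub> b)) \<bullet>' (?n \<bullet>' (?c \<star>' ?u))"
    by (simp add: B.vcmp_assoc')
  also have "... = runit B (floose F c)"
    unfolding A.conjointD(16)[OF c] using funit_right'[of c] by simp
  finally show ?thesis using 1 by (simp add: conjoint_def Let_def hom_defs)
qed

lemma has_companion_fun: "has_companion A f \<Longrightarrow> has_companion B (ftight F f)"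
  unfolding has_companion_def using companion_fun by blast

lemma has_conjoint_fun: "has_conjoint A f \<Longrightarrow> has_conjoint B (ftight F f)"
  unfolding has_conjoint_def using conjoint_fun by blast

text \<open>Invertibility is transferred in the form given by
  \<open>companion_transpose_iso\<close>. The image of \<open>(b0 \<star> s) \<star> p1\<close> and
  the square \<open>?M\<close> built from the images differ by composites of comparison squares,
  \<open>?L\<close> and \<open>?R\<close>; inserting the corrections of unit and counit adds further
  isomorphisms.\<close>

lemma companion_commuter_fun:
  assumes "companion_commuter A s"
  shows "companion_commuter B (fsq F s)"
proof -
  from assms obtain c0 b0 p0 c1 b1 p1 where [simp]: "s \<in> squares A"
    and c0: "companion A (sleft A s) c0 b0 p0" and c1: "companion A (sright A s) c1 b1 p1"
    and si: "sq_iso A (companion_transpose A s c0 b0 c1 p1)" by (auto simp: companion_commuter_def)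
  note [simp] = A.companionD(2-14)[OF c0] A.companionD(2-14)[OF c1]
  have K: "A.giso ((b0 \<star>\<^bsub>A\<^esub> s) \<star>\<^bsub>A\<^esub> p1)" using A.companion_transpose_iso[OF _ c0 c1] si by simp
  let ?x = "stop A s" and ?y = "sbot A s" and ?I = "lid A (ldom A (stop A s))" and ?J = "lid A (lcod A (sbot A s))"
  let ?u = "funit F (ldom A ?x)" and ?v = "funit F (lcod A ?y)"
  note [simp] = B.giso_sq_inv_simps[OF funit_simps(1)[of "lcod A ?y"]]
  let ?L = "fcomp F (c0 \<odot>\<^bsub>A\<^esub> ?y) ?J \<bullet>' (fcomp F c0 ?y \<star>' vid B (floose F ?J))"
  let ?R = "fcomp F (?I \<odot>\<^bsub>A\<^esub> ?x) c1 \<bullet>' (fcomp F ?I ?x \<star>' vid B (floose F c1))"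
  let ?M = "(fsq F b0 \<star>' fsq F s) \<star>' fsq F p1"
  have [simp]: "B.giso ?L" "B.giso ?R" by (intro B.giso_intros; simp add: B.giso_intros)+
  \<comment> \<open>Naturality of the composition comparison, used for the pair \<open>b0\<close>,
    \<open>s\<close> and then for their composite with \<open>p1\<close>.\<close>
  have "?L \<bullet>' ?M = fcomp F (c0 \<odot>\<^bsub>A\<^esub> ?y) ?J \<bullet>' ((fcomp F c0 ?y \<bullet>' (fsq F b0 \<star>' fsq F s)) \<star>' fsq F p1)"
    using B.interchange[of "fsq F b0 \<star>' fsq F s" "fcomp F c0 ?y" "fsq F p1" "vid B (floose F ?J)"]
    by (simp add: B.vcmp_assoc')
  also have "fcomp F c0 ?y \<bullet>' (fsq F b0 \<star>' fsq F s) = fsq F (b0 \<star>\<^bsub>A\<^esub> s) \<bullet>' fcomp F ?I ?x"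
    using fcomp_nat[of b0 s] by simp
  also have "(fsq F (b0 \<star>\<^bsub>A\<^esub> s) \<bullet>' fcomp F ?I ?x) \<star>' fsq F p1
      = (fsq F (b0 \<star>\<^bsub>A\<^esub> s) \<star>' fsq F p1) \<bullet>' (fcomp F ?I ?x \<star>' vid B (floose F c1))"
    using B.interchange[of "fcomp F ?I ?x" "fsq F (b0 \<star>\<^bsub>A\<^esub> s)" "vid B (floose F c1)" "fsq F p1"] by simp
  also have "fcomp F (c0 \<odot>\<^bsub>A\<^esub> ?y) ?J \<bullet>' ... = fsq F ((b0 \<star>\<^bsub>A\<^esub> s) \<star>\<^bsub>A\<^esub> p1) \<bullet>' ?R"
    using fcomp_nat[of "b0 \<star>\<^bsub>A\<^esub> s" p1] by (simp flip: B.vcmp_assoc')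
  finally have "?M = sq_inv B ?L \<bullet>' (fsq F ((b0 \<star>\<^bsub>A\<^esub> s) \<star>\<^bsub>A\<^esub> p1) \<bullet>' ?R)"
    using B.sq_inv_cancel(1)[of ?L ?M] B.gisoD(2)[of ?L] by simp
  also have "B.giso ..." using fsq_giso[OF K] by (intro B.giso_intros) (simp_all add: B.gisoD)
  finally have M: "B.giso ?M" .
  have "((fsq F b0 \<bullet>' ?u) \<star>' fsq F s) = (fsq F b0 \<star>' fsq F s) \<bullet>' (?u \<star>' vid B (floose F ?x))"
    using B.interchange[of ?u "fsq F b0" "vid B (floose F ?x)" "fsq F s"] by simp
  then have eq: "((fsq F b0 \<bullet>' ?u) \<star>' fsq F s) \<star>' (sq_inv B ?v \<bullet>' fsq F p1)
      = (vid B (floose F c0 \<odot>\<^bsub>B\<^esub> floose F ?y) \<star>' sq_inv B ?v) \<bullet>'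
        (?M \<bullet>' ((?u \<star>' vid B (floose F ?x)) \<star>' vid B (floose F c1)))"
    using B.interchange[of "?u \<star>' vid B (floose F ?x)" "fsq F b0 \<star>' fsq F s" "vid B (floose F c1)" "fsq F p1"]
      B.interchange[of "(fsq F b0 \<star>' fsq F s) \<bullet>' (?u \<star>' vid B (floose F ?x))"
        "vid B (floose F c0 \<odot>\<^bsub>B\<^esub> floose F ?y)" "fsq F p1" "sq_inv B ?v"] by simp
  have "B.giso (vid B (floose F c0 \<odot>\<^bsub>B\<^esub> floose F ?y) \<star>' sq_inv B ?v)"
    "B.giso ((?u \<star>' vid B (floose F ?x)) \<star>' vid B (floose F c1))"
    by (simp_all add: B.giso_intros)
  with M have "B.giso (((fsq F b0 \<bullet>' ?u) \<star>' fsq F s) \<star>' (sq_inv B ?v \<bullet>' fsq F p1))"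
    unfolding eq by (simp add: B.giso_intros(3))
  then have "sq_iso B (companion_transpose B (fsq F s) (floose F c0) (fsq F b0 \<bullet>' ?u)
      (floose F c1) (sq_inv B ?v \<bullet>' fsq F p1))"
    using B.companion_transpose_iso[of "fsq F s"] companion_fun[OF c0] companion_fun[OF c1] by simp
  then show ?thesis
    using companion_fun[OF c0] companion_fun[OF c1] unfolding companion_commuter_def by simp blast
qed

end

text \<open>The axioms of a 2-category in terms of the boundary maps rather than of hom sets.\<close>

lemma two_categoryI:
  assumes "\<And>f. f \<in> cells1 T \<Longrightarrow> dom1 T f \<in> cells0 T" "\<And>f. f \<in> cells1 T \<Longrightarrow> cod1 T f \<in> cells0 T"
    and "\<And>x. x \<in> cells0 T \<Longrightarrow> id1 T x \<in> cells1 T \<and> dom1 T (id1 T x) = x \<and> cod1 T (id1 T x) = x"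
    and "\<And>f g. \<lbrakk>f \<in> cells1 T; g \<in> cells1 T; dom1 T g = cod1 T f\<rbrakk>
      \<Longrightarrow> cmp1 T g f \<in> cells1 T \<and> dom1 T (cmp1 T g f) = dom1 T f \<and> cod1 T (cmp1 T g f) = cod1 T g"
    and "\<And>f. f \<in> cells1 T \<Longrightarrow> cmp1 T (id1 T (cod1 T f)) f = f"
    and "\<And>f. f \<in> cells1 T \<Longrightarrow> cmp1 T f (id1 T (dom1 T f)) = f"
    and "\<And>f g h. \<lbrakk>f \<in> cells1 T; g \<in> cells1 T; h \<in> cells1 T; dom1 T g = cod1 T f; dom1 T h = cod1 T g\<rbrakk>
      \<Longrightarrow> cmp1 T (cmp1 T h g) f = cmp1 T h (cmp1 T g f)"
    and "\<And>a. a \<in> cells2 T \<Longrightarrow> src2 T a \<in> cells1 T \<and> tgt2 T a \<in> cells1 T \<and>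
      dom1 T (tgt2 T a) = dom1 T (src2 T a) \<and> cod1 T (tgt2 T a) = cod1 T (src2 T a)"
    and "\<And>f. f \<in> cells1 T \<Longrightarrow> id2 T f \<in> cells2 T \<and> src2 T (id2 T f) = f \<and> tgt2 T (id2 T f) = f"
    and "\<And>a b. \<lbrakk>a \<in> cells2 T; b \<in> cells2 T; src2 T b = tgt2 T a\<rbrakk>
      \<Longrightarrow> vcmp2 T b a \<in> cells2 T \<and> src2 T (vcmp2 T b a) = src2 T a \<and> tgt2 T (vcmp2 T b a) = tgt2 T b"
    and "\<And>a. a \<in> cells2 T \<Longrightarrow> vcmp2 T (id2 T (tgt2 T a)) a = a"
    and "\<And>a. a \<in> cells2 T \<Longrightarrow> vcmp2 T a (id2 T (src2 T a)) = a"
    and "\<And>a b c. \<lbrakk>a \<in> cells2 T; b \<in> cells2 T; c \<in> cells2 T; src2 T b = tgt2 T a; src2 T c = tgt2 T b\<rbrakk>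
      \<Longrightarrow> vcmp2 T (vcmp2 T c b) a = vcmp2 T c (vcmp2 T b a)"
    and "\<And>a b. \<lbrakk>a \<in> cells2 T; b \<in> cells2 T; dom1 T (src2 T b) = cod1 T (src2 T a)\<rbrakk>
      \<Longrightarrow> hcmp2 T b a \<in> cells2 T \<and> src2 T (hcmp2 T b a) = cmp1 T (src2 T b) (src2 T a) \<and>
        tgt2 T (hcmp2 T b a) = cmp1 T (tgt2 T b) (tgt2 T a)"
    and "\<And>f g. \<lbrakk>f \<in> cells1 T; g \<in> cells1 T; dom1 T g = cod1 T f\<rbrakk>
      \<Longrightarrow> hcmp2 T (id2 T g) (id2 T f) = id2 T (cmp1 T g f)"
    and "\<And>a a' b b'. \<lbrakk>a \<in> cells2 T; a' \<in> cells2 T; b \<in> cells2 T; b' \<in> cells2 T; src2 T a' = tgt2 T a;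
        src2 T b' = tgt2 T b; dom1 T (src2 T b) = cod1 T (src2 T a)\<rbrakk>
      \<Longrightarrow> hcmp2 T (vcmp2 T b' b) (vcmp2 T a' a) = vcmp2 T (hcmp2 T b' a') (hcmp2 T b a)"
    and "\<And>a. a \<in> cells2 T \<Longrightarrow> hcmp2 T (id2 T (id1 T (cod1 T (src2 T a)))) a = a"
    and "\<And>a. a \<in> cells2 T \<Longrightarrow> hcmp2 T a (id2 T (id1 T (dom1 T (src2 T a)))) = a"
    and "\<And>a b c. \<lbrakk>a \<in> cells2 T; b \<in> cells2 T; c \<in> cells2 T; dom1 T (src2 T b) = cod1 T (src2 T a);
        dom1 T (src2 T c) = cod1 T (src2 T b)\<rbrakk> \<Longrightarrow> hcmp2 T (hcmp2 T c b) a = hcmp2 T c (hcmp2 T b a)"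
  shows "two_category T"
  by unfold_locales (use assms in \<open>auto simp: hom1_def hom2_def\<close>)

section \<open>Calculus in a strict 2-category, and slices\<close>

context two_category
begin

lemmas ends1_in [simp] = dom1_in cod1_in src2_in tgt2_in

lemma id1_simps [simp]:
  assumes "x \<in> cells0 T"
  shows "id1 T x \<in> cells1 T" "dom1 T (id1 T x) = x" "cod1 T (id1 T x) = x"
  using id1_hom[OF assms] by (auto simp: hom1_def)

lemma cmp1_simps [simp]:
  assumes "f \<in> cells1 T" "g \<in> cells1 T" "dom1 T g = cod1 T f"
  shows "cmp1 T g f \<in> cells1 T" "dom1 T (cmp1 T g f) = dom1 T f" "cod1 T (cmp1 T g f) = cod1 T g"
  using cmp1_hom[of f "dom1 T f" "cod1 T f" g "cod1 T g"] assms by (auto simp: hom1_def)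

lemma cmp1_id [simp]:
  "\<lbrakk>f \<in> cells1 T; cod1 T f = y\<rbrakk> \<Longrightarrow> cmp1 T (id1 T y) f = f"
  "\<lbrakk>f \<in> cells1 T; dom1 T f = y\<rbrakk> \<Longrightarrow> cmp1 T f (id1 T y) = f"
  using cmp1_id_left[of f "dom1 T f" "cod1 T f"] cmp1_id_right[of f "dom1 T f" "cod1 T f"] by (auto simp: hom1_def)

lemma cmp1_assoc' [simp]:
  "\<lbrakk>f \<in> cells1 T; g \<in> cells1 T; h \<in> cells1 T; dom1 T g = cod1 T f; dom1 T h = cod1 T g\<rbrakk>
    \<Longrightarrow> cmp1 T (cmp1 T h g) f = cmp1 T h (cmp1 T g f)"
  using cmp1_assoc[of f "dom1 T f" "cod1 T f" g "cod1 T g" h "cod1 T h"] by (auto simp: hom1_def)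

lemma tgt2_simps [simp]:
  assumes "a \<in> cells2 T"
  shows "dom1 T (tgt2 T a) = dom1 T (src2 T a)" "cod1 T (tgt2 T a) = cod1 T (src2 T a)"
  using parallel[OF assms] by auto

lemma id2_simps [simp]:
  assumes "f \<in> cells1 T"
  shows "id2 T f \<in> cells2 T" "src2 T (id2 T f) = f" "tgt2 T (id2 T f) = f"
  using id2_hom[OF assms] by (auto simp: hom2_def)

lemma vcmp2_simps [simp]:
  assumes "a \<in> cells2 T" "b \<in> cells2 T" "src2 T b = tgt2 T a"
  shows "vcmp2 T b a \<in> cells2 T" "src2 T (vcmp2 T b a) = src2 T a" "tgt2 T (vcmp2 T b a) = tgt2 T b"
  using vcmp2_hom[of a "src2 T a" "tgt2 T a" b "tgt2 T b"] assms by (auto simp: hom2_def)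

lemma vcmp2_id [simp]:
  "\<lbrakk>a \<in> cells2 T; tgt2 T a = f\<rbrakk> \<Longrightarrow> vcmp2 T (id2 T f) a = a"
  "\<lbrakk>a \<in> cells2 T; src2 T a = f\<rbrakk> \<Longrightarrow> vcmp2 T a (id2 T f) = a"
  using vcmp2_id_left[of a "src2 T a" f] vcmp2_id_right[of a f "tgt2 T a"] by (auto simp: hom2_def)

lemma vcmp2_assoc':
  "\<lbrakk>a \<in> cells2 T; b \<in> cells2 T; c \<in> cells2 T; src2 T b = tgt2 T a; src2 T c = tgt2 T b\<rbrakk>
    \<Longrightarrow> vcmp2 T (vcmp2 T c b) a = vcmp2 T c (vcmp2 T b a)"
  using vcmp2_assoc[of a "src2 T a" "tgt2 T a" b "tgt2 T b" c "tgt2 T c"] by (auto simp: hom2_def)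

lemma hcmp2_simps [simp]:
  assumes "a \<in> cells2 T" "b \<in> cells2 T" "dom1 T (src2 T b) = cod1 T (src2 T a)"
  shows "hcmp2 T b a \<in> cells2 T" "src2 T (hcmp2 T b a) = cmp1 T (src2 T b) (src2 T a)"
    "tgt2 T (hcmp2 T b a) = cmp1 T (tgt2 T b) (tgt2 T a)"
  using hcmp2_hom[of a "src2 T a" "tgt2 T a" b "src2 T b" "tgt2 T b"] assms by (auto simp: hom2_def)

lemma hcmp2_id' [simp]:
  "\<lbrakk>f \<in> cells1 T; g \<in> cells1 T; dom1 T g = cod1 T f\<rbrakk> \<Longrightarrow> hcmp2 T (id2 T g) (id2 T f) = id2 T (cmp1 T g f)"
  using hcmp2_id[of f "dom1 T f" "cod1 T f" g "cod1 T g"] by (auto simp: hom1_def)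

lemma interchange':
  "\<lbrakk>a \<in> cells2 T; a' \<in> cells2 T; b \<in> cells2 T; b' \<in> cells2 T; src2 T a' = tgt2 T a;
     src2 T b' = tgt2 T b; dom1 T (src2 T b) = cod1 T (src2 T a)\<rbrakk>
    \<Longrightarrow> hcmp2 T (vcmp2 T b' b) (vcmp2 T a' a) = vcmp2 T (hcmp2 T b' a') (hcmp2 T b a)"
  using interchange[of a "src2 T a" "tgt2 T a" a' "tgt2 T a'" b "src2 T b" "tgt2 T b" b' "tgt2 T b'"]
  by (auto simp: hom2_def)

lemma hcmp2_id1 [simp]:
  "\<lbrakk>a \<in> cells2 T; cod1 T (src2 T a) = y\<rbrakk> \<Longrightarrow> hcmp2 T (id2 T (id1 T y)) a = a"
  "\<lbrakk>a \<in> cells2 T; dom1 T (src2 T a) = y\<rbrakk> \<Longrightarrow> hcmp2 T a (id2 T (id1 T y)) = a"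
  using hcmp2_id_left[of a "src2 T a" "tgt2 T a"] hcmp2_id_right[of a "src2 T a" "tgt2 T a"] by (auto simp: hom2_def)

lemma hcmp2_assoc':
  "\<lbrakk>a \<in> cells2 T; b \<in> cells2 T; c \<in> cells2 T; dom1 T (src2 T b) = cod1 T (src2 T a);
     dom1 T (src2 T c) = cod1 T (src2 T b)\<rbrakk> \<Longrightarrow> hcmp2 T (hcmp2 T c b) a = hcmp2 T c (hcmp2 T b a)"
  using hcmp2_assoc[of a "src2 T a" "tgt2 T a" b "src2 T b" "tgt2 T b" c "src2 T c" "tgt2 T c"]
  by (auto simp: hom2_def)

lemma whisker_vcmp2:
  "\<lbrakk>p \<in> cells1 T; a \<in> cells2 T; b \<in> cells2 T; src2 T b = tgt2 T a; dom1 T p = cod1 T (src2 T a)\<rbrakk>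
    \<Longrightarrow> hcmp2 T (id2 T p) (vcmp2 T b a) = vcmp2 T (hcmp2 T (id2 T p) b) (hcmp2 T (id2 T p) a)"
  "\<lbrakk>q \<in> cells1 T; a \<in> cells2 T; b \<in> cells2 T; src2 T b = tgt2 T a; dom1 T (src2 T a) = cod1 T q\<rbrakk>
    \<Longrightarrow> hcmp2 T (vcmp2 T b a) (id2 T q) = vcmp2 T (hcmp2 T b (id2 T q)) (hcmp2 T a (id2 T q))"
  subgoal using interchange'[of a b "id2 T p" "id2 T p"] by simp
  subgoal using interchange'[of "id2 T q" "id2 T q" a b] by simp
  done

lemma whisker_cmp1:
  "\<lbrakk>p \<in> cells1 T; q \<in> cells1 T; a \<in> cells2 T; dom1 T q = cod1 T (src2 T a); dom1 T p = cod1 T q\<rbrakk>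
    \<Longrightarrow> hcmp2 T (id2 T (cmp1 T p q)) a = hcmp2 T (id2 T p) (hcmp2 T (id2 T q) a)"
  using hcmp2_assoc'[of a "id2 T q" "id2 T p"] by simp

end

lemma slice_simps [simp]:
  "cells0 (slice T c) = {m \<in> cells1 T. cod1 T m = c}"
  "dom1 (slice T c) (m, n, f) = m" "cod1 (slice T c) (m, n, f) = n"
  "src2 (slice T c) (m, n, a) = (m, n, src2 T a)" "tgt2 (slice T c) (m, n, a) = (m, n, tgt2 T a)"
  "id1 (slice T c) m = (m, m, id1 T (dom1 T m))" "id2 (slice T c) (m, n, f) = (m, n, id2 T f)"
  "cmp1 (slice T c) (n, k, g) (m, n', f) = (m, k, cmp1 T g f)"
  "vcmp2 (slice T c) (m', n', b) (m, n, a) = (m, n, vcmp2 T b a)"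
  "hcmp2 (slice T c) (n, k, b) (m, n', a) = (m, k, hcmp2 T b a)"
  by (simp_all add: slice_def Let_def)

lemma slice_cells1 [simp]:
  "(m, n, f) \<in> cells1 (slice T c) \<longleftrightarrow> m \<in> cells1 T \<and> cod1 T m = c \<and> n \<in> cells1 T \<and> cod1 T n = c \<and>
    f \<in> cells1 T \<and> dom1 T f = dom1 T m \<and> cod1 T f = dom1 T n \<and> cmp1 T n f = m"
  by (auto simp: slice_def Let_def hom1_def)

lemma slice_cells2 [simp]:
  "(m, n, a) \<in> cells2 (slice T c) \<longleftrightarrow> a \<in> cells2 T \<and> (m, n, src2 T a) \<in> cells1 (slice T c) \<and>
    (m, n, tgt2 T a) \<in> cells1 (slice T c) \<and> hcmp2 T (id2 T n) a = id2 T m"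
  by (auto simp: slice_def Let_def hom1_def)

lemma two_category_slice:
  assumes "two_category T"
  shows "two_category (slice T c)"
proof -
  interpret two_category T by fact
  show ?thesis
  proof (rule two_categoryI, goal_cases)
    case (4 f g)
    obtain m n f' where f: "f = (m, n, f')" by (cases f)
    obtain n' k g' where g: "g = (n', k, g')" by (cases g)
    have "cmp1 T k (cmp1 T g' f') = cmp1 T (cmp1 T k g') f'"
      by (rule cmp1_assoc'[symmetric]) (use 4 f g in auto)
    then show ?case using 4 f g by (auto simp del: cmp1_assoc')
  next
    case (8 a)
    then show ?case by (cases a) auto
  next
    case (10 a b)
    then show ?case by (cases a; cases b) (auto simp: whisker_vcmp2)
  next
    case (13 a b c)
    then show ?case by (cases a; cases b; cases c) (auto simp: vcmp2_assoc')
  next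
    case (14 a b)
    obtain m n a' where a: "a = (m, n, a')" by (cases a)
    obtain n' k b' where b: "b = (n', k, b')" by (cases b)
    have "hcmp2 T (id2 T k) (hcmp2 T b' a') = hcmp2 T (hcmp2 T (id2 T k) b') a'"
      by (rule hcmp2_assoc'[symmetric]) (use 14 a b in auto)
    moreover have "cmp1 T k (cmp1 T (src2 T b') (src2 T a')) = cmp1 T (cmp1 T k (src2 T b')) (src2 T a')"
      by (rule cmp1_assoc'[symmetric]) (use 14 a b in auto)
    moreover have "cmp1 T k (cmp1 T (tgt2 T b') (tgt2 T a')) = cmp1 T (cmp1 T k (tgt2 T b')) (tgt2 T a')"
      by (rule cmp1_assoc'[symmetric]) (use 14 a b in auto)
    ultimately show ?case using 14 a b by (auto simp del: cmp1_assoc')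
  next
    case (16 a a' b b')
    then show ?case by (cases a; cases a'; cases b; cases b') (auto simp: interchange')
  next
    case (19 a b c)
    then show ?case by (cases a; cases b; cases c) (auto simp: hcmp2_assoc')
  qed auto
qed

section \<open>Strict finite products in a 2-category and their invariance under isomorphism\<close>

lemma is_productI:
  assumes "y \<in> cells0 T" "\<And>i. i < n \<Longrightarrow> X i \<in> cells0 T" "\<And>i. i < n \<Longrightarrow> \<pi> i \<in> hom1 T y (X i)"
    and "\<And>z f. \<lbrakk>z \<in> cells0 T; \<And>i. i < n \<Longrightarrow> f i \<in> hom1 T z (X i)\<rbrakk>
      \<Longrightarrow> \<exists>h \<in> hom1 T z y. \<forall>i<n. cmp1 T (\<pi> i) h = f i"
    and "\<And>z h k. \<lbrakk>z \<in> cells0 T; h \<in> hom1 T z y; k \<in> hom1 T z y; \<And>i. i < n \<Longrightarrow> cmp1 T (\<pi> i) h = cmp1 T (\<pi> i) k\<rbrakk>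
      \<Longrightarrow> h = k"
    and "\<And>z h k a. \<lbrakk>z \<in> cells0 T; h \<in> hom1 T z y; k \<in> hom1 T z y;
        \<And>i. i < n \<Longrightarrow> a i \<in> hom2 T (cmp1 T (\<pi> i) h) (cmp1 T (\<pi> i) k)\<rbrakk>
      \<Longrightarrow> \<exists>c \<in> hom2 T h k. \<forall>i<n. hcmp2 T (id2 T (\<pi> i)) c = a i"
    and "\<And>z h k c d. \<lbrakk>z \<in> cells0 T; h \<in> hom1 T z y; k \<in> hom1 T z y; c \<in> hom2 T h k; d \<in> hom2 T h k;
        \<And>i. i < n \<Longrightarrow> hcmp2 T (id2 T (\<pi> i)) c = hcmp2 T (id2 T (\<pi> i)) d\<rbrakk> \<Longrightarrow> c = d"
  shows "is_product T n X y \<pi>"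
  unfolding is_product_def
proof (intro conjI ballI allI impI, goal_cases)
  case (4 z f)
  then obtain h where h: "h \<in> hom1 T z y" "\<forall>i<n. cmp1 T (\<pi> i) h = f i" using assms(4)[of z f] by blast
  show ?case by (rule ex1I[of _ h]) (use h assms(5)[OF 4(1)] in auto)
next
  case (5 z h k a)
  then obtain c where c: "c \<in> hom2 T h k" "\<forall>i<n. hcmp2 T (id2 T (\<pi> i)) c = a i" using assms(6)[of z h k a] by blast
  show ?case by (rule ex1I[of _ c]) (use c assms(7)[OF 5(1-3)] in auto)
qed (use assms in auto)

lemma is_productD:
  assumes "is_product T n X y \<pi>"
  shows "y \<in> cells0 T" "i < n \<Longrightarrow> X i \<in> cells0 T" "i < n \<Longrightarrow> \<pi> i \<in> hom1 T y (X i)"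
  using assms by (auto simp: is_product_def)

lemma product_ex1_map:
  assumes "is_product T n X y \<pi>" "z \<in> cells0 T" "\<And>i. i < n \<Longrightarrow> f i \<in> hom1 T z (X i)"
  shows "\<exists>!h. h \<in> hom1 T z y \<and> (\<forall>i<n. cmp1 T (\<pi> i) h = f i)"
  by (rule assms(1)[unfolded is_product_def, THEN conjunct2, THEN conjunct2, THEN bspec[OF _ assms(2)],
        THEN conjunct1, THEN spec, THEN mp]) (simp add: assms(3))

lemma product_ex1_cell:
  assumes "is_product T n X y \<pi>" "z \<in> cells0 T" "h \<in> hom1 T z y" "k \<in> hom1 T z y"
    "\<And>i. i < n \<Longrightarrow> a i \<in> hom2 T (cmp1 T (\<pi> i) h) (cmp1 T (\<pi> i) k)"
  shows "\<exists>!c. c \<in> hom2 T h k \<and> (\<forall>i<n. hcmp2 T (id2 T (\<pi> i)) c = a i)"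
  by (rule assms(1)[unfolded is_product_def, THEN conjunct2, THEN conjunct2, THEN bspec[OF _ assms(2)],
        THEN conjunct2, THEN bspec[OF _ assms(3)], THEN bspec[OF _ assms(4)], THEN spec, THEN mp]) (simp add: assms(5))

lemma product_map:
  assumes "is_product T n X y \<pi>" "z \<in> cells0 T" "\<And>i. i < n \<Longrightarrow> f i \<in> hom1 T z (X i)"
  obtains h where "h \<in> hom1 T z y" "\<And>i. i < n \<Longrightarrow> cmp1 T (\<pi> i) h = f i"
  using product_ex1_map[of T n X y \<pi> z f, OF assms] by blast

lemma product_map_unique:
  assumes "is_product T n X y \<pi>" "two_category T" "h \<in> hom1 T z y" "k \<in> hom1 T z y"
    "\<And>i. i < n \<Longrightarrow> cmp1 T (\<pi> i) h = cmp1 T (\<pi> i) k"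
  shows "h = k"
proof -
  interpret two_category T by fact
  have z: "z \<in> cells0 T" using assms(3) by (auto simp: hom1_def)
  have "cmp1 T (\<pi> i) h \<in> hom1 T z (X i)" if "i < n" for i
    using is_productD(3)[OF assms(1) that] assms(3) by (rule cmp1_hom[rotated])
  from product_ex1_map[OF assms(1) z, of "\<lambda>i. cmp1 T (\<pi> i) h", OF this] show ?thesis
    using assms(3-5) by metis
qed

lemma product_cell:
  assumes "is_product T n X y \<pi>" "two_category T" "h \<in> hom1 T z y" "k \<in> hom1 T z y"
    "\<And>i. i < n \<Longrightarrow> a i \<in> hom2 T (cmp1 T (\<pi> i) h) (cmp1 T (\<pi> i) k)"
  obtains c where "c \<in> hom2 T h k" "\<And>i. i < n \<Longrightarrow> hcmp2 T (id2 T (\<pi> i)) c = a i"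
proof -
  have z: "z \<in> cells0 T" using assms(3) two_category.dom1_in[OF assms(2)] by (auto simp: hom1_def)
  from product_ex1_cell[of T n X y \<pi> z h k a, OF assms(1) z assms(3-5)] show thesis using that by blast
qed

lemma product_cell_unique:
  assumes "is_product T n X y \<pi>" "two_category T" "h \<in> hom1 T z y" "k \<in> hom1 T z y"
    "c \<in> hom2 T h k" "d \<in> hom2 T h k" "\<And>i. i < n \<Longrightarrow> hcmp2 T (id2 T (\<pi> i)) c = hcmp2 T (id2 T (\<pi> i)) d"
  shows "c = d"
proof -
  interpret two_category T by fact
  have z: "z \<in> cells0 T" using assms(3) by (auto simp: hom1_def)
  have "hcmp2 T (id2 T (\<pi> i)) c \<in> hom2 T (cmp1 T (\<pi> i) h) (cmp1 T (\<pi> i) k)" if "i < n" for i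
    using is_productD(3)[OF assms(1) that] assms(3,5) by (auto simp: hom1_def hom2_def)
  from product_ex1_cell[OF assms(1) z assms(3,4), of "\<lambda>i. hcmp2 T (id2 T (\<pi> i)) c", OF this] show ?thesis
    using assms(5-7) by metis
qed

lemma is_product_cong:
  assumes "is_product T n X y \<pi>" "\<And>i. i < n \<Longrightarrow> X' i = X i" "\<And>i. i < n \<Longrightarrow> \<pi>' i = \<pi> i"
  shows "is_product T n X' y \<pi>'"
  using assms unfolding is_product_def by simp

text \<open>The inductive step that extends an \<open>n\<close>-fold cone by a binary one. The
  projections are given explicitly so that later inductions can test a cell of the new product on
  the two binary components.\<close>

lemma product_Suc:
  assumes T: "two_category T" and P: "is_product T n X y \<pi>"
    and Q: "is_product T 2 (\<lambda>i. if i = 0 then y else X n) z \<rho>"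
  shows "is_product T (Suc n) X z (\<lambda>i. if i < n then cmp1 T (\<pi> i) (\<rho> 0) else \<rho> 1)"
proof (rule is_productI)
  interpret two_category T by fact
  have r: "\<rho> 0 \<in> hom1 T z y" "\<rho> 1 \<in> hom1 T z (X n)" using is_productD(3)[OF Q, of 0] is_productD(3)[OF Q, of 1] by auto
  note p = is_productD(3)[OF P]
  note [simp] = r[unfolded hom1_def, simplified] p[unfolded hom1_def, simplified]
  show "z \<in> cells0 T" by (rule is_productD(1)[OF Q])
  show "X i \<in> cells0 T" if "i < Suc n" for i
    using that is_productD(2)[OF P, of i] is_productD(2)[OF Q, of 1] less_Suc_eq by auto
  show "(if i < n then cmp1 T (\<pi> i) (\<rho> 0) else \<rho> 1) \<in> hom1 T z (X i)" if "i < Suc n" for i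
    using that r p[of i] cmp1_hom less_Suc_eq by auto
  {
    fix w f assume w: "w \<in> cells0 T" and f: "\<And>i. i < Suc n \<Longrightarrow> f i \<in> hom1 T w (X i)"
    obtain h where h: "h \<in> hom1 T w y" "\<And>i. i < n \<Longrightarrow> cmp1 T (\<pi> i) h = f i"
      by (rule product_map[OF P w, of f]) (use f in auto)
    obtain k where k: "k \<in> hom1 T w z" "\<And>i. i < 2 \<Longrightarrow> cmp1 T (\<rho> i) k = (if i = 0 then h else f n)"
      by (rule product_map[OF Q w, of "\<lambda>i. if i = 0 then h else f n"]) (use f h in auto)
    have k': "cmp1 T (\<rho> 0) k = h" "cmp1 T (\<rho> 1) k = f n" using k(2)[of 0] k(2)[of 1] by auto
    have "cmp1 T (if i < n then cmp1 T (\<pi> i) (\<rho> 0) else \<rho> 1) k = f i" if "i < Suc n" for i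
      using that k(1) k' h less_Suc_eq by (auto simp: hom1_def)
    with k show "\<exists>h\<in>hom1 T w z. \<forall>i<Suc n. cmp1 T (if i < n then cmp1 T (\<pi> i) (\<rho> 0) else \<rho> 1) h = f i" by blast
  next
    fix w h k assume w: "w \<in> cells0 T" and hk: "h \<in> hom1 T w z" "k \<in> hom1 T w z"
      and e: "\<And>i. i < Suc n \<Longrightarrow> cmp1 T (if i < n then cmp1 T (\<pi> i) (\<rho> 0) else \<rho> 1) h
        = cmp1 T (if i < n then cmp1 T (\<pi> i) (\<rho> 0) else \<rho> 1) k"
    have "cmp1 T (\<rho> 0) h = cmp1 T (\<rho> 0) k"
    proof (rule product_map_unique[OF P T])
      show "cmp1 T (\<rho> 0) h \<in> hom1 T w y" "cmp1 T (\<rho> 0) k \<in> hom1 T w y" using hk r cmp1_hom by blast+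
      show "cmp1 T (\<pi> i) (cmp1 T (\<rho> 0) h) = cmp1 T (\<pi> i) (cmp1 T (\<rho> 0) k)" if "i < n" for i
        using e[of i] that hk by (simp add: hom1_def)
    qed
    then show "h = k"
      using e[of n] by (intro product_map_unique[OF Q T hk]) (auto simp: less_2_cases_iff)
  next
    fix w h k a assume w: "w \<in> cells0 T" and hk: "h \<in> hom1 T w z" "k \<in> hom1 T w z"
      and a: "\<And>i. i < Suc n \<Longrightarrow> a i \<in> hom2 T (cmp1 T (if i < n then cmp1 T (\<pi> i) (\<rho> 0) else \<rho> 1) h)
        (cmp1 T (if i < n then cmp1 T (\<pi> i) (\<rho> 0) else \<rho> 1) k)"
    have hk': "cmp1 T (\<rho> 0) h \<in> hom1 T w y" "cmp1 T (\<rho> 0) k \<in> hom1 T w y" using hk r cmp1_hom by blast+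
    obtain b where b: "b \<in> hom2 T (cmp1 T (\<rho> 0) h) (cmp1 T (\<rho> 0) k)" "\<And>i. i < n \<Longrightarrow> hcmp2 T (id2 T (\<pi> i)) b = a i"
    proof (rule product_cell[OF P T hk'])
      show "a i \<in> hom2 T (cmp1 T (\<pi> i) (cmp1 T (\<rho> 0) h)) (cmp1 T (\<pi> i) (cmp1 T (\<rho> 0) k))" if "i < n" for i
        using a[of i] that hk by (simp add: hom1_def)
    qed blast
    obtain c where c: "c \<in> hom2 T h k" "\<And>i. i < 2 \<Longrightarrow> hcmp2 T (id2 T (\<rho> i)) c = (if i = 0 then b else a n)"
      by (rule product_cell[OF Q T hk, of "\<lambda>i. if i = 0 then b else a n"])
        (use a[of n] b in \<open>auto simp: less_2_cases_iff\<close>)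
    have c': "hcmp2 T (id2 T (\<rho> 0)) c = b" "hcmp2 T (id2 T (\<rho> 1)) c = a n" using c(2)[of 0] c(2)[of 1] by auto
    have "hcmp2 T (id2 T (if i < n then cmp1 T (\<pi> i) (\<rho> 0) else \<rho> 1)) c = a i" if "i < Suc n" for i
      using that c(1) c' b hk less_Suc_eq by (auto simp: hom1_def hom2_def whisker_cmp1)
    with c show "\<exists>c\<in>hom2 T h k. \<forall>i<Suc n. hcmp2 T (id2 T (if i < n then cmp1 T (\<pi> i) (\<rho> 0) else \<rho> 1)) c = a i"
      by blast
  next
    fix w h k c d assume w: "w \<in> cells0 T" and hk: "h \<in> hom1 T w z" "k \<in> hom1 T w z"
      and cd: "c \<in> hom2 T h k" "d \<in> hom2 T h k"
      and e: "\<And>i. i < Suc n \<Longrightarrow> hcmp2 T (id2 T (if i < n then cmp1 T (\<pi> i) (\<rho> 0) else \<rho> 1)) c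
        = hcmp2 T (id2 T (if i < n then cmp1 T (\<pi> i) (\<rho> 0) else \<rho> 1)) d"
    have hk': "cmp1 T (\<rho> 0) h \<in> hom1 T w y" "cmp1 T (\<rho> 0) k \<in> hom1 T w y" using hk r cmp1_hom by blast+
    have "hcmp2 T (id2 T (\<rho> 0)) c = hcmp2 T (id2 T (\<rho> 0)) d"
    proof (rule product_cell_unique[OF P T hk'])
      show "hcmp2 T (id2 T (\<rho> 0)) c \<in> hom2 T (cmp1 T (\<rho> 0) h) (cmp1 T (\<rho> 0) k)"
        "hcmp2 T (id2 T (\<rho> 0)) d \<in> hom2 T (cmp1 T (\<rho> 0) h) (cmp1 T (\<rho> 0) k)"
        using hk cd by (auto simp: hom1_def hom2_def)
      show "hcmp2 T (id2 T (\<pi> i)) (hcmp2 T (id2 T (\<rho> 0)) c) = hcmp2 T (id2 T (\<pi> i)) (hcmp2 T (id2 T (\<rho> 0)) d)"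
        if "i < n" for i
        using e[of i] that hk cd by (auto simp: hom1_def hom2_def whisker_cmp1)
    qed
    then show "c = d"
      using e[of n] by (intro product_cell_unique[OF Q T hk cd]) (auto simp: less_2_cases_iff)
  }
qed

lemma cartesianI:
  assumes T: "two_category T" and 0: "\<And>X. \<exists>y \<pi>. is_product T 0 X y \<pi>"
    and 2: "\<And>a b. \<lbrakk>a \<in> cells0 T; b \<in> cells0 T\<rbrakk> \<Longrightarrow> \<exists>y \<pi>. is_product T 2 (\<lambda>i. if i = 0 then a else b) y \<pi>"
  shows "cartesian_two_category T"
  unfolding cartesian_two_category_def
proof (intro conjI allI impI)
  fix n :: nat and X assume "\<forall>i<n. X i \<in> cells0 T"
  then show "\<exists>y \<pi>. is_product T n X y \<pi>"
  proof (induction n)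
    case (Suc n)
    then obtain y \<pi> where P: "is_product T n X y \<pi>" by auto
    then obtain z \<rho> where "is_product T 2 (\<lambda>i. if i = 0 then y else X n) z \<rho>"
      using 2[of y "X n"] Suc.prems is_productD(1)[OF P] by blast
    from product_Suc[OF T P this] show ?case by blast
  qed (rule 0)
qed fact

text \<open>Composition with \<open>u\<close> is a bijection on the 1-cells and on the 2-cells from
  any \<open>w\<close>, with inverse given by \<open>v\<close>; both halves of the universal
  property are transported along it.\<close>

lemma product_precompose_iso:
  assumes T: "two_category T" and P: "is_product T n X y \<pi>" and u: "u \<in> hom1 T y' y" and v: "v \<in> hom1 T y y'"
    and uv: "cmp1 T u v = id1 T y" and vu: "cmp1 T v u = id1 T y'"
  shows "is_product T n X y' (\<lambda>i. cmp1 T (\<pi> i) u)"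
proof (rule is_productI)
  interpret two_category T by fact
  note p = is_productD(3)[OF P]
  note [simp] = u[unfolded hom1_def, simplified] v[unfolded hom1_def, simplified] p[unfolded hom1_def, simplified]
  show "y' \<in> cells0 T" using dom1_in[of u] by simp
  show "X i \<in> cells0 T" if "i < n" for i by (rule is_productD(2)[OF P that])
  show "cmp1 T (\<pi> i) u \<in> hom1 T y' (X i)" if "i < n" for i using p[OF that] u cmp1_hom by blast
  have vuh: "cmp1 T v (cmp1 T u h) = h" if "h \<in> hom1 T w y'" for h w
    using that vu by (simp add: hom1_def flip: cmp1_assoc')
  have uvh: "cmp1 T u (cmp1 T v h) = h" if "h \<in> hom1 T w y" for h w
    using that uv by (simp add: hom1_def flip: cmp1_assoc')
  have vuc: "hcmp2 T (id2 T v) (hcmp2 T (id2 T u) c) = c" if "c \<in> hom2 T h k" "h \<in> hom1 T w y'" for c h k w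
    using that vu by (auto simp: hom1_def hom2_def simp flip: hcmp2_assoc')
  have uvc: "hcmp2 T (id2 T u) (hcmp2 T (id2 T v) c) = c" if "c \<in> hom2 T h k" "h \<in> hom1 T w y" for c h k w
    using that uv by (auto simp: hom1_def hom2_def simp flip: hcmp2_assoc')
  {
    fix w f assume w: "w \<in> cells0 T" and f: "\<And>i. i < n \<Longrightarrow> f i \<in> hom1 T w (X i)"
    obtain h where h: "h \<in> hom1 T w y" "\<And>i. i < n \<Longrightarrow> cmp1 T (\<pi> i) h = f i"
      by (rule product_map[OF P w, of f]) (use f in auto)
    then show "\<exists>h\<in>hom1 T w y'. \<forall>i<n. cmp1 T (cmp1 T (\<pi> i) u) h = f i"
      using uvh[OF h(1)] by (intro bexI[of _ "cmp1 T v h"]) (auto simp: hom1_def)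
  next
    fix w h k assume hk: "h \<in> hom1 T w y'" "k \<in> hom1 T w y'"
      and e: "\<And>i. i < n \<Longrightarrow> cmp1 T (cmp1 T (\<pi> i) u) h = cmp1 T (cmp1 T (\<pi> i) u) k"
    have "cmp1 T u h = cmp1 T u k"
      by (rule product_map_unique[OF P T, of _ w]) (use hk e in \<open>auto simp: hom1_def\<close>)
    then show "h = k" using vuh[OF hk(1)] vuh[OF hk(2)] by metis
  next
    fix w h k a assume hk: "h \<in> hom1 T w y'" "k \<in> hom1 T w y'"
      and a: "\<And>i. i < n \<Longrightarrow> a i \<in> hom2 T (cmp1 T (cmp1 T (\<pi> i) u) h) (cmp1 T (cmp1 T (\<pi> i) u) k)"
    have hk': "cmp1 T u h \<in> hom1 T w y" "cmp1 T u k \<in> hom1 T w y" using hk u cmp1_hom by blast+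
    obtain b where b: "b \<in> hom2 T (cmp1 T u h) (cmp1 T u k)" "\<And>i. i < n \<Longrightarrow> hcmp2 T (id2 T (\<pi> i)) b = a i"
      by (rule product_cell[OF P T hk', of a]) (use a hk in \<open>auto simp: hom1_def\<close>)
    have "hcmp2 T (id2 T (cmp1 T (\<pi> i) u)) (hcmp2 T (id2 T v) b) = a i" if "i < n" for i
      using b(2)[OF that] that uvc[OF b(1) hk'(1)] b(1) hk by (simp add: whisker_cmp1 hom1_def hom2_def)
    moreover have "hcmp2 T (id2 T v) b \<in> hom2 T h k"
      using b(1) vuh[OF hk(1)] vuh[OF hk(2)] hk by (simp add: hom1_def hom2_def)
    ultimately show "\<exists>c\<in>hom2 T h k. \<forall>i<n. hcmp2 T (id2 T (cmp1 T (\<pi> i) u)) c = a i" by blast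
  next
    fix w h k c d assume hk: "h \<in> hom1 T w y'" "k \<in> hom1 T w y'" and cd: "c \<in> hom2 T h k" "d \<in> hom2 T h k"
      and e: "\<And>i. i < n \<Longrightarrow> hcmp2 T (id2 T (cmp1 T (\<pi> i) u)) c = hcmp2 T (id2 T (cmp1 T (\<pi> i) u)) d"
    have hk': "cmp1 T u h \<in> hom1 T w y" "cmp1 T u k \<in> hom1 T w y" using hk u cmp1_hom by blast+
    have "hcmp2 T (id2 T u) c = hcmp2 T (id2 T u) d"
      by (rule product_cell_unique[OF P T hk']) (use hk cd e in \<open>auto simp: hom1_def hom2_def whisker_cmp1\<close>)
    then show "c = d" using vuc[OF cd(1) hk(1)] vuc[OF cd(2) hk(1)] by metis
  }
qed

lemma product_unique:
  assumes T: "two_category T" and P: "is_product T n X y \<pi>" and Q: "is_product T n X y' \<pi>'"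
  obtains u v where "u \<in> hom1 T y' y" "v \<in> hom1 T y y'" "cmp1 T u v = id1 T y" "cmp1 T v u = id1 T y'"
    "\<And>i. i < n \<Longrightarrow> \<pi>' i = cmp1 T (\<pi> i) u"
proof -
  interpret two_category T by fact
  note p = is_productD[OF P] is_productD[OF Q]
  obtain u where u: "u \<in> hom1 T y' y" "\<And>i. i < n \<Longrightarrow> cmp1 T (\<pi> i) u = \<pi>' i"
    by (rule product_map[OF P p(4), of \<pi>']) (use p in auto)
  obtain v where v: "v \<in> hom1 T y y'" "\<And>i. i < n \<Longrightarrow> cmp1 T (\<pi>' i) v = \<pi> i"
    by (rule product_map[OF Q p(1), of \<pi>]) (use p in auto)
  have a: "cmp1 T (\<pi> i) (cmp1 T u v) = \<pi> i" "cmp1 T (\<pi>' i) (cmp1 T v u) = \<pi>' i" if "i < n" for i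
    using that p(3,6)[OF that] u v by (simp_all add: hom1_def flip: cmp1_assoc')
  have "cmp1 T u v = id1 T y"
    by (rule product_map_unique[OF P T, of _ y]) (use u v p a in \<open>auto simp: hom1_def\<close>)
  moreover have "cmp1 T v u = id1 T y'"
    by (rule product_map_unique[OF Q T, of _ y']) (use u v p a in \<open>auto simp: hom1_def\<close>)
  ultimately show thesis using that u v by metis
qed

lemma (in two_functor) functor_simps:
  "x \<in> cells0 S \<Longrightarrow> on0 P x \<in> cells0 T"
  "f \<in> cells1 S \<Longrightarrow> on1 P f \<in> cells1 T" "f \<in> cells1 S \<Longrightarrow> dom1 T (on1 P f) = on0 P (dom1 S f)"
  "f \<in> cells1 S \<Longrightarrow> cod1 T (on1 P f) = on0 P (cod1 S f)" "x \<in> cells0 S \<Longrightarrow> on1 P (id1 S x) = id1 T (on0 P x)"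
  "\<lbrakk>f \<in> cells1 S; g \<in> cells1 S; dom1 S g = cod1 S f\<rbrakk> \<Longrightarrow> on1 P (cmp1 S g f) = cmp1 T (on1 P g) (on1 P f)"
  "a \<in> cells2 S \<Longrightarrow> on2 P a \<in> cells2 T" "a \<in> cells2 S \<Longrightarrow> src2 T (on2 P a) = on1 P (src2 S a)"
  "a \<in> cells2 S \<Longrightarrow> tgt2 T (on2 P a) = on1 P (tgt2 S a)" "f \<in> cells1 S \<Longrightarrow> on2 P (id2 S f) = id2 T (on1 P f)"
  "\<lbrakk>a \<in> cells2 S; b \<in> cells2 S; src2 S b = tgt2 S a\<rbrakk> \<Longrightarrow> on2 P (vcmp2 S b a) = vcmp2 T (on2 P b) (on2 P a)"
  "\<lbrakk>a \<in> cells2 S; b \<in> cells2 S; dom1 S (src2 S b) = cod1 S (src2 S a)\<rbrakk>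
    \<Longrightarrow> on2 P (hcmp2 S b a) = hcmp2 T (on2 P b) (on2 P a)"
  using on0_in[of x] on1_hom[of f "dom1 S f" "cod1 S f"] on2_hom[of a "src2 S a" "tgt2 S a"] on1_id[of x] on2_id[of f]
    on1_cmp[of f "dom1 S f" "cod1 S f" g "cod1 S g"] on2_vcmp[of a "src2 S a" "tgt2 S a" b "tgt2 S b"]
    on2_hcmp[of a "src2 S a" "tgt2 S a" b "src2 S b" "tgt2 S b"]
  by (auto simp: hom1_def hom2_def)

text \<open>Since product cones are unique up to isomorphism, it is enough that one of them is preserved.\<close>

lemma (in two_functor) preserves_product:
  assumes P: "is_product S n X y \<pi>" and Q: "is_product S n X y' \<pi>'"
    and Q': "is_product T n (on0 P \<circ> X) (on0 P y') (on1 P \<circ> \<pi>')"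
  shows "is_product T n (on0 P \<circ> X) (on0 P y) (on1 P \<circ> \<pi>)"
proof -
  note S = S.two_category_axioms and T = T.two_category_axioms
  obtain u v where u: "u \<in> hom1 S y y'" and v: "v \<in> hom1 S y' y" and uv: "cmp1 S u v = id1 S y'" "cmp1 S v u = id1 S y"
    and pu: "\<And>i. i < n \<Longrightarrow> \<pi> i = cmp1 S (\<pi>' i) u"
    using product_unique[OF S Q P] by blast
  have "cmp1 T (on1 P u) (on1 P v) = id1 T (on0 P y')" "cmp1 T (on1 P v) (on1 P u) = id1 T (on0 P y)"
    using on1_cmp[OF v u] on1_cmp[OF u v] uv on1_id is_productD(1)[OF P] is_productD(1)[OF Q] by simp_all
  from product_precompose_iso[OF T Q' on1_hom[OF u] on1_hom[OF v] this]
  show ?thesis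
    by (rule is_product_cong) (use pu on1_cmp[OF u is_productD(3)[OF Q]] in auto)
qed

lemma slice_terminal:
  assumes "two_category T" "c \<in> cells0 T"
  shows "is_product (slice T c) 0 X (id1 T c) \<pi>"
proof -
  interpret two_category T by fact
  have h: "h = (z, id1 T c, z)" "z \<in> cells1 T" "cod1 T z = c" if "h \<in> hom1 (slice T c) z (id1 T c)" for h z
  proof -
    obtain m n f where "h = (m, n, f)" by (cases h)
    with that have f: "h = (z, id1 T c, f)" by (simp add: hom1_def)
    then have f': "f \<in> cells1 T" "cod1 T f = c" "cmp1 T (id1 T c) f = z" "z \<in> cells1 T" "cod1 T z = c"
      using that assms(2) by (simp_all add: hom1_def)
    then have "f = z" using cmp1_id(1)[OF f'(1,2)] by metis
    then show "h = (z, id1 T c, z)" "z \<in> cells1 T" "cod1 T z = c" using f f' by simp_all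
  qed
  show ?thesis
  proof (rule is_productI)
    fix z and f :: "nat \<Rightarrow> _" assume "z \<in> cells0 (slice T c)"
    then show "\<exists>h\<in>hom1 (slice T c) z (id1 T c). \<forall>i<0. cmp1 (slice T c) (\<pi> i) h = f i"
      using assms by (intro bexI[of _ "(z, id1 T c, z)"]) (auto simp: hom1_def)
  next
    fix z h k and a :: "nat \<Rightarrow> _" assume "h \<in> hom1 (slice T c) z (id1 T c)" "k \<in> hom1 (slice T c) z (id1 T c)"
    note h[OF this(1)] h[OF this(2)]
    then show "\<exists>d\<in>hom2 (slice T c) h k. \<forall>i<0. hcmp2 (slice T c) (id2 (slice T c) (\<pi> i)) d = a i"
      using assms by (intro bexI[of _ "(z, id1 T c, id2 T z)"]) (auto simp: hom2_def)
  next
    fix z h k d e assume hk: "h \<in> hom1 (slice T c) z (id1 T c)" "k \<in> hom1 (slice T c) z (id1 T c)"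
      and de: "d \<in> hom2 (slice T c) h k" "e \<in> hom2 (slice T c) h k"
    \<comment> \<open>The whiskering condition of the slice, taken over the identity of
      \<open>c\<close>, says that the underlying 2-cell is the identity of \<open>z\<close>.\<close>
    have "d = (z, id1 T c, id2 T z)" if "d \<in> hom2 (slice T c) h k" for d
    proof -
      obtain m n a where d: "d = (m, n, a)" by (cases d)
      have a: "a \<in> cells2 T" "src2 T a = z" "m = z" "n = id1 T c" "hcmp2 T (id2 T (id1 T c)) a = id2 T z"
        using that d h(1)[OF hk(1)] by (auto simp: hom2_def)
      have "hcmp2 T (id2 T (id1 T c)) a = a" by (rule hcmp2_id1) (use a h(3)[OF hk(1)] in auto)
      then show ?thesis using a d by simp
    qed
    with de show "d = e" by metis
  next
    fix z h k assume "h \<in> hom1 (slice T c) z (id1 T c)" "k \<in> hom1 (slice T c) z (id1 T c)"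
    note h(1)[OF this(1)] h(1)[OF this(2)]
    then show "h = k" by simp
  qed (use assms in auto)
qed

section \<open>\<open>Pt\<close>, \<open>Loose\<close> and binary products of double categories;
  their universal properties\<close>

lemma double_categoryI:
  fixes D :: "'u dbl" (structure)
  assumes "\<And>f. f \<in> tights D \<Longrightarrow> tdom D f \<in> obs D \<and> tcod D f \<in> obs D"
    and "\<And>x. x \<in> obs D \<Longrightarrow> tid D x \<in> tights D \<and> tdom D (tid D x) = x \<and> tcod D (tid D x) = x"
    and "\<And>f g. \<lbrakk>f \<in> tights D; g \<in> tights D; tdom D g = tcod D f\<rbrakk>
      \<Longrightarrow> g \<cdot> f \<in> tights D \<and> tdom D (g \<cdot> f) = tdom D f \<and> tcod D (g \<cdot> f) = tcod D g"
    and "\<And>f. f \<in> tights D \<Longrightarrow> tid D (tcod D f) \<cdot> f = f \<and> f \<cdot> tid D (tdom D f) = f"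
    and "\<And>f g h. \<lbrakk>f \<in> tights D; g \<in> tights D; h \<in> tights D; tdom D g = tcod D f; tdom D h = tcod D g\<rbrakk>
      \<Longrightarrow> (h \<cdot> g) \<cdot> f = h \<cdot> (g \<cdot> f)"
    and "\<And>l. l \<in> looses D \<Longrightarrow> ldom D l \<in> obs D \<and> lcod D l \<in> obs D"
    and "\<And>x. x \<in> obs D \<Longrightarrow> lid D x \<in> looses D \<and> ldom D (lid D x) = x \<and> lcod D (lid D x) = x"
    and "\<And>l m. \<lbrakk>l \<in> looses D; m \<in> looses D; lcod D l = ldom D m\<rbrakk>
      \<Longrightarrow> l \<odot> m \<in> looses D \<and> ldom D (l \<odot> m) = ldom D l \<and> lcod D (l \<odot> m) = lcod D m"
    and "\<And>s. s \<in> squares D \<Longrightarrow> stop D s \<in> looses D \<and> sbot D s \<in> looses D \<and> sleft D s \<in> tights D \<and> sright D s \<in> tights D \<and>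
      tdom D (sleft D s) = ldom D (stop D s) \<and> tcod D (sleft D s) = ldom D (sbot D s) \<and>
      tdom D (sright D s) = lcod D (stop D s) \<and> tcod D (sright D s) = lcod D (sbot D s)"
    and "\<And>l. l \<in> looses D \<Longrightarrow> vid D l \<in> squares D \<and> stop D (vid D l) = l \<and> sbot D (vid D l) = l \<and>
      sleft D (vid D l) = tid D (ldom D l) \<and> sright D (vid D l) = tid D (lcod D l)"
    and "\<And>s t. \<lbrakk>s \<in> squares D; t \<in> squares D; stop D t = sbot D s\<rbrakk>
      \<Longrightarrow> t \<bullet> s \<in> squares D \<and> stop D (t \<bullet> s) = stop D s \<and> sbot D (t \<bullet> s) = sbot D t \<and>
        sleft D (t \<bullet> s) = sleft D t \<cdot> sleft D s \<and> sright D (t \<bullet> s) = sright D t \<cdot> sright D s"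
    and "\<And>s. s \<in> squares D \<Longrightarrow> vid D (sbot D s) \<bullet> s = s \<and> s \<bullet> vid D (stop D s) = s"
    and "\<And>s t u. \<lbrakk>s \<in> squares D; t \<in> squares D; u \<in> squares D; stop D t = sbot D s; stop D u = sbot D t\<rbrakk>
      \<Longrightarrow> (u \<bullet> t) \<bullet> s = u \<bullet> (t \<bullet> s)"
    and "\<And>f. f \<in> tights D \<Longrightarrow> hid D f \<in> squares D \<and> stop D (hid D f) = lid D (tdom D f) \<and>
      sbot D (hid D f) = lid D (tcod D f) \<and> sleft D (hid D f) = f \<and> sright D (hid D f) = f"
    and "\<And>x. x \<in> obs D \<Longrightarrow> hid D (tid D x) = vid D (lid D x)"
    and "\<And>f g. \<lbrakk>f \<in> tights D; g \<in> tights D; tdom D g = tcod D f\<rbrakk> \<Longrightarrow> hid D (g \<cdot> f) = hid D g \<bullet> hid D f"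
    and "\<And>s t. \<lbrakk>s \<in> squares D; t \<in> squares D; sright D s = sleft D t\<rbrakk>
      \<Longrightarrow> s \<star> t \<in> squares D \<and> stop D (s \<star> t) = stop D s \<odot> stop D t \<and> sbot D (s \<star> t) = sbot D s \<odot> sbot D t \<and>
        sleft D (s \<star> t) = sleft D s \<and> sright D (s \<star> t) = sright D t"
    and "\<And>l m. \<lbrakk>l \<in> looses D; m \<in> looses D; lcod D l = ldom D m\<rbrakk> \<Longrightarrow> vid D l \<star> vid D m = vid D (l \<odot> m)"
    and "\<And>s s' t t'. \<lbrakk>s \<in> squares D; s' \<in> squares D; t \<in> squares D; t' \<in> squares D; stop D s' = sbot D s;
        stop D t' = sbot D t; sright D s = sleft D t; sright D s' = sleft D t'\<rbrakk>
      \<Longrightarrow> (s' \<bullet> s) \<star> (t' \<bullet> t) = (s' \<star> t') \<bullet> (s \<star> t)"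
    and "\<And>k l m. \<lbrakk>k \<in> looses D; l \<in> looses D; m \<in> looses D; lcod D k = ldom D l; lcod D l = ldom D m\<rbrakk>
      \<Longrightarrow> lassoc D k l m \<in> glob_iso D ((k \<odot> l) \<odot> m) (k \<odot> (l \<odot> m))"
    and "\<And>l. l \<in> looses D \<Longrightarrow> lunit D l \<in> glob_iso D (lid D (ldom D l) \<odot> l) l"
    and "\<And>l. l \<in> looses D \<Longrightarrow> runit D l \<in> glob_iso D (l \<odot> lid D (lcod D l)) l"
    and "\<And>r s t. \<lbrakk>r \<in> squares D; s \<in> squares D; t \<in> squares D; sright D r = sleft D s; sright D s = sleft D t\<rbrakk>
      \<Longrightarrow> lassoc D (sbot D r) (sbot D s) (sbot D t) \<bullet> ((r \<star> s) \<star> t)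
        = (r \<star> (s \<star> t)) \<bullet> lassoc D (stop D r) (stop D s) (stop D t)"
    and "\<And>s. s \<in> squares D \<Longrightarrow> lunit D (sbot D s) \<bullet> (hid D (sleft D s) \<star> s) = s \<bullet> lunit D (stop D s)"
    and "\<And>s. s \<in> squares D \<Longrightarrow> runit D (sbot D s) \<bullet> (s \<star> hid D (sright D s)) = s \<bullet> runit D (stop D s)"
    and "\<And>j k l m. \<lbrakk>j \<in> looses D; k \<in> looses D; l \<in> looses D; m \<in> looses D;
        lcod D j = ldom D k; lcod D k = ldom D l; lcod D l = ldom D m\<rbrakk>
      \<Longrightarrow> lassoc D j k (l \<odot> m) \<bullet> lassoc D (j \<odot> k) l m
        = (vid D j \<star> lassoc D k l m) \<bullet> (lassoc D j (k \<odot> l) m \<bullet> (lassoc D j k l \<star> vid D m))"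
    and "\<And>l m. \<lbrakk>l \<in> looses D; m \<in> looses D; lcod D l = ldom D m\<rbrakk>
      \<Longrightarrow> (vid D l \<star> lunit D m) \<bullet> lassoc D l (lid D (ldom D m)) m = runit D l \<star> vid D m"
  shows "double_category D"
  apply unfold_locales
  subgoal using assms(1) by (auto simp: hom_defs)
  subgoal using assms(1) by (auto simp: hom_defs)
  subgoal using assms(2) by (auto simp: hom_defs)
  subgoal using assms(3) by (auto simp: hom_defs)
  subgoal using assms(4) by (auto simp: hom_defs)
  subgoal using assms(4) by (auto simp: hom_defs)
  subgoal using assms(5) by (auto simp: hom_defs)
  subgoal using assms(6) by (auto simp: hom_defs)
  subgoal using assms(6) by (auto simp: hom_defs)
  subgoal using assms(7) by (auto simp: hom_defs)
  subgoal using assms(8) by (auto simp: hom_defs)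
  subgoal using assms(9) by (auto simp: hom_defs)
  subgoal using assms(9) by (auto simp: hom_defs)
  subgoal using assms(9) by (auto simp: hom_defs)
  subgoal using assms(9) by (auto simp: hom_defs)
  subgoal using assms(10) by (auto simp: hom_defs)
  subgoal using assms(11) by (auto simp: hom_defs)
  subgoal using assms(12) by (auto simp: hom_defs)
  subgoal using assms(12) by (auto simp: hom_defs)
  subgoal using assms(13) by (auto simp: hom_defs)
  subgoal using assms(14) by (auto simp: hom_defs)
  subgoal using assms(15) by (auto simp: hom_defs)
  subgoal using assms(16) by (auto simp: hom_defs)
  subgoal using assms(17) by (auto simp: hom_defs)
  subgoal using assms(18) by (auto simp: hom_defs)
  subgoal using assms(19) by (auto simp: hom_defs)
  subgoal using assms(20) by (auto simp: hom_defs)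
  subgoal using assms(21) by (auto simp: hom_defs)
  subgoal using assms(22) by (auto simp: hom_defs)
  subgoal using assms(23) by (auto simp: hom_defs)
  subgoal using assms(24) by (auto simp: hom_defs)
  subgoal using assms(25) by (auto simp: hom_defs)
  subgoal using assms(26) by (auto simp: hom_defs)
  subgoal for l x y m z using assms(27)[of l m] by (auto simp: hom_defs)
  done

lemma el_eq_iff [simp]: "el i = (el j :: 'u::infinite) \<longleftrightarrow> i = j"
  using inj_el by (auto dest: injD)

lemma double_category_Pt: "double_category (Pt :: 'u::infinite dbl)"
  by (rule double_categoryI)
    (auto simp: Pt_def Let_def glob_iso_def sq_hom_def sq_iso_def is_sq_inverse_def)

lemma Loose_sel:
  "obs Loose = {el 0, el 1 :: 'u::infinite}" "tights Loose = {el 0, el 1 :: 'u}"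
  "looses Loose = {el 0, el 1, el 2 :: 'u}" "squares Loose = {el 0, el 1, el 2 :: 'u}"
  "tdom Loose f = (f :: 'u)" "tcod Loose f = (f :: 'u)" "tid Loose f = (f :: 'u)" "tcmp Loose f g = (f :: 'u)"
  "ldom Loose l = (if l = el 1 then el 1 else el 0 :: 'u)" "lcod Loose l = (if l = el 0 then el 0 else el 1 :: 'u)"
  "lid Loose f = (f :: 'u)" "lcmp Loose l m = (if l = el 2 then el 2 else m :: 'u)"
  "stop Loose l = (l :: 'u)" "sbot Loose l = (l :: 'u)"
  "sleft Loose l = (if l = el 1 then el 1 else el 0 :: 'u)" "sright Loose l = (if l = el 0 then el 0 else el 1 :: 'u)"
  "vid Loose l = (l :: 'u)" "vcmp Loose l m = (l :: 'u)" "hid Loose f = (f :: 'u)"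
  "hcmp Loose l m = (if l = el 2 then el 2 else m :: 'u)"
  "lassoc Loose k l m = (if k = el 2 \<or> l = el 2 then el 2 else m :: 'u)" "lunit Loose l = (l :: 'u)"
  "runit Loose l = (l :: 'u)"
  by (simp_all add: Loose_def Let_def)

lemma sq_iso_Loose: "s \<in> squares Loose \<Longrightarrow> sq_iso Loose s"
  by (auto simp: Loose_sel sq_iso_def is_sq_inverse_def)

lemma double_category_Loose: "double_category (Loose :: 'u::infinite dbl)"
proof (rule double_categoryI, goal_cases)
  case (23 r s t)
  then show ?case by (simp add: Loose_sel split: if_splits)
next
  case (26 j k l m)
  then show ?case by (simp add: Loose_sel split: if_splits)
qed (auto simp: glob_iso_def sq_hom_def sq_iso_Loose Loose_sel split: if_splits)

lemma pair_eq [simp]: "pair a b = pair c d \<longleftrightarrow> a = c \<and> b = (d :: 'u::infinite)"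
  by (rule pair_eq_iff)

lemma pair_in_pair_set [simp]: "pair a b \<in> pair_set A B \<longleftrightarrow> a \<in> A \<and> b \<in> B"
  by (auto simp: pair_set_def)

lemma pair_setE [elim!]:
  assumes "u \<in> pair_set A B"
  obtains a b where "u = pair a b" "a \<in> A" "b \<in> B"
  using assms by (auto simp: pair_set_def)

lemma pair_set_pair [simp]: "u \<in> pair_set A B \<Longrightarrow> pair (pfst u) (psnd u) = u"
  by auto

lemma pair_set_proj [simp]: "u \<in> pair_set A B \<Longrightarrow> pfst u \<in> A" "u \<in> pair_set A B \<Longrightarrow> psnd u \<in> B"
  by auto

lemma prod_dbl_sel [simp]:
  "obs (prod_dbl D E) = pair_set (obs D) (obs E)" "tights (prod_dbl D E) = pair_set (tights D) (tights E)"
  "looses (prod_dbl D E) = pair_set (looses D) (looses E)" "squares (prod_dbl D E) = pair_set (squares D) (squares E)"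
  "tdom (prod_dbl D E) u = pair (tdom D (pfst u)) (tdom E (psnd u))"
  "tcod (prod_dbl D E) u = pair (tcod D (pfst u)) (tcod E (psnd u))"
  "tid (prod_dbl D E) u = pair (tid D (pfst u)) (tid E (psnd u))"
  "tcmp (prod_dbl D E) u v = pair (tcmp D (pfst u) (pfst v)) (tcmp E (psnd u) (psnd v))"
  "ldom (prod_dbl D E) u = pair (ldom D (pfst u)) (ldom E (psnd u))"
  "lcod (prod_dbl D E) u = pair (lcod D (pfst u)) (lcod E (psnd u))"
  "lid (prod_dbl D E) u = pair (lid D (pfst u)) (lid E (psnd u))"
  "lcmp (prod_dbl D E) u v = pair (lcmp D (pfst u) (pfst v)) (lcmp E (psnd u) (psnd v))"
  "stop (prod_dbl D E) u = pair (stop D (pfst u)) (stop E (psnd u))"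
  "sbot (prod_dbl D E) u = pair (sbot D (pfst u)) (sbot E (psnd u))"
  "sleft (prod_dbl D E) u = pair (sleft D (pfst u)) (sleft E (psnd u))"
  "sright (prod_dbl D E) u = pair (sright D (pfst u)) (sright E (psnd u))"
  "vid (prod_dbl D E) u = pair (vid D (pfst u)) (vid E (psnd u))"
  "vcmp (prod_dbl D E) u v = pair (vcmp D (pfst u) (pfst v)) (vcmp E (psnd u) (psnd v))"
  "hid (prod_dbl D E) u = pair (hid D (pfst u)) (hid E (psnd u))"
  "hcmp (prod_dbl D E) u v = pair (hcmp D (pfst u) (pfst v)) (hcmp E (psnd u) (psnd v))"
  "lassoc (prod_dbl D E) u v w
    = pair (lassoc D (pfst u) (pfst v) (pfst w)) (lassoc E (psnd u) (psnd v) (psnd w))"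
  "lunit (prod_dbl D E) u = pair (lunit D (pfst u)) (lunit E (psnd u))"
  "runit (prod_dbl D E) u = pair (runit D (pfst u)) (runit E (psnd u))"
  by (simp_all add: prod_dbl_def map1_def map2_def map3_def)

lemma sq_iso_prod:
  assumes "sq_iso D s" "sq_iso E t"
  shows "sq_iso (prod_dbl D E) (pair s t)"
proof -
  obtain s' t' where "is_sq_inverse D s s'" "is_sq_inverse E t t'" using assms by (auto simp: sq_iso_def)
  then have "is_sq_inverse (prod_dbl D E) (pair s t) (pair s' t')" by (simp add: is_sq_inverse_def)
  then show ?thesis by (auto simp: sq_iso_def)
qed

lemma double_category_prod:
  assumes "double_category D" "double_category E"
  shows "double_category (prod_dbl D E)"
proof -
  interpret D: double_category D by fact
  interpret E: double_category E by fact
  have glob: "pair s t \<in> glob_iso (prod_dbl D E) (pair x x') (pair y y')"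
    if "s \<in> glob_iso D x y" "t \<in> glob_iso E x' y'" for s t x y x' y'
    using that by (auto simp: glob_iso_def sq_hom_def sq_iso_prod)
  show ?thesis
  proof (rule double_categoryI, goal_cases)
    case (20 k l m)
    then show ?case by (auto intro!: glob simp: D.glob_iso_iff E.glob_iso_iff)
  next
    case (21 l)
    then show ?case by (auto intro!: glob simp: D.glob_iso_iff E.glob_iso_iff)
  next
    case (22 l)
    then show ?case by (auto intro!: glob simp: D.glob_iso_iff E.glob_iso_iff)
  next
    case (19 s s' t t')
    then show ?case using D.interchange E.interchange by fastforce
  next
    case (23 r s t)
    then show ?case using D.lassoc_nat E.lassoc_nat by fastforce
  next
    case (24 s)
    then show ?case using D.lunit_nat E.lunit_nat by auto
  next
    case (25 s)
    then show ?case using D.runit_nat E.runit_nat by auto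
  next
    case (26 j k l m)
    then show ?case using D.pentagon' E.pentagon' by fastforce
  next
    case (27 l m)
    then show ?case using D.triangle' E.triangle' by fastforce
  qed (auto simp: D.vcmp_assoc' E.vcmp_assoc' D.hid_id E.hid_id D.hid_tcmp E.hid_tcmp D.hcmp_vid E.hcmp_vid)
qed

definition fst_dfun :: "'u::infinite dbl \<Rightarrow> 'u dbl \<Rightarrow> 'u dfun" where
  "fst_dfun D E = strict_dfun (prod_dbl D E) D pfst pfst pfst pfst"

definition snd_dfun :: "'u::infinite dbl \<Rightarrow> 'u dbl \<Rightarrow> 'u dfun" where
  "snd_dfun D E = strict_dfun (prod_dbl D E) E psnd psnd psnd psnd"

lemma double_functor_fst:
  assumes "double_category D" "double_category E"
  shows "double_functor (prod_dbl D E) D (fst_dfun D E)"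
  unfolding fst_dfun_def
  by (rule double_functor_strict[OF double_category_prod[OF assms] assms(1)]) auto

lemma double_functor_snd:
  assumes "double_category D" "double_category E"
  shows "double_functor (prod_dbl D E) E (snd_dfun D E)"
  unfolding snd_dfun_def
  by (rule double_functor_strict[OF double_category_prod[OF assms] assms(2)]) auto

definition pair_dfun :: "'u::infinite dfun \<Rightarrow> 'u dfun \<Rightarrow> 'u dfun" where
  "pair_dfun F G = (let A = ddom F in
     \<lparr>ddom = A, dcod = prod_dbl (dcod F) (dcod G),
      fob = (\<lambda>x\<in>obs A. pair (fob F x) (fob G x)), ftight = (\<lambda>f\<in>tights A. pair (ftight F f) (ftight G f)),
      floose = (\<lambda>l\<in>looses A. pair (floose F l) (floose G l)), fsq = (\<lambda>s\<in>squares A. pair (fsq F s) (fsq G s)),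
      fcomp = restrict_comp A (\<lambda>l m. pair (fcomp F l m) (fcomp G l m)),
      funit = (\<lambda>x\<in>obs A. pair (funit F x) (funit G x))\<rparr>)"

lemma pair_dfun_apply:
  assumes "double_functor A B F"
  shows "x \<in> obs A \<Longrightarrow> fob (pair_dfun F G) x = pair (fob F x) (fob G x)"
    "f \<in> tights A \<Longrightarrow> ftight (pair_dfun F G) f = pair (ftight F f) (ftight G f)"
    "l \<in> looses A \<Longrightarrow> floose (pair_dfun F G) l = pair (floose F l) (floose G l)"
    "s \<in> squares A \<Longrightarrow> fsq (pair_dfun F G) s = pair (fsq F s) (fsq G s)"
    "\<lbrakk>l \<in> looses A; m \<in> looses A; lcod A l = ldom A m\<rbrakk> \<Longrightarrow> fcomp (pair_dfun F G) l m = pair (fcomp F l m) (fcomp G l m)"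
    "x \<in> obs A \<Longrightarrow> funit (pair_dfun F G) x = pair (funit F x) (funit G x)"
  using dfun_cats(3)[OF assms] by (simp_all add: pair_dfun_def Let_def restrict_comp_def composable_def)

lemma giso_prod_iff:
  assumes "double_category D" "double_category E"
  shows "double_category.giso (prod_dbl D E) (pair s t) \<longleftrightarrow> double_category.giso D s \<and> double_category.giso E t"
proof -
  interpret D: double_category D by fact
  interpret E: double_category E by fact
  interpret P: double_category "prod_dbl D E" by (rule double_category_prod[OF assms])
  have "sq_iso (prod_dbl D E) (pair s t) \<Longrightarrow> sq_iso D s \<and> sq_iso E t"
    by (auto simp: sq_iso_def is_sq_inverse_def)
  then show ?thesis
    by (auto simp: P.giso_def D.giso_def E.giso_def P.glob_def D.glob_def E.glob_def sq_iso_prod)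
qed

lemma double_functor_pair:
  assumes "double_functor A B F" "double_functor A C G"
  shows "double_functor A (prod_dbl B C) (pair_dfun F G)"
proof -
  interpret F: double_functor A B F by fact
  interpret G: double_functor A C G by fact
  note P = double_category_prod[OF F.B.double_category_axioms G.B.double_category_axioms]
  note [simp] = pair_dfun_apply[OF assms(1)] giso_prod_iff[OF F.B.double_category_axioms G.B.double_category_axioms]
  show ?thesis
  proof (rule dfunI, goal_cases)
    case (21 s t)
    then show ?case using F.fcomp_nat[of s t] G.fcomp_nat[of s t] by auto
  next
    case (22 f)
    then show ?case using F.funit_nat[of f] G.funit_nat[of f] by auto
  next
    case (23 k l m)
    then show ?case using F.fcomp_assoc'[of k l m] G.fcomp_assoc'[of k l m] by auto
  next
    case (24 l)
    then show ?case using F.funit_left'[of l] G.funit_left'[of l] by auto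
  next
    case (25 l)
    then show ?case using F.funit_right'[of l] G.funit_right'[of l] by auto
  qed (simp_all add: F.A.double_category_axioms P,
      simp_all add: pair_dfun_def Let_def F.ddom F.dcod G.dcod)
qed

text \<open>The comparison squares of the strict functor are vertical identities and drop out of the
  composite, whose comparison squares are therefore the plain images of those of \<open>F\<close>.
  Projections and inclusions are used in this form.\<close>

lemma strict_dfun_cmp_apply:
  assumes "double_functor A B F" "double_functor B C (strict_dfun B C fo ft fl fs)"
  defines "G \<equiv> strict_dfun B C fo ft fl fs"
  shows "x \<in> obs A \<Longrightarrow> fob (G oo F) x = fo (fob F x)"
    "f \<in> tights A \<Longrightarrow> ftight (G oo F) f = ft (ftight F f)"
    "l \<in> looses A \<Longrightarrow> floose (G oo F) l = fl (floose F l)"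
    "s \<in> squares A \<Longrightarrow> fsq (G oo F) s = fs (fsq F s)"
    "\<lbrakk>l \<in> looses A; m \<in> looses A; lcod A l = ldom A m\<rbrakk> \<Longrightarrow> fcomp (G oo F) l m = fs (fcomp F l m)"
    "x \<in> obs A \<Longrightarrow> funit (G oo F) x = fs (funit F x)"
proof -
  interpret F: double_functor A B F by fact
  interpret G: double_functor B C G unfolding G_def by fact
  note [simp] = dfun_cmp_apply[OF assms(1)]
  have e: "fsq G s = fs s" "stop C (fs s) = fl (stop B s)" "fs s \<in> squares C" if "s \<in> squares B" for s
    using that G.fsq_simps[OF that] by (simp_all add: G_def)
  show "x \<in> obs A \<Longrightarrow> fob (G oo F) x = fo (fob F x)"
    "f \<in> tights A \<Longrightarrow> ftight (G oo F) f = ft (ftight F f)"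
    "l \<in> looses A \<Longrightarrow> floose (G oo F) l = fl (floose F l)"
    "s \<in> squares A \<Longrightarrow> fsq (G oo F) s = fs (fsq F s)"
    "\<lbrakk>l \<in> looses A; m \<in> looses A; lcod A l = ldom A m\<rbrakk> \<Longrightarrow> fcomp (G oo F) l m = fs (fcomp F l m)"
    "x \<in> obs A \<Longrightarrow> funit (G oo F) x = fs (funit F x)"
    by (simp_all add: e G.dcod) (simp_all add: G_def e G.B.vcmp_vid)
qed

lemma ttrans_whisker_left:
  assumes "tight_transformation A B F F' t" "double_functor B C G"
  shows "x \<in> obs A \<Longrightarrow> tob (G *> t) x = ftight G (tob t x)"
    "l \<in> looses A \<Longrightarrow> tloose (G *> t) l = fsq G (tloose t l)"
proof -
  interpret t: tight_transformation A B F F' t by fact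
  interpret G: double_functor B C G by fact
  note ttrans_hcmp_simps[OF assms(1) ttrans_id_in[OF assms(2)]]
  then show "x \<in> obs A \<Longrightarrow> tob (G *> t) x = ftight G (tob t x)"
    "l \<in> looses A \<Longrightarrow> tloose (G *> t) l = fsq G (tloose t l)"
    by (simp_all add: ttrans_id_simps[OF assms(2)])
qed

lemma ttrans_whisker_right:
  assumes "double_functor A B F" "tight_transformation B C G G' t"
  shows "x \<in> obs A \<Longrightarrow> tob (t <* F) x = tob t (fob F x)"
    "l \<in> looses A \<Longrightarrow> tloose (t <* F) l = tloose t (floose F l)"
proof -
  interpret t: tight_transformation B C G G' t by fact
  interpret F: double_functor A B F by fact
  note ttrans_hcmp_simps[OF ttrans_id_in[OF assms(1)] assms(2)]
  then show "x \<in> obs A \<Longrightarrow> tob (t <* F) x = tob t (fob F x)"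
    "l \<in> looses A \<Longrightarrow> tloose (t <* F) l = tloose t (floose F l)"
    by (simp_all add: ttrans_id_simps[OF assms(1)])
qed

lemma fst_cmp_apply:
  assumes "double_functor A (prod_dbl D E) F" "double_category D" "double_category E"
  shows "x \<in> obs A \<Longrightarrow> fob (fst_dfun D E oo F) x = pfst (fob F x)"
    "f \<in> tights A \<Longrightarrow> ftight (fst_dfun D E oo F) f = pfst (ftight F f)"
    "l \<in> looses A \<Longrightarrow> floose (fst_dfun D E oo F) l = pfst (floose F l)"
    "s \<in> squares A \<Longrightarrow> fsq (fst_dfun D E oo F) s = pfst (fsq F s)"
    "\<lbrakk>l \<in> looses A; m \<in> looses A; lcod A l = ldom A m\<rbrakk>
      \<Longrightarrow> fcomp (fst_dfun D E oo F) l m = pfst (fcomp F l m)"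
    "x \<in> obs A \<Longrightarrow> funit (fst_dfun D E oo F) x = pfst (funit F x)"
  using strict_dfun_cmp_apply[OF assms(1) double_functor_fst[OF assms(2,3), unfolded fst_dfun_def]]
  unfolding fst_dfun_def by blast+

lemma snd_cmp_apply:
  assumes "double_functor A (prod_dbl D E) F" "double_category D" "double_category E"
  shows "x \<in> obs A \<Longrightarrow> fob (snd_dfun D E oo F) x = psnd (fob F x)"
    "f \<in> tights A \<Longrightarrow> ftight (snd_dfun D E oo F) f = psnd (ftight F f)"
    "l \<in> looses A \<Longrightarrow> floose (snd_dfun D E oo F) l = psnd (floose F l)"
    "s \<in> squares A \<Longrightarrow> fsq (snd_dfun D E oo F) s = psnd (fsq F s)"
    "\<lbrakk>l \<in> looses A; m \<in> looses A; lcod A l = ldom A m\<rbrakk>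
      \<Longrightarrow> fcomp (snd_dfun D E oo F) l m = psnd (fcomp F l m)"
    "x \<in> obs A \<Longrightarrow> funit (snd_dfun D E oo F) x = psnd (funit F x)"
  using strict_dfun_cmp_apply[OF assms(1) double_functor_snd[OF assms(2,3), unfolded snd_dfun_def]]
  unfolding snd_dfun_def by blast+

lemma fst_dfun_apply [simp]:
  "ddom (fst_dfun D E) = prod_dbl D E" "dcod (fst_dfun D E) = D"
  "u \<in> pair_set (obs D) (obs E) \<Longrightarrow> fob (fst_dfun D E) u = pfst u"
  "u \<in> pair_set (tights D) (tights E) \<Longrightarrow> ftight (fst_dfun D E) u = pfst u"
  "u \<in> pair_set (looses D) (looses E) \<Longrightarrow> floose (fst_dfun D E) u = pfst u"
  "u \<in> pair_set (squares D) (squares E) \<Longrightarrow> fsq (fst_dfun D E) u = pfst u"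
  by (simp_all add: fst_dfun_def)

lemma snd_dfun_apply [simp]:
  "ddom (snd_dfun D E) = prod_dbl D E" "dcod (snd_dfun D E) = E"
  "u \<in> pair_set (obs D) (obs E) \<Longrightarrow> fob (snd_dfun D E) u = psnd u"
  "u \<in> pair_set (tights D) (tights E) \<Longrightarrow> ftight (snd_dfun D E) u = psnd u"
  "u \<in> pair_set (looses D) (looses E) \<Longrightarrow> floose (snd_dfun D E) u = psnd u"
  "u \<in> pair_set (squares D) (squares E) \<Longrightarrow> fsq (snd_dfun D E) u = psnd u"
  by (simp_all add: snd_dfun_def)

lemma pair_eqI: "\<lbrakk>u \<in> pair_set A B; v \<in> pair_set A' B'; pfst u = pfst v; psnd u = psnd v\<rbrakk> \<Longrightarrow> u = v"
  by auto

lemma dfun_prod_eqI: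
  assumes "double_category D" "double_category E" "double_functor A (prod_dbl D E) F" "double_functor A (prod_dbl D E) G"
    and "fst_dfun D E oo F = fst_dfun D E oo G" "snd_dfun D E oo F = snd_dfun D E oo G"
  shows "F = G"
proof -
  interpret F: double_functor A "prod_dbl D E" F by fact
  interpret G: double_functor A "prod_dbl D E" G by fact
  note f = fst_cmp_apply[OF assms(3,1,2), unfolded assms(5)] and f' = fst_cmp_apply[OF assms(4,1,2)]
  note s = snd_cmp_apply[OF assms(3,1,2), unfolded assms(6)] and s' = snd_cmp_apply[OF assms(4,1,2)]
  show ?thesis
  proof (rule dfun_eqI[OF assms(3,4)])
    show "fob F x = fob G x" if "x \<in> obs A" for x
      by (rule pair_eqI[OF F.fob_in[OF that, simplified] G.fob_in[OF that, simplified]]) (use f f' s s' that in metis)+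
    show "ftight F x = ftight G x" if "x \<in> tights A" for x
      by (rule pair_eqI[OF F.ftight_simps(1)[OF that, simplified] G.ftight_simps(1)[OF that, simplified]])
        (use f f' s s' that in metis)+
    show "floose F x = floose G x" if "x \<in> looses A" for x
      by (rule pair_eqI[OF F.floose_simps(1)[OF that, simplified] G.floose_simps(1)[OF that, simplified]])
        (use f f' s s' that in metis)+
    show "fsq F x = fsq G x" if "x \<in> squares A" for x
      by (rule pair_eqI[OF F.fsq_simps(1)[OF that, simplified] G.fsq_simps(1)[OF that, simplified]])
        (use f f' s s' that in metis)+
    show "fcomp F x y = fcomp G x y" if "x \<in> looses A" "y \<in> looses A" "lcod A x = ldom A y" for x y
      by (rule pair_eqI[OF F.fcomp_simps(4)[OF that, simplified] G.fcomp_simps(4)[OF that, simplified]])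
        (use f(5) f'(5) s(5) s'(5) that in metis)+
    show "funit F x = funit G x" if "x \<in> obs A" for x
      by (rule pair_eqI[OF F.funit_simps(4)[OF that, simplified] G.funit_simps(4)[OF that, simplified]])
        (use f f' s s' that in metis)+
  qed
qed

lemma fst_pair_dfun:
  assumes "double_functor A D F" "double_functor A E G"
  shows "fst_dfun D E oo pair_dfun F G = F"
proof -
  note cats = dfun_cats[OF assms(1)] dfun_cats[OF assms(2)]
  note P = double_functor_pair[OF assms]
  show ?thesis
    by (rule dfun_eqI[OF dfun_cmp_in[OF P double_functor_fst] assms(1)])
      (simp_all add: cats fst_cmp_apply[OF P cats(2,6)] pair_dfun_apply[OF assms(1)])
qed

lemma snd_pair_dfun:
  assumes "double_functor A D F" "double_functor A E G"
  shows "snd_dfun D E oo pair_dfun F G = G"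
proof -
  note cats = dfun_cats[OF assms(1)] dfun_cats[OF assms(2)]
  note P = double_functor_pair[OF assms]
  show ?thesis
    by (rule dfun_eqI[OF dfun_cmp_in[OF P double_functor_snd] assms(2)])
      (simp_all add: cats snd_cmp_apply[OF P cats(2,6)] pair_dfun_apply[OF assms(1)])
qed

text \<open>Source and target are passed as arguments because \<open>s\<close> and \<open>t\<close>
  record only the composites of \<open>F\<close> and \<open>G\<close> with the projections.\<close>

definition pair_ttrans :: "'u::infinite dfun \<Rightarrow> 'u dfun \<Rightarrow> 'u ttrans \<Rightarrow> 'u ttrans \<Rightarrow> 'u ttrans" where
  "pair_ttrans F G s t = \<lparr>tsrc = F, ttgt = G, tob = (\<lambda>x\<in>obs (ddom F). pair (tob s x) (tob t x)),
     tloose = (\<lambda>l\<in>looses (ddom F). pair (tloose s l) (tloose t l))\<rparr>"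

lemma ttrans_pair_in:
  assumes cats: "double_category D" "double_category E"
    and F: "double_functor A (prod_dbl D E) F" and G: "double_functor A (prod_dbl D E) G"
    and s: "tight_transformation A D (fst_dfun D E oo F) (fst_dfun D E oo G) s"
    and t: "tight_transformation A E (snd_dfun D E oo F) (snd_dfun D E oo G) t"
  shows "tight_transformation A (prod_dbl D E) F G (pair_ttrans F G s t)"
    "fst_dfun D E *> pair_ttrans F G s t = s"
    "snd_dfun D E *> pair_ttrans F G s t = t"
proof -
  interpret F: double_functor A "prod_dbl D E" F by fact
  interpret G: double_functor A "prod_dbl D E" G by fact
  interpret s: tight_transformation A D "fst_dfun D E oo F" "fst_dfun D E oo G" s by fact
  interpret t: tight_transformation A E "snd_dfun D E oo F" "snd_dfun D E oo G" t by fact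
  note [simp] = fst_cmp_apply[OF F cats] fst_cmp_apply[OF G cats] snd_cmp_apply[OF F cats] snd_cmp_apply[OF G cats]
  note [simp del] = prod_dbl_sel(1-4)
  note [simp] = F.fob_in[unfolded prod_dbl_sel, THEN pair_set_pair] G.fob_in[unfolded prod_dbl_sel, THEN pair_set_pair]
    F.floose_simps(1)[unfolded prod_dbl_sel, THEN pair_set_pair] G.floose_simps(1)[unfolded prod_dbl_sel, THEN pair_set_pair]
  have app: "x \<in> obs A \<Longrightarrow> tob (pair_ttrans F G s t) x = pair (tob s x) (tob t x)"
    "l \<in> looses A \<Longrightarrow> tloose (pair_ttrans F G s t) l = pair (tloose s l) (tloose t l)" for x l
    by (simp_all add: pair_ttrans_def F.ddom)
  show p: "tight_transformation A (prod_dbl D E) F G (pair_ttrans F G s t)"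
  proof (rule ttransI, goal_cases)
    case (9 f)
    then show ?case using s.tob_nat[of f] t.tob_nat[of f] by (simp add: app)
  next
    case (10 x)
    then show ?case using s.tloose_nat[of x] t.tloose_nat[of x] by (simp add: app)
  next
    case (11 l m)
    then show ?case using s.tloose_lcmp[of l m] t.tloose_lcmp[of l m] by (simp add: app)
  next
    case (12 x)
    then show ?case using s.tloose_id[of x] t.tloose_id[of x] by (simp add: app)
  qed (simp_all add: F G app prod_dbl_sel(1-4), simp_all add: pair_ttrans_def F.ddom)
  note fw = ttrans_whisker_left[OF p double_functor_fst[OF cats]]
  note sw = ttrans_whisker_left[OF p double_functor_snd[OF cats]]
  show "fst_dfun D E *> pair_ttrans F G s t = s"
    by (rule ttrans_eqI[OF ttrans_hcmp_in[OF p ttrans_id_in[OF double_functor_fst[OF cats]]] s])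
      (simp_all add: fw app prod_dbl_sel)
  show "snd_dfun D E *> pair_ttrans F G s t = t"
    by (rule ttrans_eqI[OF ttrans_hcmp_in[OF p ttrans_id_in[OF double_functor_snd[OF cats]]] t])
      (simp_all add: sw app prod_dbl_sel)
qed

lemma ttrans_prod_eqI:
  assumes cats: "double_category D" "double_category E"
    and s: "tight_transformation A (prod_dbl D E) F G s" and t: "tight_transformation A (prod_dbl D E) F G t"
    and e: "fst_dfun D E *> s = fst_dfun D E *> t"
      "snd_dfun D E *> s = snd_dfun D E *> t"
  shows "s = t"
proof -
  interpret s: tight_transformation A "prod_dbl D E" F G s by fact
  interpret t: tight_transformation A "prod_dbl D E" F G t by fact
  note fw = ttrans_whisker_left[OF s double_functor_fst[OF cats], unfolded e]
    ttrans_whisker_left[OF t double_functor_fst[OF cats]]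
  note sw = ttrans_whisker_left[OF s double_functor_snd[OF cats], unfolded e]
    ttrans_whisker_left[OF t double_functor_snd[OF cats]]
  show ?thesis
  proof (rule ttrans_eqI[OF s t])
    fix x assume x: "x \<in> obs A"
    note i = s.tob_simps(1)[OF x] t.tob_simps(1)[OF x]
    show "tob s x = tob t x"
    proof (rule pair_eqI[OF i[unfolded prod_dbl_sel]])
      show "pfst (tob s x) = pfst (tob t x)" using fw(1)[OF x] fw(3)[OF x] i by simp
      show "psnd (tob s x) = psnd (tob t x)" using sw(1)[OF x] sw(3)[OF x] i by simp
    qed
  next
    fix x assume x: "x \<in> looses A"
    note i = s.tloose_simps(1)[OF x] t.tloose_simps(1)[OF x]
    show "tloose s x = tloose t x"
    proof (rule pair_eqI[OF i[unfolded prod_dbl_sel]])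
      show "pfst (tloose s x) = pfst (tloose t x)" using fw(2)[OF x] fw(4)[OF x] i by simp
      show "psnd (tloose s x) = psnd (tloose t x)" using sw(2)[OF x] sw(4)[OF x] i by simp
    qed
  qed
qed

lemma prod_dbl_is_product:
  assumes cats: "double_category D" "double_category E"
  shows "is_product Dbl 2 (\<lambda>i. if i = 0 then D else E) (prod_dbl D E)
    (\<lambda>i. if i = 0 then fst_dfun D E else snd_dfun D E)"
proof (rule is_productI)
  show "prod_dbl D E \<in> cells0 Dbl" by (simp add: double_category_prod cats)
next
  fix z f assume f: "\<And>i. i < (2::nat) \<Longrightarrow> f i \<in> hom1 Dbl z (if i = 0 then D else E)"
  have F: "double_functor z D (f 0)" and G: "double_functor z E (f 1)" using f[of 0] f[of 1] by (auto simp: hom1_Dbl)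
  show "\<exists>h\<in>hom1 Dbl z (prod_dbl D E). \<forall>i<2. cmp1 Dbl (if i = 0 then fst_dfun D E else snd_dfun D E) h = f i"
    using double_functor_pair[OF F G] fst_pair_dfun[OF F G] snd_pair_dfun[OF F G]
    by (intro bexI[of _ "pair_dfun (f 0) (f 1)"]) (auto simp: hom1_Dbl less_2_cases_iff)
next
  fix z h k assume hk: "h \<in> hom1 Dbl z (prod_dbl D E)" "k \<in> hom1 Dbl z (prod_dbl D E)"
    and e: "\<And>i. i < (2::nat) \<Longrightarrow> cmp1 Dbl (if i = 0 then fst_dfun D E else snd_dfun D E) h
      = cmp1 Dbl (if i = 0 then fst_dfun D E else snd_dfun D E) k"
  show "h = k" by (rule dfun_prod_eqI[OF cats, of z]) (use e[of 0] e[of 1] hk in \<open>auto simp: hom1_Dbl\<close>)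
next
  fix z h k a assume hk: "h \<in> hom1 Dbl z (prod_dbl D E)" "k \<in> hom1 Dbl z (prod_dbl D E)"
    and a: "\<And>i. i < (2::nat) \<Longrightarrow> a i \<in> hom2 Dbl (cmp1 Dbl (if i = 0 then fst_dfun D E else snd_dfun D E) h)
      (cmp1 Dbl (if i = 0 then fst_dfun D E else snd_dfun D E) k)"
  have h: "double_functor z (prod_dbl D E) h" and k: "double_functor z (prod_dbl D E) k" using hk by (auto simp: hom1_Dbl)
  have s: "tight_transformation z D (fst_dfun D E oo h) (fst_dfun D E oo k) (a 0)"
    and t: "tight_transformation z E (snd_dfun D E oo h) (snd_dfun D E oo k) (a 1)"
    using a[of 0] a[of 1] dfun_cats(3)[OF h] by (auto simp: hom2_Dbl)
  show "\<exists>c\<in>hom2 Dbl h k. \<forall>i<2. hcmp2 Dbl (id2 Dbl (if i = 0 then fst_dfun D E else snd_dfun D E)) c = a i"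
    using ttrans_pair_in[OF cats h k s t] dfun_cats[OF h]
    by (intro bexI[of _ "pair_ttrans h k (a 0) (a 1)"]) (auto simp: hom2_Dbl less_2_cases_iff)
next
  fix z h k c d assume hk: "h \<in> hom1 Dbl z (prod_dbl D E)" and cd: "c \<in> hom2 Dbl h k" "d \<in> hom2 Dbl h k"
    and e: "\<And>i. i < (2::nat) \<Longrightarrow> hcmp2 Dbl (id2 Dbl (if i = 0 then fst_dfun D E else snd_dfun D E)) c
      = hcmp2 Dbl (id2 Dbl (if i = 0 then fst_dfun D E else snd_dfun D E)) d"
  have h: "double_functor z (prod_dbl D E) h" using hk by (auto simp: hom1_Dbl)
  have *: "tight_transformation z (prod_dbl D E) h k c" "tight_transformation z (prod_dbl D E) h k d"
    using cd dfun_cats[OF h] by (auto simp: hom2_Dbl)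
  show "c = d" using ttrans_prod_eqI[OF cats *] e[of 0] e[of 1] by simp
qed (use cats double_functor_fst double_functor_snd in \<open>auto simp: hom1_Dbl less_2_cases_iff\<close>)

lemma Pt_sel [simp]:
  "obs Pt = {el 0 :: 'u::infinite}" "tights Pt = {el 0 :: 'u}" "looses Pt = {el 0 :: 'u}" "squares Pt = {el 0 :: 'u}"
  "tdom Pt x = (el 0 :: 'u)" "tcod Pt x = (el 0 :: 'u)" "tid Pt x = (el 0 :: 'u)" "tcmp Pt x y = (el 0 :: 'u)"
  "ldom Pt x = (el 0 :: 'u)" "lcod Pt x = (el 0 :: 'u)" "lid Pt x = (el 0 :: 'u)" "lcmp Pt x y = (el 0 :: 'u)"
  "stop Pt x = (el 0 :: 'u)" "sbot Pt x = (el 0 :: 'u)" "sleft Pt x = (el 0 :: 'u)" "sright Pt x = (el 0 :: 'u)"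
  "vid Pt x = (el 0 :: 'u)" "vcmp Pt x y = (el 0 :: 'u)" "hid Pt x = (el 0 :: 'u)" "hcmp Pt x y = (el 0 :: 'u)"
  "lassoc Pt x y z = (el 0 :: 'u)" "lunit Pt x = (el 0 :: 'u)" "runit Pt x = (el 0 :: 'u)"
  by (simp_all add: Pt_def Let_def)

lemma dfun_Pt_eq:
  assumes F: "double_functor A Pt F" and G: "double_functor A Pt G"
  shows "F = G"
proof -
  interpret F: double_functor A Pt F by fact
  interpret G: double_functor A Pt G by fact
  show ?thesis
    by (rule dfun_eqI[OF F G])
      (use F.fob_in F.ftight_simps F.floose_simps F.fsq_simps F.fcomp_simps F.funit_simps
        G.fob_in G.ftight_simps G.floose_simps G.fsq_simps G.fcomp_simps G.funit_simps in \<open>simp_all only: Pt_sel singleton_iff\<close>)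
qed

lemma ttrans_Pt_eq:
  assumes s: "tight_transformation A Pt F G s" and t: "tight_transformation A Pt F G t"
  shows "s = t"
proof -
  interpret s: tight_transformation A Pt F G s by fact
  interpret t: tight_transformation A Pt F G t by fact
  show ?thesis
    by (rule ttrans_eqI[OF s t])
      (use s.tob_simps(1) s.tloose_simps(1) t.tob_simps(1) t.tloose_simps(1) in \<open>simp_all only: Pt_sel singleton_iff\<close>)
qed

lemma double_functor_to_Pt:
  "double_category A \<Longrightarrow> double_functor A Pt (strict_dfun A Pt (\<lambda>_. el 0) (\<lambda>_. el 0) (\<lambda>_. el 0) (\<lambda>_. el 0))"
  by (rule double_functor_strict[OF _ double_category_Pt]) simp_all

lemma Pt_is_product:
  fixes X :: "nat \<Rightarrow> 'u::infinite dbl"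
  shows "is_product Dbl 0 X Pt \<pi>"
proof (rule is_productI)
  fix z :: "'u dbl" and h k and a :: "nat \<Rightarrow> 'u ttrans" assume "h \<in> hom1 Dbl z Pt" "k \<in> hom1 Dbl z Pt"
  then have "h = k" and h: "double_functor z Pt h" using dfun_Pt_eq by (auto simp: hom1_Dbl)
  then show "\<exists>c\<in>hom2 Dbl h k. \<forall>i<0. hcmp2 Dbl (id2 Dbl (\<pi> i)) c = a i"
    using ttrans_id_in[OF h] dfun_cats[OF h]
    by (intro bexI[of _ "ttrans_id h"]) (auto simp: hom2_Dbl)
next
  fix z :: "'u dbl" and h k c d assume "h \<in> hom1 Dbl z Pt" and cd: "c \<in> hom2 Dbl h k" "d \<in> hom2 Dbl h k"
  then have h: "double_functor z Pt h" by (auto simp: hom1_Dbl)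
  show "c = d" using cd ttrans_Pt_eq dfun_cats[OF h] by (auto simp: hom2_Dbl)
qed (use double_functor_to_Pt dfun_Pt_eq in \<open>auto simp: hom1_Dbl double_category_Pt\<close>)

section \<open>Cells reflected by product cones\<close>

text \<open>A class \<open>\<Phi>\<close> of cells that is preserved by double functors and contains a pair as soon as it
  contains both components is reflected by every product cone.\<close>

lemma product_reflects:
  fixes \<Phi> :: "'u::infinite dbl \<Rightarrow> 'u \<Rightarrow> bool"
  assumes car_fun: "\<And>A B F x. \<lbrakk>double_functor A B F; x \<in> car A\<rbrakk> \<Longrightarrow> act F x \<in> car B"
    and act_cmp: "\<And>A B F G x. \<lbrakk>double_functor A B F; x \<in> car A\<rbrakk> \<Longrightarrow> act (G oo F) x = act G (act F x)"
    and act_id: "\<And>A x. x \<in> car A \<Longrightarrow> act (dfun_id A) x = x"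
    and pres: "\<And>A B F x. \<lbrakk>double_functor A B F; x \<in> car A; \<Phi> A x\<rbrakk> \<Longrightarrow> \<Phi> B (act F x)"
    and pt: "\<And>x. x \<in> car Pt \<Longrightarrow> \<Phi> Pt x"
    and prod: "\<And>D E x. \<lbrakk>double_category D; double_category E; x \<in> car (prod_dbl D E);
      \<Phi> D (act (fst_dfun D E) x); \<Phi> E (act (snd_dfun D E) x)\<rbrakk> \<Longrightarrow> \<Phi> (prod_dbl D E) x"
    and P: "is_product Dbl n X y \<pi>" and x: "x \<in> car y" "\<And>i. i < n \<Longrightarrow> \<Phi> (X i) (act (\<pi> i) x)"
  shows "\<Phi> y x"
proof -
  have X: "\<forall>i<n. double_category (X i)" using is_productD(2)[OF P] by auto
  \<comment> \<open>Some product of the family reflects the class, namely the binary product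
    iterated from \<open>Pt\<close>: \<open>pt\<close> and \<open>prod\<close> are exactly the two
    cases of the induction.\<close>
  have "\<exists>z \<rho>. is_product Dbl n X z \<rho> \<and> (\<forall>x\<in>car z. (\<forall>i<n. \<Phi> (X i) (act (\<rho> i) x)) \<longrightarrow> \<Phi> z x)"
    using X
  proof (induction n)
    case 0
    show ?case using Pt_is_product pt by blast
  next
    case (Suc n)
    then obtain z \<rho> where z: "is_product Dbl n X z \<rho>" "\<And>x. \<lbrakk>x \<in> car z; \<And>i. i < n \<Longrightarrow> \<Phi> (X i) (act (\<rho> i) x)\<rbrakk> \<Longrightarrow> \<Phi> z x"
      by auto
    have cats: "double_category z" "double_category (X n)" using is_productD(1)[OF z(1)] Suc.prems by auto
    let ?\<rho> = "\<lambda>i. if i < n then (\<rho> i) oo (fst_dfun z (X n)) else snd_dfun z (X n)"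
    have "is_product Dbl (Suc n) X (prod_dbl z (X n)) ?\<rho>"
      using product_Suc[OF two_category_Dbl z(1) prod_dbl_is_product[OF cats]] by (simp cong: if_cong)
    moreover have "\<Phi> (prod_dbl z (X n)) x"
      if x: "x \<in> car (prod_dbl z (X n))" and e: "\<forall>i<Suc n. \<Phi> (X i) (act (?\<rho> i) x)" for x
    proof (rule prod[OF cats x])
      show "\<Phi> (X n) (act (snd_dfun z (X n)) x)" using e[rule_format, of n] by simp
      show "\<Phi> z (act (fst_dfun z (X n)) x)"
      proof (rule z(2))
        show "act (fst_dfun z (X n)) x \<in> car z" by (rule car_fun[OF double_functor_fst[OF cats] x])
        show "\<Phi> (X i) (act (\<rho> i) (act (fst_dfun z (X n)) x))" if "i < n" for i
          using e[rule_format, of i] that by (simp add: act_cmp[OF double_functor_fst[OF cats] x])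
      qed
    qed
    ultimately show ?case by blast
  qed
  then obtain z \<rho> where z: "is_product Dbl n X z \<rho>" "\<And>x. \<lbrakk>x \<in> car z; \<And>i. i < n \<Longrightarrow> \<Phi> (X i) (act (\<rho> i) x)\<rbrakk> \<Longrightarrow> \<Phi> z x"
    by blast
  obtain u v where "u \<in> hom1 Dbl y z" "v \<in> hom1 Dbl z y" "cmp1 Dbl v u = id1 Dbl y"
    "\<And>i. i < n \<Longrightarrow> \<pi> i = cmp1 Dbl (\<rho> i) u"
    using product_unique[OF two_category_Dbl z(1) P] by blast
  then have u: "double_functor y z u" and v: "double_functor z y v" and vu: "v oo u = dfun_id y"
    and pu: "\<And>i. i < n \<Longrightarrow> \<pi> i = \<rho> i oo u" by (simp_all add: hom1_Dbl)
  \<comment> \<open>The cell is carried by \<open>u\<close> into the product that reflects the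
    class, and then brought back by \<open>v\<close>; the membership survives because
    \<open>v\<close> preserves the class, and the cell returns unchanged because
    \<open>v oo u\<close> is the identity.\<close>
  have "\<Phi> z (act u x)"
  proof (rule z(2)[OF car_fun[OF u x(1)]])
    show "\<Phi> (X i) (act (\<rho> i) (act u x))" if "i < n" for i
      using x(2)[OF that] pu[OF that] act_cmp[OF u x(1)] by simp
  qed
  from pres[OF v car_fun[OF u x(1)] this] show ?thesis
    using act_cmp[OF u x(1), of v] act_id[OF x(1)] vu by simp
qed

lemma companion_pair:
  assumes "companion D f c b p" "companion E f' c' b' p'"
  shows "companion (prod_dbl D E) (pair f f') (pair c c') (pair b b') (pair p p')"
  using assms by (simp add: companion_def Let_def hom_defs)

lemma conjoint_pair:
  assumes "conjoint D f c b p" "conjoint E f' c' b' p'"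
  shows "conjoint (prod_dbl D E) (pair f f') (pair c c') (pair b b') (pair p p')"
  using assms by (simp add: conjoint_def Let_def hom_defs)

text \<open>The transpose contains \<open>sq_inv\<close>, a definite description, which would first
  have to be evaluated in the product. \<open>companion_transpose_iso\<close> replaces the transpose
  by a square formed by horizontal composition alone, and this is computed componentwise.\<close>

lemma companion_commuter_pair:
  assumes "double_category D" "double_category E" "companion_commuter D s" "companion_commuter E t"
  shows "companion_commuter (prod_dbl D E) (pair s t)"
proof -
  interpret D: double_category D by fact
  interpret E: double_category E by fact
  interpret P: double_category "prod_dbl D E" by (rule double_category_prod[OF assms(1,2)])
  from assms(3) obtain c0 b0 p0 c1 b1 p1 where s: "s \<in> squares D"
    and c: "companion D (sleft D s) c0 b0 p0" "companion D (sright D s) c1 b1 p1"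
    and si: "sq_iso D (companion_transpose D s c0 b0 c1 p1)" by (auto simp: companion_commuter_def)
  from assms(4) obtain d0 \<theta>0 \<delta>0 d1 \<theta>1 \<delta>1 where t: "t \<in> squares E"
    and d: "companion E (sleft E t) d0 \<theta>0 \<delta>0" "companion E (sright E t) d1 \<theta>1 \<delta>1"
    and ti: "sq_iso E (companion_transpose E t d0 \<theta>0 d1 \<delta>1)" by (auto simp: companion_commuter_def)
  have "D.giso (hcmp D (hcmp D b0 s) p1)" "E.giso (hcmp E (hcmp E \<theta>0 t) \<delta>1)"
    using D.companion_transpose_iso[OF s c] E.companion_transpose_iso[OF t d] si ti by auto
  then have g: "P.giso (hcmp (prod_dbl D E) (hcmp (prod_dbl D E) (pair b0 \<theta>0) (pair s t)) (pair p1 \<delta>1))"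
    by (simp add: giso_prod_iff[OF assms(1,2)])
  have "companion (prod_dbl D E) (sleft (prod_dbl D E) (pair s t)) (pair c0 d0) (pair b0 \<theta>0) (pair p0 \<delta>0)"
    "companion (prod_dbl D E) (sright (prod_dbl D E) (pair s t)) (pair c1 d1) (pair b1 \<theta>1) (pair p1 \<delta>1)"
    "pair s t \<in> squares (prod_dbl D E)"
    using companion_pair[OF c(1) d(1)] companion_pair[OF c(2) d(2)] s t by simp_all
  with g P.companion_transpose_iso show ?thesis unfolding companion_commuter_def by blast
qed

lemma companion_commuter_Pt: "x \<in> squares Pt \<Longrightarrow> companion_commuter Pt x"
  using double_category.companion_commuter_vid[OF double_category_Pt, of "el 0"] by simp

lemma product_reflects_tight_iso:
  fixes X :: "nat \<Rightarrow> 'u::infinite dbl"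
  assumes "is_product Dbl n X y \<pi>" "f \<in> tights y" "\<And>i. i < n \<Longrightarrow> tight_iso (X i) (ftight (\<pi> i) f)"
  shows "tight_iso y f"
proof (rule product_reflects[where act = ftight and car = tights and \<Phi> = tight_iso and X = X and \<pi> = \<pi> and n = n], goal_cases)
  case (5 x)
  then show ?case using double_category.tight_iso_tid[OF double_category_Pt, of "el 0"] by simp
next
  case (6 D E x)
  then obtain f g where x: "x = pair f g" "f \<in> tights D" "g \<in> tights E" by auto
  with 6 have "tight_iso D f" "tight_iso E g" by simp_all
  then obtain f' g' where "f' \<in> tights D" "tdom D f' = tcod D f" "tcod D f' = tdom D f"
    "tcmp D f' f = tid D (tdom D f)" "tcmp D f f' = tid D (tcod D f)"
    "g' \<in> tights E" "tdom E g' = tcod E g" "tcod E g' = tdom E g"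
    "tcmp E g' g = tid E (tdom E g)" "tcmp E g g' = tid E (tcod E g)"
    by (elim tight_isoE) blast
  with x show ?case by (intro tight_isoI[of _ _ "pair f' g'"]) simp_all
next
  case 7
  show ?case by (rule assms)
next
  case 8
  show ?case by (rule assms)
next
  case (9 i)
  then show ?case by (rule assms)
qed (auto simp: dfun_cmp_apply double_functor.ftight_simps double_functor.tight_iso_ftight)

lemma product_reflects_has_companion:
  fixes X :: "nat \<Rightarrow> 'u::infinite dbl"
  assumes "is_product Dbl n X y \<pi>" "f \<in> tights y" "\<And>i. i < n \<Longrightarrow> has_companion (X i) (ftight (\<pi> i) f)"
  shows "has_companion y f"
proof (rule product_reflects[where act = ftight and car = tights and \<Phi> = has_companion and X = X and \<pi> = \<pi> and n = n], goal_cases)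
  case (5 x)
  then show ?case using double_category.has_companion_tid[OF double_category_Pt, of "el 0"] by simp
next
  case (6 D E x)
  then obtain f g where "x = pair f g" "has_companion D f" "has_companion E g" by auto
  then show ?case unfolding has_companion_def using companion_pair by metis
next
  case 7
  show ?case by (rule assms)
next
  case 8
  show ?case by (rule assms)
next
  case (9 i)
  then show ?case by (rule assms)
qed (auto simp: dfun_cmp_apply double_functor.ftight_simps double_functor.has_companion_fun)

lemma product_reflects_has_conjoint:
  fixes X :: "nat \<Rightarrow> 'u::infinite dbl"
  assumes "is_product Dbl n X y \<pi>" "f \<in> tights y" "\<And>i. i < n \<Longrightarrow> has_conjoint (X i) (ftight (\<pi> i) f)"
  shows "has_conjoint y f"
proof (rule product_reflects[where act = ftight and car = tights and \<Phi> = has_conjoint and X = X and \<pi> = \<pi> and n = n], goal_cases)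
  case (5 x)
  then show ?case using double_category.has_conjoint_tid[OF double_category_Pt, of "el 0"] by simp
next
  case (6 D E x)
  then obtain f g where "x = pair f g" "has_conjoint D f" "has_conjoint E g" by auto
  then show ?case unfolding has_conjoint_def using conjoint_pair by metis
next
  case 7
  show ?case by (rule assms)
next
  case 8
  show ?case by (rule assms)
next
  case (9 i)
  then show ?case by (rule assms)
qed (auto simp: dfun_cmp_apply double_functor.ftight_simps double_functor.has_conjoint_fun)

lemma product_reflects_companion_commuter:
  fixes X :: "nat \<Rightarrow> 'u::infinite dbl"
  assumes "is_product Dbl n X y \<pi>" "s \<in> squares y" "\<And>i. i < n \<Longrightarrow> companion_commuter (X i) (fsq (\<pi> i) s)"
  shows "companion_commuter y s"
proof (rule product_reflects[where act = fsq and car = squares and \<Phi> = companion_commuter and X = X and \<pi> = \<pi> and n = n], goal_cases)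
  case (5 x)
  then show ?case by (rule companion_commuter_Pt)
next
  case (6 D E x)
  then show ?case by (auto intro: companion_commuter_pair)
next
  case 7
  show ?case by (rule assms)
next
  case 8
  show ?case by (rule assms)
next
  case (9 i)
  then show ?case by (rule assms)
qed (auto simp: dfun_cmp_apply double_functor.fsq_simps double_functor.companion_commuter_fun)

section \<open>\<open>Dbl\<close> as an interpreted 2-category; sub-double categories; functors into
  \<open>Loose\<close>\<close>

lemma dfun_iff: "double_functor A B F \<longleftrightarrow> F \<in> cells1 Dbl \<and> ddom F = A \<and> dcod F = B"
  using hom1_Dbl[of F A B] by (simp add: hom1_def)

lemma ttrans_iff:
  "tight_transformation A B F G t \<longleftrightarrow> t \<in> cells2 Dbl \<and> tsrc t = F \<and> ttgt t = G \<and> ddom F = A \<and> dcod F = B"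
  using hom2_Dbl[of t F G] ttrans_ends[of A B F G t] by (auto simp: hom2_def)

text \<open>The rewrites state the abstract rules in terms of the concrete operations, since goals
  are simplified to these before the rules are applied.\<close>

interpretation Dbl: two_category Dbl
  rewrites "dom1 Dbl = ddom" and "cod1 Dbl = dcod" and "src2 Dbl = tsrc" and "tgt2 Dbl = ttgt"
    and "id1 Dbl = dfun_id" and "cmp1 Dbl = dfun_cmp" and "id2 Dbl = ttrans_id"
    and "vcmp2 Dbl = ttrans_vcmp" and "hcmp2 Dbl = ttrans_hcmp"
  by (rule two_category_Dbl) simp_all

lemma cells1_cats [simp]: "F \<in> cells1 Dbl \<Longrightarrow> double_category (ddom F)" "F \<in> cells1 Dbl \<Longrightarrow> double_category (dcod F)"
  using dfun_cats[of "ddom F" "dcod F" F] by (simp_all add: dfun_iff)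

lemma dfun_id_cells1 [simp]: "double_category A \<Longrightarrow> dfun_id A \<in> cells1 Dbl"
  using dfun_id_in[of A] by (simp add: dfun_iff)

text \<open>Tight arrows are selected by their domain and squares by their top; in a saturated
  situation the codomain and the bottom then belong to the selected sets as well.\<close>

definition sub_dbl :: "'u dbl \<Rightarrow> 'u set \<Rightarrow> 'u set \<Rightarrow> 'u dbl" where
  "sub_dbl D Ob Lo = D\<lparr>obs := Ob, tights := {f \<in> tights D. tdom D f \<in> Ob}, looses := Lo,
     squares := {s \<in> squares D. stop D s \<in> Lo}\<rparr>"

lemma sub_dbl_sel [simp]:
  "obs (sub_dbl D Ob Lo) = Ob" "tights (sub_dbl D Ob Lo) = {f \<in> tights D. tdom D f \<in> Ob}"
  "looses (sub_dbl D Ob Lo) = Lo" "squares (sub_dbl D Ob Lo) = {s \<in> squares D. stop D s \<in> Lo}"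
  "tdom (sub_dbl D Ob Lo) = tdom D" "tcod (sub_dbl D Ob Lo) = tcod D" "tid (sub_dbl D Ob Lo) = tid D"
  "tcmp (sub_dbl D Ob Lo) = tcmp D" "ldom (sub_dbl D Ob Lo) = ldom D" "lcod (sub_dbl D Ob Lo) = lcod D"
  "lid (sub_dbl D Ob Lo) = lid D" "lcmp (sub_dbl D Ob Lo) = lcmp D" "stop (sub_dbl D Ob Lo) = stop D"
  "sbot (sub_dbl D Ob Lo) = sbot D" "sleft (sub_dbl D Ob Lo) = sleft D" "sright (sub_dbl D Ob Lo) = sright D"
  "vid (sub_dbl D Ob Lo) = vid D" "vcmp (sub_dbl D Ob Lo) = vcmp D" "hid (sub_dbl D Ob Lo) = hid D"
  "hcmp (sub_dbl D Ob Lo) = hcmp D" "lassoc (sub_dbl D Ob Lo) = lassoc D" "lunit (sub_dbl D Ob Lo) = lunit D"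
  "runit (sub_dbl D Ob Lo) = runit D"
  by (simp_all add: sub_dbl_def)

text \<open>A saturated pair of a set of objects and a set of loose arrows spans a full sub-double category
  that is closed under tight and square isomorphism, so that it can be tested on objects and loose arrows
  whether a double functor or a transformation factors through it.\<close>

locale saturated = double_category D for D :: "'u dbl" (structure) +
  fixes Ob Lo :: "'u set"
  assumes Ob_sub: "x \<in> Ob \<Longrightarrow> x \<in> obs D" and Lo_sub: "l \<in> Lo \<Longrightarrow> l \<in> looses D"
    and Lo_ends: "l \<in> Lo \<Longrightarrow> ldom D l \<in> Ob" "l \<in> Lo \<Longrightarrow> lcod D l \<in> Ob"
    and lid_Lo: "x \<in> Ob \<Longrightarrow> lid D x \<in> Lo"
    and lcmp_Lo: "\<lbrakk>l \<in> Lo; m \<in> Lo; lcod D l = ldom D m\<rbrakk> \<Longrightarrow> l \<odot> m \<in> Lo"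
    and tights_Ob: "f \<in> tights D \<Longrightarrow> tdom D f \<in> Ob \<longleftrightarrow> tcod D f \<in> Ob"
    and squares_Lo: "s \<in> squares D \<Longrightarrow> stop D s \<in> Lo \<longleftrightarrow> sbot D s \<in> Lo"
begin

abbreviation S where "S \<equiv> sub_dbl D Ob Lo"

definition incl :: "'u dfun" where
  "incl = strict_dfun S D (\<lambda>x. x) (\<lambda>f. f) (\<lambda>l. l) (\<lambda>s. s)"

lemma sub_sq_iso: "\<lbrakk>sq_iso D s; stop D s \<in> Lo\<rbrakk> \<Longrightarrow> sq_iso S s"
  using squares_Lo[of s] by (auto simp: sq_iso_def is_sq_inverse_def)

lemma sub_glob_iso: "\<lbrakk>s \<in> glob_iso D x y; x \<in> Lo\<rbrakk> \<Longrightarrow> s \<in> glob_iso S x y"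
  by (auto simp: glob_iso_def sq_hom_def sub_sq_iso)

lemma double_category_sub: "double_category S"
proof (rule double_categoryI, goal_cases)
  case (20 k l m)
  then show ?case
    by (intro sub_glob_iso[unfolded sub_dbl_sel]) (simp_all add: glob_iso_iff Lo_sub lcmp_Lo)
next
  case (21 l)
  then show ?case by (intro sub_glob_iso) (simp_all add: glob_iso_iff Lo_sub lcmp_Lo lid_Lo Lo_ends)
next
  case (22 l)
  then show ?case by (intro sub_glob_iso) (simp_all add: glob_iso_iff Lo_sub lcmp_Lo lid_Lo Lo_ends)
next
  case (17 s t)
  then show ?case using adjacent[of s t] by (simp add: Lo_sub lcmp_Lo)
next
  case (19 s s' t t')
  then show ?case by (simp add: interchange)
next
  case (23 r s t)
  then show ?case by (simp add: lassoc_nat)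
next
  case (24 s)
  then show ?case by (simp add: lunit_nat)
next
  case (25 s)
  then show ?case by (simp add: runit_nat)
next
  case (26 j k l m)
  then show ?case by (simp add: pentagon' Lo_sub)
next
  case (27 l m)
  then show ?case by (simp add: triangle' Lo_sub)
next
  case (9 s)
  then show ?case using squares_Lo[of s] Lo_ends by simp
next
  case (1 f)
  then show ?case using tights_Ob[of f] by simp
qed (simp_all add: Ob_sub Lo_sub Lo_ends lid_Lo lcmp_Lo vcmp_assoc' hid_id hid_tcmp hcmp_vid)

lemma double_functor_incl: "double_functor S D incl"
  unfolding incl_def by (rule double_functor_strict[OF double_category_sub double_category_axioms])
    (simp_all add: Ob_sub Lo_sub)

lemma incl_simps [simp]: "incl \<in> cells1 Dbl" "ddom incl = S" "dcod incl = D"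
  using double_functor_incl by (simp_all add: dfun_iff)

lemma incl_apply [simp]:
  "x \<in> Ob \<Longrightarrow> fob incl x = x" "\<lbrakk>f \<in> tights D; tdom D f \<in> Ob\<rbrakk> \<Longrightarrow> ftight incl f = f"
  "l \<in> Lo \<Longrightarrow> floose incl l = l" "\<lbrakk>s \<in> squares D; stop D s \<in> Lo\<rbrakk> \<Longrightarrow> fsq incl s = s"
  by (simp_all add: incl_def)

lemma incl_cmp_apply:
  assumes "double_functor A S F"
  shows "x \<in> obs A \<Longrightarrow> fob (incl oo F) x = fob F x"
    "f \<in> tights A \<Longrightarrow> ftight (incl oo F) f = ftight F f"
    "l \<in> looses A \<Longrightarrow> floose (incl oo F) l = floose F l"
    "s \<in> squares A \<Longrightarrow> fsq (incl oo F) s = fsq F s"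
    "\<lbrakk>l \<in> looses A; m \<in> looses A; lcod A l = ldom A m\<rbrakk> \<Longrightarrow> fcomp (incl oo F) l m = fcomp F l m"
    "x \<in> obs A \<Longrightarrow> funit (incl oo F) x = funit F x"
  using strict_dfun_cmp_apply[OF assms double_functor_incl[unfolded incl_def], folded incl_def] by blast+

lemma incl_mono:
  assumes F: "double_functor A S F" and G: "double_functor A S G" and e: "incl oo F = incl oo G"
  shows "F = G"
  using incl_cmp_apply[OF F, unfolded e] incl_cmp_apply[OF G] by (intro dfun_eqI[OF F G]) metis+

lemma incl_faithful:
  assumes s: "tight_transformation A S F G s" and t: "tight_transformation A S F G t"
    and e: "incl *> s = incl *> t"
  shows "s = t"
proof -
  interpret s: tight_transformation A S F G s by fact
  interpret t: tight_transformation A S F G t by fact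
  note w = ttrans_whisker_left[OF s double_functor_incl, unfolded e] ttrans_whisker_left[OF t double_functor_incl]
  show ?thesis
  proof (rule ttrans_eqI[OF s t])
    show "tob s x = tob t x" if "x \<in> obs A" for x
      using w(1)[OF that] w(3)[OF that] s.tob_simps(1)[OF that] t.tob_simps(1)[OF that] by simp
    show "tloose s x = tloose t x" if "x \<in> looses A" for x
      using w(2)[OF that] w(4)[OF that] s.tloose_simps(1)[OF that] t.tloose_simps(1)[OF that] by simp
  qed
qed

text \<open>Tight arrows and squares between selected objects and loose arrows are selected too, so
  the conditions on \<open>ob\<close> and \<open>lo\<close> suffice. The inclusion is the identity
  on cells, hence the lift is the same record with another codomain.\<close>

lemma sub_lift:
  assumes F: "double_functor A D F" and ob: "\<And>x. x \<in> obs A \<Longrightarrow> fob F x \<in> Ob"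
    and lo: "\<And>l. l \<in> looses A \<Longrightarrow> floose F l \<in> Lo"
  shows "double_functor A S (F\<lparr>dcod := S\<rparr>)" "incl oo (F\<lparr>dcod := S\<rparr>) = F"
proof -
  interpret F: double_functor A D F by fact
  interpret S: double_category S by (rule double_category_sub)
  have giso: "S.giso s" if "giso s" "stop D s \<in> Lo" for s
    using that sub_sq_iso[of s] by (simp add: S.giso_def giso_def S.glob_def glob_def)
  show l: "double_functor A S (F\<lparr>dcod := S\<rparr>)"
  proof (rule dfunI, goal_cases)
    case (21 s t)
    then show ?case using F.fcomp_nat[of s t] by simp
  next
    case (22 f)
    then show ?case using F.funit_nat[of f] by simp
  next
    case (23 k l m)
    then show ?case using F.fcomp_assoc'[of k l m] by simp
  next
    case (24 l)
    then show ?case using F.funit_left'[of l] by simp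
  next
    case (25 l)
    then show ?case using F.funit_right'[of l] by simp
  qed (simp_all add: F.A.double_category_axioms double_category_sub F.ddom F.fob_ext F.ftight_ext F.floose_ext
      F.fsq_ext F.fcomp_ext F.funit_ext ob lo giso lid_Lo lcmp_Lo)
  show "incl oo (F\<lparr>dcod := S\<rparr>) = F"
    by (rule dfun_eqI[OF dfun_cmp_in[OF l double_functor_incl] F]) (simp_all add: incl_cmp_apply[OF l])
qed

lemma sub_lift_cell:
  assumes F: "double_functor A S F" and G: "double_functor A S G"
    and t: "tight_transformation A D (incl oo F) (incl oo G) t"
  shows "tight_transformation A S F G (t\<lparr>tsrc := F, ttgt := G\<rparr>)"
    "incl *> (t\<lparr>tsrc := F, ttgt := G\<rparr>) = t"
proof -
  interpret F: double_functor A S F by fact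
  interpret G: double_functor A S G by fact
  interpret t: tight_transformation A D "incl oo F" "incl oo G" t by fact
  note [simp] = incl_cmp_apply[OF F] incl_cmp_apply[OF G]
  note [simp] = F.fob_in[unfolded sub_dbl_sel] F.floose_simps(1)[unfolded sub_dbl_sel]
  show l: "tight_transformation A S F G (t\<lparr>tsrc := F, ttgt := G\<rparr>)"
  proof (rule ttransI, goal_cases)
    case (9 f)
    then show ?case using t.tob_nat[of f] by simp
  next
    case (10 x)
    then show ?case using t.tloose_nat[of x] by simp
  next
    case (11 l m)
    then show ?case using t.tloose_lcmp[of l m] by simp
  next
    case (12 x)
    then show ?case using t.tloose_id[of x] by simp
  qed (simp_all add: F G t.tob_ext t.tloose_ext)
  interpret l: tight_transformation A S F G "t\<lparr>tsrc := F, ttgt := G\<rparr>" by (rule l)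
  have e: "ftight incl (tob t x) = tob t x" if "x \<in> obs A" for x using that l.tob_simps(1)[OF that] by simp
  have e': "fsq incl (tloose t x) = tloose t x" if "x \<in> looses A" for x using that l.tloose_simps(1)[OF that] by simp
  show "incl *> (t\<lparr>tsrc := F, ttgt := G\<rparr>) = t"
    by (rule ttrans_eqI[OF ttrans_hcmp_in[OF l ttrans_id_in[OF double_functor_incl]] t])
      (simp_all add: ttrans_whisker_left[OF l double_functor_incl] e e')
qed

end

text \<open>The squares of \<open>Loose\<close> are identities, so that a double functor to \<open>Loose\<close> is determined by its
  actions on objects and loose arrows, and transformations between such functors are identities.\<close>

locale over_Loose = double_functor A Loose M for A :: "'u::infinite dbl" and M
begin

lemma over_apply:
  "f \<in> tights A \<Longrightarrow> ftight M f = fob M (tdom A f)" "f \<in> tights A \<Longrightarrow> fob M (tcod A f) = fob M (tdom A f)"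
  "s \<in> squares A \<Longrightarrow> fsq M s = floose M (stop A s)" "s \<in> squares A \<Longrightarrow> floose M (sbot A s) = floose M (stop A s)"
  "x \<in> obs A \<Longrightarrow> funit M x = fob M x" "x \<in> obs A \<Longrightarrow> floose M (lid A x) = fob M x"
  "\<lbrakk>l \<in> looses A; m \<in> looses A; lcod A l = ldom A m\<rbrakk> \<Longrightarrow> fcomp M l m = lcmp Loose (floose M l) (floose M m)"
  "\<lbrakk>l \<in> looses A; m \<in> looses A; lcod A l = ldom A m\<rbrakk>
    \<Longrightarrow> floose M (l \<odot>\<^bsub>A\<^esub> m) = lcmp Loose (floose M l) (floose M m)"
  using ftight_simps(2,3)[of f] fsq_simps(4,5)[of s] funit_simps(2,3)[of x] fcomp_simps(2,3)[of l m]
  by (simp_all add: Loose_sel)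

end

lemma dfun_Loose_eqI:
  assumes "double_functor A Loose M" "double_functor A Loose N"
    and "\<And>x. x \<in> obs A \<Longrightarrow> fob M x = fob N x" "\<And>l. l \<in> looses A \<Longrightarrow> floose M l = floose N l"
  shows "M = N"
proof -
  interpret M: over_Loose A M by (simp add: over_Loose_def assms)
  interpret N: over_Loose A N by (simp add: over_Loose_def assms)
  show ?thesis
    by (rule dfun_eqI[OF assms(1,2)]) (simp_all add: assms(3,4) M.over_apply N.over_apply)
qed

lemma ttrans_Loose:
  assumes t: "tight_transformation A Loose M N t"
  shows "N = M" "t = ttrans_id M"
proof -
  interpret t: tight_transformation A Loose M N t by fact
  have ob: "fob N x = fob M x" "tob t x = fob M x" if "x \<in> obs A" for x
    using t.tob_simps[OF that] by (simp_all add: Loose_sel)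
  have lo: "floose N l = floose M l" "tloose t l = floose M l" if "l \<in> looses A" for l
    using t.tloose_simps[OF that] by (simp_all add: Loose_sel)
  show e: "N = M"
    by (rule dfun_Loose_eqI[OF t.G.double_functor_axioms t.F.double_functor_axioms]) (use ob lo in simp_all)
  show "t = ttrans_id M"
    by (rule ttrans_eqI[OF t[unfolded e] ttrans_id_in[OF t.F.double_functor_axioms]])
      (simp_all add: ttrans_id_simps[OF t.F.double_functor_axioms] ob lo Loose_sel)
qed

lemma cell_Loose: "\<lbrakk>t \<in> cells2 Dbl; dcod (tsrc t) = Loose\<rbrakk> \<Longrightarrow> ttgt t = tsrc t \<and> t = ttrans_id (tsrc t)"
  using ttrans_Loose[of "ddom (tsrc t)" "tsrc t" "ttgt t" t] by (simp add: ttrans_iff)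

definition const_Loose :: "'u::infinite dbl \<Rightarrow> 'u \<Rightarrow> 'u dfun" where
  "const_Loose A i = strict_dfun A Loose (\<lambda>_. i) (\<lambda>_. i) (\<lambda>_. i) (\<lambda>_. i)"

lemma double_functor_const:
  "\<lbrakk>double_category A; i \<in> obs Loose\<rbrakk> \<Longrightarrow> double_functor A Loose (const_Loose A i)"
  unfolding const_Loose_def
  by (rule double_functor_strict[OF _ double_category_Loose]) (auto simp: Loose_sel)

lemma const_Loose_apply [simp]:
  "ddom (const_Loose A i) = A" "dcod (const_Loose A i) = Loose"
  "x \<in> obs A \<Longrightarrow> fob (const_Loose A i) x = i" "l \<in> looses A \<Longrightarrow> floose (const_Loose A i) l = i"
  by (simp_all add: const_Loose_def)

lemma const_Loose_cells1 [simp]: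
  "\<lbrakk>double_category A; i \<in> obs Loose\<rbrakk> \<Longrightarrow> const_Loose A i \<in> cells1 Dbl"
  using double_functor_const[of A i] by (simp add: dfun_iff)

lemma const_Loose_cmp:
  assumes "double_functor A B F" "i \<in> obs Loose"
  shows "const_Loose B i oo F = const_Loose A i"
proof -
  interpret F: double_functor A B F by fact
  show ?thesis
    by (rule dfun_Loose_eqI[OF dfun_cmp_in[OF assms(1) double_functor_const] double_functor_const])
      (simp_all add: assms F.A.double_category_axioms F.B.double_category_axioms dfun_cmp_apply[OF assms(1)])
qed

section \<open>Loose bimodules and the 2-functor of fibres\<close>

lemma LBimod_simps [simp]:
  "cells0 LBimod = {m \<in> cells1 Dbl. dcod m = Loose}"
  "dom1 LBimod (m, n, f) = m" "cod1 LBimod (m, n, f) = n"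
  "src2 LBimod (m, n, a) = (m, n, tsrc a)" "tgt2 LBimod (m, n, a) = (m, n, ttgt a)"
  "id1 LBimod m = (m, m, dfun_id (ddom m))" "id2 LBimod (m, n, f) = (m, n, ttrans_id f)"
  "cmp1 LBimod (n, k, g) (m, n', f) = (m, k, g oo f)"
  "vcmp2 LBimod (m', n', b) (m, n, a) = (m, n, ttrans_vcmp b a)"
  "hcmp2 LBimod (n, k, b) (m, n', a) = (m, k, ttrans_hcmp b a)"
  by (simp_all add: LBimod_def)

lemma LBimod_cells1 [simp]:
  "(m, n, f) \<in> cells1 LBimod \<longleftrightarrow> m \<in> cells1 Dbl \<and> dcod m = Loose \<and> n \<in> cells1 Dbl \<and> dcod n = Loose \<and>
    f \<in> cells1 Dbl \<and> ddom f = ddom m \<and> dcod f = ddom n \<and> n oo f = m"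
  by (simp add: LBimod_def)

text \<open>A transformation between functors into \<open>Loose\<close> is an identity. Applied to
  \<open>n *> a\<close>, whose source is \<open>n oo tsrc a = m\<close>, this gives the whiskering
  condition of the slice.\<close>

lemma LBimod_cells2 [simp]:
  "(m, n, a) \<in> cells2 LBimod \<longleftrightarrow> a \<in> cells2 Dbl \<and> (m, n, tsrc a) \<in> cells1 LBimod \<and> (m, n, ttgt a) \<in> cells1 LBimod"
proof -
  have "n *> a = ttrans_id m" if "a \<in> cells2 Dbl" "(m, n, tsrc a) \<in> cells1 LBimod"
    using cell_Loose[of "n *> a"] that by simp
  then show ?thesis by (auto simp: LBimod_def)
qed

lemma LBimod_hom1:
  "F \<in> hom1 LBimod M N \<longleftrightarrow> (\<exists>f. F = (M, N, f) \<and> (M, N, f) \<in> cells1 LBimod)"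
  by (cases F) (auto simp: hom1_def)

lemma LBimod_hom2:
  "t \<in> hom2 LBimod (M, N, f) (M', N', g) \<longleftrightarrow> (\<exists>a. t = (M, N, a) \<and> M' = M \<and> N' = N \<and> (M, N, a) \<in> cells2 LBimod \<and>
    tsrc a = f \<and> ttgt a = g)"
  by (cases t) (auto simp: hom2_def)

lemma two_category_LBimod: "two_category LBimod"
  unfolding LBimod_def by (rule two_category_slice[OF two_category_Dbl])

text \<open>Over \<open>Loose\<close> a tight arrow lies over the object below its domain and a
  square over the loose arrow below its top, so the four conditions in \<open>fibre\<close> amount
  to conditions on objects and loose arrows.\<close>

lemma fibre_eq_sub:
  assumes "double_functor A Loose M"
  shows "fibre M i = sub_dbl A {x \<in> obs A. fob M x = i} {l \<in> looses A. floose M l = i}"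
proof -
  interpret M: over_Loose A M by (simp add: over_Loose_def assms)
  show ?thesis unfolding fibre_def sub_dbl_def M.ddom
    by (auto intro!: dbl.equality simp: Loose_sel M.over_apply)
qed

text \<open>The image in \<open>Loose\<close> does not change along tight arrows and squares. That
  \<open>i\<close> is an object matters for the ends of loose arrows: over a loose identity both
  ends lie over the same object, over the generator they would not.\<close>

lemma saturated_fibre:
  assumes "double_functor A Loose M" and i: "i \<in> obs Loose"
  shows "saturated A {x \<in> obs A. fob M x = i} {l \<in> looses A. floose M l = i}"
proof -
  interpret M: over_Loose A M by (simp add: over_Loose_def assms)
  have "ldom Loose (floose M l) = fob M (ldom A l)" "lcod Loose (floose M l) = fob M (lcod A l)" if "l \<in> looses A" for l
    using that by simp_all
  then have "fob M (ldom A l) = floose M l" "fob M (lcod A l) = floose M l"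
    if "l \<in> looses A" "floose M l \<in> obs Loose" for l
    using that by (fastforce simp: Loose_sel)+
  then show ?thesis
    by unfold_locales (use i in \<open>auto simp: M.over_apply, auto simp: Loose_sel\<close>)
qed

lemma LBimod_obj_functor: "M \<in> cells0 LBimod \<Longrightarrow> double_functor (ddom M) Loose M"
  by (simp add: dfun_iff)

text \<open>The projection from the pullback of \<open>M\<close> along the object \<open>i\<close>
  to the domain of \<open>M\<close>. All statements about fibres below are reduced to it.\<close>

definition fincl :: "'u::infinite dfun \<Rightarrow> 'u \<Rightarrow> 'u dfun" where
  "fincl M i = saturated.incl (ddom M) {x \<in> obs (ddom M). fob M x = i} {l \<in> looses (ddom M). floose M l = i}"

context
  fixes i :: "'u::infinite"
  assumes i: "i \<in> obs Loose"
begin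

lemma fincl_simps:
  assumes "M \<in> cells0 LBimod"
  shows "fincl M i \<in> cells1 Dbl" "ddom (fincl M i) = fibre M i" "dcod (fincl M i) = ddom M"
    "M oo fincl M i = const_Loose (fibre M i) i" "double_category (fibre M i)"
proof -
  note M = LBimod_obj_functor[OF assms]
  interpret S: saturated "ddom M" "{x \<in> obs (ddom M). fob M x = i}" "{l \<in> looses (ddom M). floose M l = i}"
    by (rule saturated_fibre[OF M i])
  note eq = fibre_eq_sub[OF M, of i]
  show "fincl M i \<in> cells1 Dbl" "ddom (fincl M i) = fibre M i" "dcod (fincl M i) = ddom M"
    "double_category (fibre M i)"
    unfolding fincl_def eq by (simp_all add: S.double_category_sub)
  show "M oo fincl M i = const_Loose (fibre M i) i"
    unfolding fincl_def eq
    by (rule dfun_Loose_eqI[OF dfun_cmp_in[OF S.double_functor_incl M] double_functor_const[OF S.double_category_sub i]])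
      (simp_all add: dfun_cmp_apply[OF S.double_functor_incl])
qed

lemma fibre_incl_mono:
  assumes "M \<in> cells0 LBimod" "double_functor A (fibre M i) F" "double_functor A (fibre M i) G"
    "fincl M i oo F = fincl M i oo G"
  shows "F = G"
  using saturated.incl_mono[OF saturated_fibre[OF LBimod_obj_functor[OF assms(1)] i]] assms(2-4)
  unfolding fibre_eq_sub[OF LBimod_obj_functor[OF assms(1)], of i] fincl_def by blast

lemma fibre_incl_faithful:
  assumes "M \<in> cells0 LBimod" "tight_transformation A (fibre M i) F G s" "tight_transformation A (fibre M i) F G t"
    "fincl M i *> s = fincl M i *> t"
  shows "s = t"
  using saturated.incl_faithful[OF saturated_fibre[OF LBimod_obj_functor[OF assms(1)] i]] assms(2-4)
  unfolding fibre_eq_sub[OF LBimod_obj_functor[OF assms(1)], of i] fincl_def by blast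

text \<open>The universal property of the pullback of \<open>M\<close> along \<open>i\<close>; the
  composite \<open>A \<rightarrow> \<bullet> \<rightarrow> Loose\<close> is represented directly by
  the constant functor at \<open>i\<close>.\<close>

lemma fibre_lift:
  assumes M: "M \<in> cells0 LBimod" and F: "double_functor A (ddom M) F" and e: "M oo F = const_Loose A i"
  shows "double_functor A (fibre M i) (F\<lparr>dcod := fibre M i\<rparr>)"
    "fincl M i oo (F\<lparr>dcod := fibre M i\<rparr>) = F"
proof -
  interpret F: double_functor A "ddom M" F by fact
  note sat = saturated_fibre[OF LBimod_obj_functor[OF M] i]
  have ob: "fob F x \<in> {x \<in> obs (ddom M). fob M x = i}" if "x \<in> obs A" for x
    using that dfun_cmp_apply(1)[OF F that, of M] e by simp
  have lo: "floose F l \<in> {l \<in> looses (ddom M). floose M l = i}" if "l \<in> looses A" for l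
    using that dfun_cmp_apply(3)[OF F that, of M] e by simp
  show "double_functor A (fibre M i) (F\<lparr>dcod := fibre M i\<rparr>)"
    "fincl M i oo (F\<lparr>dcod := fibre M i\<rparr>) = F"
    using saturated.sub_lift[OF sat F ob lo]
    unfolding fibre_eq_sub[OF LBimod_obj_functor[OF M], of i] fincl_def by blast+
qed

lemma fibre_lift_cell:
  assumes M: "M \<in> cells0 LBimod" and F: "double_functor A (fibre M i) F" and G: "double_functor A (fibre M i) G"
    and t: "tight_transformation A (ddom M) (fincl M i oo F) (fincl M i oo G) t"
  shows "tight_transformation A (fibre M i) F G (t\<lparr>tsrc := F, ttgt := G\<rparr>)"
    "fincl M i *> (t\<lparr>tsrc := F, ttgt := G\<rparr>) = t"
  using saturated.sub_lift_cell[OF saturated_fibre[OF LBimod_obj_functor[OF M] i]] F G t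
  unfolding fibre_eq_sub[OF LBimod_obj_functor[OF M], of i] fincl_def by blast+

text \<open>The pointwise restriction of \<open>f\<close> is recognised as the lift of
  \<open>f oo fincl M i\<close>. The comparison squares of this composite carry an extra image of a
  vertical identity, which \<open>c\<close> and \<open>u\<close> remove.\<close>

lemma fibre_map_lift:
  assumes m: "(M, N, f) \<in> cells1 LBimod"
  shows "fibre_map i (M, N, f) = (f oo fincl M i)\<lparr>dcod := fibre N i\<rparr>"
proof -
  have M: "M \<in> cells0 LBimod" using m by simp
  note I = fincl_simps[OF M]
  have f: "double_functor (ddom M) (ddom N) f" and J: "double_functor (fibre M i) (ddom M) (fincl M i)"
    using m I by (simp_all add: dfun_iff)
  interpret f: double_functor "ddom M" "ddom N" f by (rule f)
  interpret J: double_functor "fibre M i" "ddom M" "fincl M i" by (rule J)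
  note Md = LBimod_obj_functor[OF M]
  interpret S: saturated "ddom M" "{x \<in> obs (ddom M). fob M x = i}" "{l \<in> looses (ddom M). floose M l = i}"
    by (rule saturated_fibre[OF Md i])
  have J': "x \<in> obs (fibre M i) \<Longrightarrow> fob (fincl M i) x = x" "g \<in> tights (fibre M i) \<Longrightarrow> ftight (fincl M i) g = g"
    "l \<in> looses (fibre M i) \<Longrightarrow> floose (fincl M i) l = l" "s \<in> squares (fibre M i) \<Longrightarrow> fsq (fincl M i) s = s"
    for x g l s
    unfolding fincl_def fibre_eq_sub[OF Md, of i] by simp_all
  have sub: "x \<in> obs (fibre M i) \<Longrightarrow> x \<in> obs (ddom M)" "g \<in> tights (fibre M i) \<Longrightarrow> g \<in> tights (ddom M)"
    "l \<in> looses (fibre M i) \<Longrightarrow> l \<in> looses (ddom M)" "s \<in> squares (fibre M i) \<Longrightarrow> s \<in> squares (ddom M)"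
    "ldom (fibre M i) = ldom (ddom M)" "lcod (fibre M i) = lcod (ddom M)" for x g l s
    by (simp_all add: fibre_def)
  have J'': "\<lbrakk>l \<in> looses (fibre M i); k \<in> looses (fibre M i); lcod (ddom M) l = ldom (ddom M) k\<rbrakk>
      \<Longrightarrow> fcomp (fincl M i) l k = vid (ddom M) (l \<odot>\<^bsub>ddom M\<^esub> k)"
    "x \<in> obs (fibre M i) \<Longrightarrow> funit (fincl M i) x = vid (ddom M) (lid (ddom M) x)" for l k x
    unfolding fincl_def S.incl_def fibre_eq_sub[OF Md, of i] by simp_all
  have c: "fsq f (fcomp (fincl M i) l k) \<bullet>\<^bsub>ddom N\<^esub> fcomp f l k = fcomp f l k"
    if "l \<in> looses (fibre M i)" "k \<in> looses (fibre M i)" "lcod (ddom M) l = ldom (ddom M) k" for l k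
    using that sub(3)[OF that(1)] sub(3)[OF that(2)] by (simp add: J'')
  have u: "fsq f (funit (fincl M i) x) \<bullet>\<^bsub>ddom N\<^esub> funit f x = funit f x" if "x \<in> obs (fibre M i)" for x
    using that sub(1)[OF that] by (simp add: J'')
  show ?thesis
    unfolding fibre_map_def dfun_restrict_def dfun_cmp_def
    by (simp add: I J.ddom f.dcod J' c u compose_def restrict_comp_def composable_def fun_eq_iff restrict_def sub cong: if_cong)
qed

text \<open>Compatibility with the inclusions, the last equation, determines the induced functor on
  fibres because inclusions are monic; functoriality and naturality are derived from it rather than
  from the restriction formula.\<close>

lemma fibre_map_simps:
  assumes m: "(M, N, f) \<in> cells1 LBimod"
  shows "fibre_map i (M, N, f) \<in> cells1 Dbl" "ddom (fibre_map i (M, N, f)) = fibre M i"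
    "dcod (fibre_map i (M, N, f)) = fibre N i"
    "fincl N i oo fibre_map i (M, N, f) = f oo fincl M i"
proof -
  have M: "M \<in> cells0 LBimod" and N: "N \<in> cells0 LBimod" and f: "f \<in> cells1 Dbl" "ddom f = ddom M" "dcod f = ddom N"
    "N oo f = M"
    using m by simp_all
  note I = fincl_simps[OF M]
  have "double_functor (fibre M i) (ddom N) (f oo fincl M i)"
    using I f by (simp add: dfun_iff)
  moreover have "N oo f oo fincl M i = const_Loose (fibre M i) i"
  proof -
    have "N oo f oo fincl M i = (N oo f) oo fincl M i"
      using M N f(1-3) I by (intro Dbl.cmp1_assoc'[symmetric]) simp_all
    then show ?thesis using f(4) I(4) by simp
  qed
  ultimately show "fibre_map i (M, N, f) \<in> cells1 Dbl" "ddom (fibre_map i (M, N, f)) = fibre M i"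
    "dcod (fibre_map i (M, N, f)) = fibre N i"
    "fincl N i oo fibre_map i (M, N, f) = f oo fincl M i"
    using fibre_lift[OF N] unfolding fibre_map_lift[OF m] by (simp_all add: dfun_iff)
qed

lemma fibre_trans_lift:
  assumes t: "(M, N, t) \<in> cells2 LBimod"
  shows "fibre_trans i (M, N, t) = (t <* fincl M i)
    \<lparr>tsrc := fibre_map i (M, N, tsrc t), ttgt := fibre_map i (M, N, ttgt t)\<rparr>"
proof -
  have M: "M \<in> cells0 LBimod" using t by simp
  note Md = LBimod_obj_functor[OF M]
  note I = fincl_simps[OF M]
  have J: "double_functor (fibre M i) (ddom M) (fincl M i)"
    and tt: "tight_transformation (ddom M) (ddom N) (tsrc t) (ttgt t) t"
    using t I by (simp_all add: dfun_iff ttrans_iff)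
  interpret S: saturated "ddom M" "{x \<in> obs (ddom M). fob M x = i}" "{l \<in> looses (ddom M). floose M l = i}"
    by (rule saturated_fibre[OF Md i])
  interpret h: tight_transformation "fibre M i" "ddom N" "tsrc t oo fincl M i"
    "ttgt t oo fincl M i" "t <* fincl M i"
    by (rule ttrans_hcmp_in[OF ttrans_id_in[OF J] tt])
  have J': "x \<in> obs (fibre M i) \<Longrightarrow> fob (fincl M i) x = x"
    "l \<in> looses (fibre M i) \<Longrightarrow> floose (fincl M i) l = l" for x l
    unfolding fincl_def fibre_eq_sub[OF Md, of i] by simp_all
  have "restrict (tob t) (obs (fibre M i)) = tob (t <* fincl M i)"
    "restrict (tloose t) (looses (fibre M i)) = tloose (t <* fincl M i)"
    by (rule extensionalityI[OF restrict_extensional h.tob_ext],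
        simp add: ttrans_whisker_right[OF J tt] J')
      (rule extensionalityI[OF restrict_extensional h.tloose_ext],
        simp add: ttrans_whisker_right[OF J tt] J')
  then show ?thesis by (simp add: fibre_trans_def)
qed

lemma fibre_trans_simps:
  assumes t: "(M, N, t) \<in> cells2 LBimod"
  shows "fibre_trans i (M, N, t) \<in> cells2 Dbl" "tsrc (fibre_trans i (M, N, t)) = fibre_map i (M, N, tsrc t)"
    "ttgt (fibre_trans i (M, N, t)) = fibre_map i (M, N, ttgt t)"
    "fincl N i *> fibre_trans i (M, N, t) = t <* fincl M i"
proof -
  have M: "M \<in> cells0 LBimod" and N: "N \<in> cells0 LBimod" and m: "(M, N, tsrc t) \<in> cells1 LBimod" "(M, N, ttgt t) \<in> cells1 LBimod"
    and t': "t \<in> cells2 Dbl"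
    using t by simp_all
  note I = fincl_simps[OF M] and s = fibre_map_simps[OF m(1)] and g = fibre_map_simps[OF m(2)]
  have "tight_transformation (fibre M i) (ddom N) (fincl N i oo fibre_map i (M, N, tsrc t))
    (fincl N i oo fibre_map i (M, N, ttgt t)) (t <* fincl M i)"
    unfolding s(4) g(4) using I m t' by (simp add: ttrans_iff)
  from fibre_lift_cell[OF N _ _ this]
  show "fibre_trans i (M, N, t) \<in> cells2 Dbl" "tsrc (fibre_trans i (M, N, t)) = fibre_map i (M, N, tsrc t)"
    "ttgt (fibre_trans i (M, N, t)) = fibre_map i (M, N, ttgt t)"
    "fincl N i *> fibre_trans i (M, N, t) = t <* fincl M i"
    using s(1-3) g(1-3) unfolding fibre_trans_lift[OF t] by (simp_all add: dfun_iff ttrans_iff)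
qed

lemma fibre_dfun_eqI:
  assumes "N \<in> cells0 LBimod" "F \<in> cells1 Dbl" "G \<in> cells1 Dbl" "ddom F = ddom G" "dcod F = fibre N i" "dcod G = fibre N i"
    "fincl N i oo F = fincl N i oo G"
  shows "F = G"
  using fibre_incl_mono[OF assms(1), of "ddom G" F G] assms(2-7) by (simp add: dfun_iff)

lemma fibre_ttrans_eqI:
  assumes "N \<in> cells0 LBimod" "s \<in> cells2 Dbl" "t \<in> cells2 Dbl" "tsrc s = tsrc t" "ttgt s = ttgt t" "dcod (tsrc t) = fibre N i"
    "fincl N i *> s = fincl N i *> t"
  shows "s = t"
  using fibre_incl_faithful[OF assms(1), of "ddom (tsrc t)" "tsrc t" "ttgt t" s t] assms(2-7)
  by (simp add: ttrans_iff)

text \<open>Every law is compared after composing with the inclusion of the target fibre, which is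
  monic on functors and faithful on transformations. There it becomes associativity or a whiskering
  law of \<open>Dbl\<close>.\<close>

lemma two_functor_fibre: "two_functor LBimod Dbl \<lparr>on0 = (\<lambda>M. fibre M i), on1 = fibre_map i, on2 = fibre_trans i\<rparr>"
proof -
  interpret L: two_category LBimod by (rule two_category_LBimod)
  show ?thesis
  proof (rule two_functor.intro[OF two_category_LBimod two_category_Dbl], rule two_functor_axioms.intro,
      unfold twofun.simps Dbl_simps, goal_cases)
    case (1 x)
    then show ?case using fincl_simps(5)[OF 1] by simp
  next
    case (2 f x y)
    then obtain f' where "f = (x, y, f')" "(x, y, f') \<in> cells1 LBimod" by (auto simp only: LBimod_hom1)
    then show ?case using fibre_map_simps[of x y f'] by (simp add: hom1_def)
  next
    case (3 a f g)
    obtain M N f' where f: "f = (M, N, f')" by (cases f)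
    obtain M' N' g' where g: "g = (M', N', g')" by (cases g)
    from 3 f g obtain a' where a: "a = (M, N, a')" "M' = M" "N' = N" "(M, N, a') \<in> cells2 LBimod" "tsrc a' = f'" "ttgt a' = g'"
      by (auto simp only: LBimod_hom2)
    show ?case using fibre_trans_simps[OF a(4)] a(1-3,5,6) f g by (simp add: hom2_def)
  next
    case (4 x)
    have m: "(x, x, dfun_id (ddom x)) \<in> cells1 LBimod" using 4 by simp
    note I = fincl_simps[OF 4] and s = fibre_map_simps[OF m]
    show ?case unfolding LBimod_simps
      by (rule fibre_dfun_eqI[OF 4]) (use I s in simp_all)
  next
    case (5 f x y g z)
    then obtain f' g' where f: "f = (x, y, f')" "(x, y, f') \<in> cells1 LBimod" and g: "g = (y, z, g')" "(y, z, g') \<in> cells1 LBimod"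
      by (auto simp only: LBimod_hom1)
    have x: "x \<in> cells0 LBimod" and y: "y \<in> cells0 LBimod" and z: "z \<in> cells0 LBimod" using f(2) g(2) by simp_all
    have gf: "(x, z, g' oo f') \<in> cells1 LBimod" using L.cmp1_simps[of f g] f g by (auto simp del: LBimod_cells1)
    note F = fibre_map_simps[OF f(2)] and G = fibre_map_simps[OF g(2)] and GF = fibre_map_simps[OF gf]
    note I = fincl_simps(1-3)[OF x] fincl_simps(1-3)[OF y] fincl_simps(1-3)[OF z]
    have c: "f' \<in> cells1 Dbl" "g' \<in> cells1 Dbl" "ddom g' = ddom y" "dcod f' = ddom y" "ddom f' = ddom x"
      using f(2) g(2) by simp_all
    have "fincl z i oo fibre_map i (y, z, g') oo fibre_map i (x, y, f')
      = (fincl z i oo fibre_map i (y, z, g')) oo fibre_map i (x, y, f')"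
      using F(1-3) G(1-3) I by simp
    also have "... = g' oo fincl y i oo fibre_map i (x, y, f')"
      unfolding G(4) using F(1-3) I c by simp
    also have "... = (g' oo f') oo fincl x i"
      unfolding F(4) using I c by simp
    finally show ?case unfolding f(1) g(1) LBimod_simps
      using fibre_dfun_eqI[OF z GF(1), of "fibre_map i (y, z, g') oo fibre_map i (x, y, f')"] F(1-3) G(1-3) GF
      by simp
  next
    case (6 f)
    obtain M N f' where f: "f = (M, N, f')" by (cases f)
    have m: "(M, N, f') \<in> cells1 LBimod" and t: "(M, N, ttrans_id f') \<in> cells2 LBimod" using 6 f by simp_all
    have MN: "M \<in> cells0 LBimod" "N \<in> cells0 LBimod" using m by simp_all
    note s = fibre_trans_simps[OF t] and F = fibre_map_simps[OF m] and I = fincl_simps(1-3)[OF MN(1)] fincl_simps(1-3)[OF MN(2)]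
    show ?case unfolding f LBimod_simps
      by (rule fibre_ttrans_eqI[OF MN(2)]) (use s F I m in simp_all)
  next
    case (7 a f g b h)
    obtain M N f' where f: "f = (M, N, f')" by (cases f)
    obtain a' where a: "a = (M, N, a')" using 7(1) f by (cases g) (auto simp only: LBimod_hom2)
    obtain M' N' b' where b: "b = (M', N', b')" by (cases b)
    have ab: "(M, N, a') \<in> cells2 LBimod" "(M, N, b') \<in> cells2 LBimod" "M' = M" "N' = N" "tsrc b' = ttgt a'"
      using 7 a b by (auto simp: hom2_def simp del: LBimod_cells1)
    have ba: "(M, N, ttrans_vcmp b' a') \<in> cells2 LBimod" using ab by simp
    have MN: "M \<in> cells0 LBimod" "N \<in> cells0 LBimod" using ba by simp_all
    note A = fibre_trans_simps[OF ab(1)] and B = fibre_trans_simps[OF ab(2)] and C = fibre_trans_simps[OF ba]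
    note I = fincl_simps(1-3)[OF MN(1)] fincl_simps(1-3)[OF MN(2)]
    have m: "(M, N, tsrc a') \<in> cells1 LBimod" using ab(1) by simp
    note F = fibre_map_simps[OF m]
    have c: "a' \<in> cells2 Dbl" "b' \<in> cells2 Dbl" "ddom (tsrc a') = ddom M" using ab by simp_all
    have "fincl N i *> ttrans_vcmp (fibre_trans i (M, N, b')) (fibre_trans i (M, N, a'))
      = ttrans_vcmp (fincl N i *> fibre_trans i (M, N, b'))
          (fincl N i *> fibre_trans i (M, N, a'))"
      by (rule Dbl.whisker_vcmp2) (use A(1-3) B(1-3) I F ab in simp_all)
    also have "... = ttrans_vcmp b' a' <* fincl M i"
      unfolding A(4) B(4) by (rule Dbl.whisker_vcmp2(2)[symmetric]) (use c I ab in simp_all)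
    finally show ?case unfolding a b LBimod_simps ab
      using fibre_ttrans_eqI[OF MN(2) C(1), of "ttrans_vcmp (fibre_trans i (M, N, b')) (fibre_trans i (M, N, a'))"]
        A(1-3) B(1-3) C F ab c by simp
  next
    case (8 a f f' b g g')
    obtain M N f0 where f: "f = (M, N, f0)" by (cases f)
    obtain K N' g0 where g: "g = (N', K, g0)" by (cases g)
    obtain a' where a: "a = (M, N, a')" using 8(1) f by (cases f') (auto simp only: LBimod_hom2)
    obtain b' where b: "b = (N', K, b')" using 8(2) g by (cases g') (auto simp only: LBimod_hom2)
    have N: "N' = N" using 8(3) f g by simp
    have ab: "(M, N, a') \<in> cells2 LBimod" "(N, K, b') \<in> cells2 LBimod"
      using 8(1,2) a b N by (simp_all add: hom2_def del: LBimod_cells2)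
    have ba: "(M, K, ttrans_hcmp b' a') \<in> cells2 LBimod"
      using L.hcmp2_simps(1)[of a b] ab a b N by (auto simp del: LBimod_cells2 LBimod_cells1 simp: LBimod_simps)
    have MN: "M \<in> cells0 LBimod" "N \<in> cells0 LBimod" "K \<in> cells0 LBimod" using ab by simp_all
    have m: "(M, N, tsrc a') \<in> cells1 LBimod" "(N, K, tsrc b') \<in> cells1 LBimod"
      "(M, N, ttgt a') \<in> cells1 LBimod" "(N, K, ttgt b') \<in> cells1 LBimod" using ab by simp_all
    note A = fibre_trans_simps[OF ab(1)] and B = fibre_trans_simps[OF ab(2)] and C = fibre_trans_simps[OF ba]
    note F = fibre_map_simps[OF m(1)] fibre_map_simps[OF m(3)] and G = fibre_map_simps[OF m(2)] fibre_map_simps[OF m(4)]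
    note I = fincl_simps(1-3)[OF MN(1)] fincl_simps(1-3)[OF MN(2)] fincl_simps(1-3)[OF MN(3)]
    have c: "a' \<in> cells2 Dbl" "b' \<in> cells2 Dbl" "ddom (tsrc a') = ddom M" "dcod (tsrc a') = ddom N" "ddom (tsrc b') = ddom N"
      "dcod (tsrc b') = ddom K"
      using ab by simp_all
    have cmp: "fibre_map i (M, K, q oo p) = fibre_map i (N, K, q) oo fibre_map i (M, N, p)"
      if p: "(M, N, p) \<in> cells1 LBimod" and q: "(N, K, q) \<in> cells1 LBimod" for p q
    proof -
      have qp: "(M, K, q oo p) \<in> cells1 LBimod"
        using L.cmp1_simps(1)[of "(M, N, p)" "(N, K, q)"] p q by (auto simp del: LBimod_cells1)
      note P = fibre_map_simps[OF p] and Q = fibre_map_simps[OF q] and QP = fibre_map_simps[OF qp]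
      have e: "p \<in> cells1 Dbl" "q \<in> cells1 Dbl" "ddom q = ddom N" "dcod p = ddom N" "ddom p = ddom M"
        using p q by simp_all
      have "fincl K i oo fibre_map i (N, K, q) oo fibre_map i (M, N, p)
        = (fincl K i oo fibre_map i (N, K, q)) oo fibre_map i (M, N, p)"
        using P(1-3) Q(1-3) I by simp
      also have "... = q oo fincl N i oo fibre_map i (M, N, p)"
        unfolding Q(4) using P(1-3) I e by simp
      also have "... = (q oo p) oo fincl M i"
        unfolding P(4) using I e by simp
      finally show ?thesis
        using fibre_dfun_eqI[OF MN(3) QP(1), of "fibre_map i (N, K, q) oo fibre_map i (M, N, p)"] P(1-3) Q(1-3) QP
        by simp
    qed
    have "fincl K i *> ttrans_hcmp (fibre_trans i (N, K, b')) (fibre_trans i (M, N, a'))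
      = ttrans_hcmp (fincl K i *> fibre_trans i (N, K, b')) (fibre_trans i (M, N, a'))"
      by (rule Dbl.hcmp2_assoc'[symmetric]) (use A(1-3) B(1-3) I F G in simp_all)
    also have "... = ttrans_hcmp b' (fincl N i *> fibre_trans i (M, N, a'))"
      unfolding B(4) by (rule Dbl.hcmp2_assoc') (use A(1-3) I F c in simp_all)
    also have "... = ttrans_hcmp b' a' <* fincl M i"
      unfolding A(4) by (rule Dbl.hcmp2_assoc'[symmetric]) (use I c in simp_all)
    finally show ?case unfolding a b LBimod_simps N
      using fibre_ttrans_eqI[OF MN(3) C(1), of "ttrans_hcmp (fibre_trans i (N, K, b')) (fibre_trans i (M, N, a'))"]
        A(1-3) B(1-3) C F G c cmp[OF m(1,2)] cmp[OF m(3,4)] by simp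
  qed
qed

text \<open>Functors from \<open>z\<close> to the fibre of \<open>M\<close> over \<open>i\<close>
  correspond to bimodule maps from \<open>const_Loose z i\<close> to \<open>M\<close>, and likewise
  for 2-cells. The fibre is thus a right adjoint, and its universal property is that of the given
  product at constant bimodules.\<close>

lemma fibre_preserves_product:
  assumes P: "is_product LBimod n X y \<pi>"
  shows "is_product Dbl n (\<lambda>j. fibre (X j) i) (fibre y i) (\<lambda>j. fibre_map i (\<pi> j))"
proof (rule is_productI)
  note L = two_category_LBimod
  have y: "y \<in> cells0 LBimod" and X: "\<And>j. j < n \<Longrightarrow> X j \<in> cells0 LBimod" using is_productD[OF P] by blast+
  have "\<exists>p. \<forall>j<n. \<pi> j = (y, X j, p j) \<and> (y, X j, p j) \<in> cells1 LBimod"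
    using is_productD(3)[OF P] unfolding LBimod_hom1 by meson
  then obtain p where p: "\<And>j. j < n \<Longrightarrow> \<pi> j = (y, X j, p j)" "\<And>j. j < n \<Longrightarrow> (y, X j, p j) \<in> cells1 LBimod" by blast
  have p': "p j \<in> cells1 Dbl" "ddom (p j) = ddom y" "dcod (p j) = ddom (X j)" "X j oo p j = y" if "j < n" for j
    using p(2)[OF that] by simp_all
  note Iy = fincl_simps[OF y] and IX = fincl_simps[OF X]
  note F = fibre_map_simps[OF p(2)]
  show "fibre y i \<in> cells0 Dbl" using Iy(5) by simp
  show "fibre (X j) i \<in> cells0 Dbl" if "j < n" for j using IX(5)[OF that] by simp
  show "fibre_map i (\<pi> j) \<in> hom1 Dbl (fibre y i) (fibre (X j) i)" if "j < n" for j
    using F[OF that] p(1)[OF that] by (simp add: hom1_def)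
  have inc: "p j oo fincl y i oo h = fincl (X j) i oo fibre_map i (\<pi> j) oo h"
    if "j < n" "h \<in> cells1 Dbl" "dcod h = fibre y i" for j h
  proof -
    have "p j oo fincl y i oo h = (p j oo fincl y i) oo h"
      using that p'[OF that(1)] Iy by simp
    also have "... = fincl (X j) i oo fibre_map i (\<pi> j) oo h"
      using that F(1-3)[OF that(1)] IX(1-3)[OF that(1)] by (simp add: p(1) flip: F(4))
    finally show ?thesis .
  qed
  have inc2: "p j *> fincl y i *> c
      = fincl (X j) i *> fibre_map i (\<pi> j) *> c"
    if "j < n" "c \<in> cells2 Dbl" "dcod (tsrc c) = fibre y i" for j c
  proof -
    have "p j *> fincl y i *> c
      = (p j oo fincl y i) *> c"
      by (rule Dbl.whisker_cmp1[symmetric]) (use that p'[OF that(1)] Iy in simp_all)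
    also have "... = fincl (X j) i *> fibre_map i (\<pi> j) *> c"
      unfolding F(4)[OF that(1), symmetric] p(1)[OF that(1)]
      by (rule Dbl.whisker_cmp1) (use that F(1-3)[OF that(1)] IX(1-3)[OF that(1)] in simp_all)
    finally show ?thesis .
  qed
  \<comment> \<open>One direction of the adjunction: a functor to the fibre, followed by the
    inclusion, lies over the constant functor at \<open>i\<close>.\<close>
  have cone: "(const_Loose z i, y, fincl y i oo h) \<in> cells1 LBimod" if "h \<in> hom1 Dbl z (fibre y i)" for h z
  proof -
    have h: "double_functor z (fibre y i) h" using that by (simp add: hom1_Dbl)
    have "y oo fincl y i oo h = (y oo fincl y i) oo h"
      using h y Iy(1-3) by (simp add: dfun_iff)
    also have "... = const_Loose z i" unfolding Iy(4) by (rule const_Loose_cmp[OF h i])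
    finally show ?thesis using h y Iy(1-3) i dfun_cats(1)[OF h] by (simp add: dfun_iff)
  qed
  have proj: "cmp1 LBimod (\<pi> j) (const_Loose z i, y, fincl y i oo h)
      = (const_Loose z i, X j, fincl (X j) i oo fibre_map i (\<pi> j) oo h)"
    if "h \<in> hom1 Dbl z (fibre y i)" "j < n" for h z j
    using inc[OF that(2), of h] that p(1)[OF that(2)] by (simp add: hom1_def)
  {
    fix z f assume z: "z \<in> cells0 Dbl" and f: "\<And>j. j < n \<Longrightarrow> f j \<in> hom1 Dbl z (fibre (X j) i)"
    have f': "f j \<in> cells1 Dbl" "ddom (f j) = z" "dcod (f j) = fibre (X j) i" if "j < n" for j
      using f[OF that] by (simp_all add: hom1_def)
    have "(const_Loose z i, X j, fincl (X j) i oo f j) \<in> hom1 LBimod (const_Loose z i) (X j)" if "j < n" for j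
    proof -
      have "X j oo fincl (X j) i oo f j = (X j oo fincl (X j) i) oo f j"
        using f'[OF that] X[OF that] IX(1-3)[OF that] by simp
      also have "... = const_Loose z i"
        unfolding IX(4)[OF that] by (rule const_Loose_cmp) (use f'[OF that] i in \<open>simp_all add: dfun_iff\<close>)
      finally show ?thesis using f'[OF that] X[OF that] IX(1-3)[OF that] z i by (simp add: hom1_def)
    qed
    moreover have "const_Loose z i \<in> cells0 LBimod" using z i by simp
    ultimately obtain h where h: "h \<in> hom1 LBimod (const_Loose z i) y"
      "\<And>j. j < n \<Longrightarrow> cmp1 LBimod (\<pi> j) h = (const_Loose z i, X j, fincl (X j) i oo f j)"
      using product_map[OF P, of "const_Loose z i" "\<lambda>j. (const_Loose z i, X j, fincl (X j) i oo f j)"] by blast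
    then obtain h' where h': "h = (const_Loose z i, y, h')" "(const_Loose z i, y, h') \<in> cells1 LBimod" by (auto simp only: LBimod_hom1)
    have "double_functor z (ddom y) h'" "y oo h' = const_Loose z i" using h'(2) by (simp_all add: dfun_iff)
    from fibre_lift[OF y this] obtain k where k: "k \<in> hom1 Dbl z (fibre y i)" "fincl y i oo k = h'"
      by (auto simp: hom1_Dbl)
    have "fibre_map i (\<pi> j) oo k = f j" if j: "j < n" for j
    proof (rule fibre_dfun_eqI[OF X[OF j]])
      show "fincl (X j) i oo fibre_map i (\<pi> j) oo k = fincl (X j) i oo f j"
        using proj[OF k(1) j] h(2)[OF j] h'(1) k(2) by simp
    qed (use k(1) f'[OF j] F(1-3)[OF j] p(1)[OF j] in \<open>simp_all add: hom1_def\<close>)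
    with k(1) show "\<exists>h\<in>hom1 Dbl z (fibre y i). \<forall>j<n. cmp1 Dbl (fibre_map i (\<pi> j)) h = f j" by auto
  next
    fix z h k assume hk: "h \<in> hom1 Dbl z (fibre y i)" "k \<in> hom1 Dbl z (fibre y i)"
      and e: "\<And>j. j < n \<Longrightarrow> cmp1 Dbl (fibre_map i (\<pi> j)) h = cmp1 Dbl (fibre_map i (\<pi> j)) k"
    have "(const_Loose z i, y, fincl y i oo h) = (const_Loose z i, y, fincl y i oo k)"
    proof (rule product_map_unique[OF P L, of _ "const_Loose z i"])
      show "cmp1 LBimod (\<pi> j) (const_Loose z i, y, fincl y i oo h)
        = cmp1 LBimod (\<pi> j) (const_Loose z i, y, fincl y i oo k)" if "j < n" for j
        using proj[OF hk(1) that] proj[OF hk(2) that] e[OF that] by simp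
    qed (use cone[OF hk(1)] cone[OF hk(2)] in \<open>auto simp only: LBimod_hom1\<close>)
    then show "h = k" using fibre_dfun_eqI[OF y, of h k] hk by (simp add: hom1_def)
  next
    fix z h k a assume hk: "h \<in> hom1 Dbl z (fibre y i)" "k \<in> hom1 Dbl z (fibre y i)"
      and a: "\<And>j. j < n \<Longrightarrow> a j \<in> hom2 Dbl (cmp1 Dbl (fibre_map i (\<pi> j)) h) (cmp1 Dbl (fibre_map i (\<pi> j)) k)"
    have a': "a j \<in> cells2 Dbl" "tsrc (a j) = fibre_map i (\<pi> j) oo h" "ttgt (a j) = fibre_map i (\<pi> j) oo k"
      if "j < n" for j using a[OF that] by (simp_all add: hom2_def)
    have hk': "h \<in> cells1 Dbl" "ddom h = z" "dcod h = fibre y i" "k \<in> cells1 Dbl" "ddom k = z" "dcod k = fibre y i"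
      using hk by (simp_all add: hom1_def)
    let ?h = "(const_Loose z i, y, fincl y i oo h)" and ?k = "(const_Loose z i, y, fincl y i oo k)"
    let ?a = "\<lambda>j. (const_Loose z i, X j, fincl (X j) i *> a j)"
    have "?a j \<in> hom2 LBimod (cmp1 LBimod (\<pi> j) ?h) (cmp1 LBimod (\<pi> j) ?k)" if j: "j < n" for j
    proof -
      have "cmp1 LBimod (\<pi> j) ?h \<in> cells1 LBimod" "cmp1 LBimod (\<pi> j) ?k \<in> cells1 LBimod"
        using two_category.cmp1_simps(1)[OF L, of ?h "\<pi> j"] two_category.cmp1_simps(1)[OF L, of ?k "\<pi> j"]
          cone[OF hk(1)] cone[OF hk(2)] p(2)[OF j] by (auto simp only: p(1)[OF j] LBimod_simps)
      then show ?thesis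
        using a'[OF j] F(1-3)[OF j] IX(1-3)[OF j] hk' unfolding proj[OF hk(1) j] proj[OF hk(2) j]
        by (simp add: hom2_def p(1)[OF j] del: LBimod_cells1)
    qed
    then obtain c where c: "c \<in> hom2 LBimod ?h ?k" "\<And>j. j < n \<Longrightarrow> hcmp2 LBimod (id2 LBimod (\<pi> j)) c = ?a j"
      using product_cell[OF P L, of ?h "const_Loose z i" ?k ?a] cone[OF hk(1)] cone[OF hk(2)] unfolding LBimod_hom1 by blast
    then obtain c' where c': "c = (const_Loose z i, y, c')" "c' \<in> cells2 Dbl" "tsrc c' = fincl y i oo h"
      "ttgt c' = fincl y i oo k"
      unfolding LBimod_hom2 by (auto simp only: LBimod_cells2)
    then have "tight_transformation z (ddom y) (fincl y i oo h) (fincl y i oo k) c'"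
      using hk' Iy(1-3) by (simp add: ttrans_iff)
    from fibre_lift_cell[OF y _ _ this] obtain d where d: "d \<in> hom2 Dbl h k" "fincl y i *> d = c'"
      using hk' by (auto simp: hom2_Dbl dfun_iff)
    have d': "d \<in> cells2 Dbl" "tsrc d = h" "ttgt d = k" using d(1) by (simp_all add: hom2_def)
    have "fibre_map i (\<pi> j) *> d = a j" if j: "j < n" for j
    proof (rule fibre_ttrans_eqI[OF X[OF j]])
      show "fincl (X j) i *> fibre_map i (\<pi> j) *> d
        = fincl (X j) i *> a j"
        using inc2[OF j d'(1)] c(2)[OF j] c'(1) d(2) d'(2) hk' p(1)[OF j] by simp
    qed (use d' a'[OF j] hk' F(1-3)[OF j] p(1)[OF j] in simp_all)
    with d(1) show "\<exists>c\<in>hom2 Dbl h k. \<forall>j<n. hcmp2 Dbl (id2 Dbl (fibre_map i (\<pi> j))) c = a j" by auto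
  next
    fix z h k c d assume hk: "h \<in> hom1 Dbl z (fibre y i)" "k \<in> hom1 Dbl z (fibre y i)"
      and cd: "c \<in> hom2 Dbl h k" "d \<in> hom2 Dbl h k"
      and e: "\<And>j. j < n \<Longrightarrow> hcmp2 Dbl (id2 Dbl (fibre_map i (\<pi> j))) c = hcmp2 Dbl (id2 Dbl (fibre_map i (\<pi> j))) d"
    have hk': "h \<in> cells1 Dbl" "ddom h = z" "dcod h = fibre y i" "k \<in> cells1 Dbl" "ddom k = z" "dcod k = fibre y i"
      using hk by (simp_all add: hom1_def)
    have cd': "c \<in> cells2 Dbl" "tsrc c = h" "ttgt c = k" "d \<in> cells2 Dbl" "tsrc d = h" "ttgt d = k"
      using cd by (simp_all add: hom2_def)
    let ?h = "(const_Loose z i, y, fincl y i oo h)" and ?k = "(const_Loose z i, y, fincl y i oo k)"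
    let ?c = "\<lambda>c. (const_Loose z i, y, fincl y i *> c)"
    have "?c c = ?c d"
    proof (rule product_cell_unique[OF P L, of ?h "const_Loose z i" ?k])
      show "?c c \<in> hom2 LBimod ?h ?k" "?c d \<in> hom2 LBimod ?h ?k"
        using cone[OF hk(1)] cone[OF hk(2)] cd' hk' Iy(1-3) by (simp_all add: hom2_def del: LBimod_cells1)
      show "hcmp2 LBimod (id2 LBimod (\<pi> j)) (?c c) = hcmp2 LBimod (id2 LBimod (\<pi> j)) (?c d)" if j: "j < n" for j
        using inc2[OF j cd'(1)] inc2[OF j cd'(4)] e[OF j] cd' hk' p(1)[OF j] by simp
    qed (use cone[OF hk(1)] cone[OF hk(2)] in \<open>auto simp only: LBimod_hom1\<close>)
    then show "c = d" using fibre_ttrans_eqI[OF y, of c d] cd' hk' by simp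
  }
qed

end

section \<open>Finite products of loose bimodules\<close>

lemma LB_hom1E:
  assumes "F \<in> hom1 LBimod M N"
  obtains f where "F = (M, N, f)" "(M, N, f) \<in> cells1 LBimod"
  using assms unfolding LBimod_hom1 by blast

text \<open>The product in the slice over \<open>Loose\<close> is a pullback over
  \<open>Loose\<close>. It can be cut out of the product of the domains by objects and loose arrows
  alone, since images in \<open>Loose\<close> are constant along tight arrows and squares.\<close>

lemma product_square_saturated:
  assumes M: "double_functor A Loose M" and N: "double_functor B Loose N"
  shows "saturated (prod_dbl A B) {u \<in> obs (prod_dbl A B). fob M (pfst u) = fob N (psnd u)}
    {u \<in> looses (prod_dbl A B). floose M (pfst u) = floose N (psnd u)}"
proof -
  interpret M: over_Loose A M by (simp add: over_Loose_def M)
  interpret N: over_Loose B N by (simp add: over_Loose_def N)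
  interpret P: double_category "prod_dbl A B"
    by (rule double_category_prod[OF M.A.double_category_axioms N.A.double_category_axioms])
  have "fob M (ldom A a) = fob N (ldom B b)" "fob M (lcod A a) = fob N (lcod B b)"
    if "floose M a = floose N b" "a \<in> looses A" "b \<in> looses B" for a b
    using that M.floose_simps(2,3) N.floose_simps(2,3) by metis+
  then show ?thesis
    by unfold_locales (auto simp: M.over_apply N.over_apply)
qed

lemma prod_dfun_eqI:
  assumes "double_category D" "double_category E" "F \<in> cells1 Dbl" "G \<in> cells1 Dbl" "ddom F = ddom G"
    "dcod F = prod_dbl D E" "dcod G = prod_dbl D E"
    "fst_dfun D E oo F = fst_dfun D E oo G" "snd_dfun D E oo F = snd_dfun D E oo G"
  shows "F = G"
  using dfun_prod_eqI[OF assms(1,2), of "ddom G" F G] assms(3-9) by (simp add: dfun_iff)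

lemma prod_ttrans_eqI:
  assumes "double_category D" "double_category E" "s \<in> cells2 Dbl" "t \<in> cells2 Dbl" "tsrc s = tsrc t" "ttgt s = ttgt t"
    "dcod (tsrc t) = prod_dbl D E"
    "fst_dfun D E *> s = fst_dfun D E *> t"
    "snd_dfun D E *> s = snd_dfun D E *> t"
  shows "s = t"
  using ttrans_prod_eqI[OF assms(1,2), of "ddom (tsrc t)" "tsrc t" "ttgt t" s t] assms(3-9)
  by (simp add: ttrans_iff)

lemma proj_cells1 [simp]:
  "\<lbrakk>double_category D; double_category E\<rbrakk> \<Longrightarrow> fst_dfun D E \<in> cells1 Dbl"
  "\<lbrakk>double_category D; double_category E\<rbrakk> \<Longrightarrow> snd_dfun D E \<in> cells1 Dbl"
  using double_functor_fst[of D E] double_functor_snd[of D E] by (simp_all add: dfun_iff)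

text \<open>The product bimodule is the pullback \<open>?S\<close> of \<open>M\<close> and
  \<open>N\<close> with the common composite \<open>q\<close> to \<open>Loose\<close>. Maps into it
  are pairings that factor through the inclusion \<open>I\<close>, and \<open>I\<close> being monic
  and faithful reduces uniqueness to the product of the domains.\<close>

lemma LBimod_binary_product:
  assumes M: "M \<in> cells0 LBimod" and N: "N \<in> cells0 LBimod"
  shows "\<exists>y \<pi>. is_product LBimod 2 (\<lambda>i. if i = 0 then M else N) y \<pi>"
proof -
  let ?A = "ddom M" and ?B = "ddom N"
  note Md = LBimod_obj_functor[OF M] and Nd = LBimod_obj_functor[OF N]
  note MN [simp] = M[simplified] N[simplified]
  have cats [simp]: "double_category ?A" "double_category ?B" by simp_all
  interpret S: saturated "prod_dbl ?A ?B" "{u \<in> obs (prod_dbl ?A ?B). fob M (pfst u) = fob N (psnd u)}"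
    "{u \<in> looses (prod_dbl ?A ?B). floose M (pfst u) = floose N (psnd u)}"
    by (rule product_square_saturated[OF Md Nd])
  define I where "I = S.incl"
  let ?S = "S.S" and ?p = "fst_dfun ?A ?B oo I" and ?r = "snd_dfun ?A ?B oo I"
  have I [simp]: "I \<in> cells1 Dbl" "ddom I = ?S" "dcod I = prod_dbl ?A ?B" unfolding I_def by (rule S.incl_simps)+
  have Id: "double_functor ?S (prod_dbl ?A ?B) I" unfolding I_def by (rule S.double_functor_incl)
  have Ia: "x \<in> obs ?S \<Longrightarrow> fob I x = x" "l \<in> looses ?S \<Longrightarrow> floose I l = l" for x l
    unfolding I_def by (simp_all only: S.incl_apply sub_dbl_sel(1,3))
  define q where "q = M oo ?p"
  have q [simp]: "q \<in> cells1 Dbl" "ddom q = ?S" "dcod q = Loose" by (simp_all add: q_def)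
  have qd: "double_functor ?S Loose q" by (simp add: dfun_iff)
  have pd: "double_functor ?S ?A ?p" and rd: "double_functor ?S ?B ?r" by (simp_all add: dfun_iff)
  have q2: "N oo ?r = q"
    unfolding q_def
  proof (rule dfun_Loose_eqI[OF dfun_cmp_in[OF rd Nd] dfun_cmp_in[OF pd Md]])
    show "fob (N oo ?r) x = fob (M oo ?p) x" if "x \<in> obs ?S" for x
      using that
      by (simp add: dfun_cmp_apply[OF rd] dfun_cmp_apply[OF pd] fst_cmp_apply[OF Id] snd_cmp_apply[OF Id] Ia)
    show "floose (N oo ?r) x = floose (M oo ?p) x" if "x \<in> looses ?S" for x
      using that
      by (simp add: dfun_cmp_apply[OF rd] dfun_cmp_apply[OF pd] fst_cmp_apply[OF Id] snd_cmp_apply[OF Id] Ia)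
  qed
  let ?\<pi> = "\<lambda>i::nat. if i = 0 then (q, M, ?p) else (q, N, ?r)"
  have \<pi>: "(q, M, ?p) \<in> cells1 LBimod" "(q, N, ?r) \<in> cells1 LBimod"
    using q2 by (simp_all add: q_def[symmetric])
  have K: "h \<in> hom1 LBimod z q \<longleftrightarrow> (\<exists>K. h = (z, q, K) \<and> K \<in> cells1 Dbl \<and> ddom K = ddom z \<and> dcod K = ?S \<and>
      z \<in> cells1 Dbl \<and> dcod z = Loose \<and> q oo K = z)" for h z
    unfolding LBimod_hom1 LBimod_cells1 q by auto
  have mono: "K = K'" if "K \<in> cells1 Dbl" "K' \<in> cells1 Dbl" "ddom K = ddom K'" "dcod K = ?S" "dcod K' = ?S"
    "?p oo K = ?p oo K'" "?r oo K = ?r oo K'" for K K'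
  proof -
    have "I oo K = I oo K'"
      by (rule prod_dfun_eqI[OF cats]) (use that in simp_all)
    then show ?thesis
      using S.incl_mono[of "ddom K'" K K'] that by (simp add: dfun_iff I_def)
  qed
  have whisk: "(F oo I) *> d = F *> I *> d"
    if "F \<in> cells1 Dbl" "ddom F = prod_dbl ?A ?B" "d \<in> cells2 Dbl" "dcod (tsrc d) = ?S" for F d
    by (rule Dbl.whisker_cmp1) (use that in simp_all)
  have "is_product LBimod 2 (\<lambda>i. if i = 0 then M else N) q ?\<pi>"
  proof (rule is_productI)
    fix z and f :: "nat \<Rightarrow> _" assume z: "z \<in> cells0 LBimod"
      and f: "\<And>i. i < (2::nat) \<Longrightarrow> f i \<in> hom1 LBimod z (if i = 0 then M else N)"
    have "f 0 \<in> hom1 LBimod z M" "f 1 \<in> hom1 LBimod z N" using f[of 0] f[of 1] by simp_all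
    then obtain F G where F: "f 0 = (z, M, F)" "(z, M, F) \<in> cells1 LBimod" and G: "f 1 = (z, N, G)" "(z, N, G) \<in> cells1 LBimod"
      by (elim LB_hom1E)
    have Fd: "double_functor (ddom z) ?A F" and Gd: "double_functor (ddom z) ?B G" and FG: "M oo F = z" "N oo G = z"
      using F(2) G(2) by (simp_all add: dfun_iff)
    interpret F: double_functor "ddom z" ?A F by (rule Fd)
    interpret G: double_functor "ddom z" ?B G by (rule Gd)
    note H = double_functor_pair[OF Fd Gd]
    \<comment> \<open>\<open>M oo F\<close> and \<open>N oo G\<close> both equal \<open>z\<close>,
      so the pairing lands in the pullback; this is where the two components have to be maps over
      \<open>Loose\<close>.\<close>
    have "fob (pair_dfun F G) x \<in> {u \<in> obs (prod_dbl ?A ?B). fob M (pfst u) = fob N (psnd u)}" if "x \<in> obs (ddom z)" for x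
      using that dfun_cmp_apply(1)[OF Fd that, of M] dfun_cmp_apply(1)[OF Gd that, of N] FG
      by (simp add: pair_dfun_apply[OF Fd])
    moreover have "floose (pair_dfun F G) x \<in> {u \<in> looses (prod_dbl ?A ?B). floose M (pfst u) = floose N (psnd u)}"
      if "x \<in> looses (ddom z)" for x
      using that dfun_cmp_apply(3)[OF Fd that, of M] dfun_cmp_apply(3)[OF Gd that, of N] FG
      by (simp add: pair_dfun_apply[OF Fd])
    ultimately obtain K where K': "K \<in> cells1 Dbl" "ddom K = ddom z" "dcod K = ?S" "I oo K = pair_dfun F G"
      using S.sub_lift[OF H] by (auto simp: dfun_iff I_def)
    have e: "?p oo K = F" "?r oo K = G"
      using K' fst_pair_dfun[OF Fd Gd] snd_pair_dfun[OF Fd Gd] by simp_all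
    have "q oo K = z" using e(1) FG(1) K'(1-3) by (simp add: q_def)
    then have "(z, q, K) \<in> hom1 LBimod z q" using z K'(1-3) unfolding K by simp
    moreover have "\<forall>i<2. cmp1 LBimod (?\<pi> i) (z, q, K) = f i" using e F(1) G(1) by (auto simp: less_2_cases_iff)
    ultimately show "\<exists>h\<in>hom1 LBimod z q. \<forall>i<2. cmp1 LBimod (?\<pi> i) h = f i" by blast
  next
    fix z h k assume hk: "h \<in> hom1 LBimod z q" "k \<in> hom1 LBimod z q"
      and e: "\<And>i. i < (2::nat) \<Longrightarrow> cmp1 LBimod (?\<pi> i) h = cmp1 LBimod (?\<pi> i) k"
    obtain K1 where K1: "h = (z, q, K1)" "K1 \<in> cells1 Dbl" "ddom K1 = ddom z" "dcod K1 = ?S" using hk(1) unfolding K by auto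
    obtain K2 where K2: "k = (z, q, K2)" "K2 \<in> cells1 Dbl" "ddom K2 = ddom z" "dcod K2 = ?S" using hk(2) unfolding K by auto
    have e': "?p oo K1 = ?p oo K2" "?r oo K1 = ?r oo K2"
      using e[of 0] e[of 1] unfolding K1(1) K2(1) by simp_all
    have "K1 = K2" by (rule mono[OF _ _ _ _ _ e']) (use K1 K2 in simp_all)
    then show "h = k" using K1 K2 by simp
  next
    fix z h k and a :: "nat \<Rightarrow> _" assume hk: "h \<in> hom1 LBimod z q" "k \<in> hom1 LBimod z q"
      and a: "\<And>i. i < (2::nat) \<Longrightarrow> a i \<in> hom2 LBimod (cmp1 LBimod (?\<pi> i) h) (cmp1 LBimod (?\<pi> i) k)"
    obtain K1 where K1: "h = (z, q, K1)" "K1 \<in> cells1 Dbl" "ddom K1 = ddom z" "dcod K1 = ?S" "q oo K1 = z"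
      "z \<in> cells1 Dbl" "dcod z = Loose" using hk(1) unfolding K by auto
    obtain K2 where K2: "k = (z, q, K2)" "K2 \<in> cells1 Dbl" "ddom K2 = ddom z" "dcod K2 = ?S" "q oo K2 = z"
      using hk(2) unfolding K by auto
    obtain s where s: "a 0 = (z, M, s)" "s \<in> cells2 Dbl" "tsrc s = ?p oo K1" "ttgt s = ?p oo K2"
      using a[of 0] unfolding K1(1) K2(1) by (auto simp: LBimod_hom2 simp del: Dbl.cmp1_assoc')
    obtain t where t: "a 1 = (z, N, t)" "t \<in> cells2 Dbl" "tsrc t = ?r oo K1" "ttgt t = ?r oo K2"
      using a[of 1] unfolding K1(1) K2(1) by (auto simp: LBimod_hom2 simp del: Dbl.cmp1_assoc')
    have d: "double_functor (ddom z) (prod_dbl ?A ?B) (I oo K1)" "double_functor (ddom z) (prod_dbl ?A ?B) (I oo K2)"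
      "tight_transformation (ddom z) ?A (fst_dfun ?A ?B oo I oo K1) (fst_dfun ?A ?B oo I oo K2) s"
      "tight_transformation (ddom z) ?B (snd_dfun ?A ?B oo I oo K1) (snd_dfun ?A ?B oo I oo K2) t"
      using K1 K2 s t by (simp_all add: dfun_iff ttrans_iff)
    note c = ttrans_pair_in[OF cats d]
    have "double_functor (ddom z) ?S K1" "double_functor (ddom z) ?S K2" using K1 K2 by (simp_all add: dfun_iff)
    from S.sub_lift_cell[OF this, folded I_def, OF c(1)] obtain d where
      d: "d \<in> cells2 Dbl" "tsrc d = K1" "ttgt d = K2" "I *> d = pair_ttrans (I oo K1) (I oo K2) s t"
      by (auto simp: ttrans_iff)
    have e: "?p *> d = s" "?r *> d = t"
      using d c(2,3) K1 whisk[of "fst_dfun ?A ?B" d] whisk[of "snd_dfun ?A ?B" d] by simp_all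
    have "(z, q, d) \<in> hom2 LBimod h k" using d K1 K2 by (simp add: hom2_def)
    moreover have "\<forall>i<2. hcmp2 LBimod (id2 LBimod (?\<pi> i)) (z, q, d) = a i"
      using e s(1) t(1) by (auto simp: less_2_cases_iff)
    ultimately show "\<exists>c\<in>hom2 LBimod h k. \<forall>i<2. hcmp2 LBimod (id2 LBimod (?\<pi> i)) c = a i" by blast
  next
    fix z h k c d assume hk: "h \<in> hom1 LBimod z q" "k \<in> hom1 LBimod z q" and cd: "c \<in> hom2 LBimod h k" "d \<in> hom2 LBimod h k"
      and e: "\<And>i. i < (2::nat) \<Longrightarrow> hcmp2 LBimod (id2 LBimod (?\<pi> i)) c = hcmp2 LBimod (id2 LBimod (?\<pi> i)) d"
    obtain K1 where K1: "h = (z, q, K1)" "K1 \<in> cells1 Dbl" "ddom K1 = ddom z" "dcod K1 = ?S" using hk(1) unfolding K by auto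
    obtain K2 where K2: "k = (z, q, K2)" "K2 \<in> cells1 Dbl" "ddom K2 = ddom z" "dcod K2 = ?S" using hk(2) unfolding K by auto
    obtain c' where c: "c = (z, q, c')" "c' \<in> cells2 Dbl" "tsrc c' = K1" "ttgt c' = K2"
      using cd(1) unfolding K1(1) K2(1) by (auto simp: LBimod_hom2)
    obtain d' where d: "d = (z, q, d')" "d' \<in> cells2 Dbl" "tsrc d' = K1" "ttgt d' = K2"
      using cd(2) unfolding K1(1) K2(1) by (auto simp: LBimod_hom2)
    have e': "?p *> c' = ?p *> d'" "?r *> c' = ?r *> d'"
      using e[of 0] e[of 1] unfolding c(1) d(1) by simp_all
    have "I *> c' = I *> d'"
      by (rule prod_ttrans_eqI[OF cats])
        (use c d K1 K2 e' whisk[of _ c'] whisk[of _ d'] in \<open>simp_all del: Dbl.hcmp2_id'\<close>)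
    moreover have "tight_transformation (ddom z) ?S K1 K2 c'" "tight_transformation (ddom z) ?S K1 K2 d'"
      using c d K1 K2 by (simp_all add: ttrans_iff)
    ultimately show "c = d" using S.incl_faithful[of "ddom z" K1 K2 c' d'] c(1) d(1) by (simp add: I_def)
  qed (use \<pi> in \<open>auto simp: LBimod_hom1 simp del: LBimod_cells1\<close>)
  then show ?thesis by blast
qed

lemma cartesian_LBimod: "cartesian_two_category LBimod"
proof (rule cartesianI[OF two_category_LBimod _ LBimod_binary_product])
  show "\<exists>y \<pi>. is_product LBimod 0 X y \<pi>" for X :: "nat \<Rightarrow> 'a dfun"
    unfolding LBimod_def using slice_terminal[OF two_category_Dbl, of Loose] double_category_Loose by auto
qed

lemma cartesian_Dbl: "cartesian_two_category (Dbl :: ('u::infinite dbl, 'u dfun, 'u ttrans) twocat)"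
proof (rule cartesianI[OF two_category_Dbl])
  show "\<exists>y \<pi>. is_product Dbl 0 X y \<pi>" for X :: "nat \<Rightarrow> 'u dbl"
    using Pt_is_product by blast
  show "\<exists>y \<pi>. is_product Dbl 2 (\<lambda>i. if i = 0 then a else b) y \<pi>" if "a \<in> cells0 Dbl" "b \<in> cells0 Dbl" for a b :: "'u dbl"
    using prod_dbl_is_product[of a b] that by auto
qed

section \<open>The loose hom bimodule as a product-preserving 2-functor\<close>

lemmas Loose_cat [simp] = double_category_Loose

lemma HomL_eq: "HomL D = snd_dfun D Loose"
  by (simp add: HomL_def snd_dfun_def)

lemma HomL_simps [simp]:
  "double_category D \<Longrightarrow> HomL D \<in> cells1 Dbl" "ddom (HomL D) = prod_dbl D Loose" "dcod (HomL D) = Loose"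
  by (simp_all add: HomL_eq)

text \<open>The functor \<open>f \<times> Loose\<close>, written as a pairing so that its
  projections come from \<open>fst_pair_dfun\<close> and \<open>snd_pair_dfun\<close>. It inherits
  the comparison squares of \<open>f\<close>, so it is in general not strict.\<close>

definition times_L :: "'u::infinite dfun \<Rightarrow> 'u dfun" where
  "times_L f = pair_dfun (f oo fst_dfun (ddom f) Loose) (HomL (ddom f))"

definition HomL_map :: "'u::infinite dfun \<Rightarrow> 'u dfun \<times> 'u dfun \<times> 'u dfun" where
  "HomL_map f = (HomL (ddom f), HomL (dcod f), times_L f)"

definition times_L_cell :: "'u::infinite ttrans \<Rightarrow> 'u ttrans" where
  "times_L_cell a = pair_ttrans (times_L (tsrc a)) (times_L (ttgt a))
     (a <* fst_dfun (ddom (tsrc a)) Loose) (ttrans_id (HomL (ddom (tsrc a))))"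

definition HomL_cell :: "'u::infinite ttrans \<Rightarrow> 'u dfun \<times> 'u dfun \<times> 'u ttrans" where
  "HomL_cell a = (HomL (ddom (tsrc a)), HomL (dcod (tsrc a)), times_L_cell a)"

lemma times_Loose_simps [simp]:
  assumes "f \<in> cells1 Dbl"
  shows "times_L f \<in> cells1 Dbl" "ddom (times_L f) = prod_dbl (ddom f) Loose"
    "dcod (times_L f) = prod_dbl (dcod f) Loose"
    "fst_dfun (dcod f) Loose oo times_L f = f oo fst_dfun (ddom f) Loose"
    "HomL (dcod f) oo times_L f = HomL (ddom f)"
proof -
  let ?P = "prod_dbl (ddom f) Loose"
  have F: "double_functor ?P (dcod f) (f oo fst_dfun (ddom f) Loose)" and G: "double_functor ?P Loose (HomL (ddom f))"
    using assms by (simp_all add: dfun_iff)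
  show "times_L f \<in> cells1 Dbl" "ddom (times_L f) = ?P" "dcod (times_L f) = prod_dbl (dcod f) Loose"
    using double_functor_pair[OF F G] by (simp_all add: times_L_def dfun_iff)
  show "fst_dfun (dcod f) Loose oo times_L f = f oo fst_dfun (ddom f) Loose"
    "HomL (dcod f) oo times_L f = HomL (ddom f)"
    using fst_pair_dfun[OF F G] snd_pair_dfun[OF F G] by (simp_all add: times_L_def HomL_eq)
qed

text \<open>Composites are kept nested to the right; a projection of \<open>times_L f\<close> is
  then usually met in front of a further functor \<open>h\<close>, and the projection equations are
  needed in that shape.\<close>

lemma times_Loose_proj_cmp [simp]:
  assumes "f \<in> cells1 Dbl" "h \<in> cells1 Dbl" "dcod h = prod_dbl (ddom f) Loose"
  shows "dcod f = D \<Longrightarrow> fst_dfun D Loose oo times_L f oo h = f oo fst_dfun (ddom f) Loose oo h"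
    "dcod f = D \<Longrightarrow> HomL D oo times_L f oo h = HomL (ddom f) oo h"
proof -
  have "fst_dfun (dcod f) Loose oo times_L f oo h = (fst_dfun (dcod f) Loose oo times_L f) oo h"
    by (rule Dbl.cmp1_assoc'[symmetric]) (use assms in simp_all)
  moreover have "HomL (dcod f) oo times_L f oo h = (HomL (dcod f) oo times_L f) oo h"
    by (rule Dbl.cmp1_assoc'[symmetric]) (use assms in simp_all)
  ultimately show "dcod f = D \<Longrightarrow> fst_dfun D Loose oo times_L f oo h = f oo fst_dfun (ddom f) Loose oo h"
    "dcod f = D \<Longrightarrow> HomL D oo times_L f oo h = HomL (ddom f) oo h"
    using assms by auto
qed

lemma times_dfun_eqI:
  assumes "double_category D" "F \<in> cells1 Dbl" "G \<in> cells1 Dbl" "ddom F = ddom G"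
    "dcod F = prod_dbl D Loose" "dcod G = prod_dbl D Loose"
    "fst_dfun D Loose oo F = fst_dfun D Loose oo G" "HomL D oo F = HomL D oo G"
  shows "F = G"
  using prod_dfun_eqI[OF assms(1) Loose_cat assms(2-7)] assms(8) by (simp add: HomL_eq)

text \<open>Only the projection to \<open>D\<close> has to be compared: after the other projection
  both cells are transformations into \<open>Loose\<close> with the same source, hence the same
  identity.\<close>

lemma times_ttrans_eqI:
  assumes "double_category D" "s \<in> cells2 Dbl" "t \<in> cells2 Dbl" "tsrc s = tsrc t" "ttgt s = ttgt t"
    "dcod (tsrc t) = prod_dbl D Loose"
    "fst_dfun D Loose *> s = fst_dfun D Loose *> t"
  shows "s = t"
proof (rule prod_ttrans_eqI[OF assms(1) Loose_cat assms(2-7)])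
  show "snd_dfun D Loose *> s = snd_dfun D Loose *> t"
    using cell_Loose[of "snd_dfun D Loose *> s"]
      cell_Loose[of "snd_dfun D Loose *> t"] assms(1-6) by simp
qed

lemma times_Loose_cell_simps [simp]:
  assumes "a \<in> cells2 Dbl"
  shows "times_L_cell a \<in> cells2 Dbl" "tsrc (times_L_cell a) = times_L (tsrc a)"
    "ttgt (times_L_cell a) = times_L (ttgt a)"
    "fst_dfun (dcod (tsrc a)) Loose *> times_L_cell a
      = a <* fst_dfun (ddom (tsrc a)) Loose"
proof -
  let ?A = "ddom (tsrc a)" and ?B = "dcod (tsrc a)"
  let ?P = "prod_dbl ?A Loose"
  have s: "tsrc a \<in> cells1 Dbl" and t: "ttgt a \<in> cells1 Dbl" using assms by simp_all
  have e: "fst_dfun ?B Loose oo times_L (tsrc a) = tsrc a oo fst_dfun ?A Loose"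
    "fst_dfun ?B Loose oo times_L (ttgt a) = ttgt a oo fst_dfun ?A Loose"
    "HomL ?B oo times_L (tsrc a) = HomL ?A" "HomL ?B oo times_L (ttgt a) = HomL ?A"
    using times_Loose_simps(4,5)[OF s] times_Loose_simps(4,5)[OF t] assms by simp_all
  have "double_functor ?P (prod_dbl ?B Loose) (times_L (tsrc a))" "double_functor ?P (prod_dbl ?B Loose) (times_L (ttgt a))"
    "tight_transformation ?P ?B (fst_dfun ?B Loose oo times_L (tsrc a))
      (fst_dfun ?B Loose oo times_L (ttgt a)) (a <* fst_dfun ?A Loose)"
    "tight_transformation ?P Loose (snd_dfun ?B Loose oo times_L (tsrc a))
      (snd_dfun ?B Loose oo times_L (ttgt a)) (ttrans_id (HomL ?A))"
    using assms s t e by (simp_all add: dfun_iff ttrans_iff flip: HomL_eq)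
  from ttrans_pair_in[OF _ Loose_cat this]
  show "times_L_cell a \<in> cells2 Dbl" "tsrc (times_L_cell a) = times_L (tsrc a)"
    "ttgt (times_L_cell a) = times_L (ttgt a)"
    "fst_dfun (dcod (tsrc a)) Loose *> times_L_cell a
      = a <* fst_dfun (ddom (tsrc a)) Loose"
    using s by (simp_all add: times_L_cell_def ttrans_iff)
qed

lemma HomL_map_cells1 [simp]: "f \<in> cells1 Dbl \<Longrightarrow> HomL_map f \<in> cells1 LBimod"
  by (simp add: HomL_map_def)

lemma HomL_cell_cells2 [simp]: "a \<in> cells2 Dbl \<Longrightarrow> HomL_cell a \<in> cells2 LBimod"
  using times_Loose_simps(5)[of "ttgt a"] by (simp add: HomL_cell_def)

lemma times_Loose_id: "double_category D \<Longrightarrow> times_L (dfun_id D) = dfun_id (prod_dbl D Loose)"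
  using times_Loose_simps(4,5)[of "dfun_id D"]
  by (intro times_dfun_eqI[of D "times_L (dfun_id D)" "dfun_id (prod_dbl D Loose)", THEN trans])
    (simp_all add: double_category_prod)

lemma times_Loose_dfun_cmp:
  assumes "f \<in> cells1 Dbl" "g \<in> cells1 Dbl" "ddom g = dcod f"
  shows "times_L (g oo f) = times_L g oo times_L f"
proof (rule times_dfun_eqI[of "dcod g"])
  show "fst_dfun (dcod g) Loose oo times_L (g oo f)
      = fst_dfun (dcod g) Loose oo times_L g oo times_L f"
    using times_Loose_simps(4)[of "g oo f"] assms by simp
  show "HomL (dcod g) oo times_L (g oo f) = HomL (dcod g) oo times_L g oo times_L f"
    using times_Loose_simps(5)[of "g oo f"] assms by simp
qed (use assms in simp_all)

text \<open>Whiskered with the projection to the double category itself,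
  \<open>times_L_cell a\<close> becomes \<open>a\<close> whiskered with the projection of its
  domain. By \<open>times_ttrans_eqI\<close> the laws for 2-cells thus reduce to whiskering laws in
  \<open>Dbl\<close>.\<close>

lemma two_functor_HomL: "two_functor Dbl LBimod \<lparr>on0 = HomL, on1 = HomL_map, on2 = HomL_cell\<rparr>"
proof (rule two_functor.intro[OF two_category_Dbl two_category_LBimod], rule two_functor_axioms.intro,
    unfold twofun.simps Dbl_simps(2-), goal_cases)
  case (1 x)
  then show ?case by simp
next
  case (2 f x y)
  then show ?case by (auto simp: hom1_def HomL_map_def)
next
  case (3 a f g)
  then have "a \<in> cells2 Dbl" "tsrc a = f" "ttgt a = g" by (simp_all add: hom2_def)
  then show ?case using HomL_cell_cells2[of a] by (auto simp: hom2_def HomL_map_def HomL_cell_def simp del: LBimod_cells2)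
next
  case (4 x)
  then show ?case by (simp add: HomL_map_def times_Loose_id)
next
  case (5 f x y g z)
  then show ?case by (simp add: hom1_def HomL_map_def times_Loose_dfun_cmp)
next
  case (6 f)
  have "times_L_cell (ttrans_id f) = ttrans_id (times_L f)"
    by (rule times_ttrans_eqI[of "dcod f"]) (use times_Loose_cell_simps(4)[of "ttrans_id f"] 6 in simp_all)
  then show ?case using 6 by (simp add: HomL_map_def HomL_cell_def)
next
  case (7 a f g b h)
  then have ab: "a \<in> cells2 Dbl" "b \<in> cells2 Dbl" "tsrc b = ttgt a" by (simp_all add: hom2_def)
  let ?f = "fst_dfun (dcod (tsrc a)) Loose" and ?f' = "fst_dfun (ddom (tsrc a)) Loose"
  have "times_L_cell (ttrans_vcmp b a) = ttrans_vcmp (times_L_cell b) (times_L_cell a)"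
  proof (rule times_ttrans_eqI[of "dcod (tsrc a)"])
    have "?f *> ttrans_vcmp (times_L_cell b) (times_L_cell a)
      = ttrans_vcmp (?f *> times_L_cell b) (?f *> times_L_cell a)"
      by (rule Dbl.whisker_vcmp2) (use ab in simp_all)
    also have "... = ttrans_vcmp (b <* ?f') (a <* ?f')"
      using times_Loose_cell_simps(4)[OF ab(2)] ab by simp
    also have "... = ttrans_vcmp b a <* ?f'"
      by (rule Dbl.whisker_vcmp2(2)[symmetric]) (use ab in simp_all)
    finally show "?f *> times_L_cell (ttrans_vcmp b a)
      = ?f *> ttrans_vcmp (times_L_cell b) (times_L_cell a)"
      using times_Loose_cell_simps(4)[of "ttrans_vcmp b a"] ab by simp
  qed (use ab in simp_all)
  then show ?case using ab by (simp add: HomL_cell_def)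
next
  case (8 a f f' b g g')
  then have ab: "a \<in> cells2 Dbl" "b \<in> cells2 Dbl" "ddom (tsrc b) = dcod (tsrc a)" by (simp_all add: hom2_def)
  let ?f = "fst_dfun (dcod (tsrc b)) Loose" and ?f' = "fst_dfun (dcod (tsrc a)) Loose" and ?f'' = "fst_dfun (ddom (tsrc a)) Loose"
  have "times_L_cell (ttrans_hcmp b a) = ttrans_hcmp (times_L_cell b) (times_L_cell a)"
  proof (rule times_ttrans_eqI[of "dcod (tsrc b)"])
    have "?f *> ttrans_hcmp (times_L_cell b) (times_L_cell a)
      = ttrans_hcmp (?f *> times_L_cell b) (times_L_cell a)"
      by (rule Dbl.hcmp2_assoc'[symmetric]) (use ab in simp_all)
    also have "... = ttrans_hcmp (b <* ?f') (times_L_cell a)"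
      using times_Loose_cell_simps(4)[OF ab(2)] ab by simp
    also have "... = ttrans_hcmp b (?f' *> times_L_cell a)"
      by (rule Dbl.hcmp2_assoc') (use ab in simp_all)
    also have "... = ttrans_hcmp b (a <* ?f'')"
      using times_Loose_cell_simps(4)[OF ab(1)] by simp
    also have "... = ttrans_hcmp b a <* ?f''"
      by (rule Dbl.hcmp2_assoc'[symmetric]) (use ab in simp_all)
    finally show "?f *> times_L_cell (ttrans_hcmp b a)
      = ?f *> ttrans_hcmp (times_L_cell b) (times_L_cell a)"
      using times_Loose_cell_simps(4)[of "ttrans_hcmp b a"] ab by simp
  qed (use ab in \<open>simp_all add: times_Loose_dfun_cmp\<close>)
  then show ?case using ab by (simp add: HomL_cell_def)
qed

text \<open>\<open>HomL\<close> is right adjoint to the domain 2-functor from bimodules to double categories, hence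
  preserves products.\<close>

lemma HomL_preserves_product:
  assumes P: "is_product Dbl n X y \<pi>"
  shows "is_product LBimod n (\<lambda>j. HomL (X j)) (HomL y) (\<lambda>j. HomL_map (\<pi> j))"
proof (rule is_productI)
  note D = two_category_Dbl
  have y [simp]: "double_category y" and X [simp]: "\<And>j. j < n \<Longrightarrow> double_category (X j)" using is_productD[OF P] by auto
  have p [simp]: "\<pi> j \<in> cells1 Dbl" "ddom (\<pi> j) = y" "dcod (\<pi> j) = X j" if "j < n" for j
    using is_productD(3)[OF P that] by (simp_all add: hom1_def)
  show "HomL y \<in> cells0 LBimod" by simp
  show "HomL (X j) \<in> cells0 LBimod" if "j < n" for j using that by simp
  show "HomL_map (\<pi> j) \<in> hom1 LBimod (HomL y) (HomL (X j))" if "j < n" for j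
    using that HomL_map_cells1[of "\<pi> j"] by (simp add: hom1_def HomL_map_def del: LBimod_cells1)
  have H: "\<exists>K. h = (z, HomL y, K) \<and> K \<in> cells1 Dbl \<and> ddom K = ddom z \<and> dcod K = prod_dbl y Loose \<and>
      z \<in> cells1 Dbl \<and> dcod z = Loose \<and> HomL y oo K = z" if "h \<in> hom1 LBimod z (HomL y)" for h z
    using that by (rule LB_hom1E) simp
  let ?f = "fst_dfun y Loose"
  have fs: "fst_dfun (X j) Loose oo times_L (\<pi> j) oo K = \<pi> j oo ?f oo K"
    if "j < n" "K \<in> cells1 Dbl" "dcod K = prod_dbl y Loose" for j K
    using that times_Loose_proj_cmp(1)[of "\<pi> j" K "X j"] by simp
  have fs2: "fst_dfun (X j) Loose *> times_L (\<pi> j) *> c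
      = \<pi> j *> ?f *> c"
    if "j < n" "c \<in> cells2 Dbl" "dcod (tsrc c) = prod_dbl y Loose" for j c
  proof -
    have "fst_dfun (X j) Loose *> times_L (\<pi> j) *> c
      = (fst_dfun (X j) Loose oo times_L (\<pi> j)) *> c"
      by (rule Dbl.whisker_cmp1[symmetric]) (use that in simp_all)
    also have "... = (\<pi> j oo ?f) *> c"
      using times_Loose_simps(4)[of "\<pi> j"] that by simp
    also have "... = \<pi> j *> ?f *> c"
      by (rule Dbl.whisker_cmp1) (use that in simp_all)
    finally show ?thesis .
  qed
  {
    fix z and f :: "nat \<Rightarrow> _" assume z: "z \<in> cells0 LBimod" and f: "\<And>j. j < n \<Longrightarrow> f j \<in> hom1 LBimod z (HomL (X j))"
    have "\<exists>F. \<forall>j<n. f j = (z, HomL (X j), F j) \<and> (z, HomL (X j), F j) \<in> cells1 LBimod"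
      using f unfolding LBimod_hom1 by meson
    then obtain F where F: "\<And>j. j < n \<Longrightarrow> f j = (z, HomL (X j), F j)" "\<And>j. j < n \<Longrightarrow> (z, HomL (X j), F j) \<in> cells1 LBimod"
      by blast
    have F': "F j \<in> cells1 Dbl" "ddom (F j) = ddom z" "dcod (F j) = prod_dbl (X j) Loose" "HomL (X j) oo F j = z"
      if "j < n" for j using F(2)[OF that] by simp_all
    have z': "z \<in> cells1 Dbl" "dcod z = Loose" using z by simp_all
    obtain g where g: "g \<in> hom1 Dbl (ddom z) y" "\<And>j. j < n \<Longrightarrow> cmp1 Dbl (\<pi> j) g = fst_dfun (X j) Loose oo F j"
      by (rule product_map[OF P, of "ddom z" "\<lambda>j. fst_dfun (X j) Loose oo F j"])
        (use F' z' in \<open>simp_all add: hom1_def\<close>)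
    have gd: "double_functor (ddom z) y g" and zd: "double_functor (ddom z) Loose z"
      using g(1) z' by (simp_all add: hom1_Dbl dfun_iff[of _ _ z])
    \<comment> \<open>The transpose of \<open>g\<close> under the adjunction: its second component
      is \<open>z\<close> itself, which makes the pairing a map over \<open>Loose\<close>.\<close>
    let ?K = "pair_dfun g z"
    have K: "?K \<in> cells1 Dbl" "ddom ?K = ddom z" "dcod ?K = prod_dbl y Loose" "?f oo ?K = g" "HomL y oo ?K = z"
      using double_functor_pair[OF gd zd] fst_pair_dfun[OF gd zd] snd_pair_dfun[OF gd zd]
      by (simp_all add: dfun_iff HomL_eq)
    have "times_L (\<pi> j) oo ?K = F j" if j: "j < n" for j
      by (rule times_dfun_eqI[of "X j"]) (use K F'[OF j] g(2)[OF j] j fs[OF j K(1,3)] in simp_all)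
    then have "\<forall>j<n. cmp1 LBimod (HomL_map (\<pi> j)) (z, HomL y, ?K) = f j"
      using F(1) by (simp add: HomL_map_def)
    moreover have "(z, HomL y, ?K) \<in> hom1 LBimod z (HomL y)" using K z' by (simp add: hom1_def)
    ultimately show "\<exists>h\<in>hom1 LBimod z (HomL y). \<forall>j<n. cmp1 LBimod (HomL_map (\<pi> j)) h = f j" by blast
  next
    fix z h k assume hk: "h \<in> hom1 LBimod z (HomL y)" "k \<in> hom1 LBimod z (HomL y)"
      and e: "\<And>j. j < n \<Longrightarrow> cmp1 LBimod (HomL_map (\<pi> j)) h = cmp1 LBimod (HomL_map (\<pi> j)) k"
    from H[OF hk(1)] obtain K where K: "h = (z, HomL y, K)" "K \<in> cells1 Dbl" "ddom K = ddom z" "dcod K = prod_dbl y Loose"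
      "HomL y oo K = z" by blast
    from H[OF hk(2)] obtain K' where K': "k = (z, HomL y, K')" "K' \<in> cells1 Dbl" "ddom K' = ddom z" "dcod K' = prod_dbl y Loose"
      "HomL y oo K' = z" by blast
    have e': "times_L (\<pi> j) oo K = times_L (\<pi> j) oo K'" if "j < n" for j
      using e[OF that] unfolding K(1) K'(1) HomL_map_def by simp
    have "?f oo K = ?f oo K'"
    proof (rule product_map_unique[OF P D, of _ "ddom z"])
      show "cmp1 Dbl (\<pi> j) (?f oo K) = cmp1 Dbl (\<pi> j) (?f oo K')" if "j < n" for j
        using fs[OF that K(2,4)] fs[OF that K'(2,4)] e'[OF that] by simp
    qed (use K K' in \<open>simp_all add: hom1_def\<close>)
    then have "K = K'" using times_dfun_eqI[of y K K'] K K' by simp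
    then show "h = k" using K K' by simp
  next
    fix z h k and a :: "nat \<Rightarrow> _" assume hk: "h \<in> hom1 LBimod z (HomL y)" "k \<in> hom1 LBimod z (HomL y)"
      and a: "\<And>j. j < n \<Longrightarrow> a j \<in> hom2 LBimod (cmp1 LBimod (HomL_map (\<pi> j)) h) (cmp1 LBimod (HomL_map (\<pi> j)) k)"
    from H[OF hk(1)] obtain K where K: "h = (z, HomL y, K)" "K \<in> cells1 Dbl" "ddom K = ddom z" "dcod K = prod_dbl y Loose"
      "HomL y oo K = z" and z: "z \<in> cells1 Dbl" "dcod z = Loose" by blast
    from H[OF hk(2)] obtain K' where K': "k = (z, HomL y, K')" "K' \<in> cells1 Dbl" "ddom K' = ddom z" "dcod K' = prod_dbl y Loose"
      "HomL y oo K' = z" by blast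
    have "\<exists>s. \<forall>j<n. a j = (z, HomL (X j), s j) \<and> s j \<in> cells2 Dbl \<and> tsrc (s j) = times_L (\<pi> j) oo K \<and>
        ttgt (s j) = times_L (\<pi> j) oo K'"
    proof -
      have "\<forall>j<n. \<exists>s. a j = (z, HomL (X j), s) \<and> s \<in> cells2 Dbl \<and> tsrc s = times_L (\<pi> j) oo K \<and>
        ttgt s = times_L (\<pi> j) oo K'"
        using a unfolding K(1) K'(1) HomL_map_def LBimod_simps LBimod_hom2 LBimod_cells2 by auto
      then show ?thesis by metis
    qed
    then obtain s where s: "\<And>j. j < n \<Longrightarrow> a j = (z, HomL (X j), s j)" "\<And>j. j < n \<Longrightarrow> s j \<in> cells2 Dbl"
      "\<And>j. j < n \<Longrightarrow> tsrc (s j) = times_L (\<pi> j) oo K"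
      "\<And>j. j < n \<Longrightarrow> ttgt (s j) = times_L (\<pi> j) oo K'" by blast
    obtain c where c: "c \<in> hom2 Dbl (?f oo K) (?f oo K')"
      "\<And>j. j < n \<Longrightarrow> hcmp2 Dbl (id2 Dbl (\<pi> j)) c = fst_dfun (X j) Loose *> s j"
    proof (rule product_cell[OF P D, of "?f oo K" "ddom z" "?f oo K'"
          "\<lambda>j. fst_dfun (X j) Loose *> s j"])
      show "fst_dfun (X j) Loose *> s j
        \<in> hom2 Dbl (cmp1 Dbl (\<pi> j) (?f oo K)) (cmp1 Dbl (\<pi> j) (?f oo K'))" if j: "j < n" for j
        using s(2-4)[OF j] K K' j fs[OF j K(2,4)] fs[OF j K'(2,4)] by (simp add: hom2_def)
    qed (use K K' in \<open>simp_all add: hom1_def\<close>)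
    have c': "c \<in> cells2 Dbl" "tsrc c = ?f oo K" "ttgt c = ?f oo K'" using c(1) by (simp_all add: hom2_def)
    have "double_functor (ddom z) (prod_dbl y Loose) K" "double_functor (ddom z) (prod_dbl y Loose) K'"
      "tight_transformation (ddom z) y (?f oo K) (?f oo K') c"
      "tight_transformation (ddom z) Loose (snd_dfun y Loose oo K) (snd_dfun y Loose oo K') (ttrans_id z)"
      using K K' c' z by (simp_all add: dfun_iff ttrans_iff flip: HomL_eq)
    from ttrans_pair_in[OF y Loose_cat this] obtain d where
      d: "d \<in> cells2 Dbl" "tsrc d = K" "ttgt d = K'" "?f *> d = c"
      by (auto simp: ttrans_iff)
    have "times_L (\<pi> j) *> d = s j" if j: "j < n" for j
      by (rule times_ttrans_eqI[of "X j"]) (use d s(2-4)[OF j] K K' j c(2)[OF j] fs2[OF j d(1)] in simp_all)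
    then have "\<forall>j<n. hcmp2 LBimod (id2 LBimod (HomL_map (\<pi> j))) (z, HomL y, d) = a j"
      using s(1) by (simp add: HomL_map_def)
    moreover have "(z, HomL y, d) \<in> hom2 LBimod h k" using d K K' z by (simp add: hom2_def)
    ultimately show "\<exists>c\<in>hom2 LBimod h k. \<forall>j<n. hcmp2 LBimod (id2 LBimod (HomL_map (\<pi> j))) c = a j" by blast
  next
    fix z h k c d assume hk: "h \<in> hom1 LBimod z (HomL y)" "k \<in> hom1 LBimod z (HomL y)"
      and cd: "c \<in> hom2 LBimod h k" "d \<in> hom2 LBimod h k"
      and e: "\<And>j. j < n \<Longrightarrow> hcmp2 LBimod (id2 LBimod (HomL_map (\<pi> j))) c = hcmp2 LBimod (id2 LBimod (HomL_map (\<pi> j))) d"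
    from H[OF hk(1)] obtain K where K: "h = (z, HomL y, K)" "K \<in> cells1 Dbl" "ddom K = ddom z" "dcod K = prod_dbl y Loose"
      by blast
    from H[OF hk(2)] obtain K' where K': "k = (z, HomL y, K')" "K' \<in> cells1 Dbl" "ddom K' = ddom z" "dcod K' = prod_dbl y Loose"
      by blast
    obtain c' where c: "c = (z, HomL y, c')" "c' \<in> cells2 Dbl" "tsrc c' = K" "ttgt c' = K'"
      using cd(1) unfolding K(1) K'(1) LBimod_hom2 LBimod_cells2 by auto
    obtain d' where d: "d = (z, HomL y, d')" "d' \<in> cells2 Dbl" "tsrc d' = K" "ttgt d' = K'"
      using cd(2) unfolding K(1) K'(1) LBimod_hom2 LBimod_cells2 by auto
    have e': "times_L (\<pi> j) *> c' = times_L (\<pi> j) *> d'" if "j < n" for j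
      using e[OF that] unfolding c(1) d(1) HomL_map_def by simp
    have "?f *> c' = ?f *> d'"
    proof (rule product_cell_unique[OF P D, of "?f oo K" "ddom z" "?f oo K'"])
      show "hcmp2 Dbl (id2 Dbl (\<pi> j)) (?f *> c') = hcmp2 Dbl (id2 Dbl (\<pi> j)) (?f *> d')"
        if "j < n" for j
        using fs2[OF that c(2)] fs2[OF that d(2)] e'[OF that] c d K by simp
    qed (use c d K K' in \<open>simp_all add: hom1_def hom2_def\<close>)
    then have "c' = d'" using times_ttrans_eqI[of y c' d'] c d K by simp
    then show "c = d" using c d by simp
  }
qed

section \<open>Fibres of the loose hom bimodule and naturality of the legs\<close>

definition fibre_fst :: "'u::infinite \<Rightarrow> 'u dbl \<Rightarrow> 'u dfun" where
  "fibre_fst i D = fst_dfun D Loose oo fincl (HomL D) i"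

context
  fixes i :: "'u::infinite"
  assumes i: "i \<in> obs Loose"
begin

lemma HomL_fibre_incl [simp]:
  assumes "double_category D"
  shows "fincl (HomL D) i \<in> cells1 Dbl" "ddom (fincl (HomL D) i) = fibre (HomL D) i"
    "dcod (fincl (HomL D) i) = prod_dbl D Loose"
    "HomL D oo fincl (HomL D) i = const_Loose (fibre (HomL D) i) i"
    "double_category (fibre (HomL D) i)"
  using fincl_simps[OF i, of "HomL D"] assms by simp_all

lemma fibre_fst_simps [simp]:
  assumes "double_category D"
  shows "fibre_fst i D \<in> cells1 Dbl" "ddom (fibre_fst i D) = fibre (HomL D) i" "dcod (fibre_fst i D) = D"
  using assms by (simp_all add: fibre_fst_def)

text \<open>Two functors into the fibre agree under the second projection, where both are constant
  at \<open>i\<close>; so the first projection separates them. Since \<open>fibre_fst\<close> is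
  also a retraction of \<open>HomL_leg\<close>, equations between functors into a fibre can be
  tested in \<open>D\<close>.\<close>

lemma fibre_fst_mono:
  assumes D: "double_category D" and FG: "F \<in> cells1 Dbl" "G \<in> cells1 Dbl" "ddom F = ddom G"
    "dcod F = fibre (HomL D) i" "dcod G = fibre (HomL D) i"
    and e: "fibre_fst i D oo F = fibre_fst i D oo G"
  shows "F = G"
proof (rule fibre_dfun_eqI[OF i, of "HomL D"])
  have c: "HomL D oo fincl (HomL D) i oo H = const_Loose (ddom H) i"
    if "H \<in> cells1 Dbl" "dcod H = fibre (HomL D) i" for H
  proof -
    have "HomL D oo fincl (HomL D) i oo H = (HomL D oo fincl (HomL D) i) oo H"
      using that D by (simp del: HomL_fibre_incl(4))
    also have "... = const_Loose (ddom H) i"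
      using const_Loose_cmp[of "ddom H" "fibre (HomL D) i" H i] that D i by (simp add: dfun_iff)
    finally show ?thesis .
  qed
  show "fincl (HomL D) i oo F = fincl (HomL D) i oo G"
    by (rule times_dfun_eqI[OF D]) (use D FG e c[of F] c[of G] in \<open>simp_all add: fibre_fst_def\<close>)
qed (use D FG in simp_all)

lemma fibre_fst_faithful:
  assumes D: "double_category D" and st: "s \<in> cells2 Dbl" "t \<in> cells2 Dbl" "tsrc s = tsrc t" "ttgt s = ttgt t"
    "dcod (tsrc t) = fibre (HomL D) i"
    and e: "fibre_fst i D *> s = fibre_fst i D *> t"
  shows "s = t"
proof (rule fibre_ttrans_eqI[OF i, of "HomL D"])
  have w: "fibre_fst i D *> u
      = fst_dfun D Loose *> fincl (HomL D) i *> u"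
    if "u \<in> cells2 Dbl" "dcod (tsrc u) = fibre (HomL D) i" for u
    unfolding fibre_fst_def by (rule Dbl.whisker_cmp1) (use that D in simp_all)
  show "fincl (HomL D) i *> s = fincl (HomL D) i *> t"
    by (rule times_ttrans_eqI[OF D]) (use D st e w[of s] w[of t] in simp_all)
qed (use D st in simp_all)

lemma HomL_fibre_map [simp]:
  assumes "f \<in> cells1 Dbl"
  shows "fibre_map i (HomL_map f) \<in> cells1 Dbl" "ddom (fibre_map i (HomL_map f)) = fibre (HomL (ddom f)) i"
    "dcod (fibre_map i (HomL_map f)) = fibre (HomL (dcod f)) i"
    "fibre_fst i (dcod f) oo fibre_map i (HomL_map f) = f oo fibre_fst i (ddom f)"
proof -
  note s = fibre_map_simps[OF i HomL_map_cells1[OF assms, unfolded HomL_map_def], folded HomL_map_def]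
  show 1: "fibre_map i (HomL_map f) \<in> cells1 Dbl" "ddom (fibre_map i (HomL_map f)) = fibre (HomL (ddom f)) i"
    "dcod (fibre_map i (HomL_map f)) = fibre (HomL (dcod f)) i" by (fact s)+
  have "fibre_fst i (dcod f) oo fibre_map i (HomL_map f)
    = fst_dfun (dcod f) Loose oo fincl (HomL (dcod f)) i oo fibre_map i (HomL_map f)"
    using 1 assms by (simp add: fibre_fst_def)
  also have "... = f oo fibre_fst i (ddom f)"
    unfolding s(4) using assms by (simp add: fibre_fst_def)
  finally show "fibre_fst i (dcod f) oo fibre_map i (HomL_map f) = f oo fibre_fst i (ddom f)" .
qed

lemma HomL_fibre_trans [simp]:
  assumes "a \<in> cells2 Dbl"
  shows "fibre_trans i (HomL_cell a) \<in> cells2 Dbl" "tsrc (fibre_trans i (HomL_cell a)) = fibre_map i (HomL_map (tsrc a))"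
    "ttgt (fibre_trans i (HomL_cell a)) = fibre_map i (HomL_map (ttgt a))"
    "fibre_fst i (dcod (tsrc a)) *> fibre_trans i (HomL_cell a)
      = a <* fibre_fst i (ddom (tsrc a))"
proof -
  let ?A = "ddom (tsrc a)" and ?B = "dcod (tsrc a)"
  note s = fibre_trans_simps[OF i HomL_cell_cells2[OF assms, unfolded HomL_cell_def], folded HomL_cell_def]
  show 1: "fibre_trans i (HomL_cell a) \<in> cells2 Dbl" "tsrc (fibre_trans i (HomL_cell a)) = fibre_map i (HomL_map (tsrc a))"
    "ttgt (fibre_trans i (HomL_cell a)) = fibre_map i (HomL_map (ttgt a))"
    using s(1-3) assms by (simp_all add: HomL_map_def)
  have "fibre_fst i ?B *> fibre_trans i (HomL_cell a)
    = fst_dfun ?B Loose *> fincl (HomL ?B) i *> fibre_trans i (HomL_cell a)"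
    unfolding fibre_fst_def by (rule Dbl.whisker_cmp1) (use 1 assms in simp_all)
  also have "... = (fst_dfun ?B Loose *> times_L_cell a) <* fincl (HomL ?A) i"
    unfolding s(4) by (rule Dbl.hcmp2_assoc'[symmetric]) (use assms in simp_all)
  also have "... = ttrans_hcmp a (ttrans_hcmp (ttrans_id (fst_dfun ?A Loose)) (ttrans_id (fincl (HomL ?A) i)))"
    unfolding times_Loose_cell_simps(4)[OF assms] by (rule Dbl.hcmp2_assoc') (use assms in simp_all)
  also have "... = a <* fibre_fst i ?A"
    using assms by (simp add: fibre_fst_def)
  finally show "fibre_fst i ?B *> fibre_trans i (HomL_cell a)
      = a <* fibre_fst i ?A" .
qed

text \<open>The leg is the lift to the fibre of the pairing of the identity with the constant
  functor at \<open>i\<close>. It is therefore a double functor by the universal property of the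
  fibre.\<close>

lemma HomL_leg_lift:
  "HomL_leg i D = (pair_dfun (dfun_id D) (const_Loose D i))\<lparr>dcod := fibre (HomL D) i\<rparr>"
  by (rule dfun.equality)
    (auto simp: HomL_leg_def pair_dfun_def strict_dfun_def dfun_id_def const_Loose_def Let_def restrict_comp_def composable_def
      fun_eq_iff restrict_def Loose_sel fibre_def)

lemma HomL_leg_simps [simp]:
  assumes "double_category D"
  shows "HomL_leg i D \<in> cells1 Dbl" "ddom (HomL_leg i D) = D" "dcod (HomL_leg i D) = fibre (HomL D) i"
    "fibre_fst i D oo HomL_leg i D = dfun_id D"
proof -
  have id: "double_functor D D (dfun_id D)" and c: "double_functor D Loose (const_Loose D i)"
    using assms i by (simp_all add: dfun_iff)
  have p: "double_functor D (ddom (HomL D)) (pair_dfun (dfun_id D) (const_Loose D i))"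
    using double_functor_pair[OF id c] by simp
  have "HomL D oo pair_dfun (dfun_id D) (const_Loose D i) = const_Loose D i"
    unfolding HomL_eq by (rule snd_pair_dfun[OF id c])
  note l = fibre_lift[OF i _ p this, folded HomL_leg_lift]
  show 1: "HomL_leg i D \<in> cells1 Dbl" "ddom (HomL_leg i D) = D" "dcod (HomL_leg i D) = fibre (HomL D) i"
    using l(1) assms by (simp_all add: dfun_iff)
  show "fibre_fst i D oo HomL_leg i D = dfun_id D"
    using l(2) 1 assms fst_pair_dfun[OF id c] by (simp add: fibre_fst_def)
qed

text \<open>Both sides become \<open>f\<close> under \<open>fibre_fst\<close>, because the legs are
  sections of it and \<open>HomL_map f\<close> acts as \<open>f\<close> on the first component. The
  equation is strict, which allows identity structure cells on the right legs later.\<close>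

lemma HomL_leg_natural:
  assumes f: "f \<in> cells1 Dbl"
  shows "fibre_map i (HomL_map f) oo HomL_leg i (ddom f) = HomL_leg i (dcod f) oo f"
proof (rule fibre_fst_mono[of "dcod f"])
  have "fibre_fst i (dcod f) oo fibre_map i (HomL_map f) oo HomL_leg i (ddom f)
    = (fibre_fst i (dcod f) oo fibre_map i (HomL_map f)) oo HomL_leg i (ddom f)"
    by (rule Dbl.cmp1_assoc'[symmetric]) (use f in simp_all)
  also have "... = f oo fibre_fst i (ddom f) oo HomL_leg i (ddom f)"
    unfolding HomL_fibre_map(4)[OF f] by (rule Dbl.cmp1_assoc') (use f in simp_all)
  also have "... = (fibre_fst i (dcod f) oo HomL_leg i (dcod f)) oo f" using f by simp
  also have "... = fibre_fst i (dcod f) oo HomL_leg i (dcod f) oo f"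
    by (rule Dbl.cmp1_assoc') (use f in simp_all)
  finally show "fibre_fst i (dcod f) oo fibre_map i (HomL_map f) oo HomL_leg i (ddom f)
    = fibre_fst i (dcod f) oo HomL_leg i (dcod f) oo f" .
qed (use f in simp_all)

lemma HomL_leg_natural_cell:
  assumes a: "a \<in> cells2 Dbl"
  shows "fibre_trans i (HomL_cell a) <* HomL_leg i (ddom (tsrc a))
    = HomL_leg i (dcod (tsrc a)) *> a"
proof (rule fibre_fst_faithful[of "dcod (tsrc a)"])
  let ?A = "ddom (tsrc a)" and ?B = "dcod (tsrc a)"
  let ?A' = "HomL_leg i ?A" and ?B' = "HomL_leg i ?B"
  have "fibre_fst i ?B *> (fibre_trans i (HomL_cell a) <* ?A')
    = (fibre_fst i ?B *> fibre_trans i (HomL_cell a)) <* ?A'"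
    by (rule Dbl.hcmp2_assoc'[symmetric]) (use a in simp_all)
  also have "... = ttrans_hcmp a (ttrans_hcmp (ttrans_id (fibre_fst i ?A)) (ttrans_id ?A'))"
    unfolding HomL_fibre_trans(4)[OF a] by (rule Dbl.hcmp2_assoc') (use a in simp_all)
  also have "... = (fibre_fst i ?B oo ?B') *> a" using a by simp
  also have "... = fibre_fst i ?B *> ?B' *> a"
    by (rule Dbl.whisker_cmp1) (use a in simp_all)
  finally show "fibre_fst i ?B *> (fibre_trans i (HomL_cell a) <* ?A')
    = fibre_fst i ?B *> ?B' *> a" .
qed (use a HomL_leg_natural[of "tsrc a"] HomL_leg_natural[of "ttgt a"] in simp_all)

end

section \<open>Pasting calculus for one leg of a niche\<close>

definition leg_sq :: "'u dfun \<Rightarrow> 'u dfun \<Rightarrow> 'u dfun \<Rightarrow> 'u dfun \<Rightarrow> 'u ttrans \<Rightarrow> bool" where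
  "leg_sq a F f F' s \<longleftrightarrow> a \<in> cells1 Dbl \<and> F \<in> cells1 Dbl \<and> f \<in> cells1 Dbl \<and> F' \<in> cells1 Dbl \<and> s \<in> cells2 Dbl \<and>
     ddom a = dcod F \<and> dcod a = dcod F' \<and> ddom f = ddom F \<and> dcod f = ddom F' \<and>
     tsrc s = a oo F \<and> ttgt s = F' oo f"

lemma leg_sqD:
  assumes "leg_sq a F f F' s"
  shows "a \<in> cells1 Dbl" "F \<in> cells1 Dbl" "f \<in> cells1 Dbl" "F' \<in> cells1 Dbl" "s \<in> cells2 Dbl"
    "ddom a = dcod F" "dcod a = dcod F'" "ddom f = ddom F" "dcod f = ddom F'"
    "tsrc s = a oo F" "ttgt s = F' oo f"
  using assms by (simp_all add: leg_sq_def)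

text \<open>Together with \<open>leg_sq\<close> this isolates the data on one leg of a niche map and
  of a niche cell. Commuter conditions are kept apart, so the same calculus applies to left legs, to
  right legs and to maps of pointed double categories.\<close>

definition leg_cell :: "'u dfun \<Rightarrow> 'u dfun \<Rightarrow> 'u ttrans \<Rightarrow> 'u ttrans \<Rightarrow> 'u ttrans \<Rightarrow> 'u ttrans \<Rightarrow> bool" where
  "leg_cell F F' s t \<alpha> \<phi> \<longleftrightarrow>
     ttrans_vcmp t (\<alpha> <* F) = ttrans_vcmp (F' *> \<phi>) s"

lemma leg_sq_id: "F \<in> cells1 Dbl \<Longrightarrow> leg_sq (dfun_id (dcod F)) F (dfun_id (ddom F)) F (ttrans_id F)"
  by (simp add: leg_sq_def)

lemma leg_sq_paste:
  assumes "leg_sq a F f F' s" "leg_sq a' F' f' F'' s'"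
  shows "leg_sq (a' oo a) F (f' oo f) F'' (paste s' a' f s)"
  using leg_sqD[OF assms(1)] leg_sqD[OF assms(2)] by (simp add: leg_sq_def paste_def)

lemma paste_id_left:
  assumes "leg_sq a F f F' s"
  shows "paste (ttrans_id F') (dfun_id (dcod F')) f s = s"
  using leg_sqD[OF assms] by (simp add: paste_def)

lemma paste_id_right:
  assumes "leg_sq a F f F' s"
  shows "paste s a (dfun_id (ddom F)) (ttrans_id F) = s"
  using leg_sqD[OF assms] by (simp add: paste_def)

lemma paste_assoc:
  assumes "leg_sq a F f F' s" "leg_sq a' F' f' F'' s'" "leg_sq a'' F'' f'' F''' s''"
  shows "paste (paste s'' a'' f' s') (a'' oo a') f s = paste s'' a'' (f' oo f) (paste s' a' f s)"
proof -
  note [simp] = leg_sqD[OF assms(1)] leg_sqD[OF assms(2)] leg_sqD[OF assms(3)]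
  have 1: "(s'' <* f') <* f = s'' <* (f' oo f)"
    using Dbl.hcmp2_assoc'[of "ttrans_id f" "ttrans_id f'" s''] by simp
  have 2: "(a'' *> s') <* f = a'' *> (s' <* f)"
    by (rule Dbl.hcmp2_assoc') simp_all
  have "paste (paste s'' a'' f' s') (a'' oo a') f s
    = ttrans_vcmp (ttrans_vcmp (s'' <* (f' oo f)) (a'' *> (s' <* f)))
        (a'' *> a' *> s)"
    by (simp add: paste_def Dbl.whisker_vcmp2 1 2 Dbl.whisker_cmp1)
  also have "... = paste s'' a'' (f' oo f) (paste s' a' f s)"
    by (simp add: paste_def Dbl.whisker_vcmp2 Dbl.vcmp2_assoc')
  finally show ?thesis .
qed

lemma leg_cell_id:
  assumes "leg_sq a F f F' s"
  shows "leg_cell F F' s s (ttrans_id a) (ttrans_id f)"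
  using leg_sqD[OF assms] by (simp add: leg_cell_def)

lemma leg_cell_vcmp:
  assumes s: "leg_sq a F f F' s" and t: "leg_sq b F g F' t" and u: "leg_sq c F h F' u"
    and \<alpha>: "\<alpha> \<in> cells2 Dbl" "tsrc \<alpha> = a" "ttgt \<alpha> = b" and \<beta>: "\<beta> \<in> cells2 Dbl" "tsrc \<beta> = b" "ttgt \<beta> = c"
    and \<phi>: "\<phi> \<in> cells2 Dbl" "tsrc \<phi> = f" "ttgt \<phi> = g" and \<psi>: "\<psi> \<in> cells2 Dbl" "tsrc \<psi> = g" "ttgt \<psi> = h"
    and st: "leg_cell F F' s t \<alpha> \<phi>" and tu: "leg_cell F F' t u \<beta> \<psi>"
  shows "leg_cell F F' s u (ttrans_vcmp \<beta> \<alpha>) (ttrans_vcmp \<psi> \<phi>)"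
proof -
  note [simp] = leg_sqD[OF s] leg_sqD[OF t] leg_sqD[OF u] \<alpha> \<beta> \<phi> \<psi>
  let ?F = "ttrans_id F" and ?F' = "ttrans_id F'"
  have "ttrans_vcmp u (ttrans_hcmp (ttrans_vcmp \<beta> \<alpha>) ?F) = ttrans_vcmp (ttrans_vcmp u (ttrans_hcmp \<beta> ?F)) (ttrans_hcmp \<alpha> ?F)"
    by (simp add: Dbl.whisker_vcmp2 Dbl.vcmp2_assoc')
  also have "... = ttrans_vcmp (ttrans_hcmp ?F' \<psi>) (ttrans_vcmp t (ttrans_hcmp \<alpha> ?F))"
    unfolding tu[unfolded leg_cell_def] by (simp add: Dbl.vcmp2_assoc')
  also have "... = ttrans_vcmp (ttrans_hcmp ?F' (ttrans_vcmp \<psi> \<phi>)) s"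
    unfolding st[unfolded leg_cell_def] by (simp add: Dbl.whisker_vcmp2 Dbl.vcmp2_assoc')
  finally show ?thesis unfolding leg_cell_def .
qed

text \<open>Interchange moves \<open>t\<close> past \<open>\<beta>\<close> and then
  \<open>\<phi>\<close> past \<open>t'\<close>; each move brings one of the two given equations into
  a position where it can be applied.\<close>

lemma leg_cell_hcmp:
  assumes s: "leg_sq a F f F' s" and t: "leg_sq b F g F' t" and s': "leg_sq a' F' f' F'' s'" and t': "leg_sq b' F' g' F'' t'"
    and \<alpha>: "\<alpha> \<in> cells2 Dbl" "tsrc \<alpha> = a" "ttgt \<alpha> = b" and \<beta>: "\<beta> \<in> cells2 Dbl" "tsrc \<beta> = a'" "ttgt \<beta> = b'"
    and \<phi>: "\<phi> \<in> cells2 Dbl" "tsrc \<phi> = f" "ttgt \<phi> = g" and \<psi>: "\<psi> \<in> cells2 Dbl" "tsrc \<psi> = f'" "ttgt \<psi> = g'"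
    and st: "leg_cell F F' s t \<alpha> \<phi>" and st': "leg_cell F' F'' s' t' \<beta> \<psi>"
  shows "leg_cell F F'' (paste s' a' f s) (paste t' b' g t) (ttrans_hcmp \<beta> \<alpha>) (ttrans_hcmp \<psi> \<phi>)"
proof -
  note [simp] = leg_sqD[OF s] leg_sqD[OF t] leg_sqD[OF s'] leg_sqD[OF t'] \<alpha> \<beta> \<phi> \<psi>
  let ?F = "ttrans_id F" and ?F' = "ttrans_id F'" and ?F'' = "ttrans_id F''"
  have "ttrans_vcmp (paste t' b' g t) (ttrans_hcmp (ttrans_hcmp \<beta> \<alpha>) ?F)
    = ttrans_vcmp (t' <* g) (ttrans_vcmp (b' *> t) (ttrans_hcmp \<beta> (ttrans_hcmp \<alpha> ?F)))"
    by (simp add: paste_def Dbl.vcmp2_assoc' Dbl.hcmp2_assoc')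
  also have "ttrans_vcmp (b' *> t) (ttrans_hcmp \<beta> (ttrans_hcmp \<alpha> ?F))
    = ttrans_hcmp \<beta> (ttrans_vcmp (ttrans_hcmp ?F' \<phi>) s)"
    unfolding st[unfolded leg_cell_def, symmetric]
    using Dbl.interchange'[of "ttrans_hcmp \<alpha> ?F" t \<beta> "ttrans_id b'"] by simp
  also have "... = ttrans_vcmp (ttrans_hcmp (ttrans_hcmp \<beta> ?F') \<phi>) (a' *> s)"
    using Dbl.interchange'[of s "ttrans_hcmp ?F' \<phi>" "ttrans_id a'" \<beta>] by (simp add: Dbl.hcmp2_assoc')
  also have "ttrans_vcmp (t' <* g) (ttrans_vcmp (ttrans_hcmp (ttrans_hcmp \<beta> ?F') \<phi>) (a' *> s))
    = ttrans_vcmp (ttrans_vcmp (t' <* g) (ttrans_hcmp (ttrans_hcmp \<beta> ?F') \<phi>)) (a' *> s)"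
    by (simp add: Dbl.vcmp2_assoc')
  also have "ttrans_vcmp (t' <* g) (ttrans_hcmp (ttrans_hcmp \<beta> ?F') \<phi>)
    = ttrans_hcmp (ttrans_vcmp (ttrans_hcmp ?F'' \<psi>) s') \<phi>"
    unfolding st'[unfolded leg_cell_def, symmetric]
    using Dbl.interchange'[of \<phi> "ttrans_id g" "ttrans_hcmp \<beta> ?F'" t'] by simp
  also have "... = ttrans_vcmp (ttrans_hcmp ?F'' (ttrans_hcmp \<psi> \<phi>)) (s' <* f)"
    using Dbl.interchange'[of "ttrans_id f" \<phi> s' "ttrans_hcmp ?F'' \<psi>"] by (simp add: Dbl.hcmp2_assoc')
  also have "ttrans_vcmp ... (a' *> s) = ttrans_vcmp (ttrans_hcmp ?F'' (ttrans_hcmp \<psi> \<phi>)) (paste s' a' f s)"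
    by (simp add: paste_def Dbl.vcmp2_assoc')
  finally show ?thesis unfolding leg_cell_def .
qed

section \<open>Closure of commuter transformations under pasting and their reflection by
  products\<close>

lemma companion_commuter_trans_id:
  assumes "F \<in> cells1 Dbl"
  shows "companion_commuter_trans (ttrans_id F)"
proof -
  interpret F: double_functor "ddom F" "dcod F" F using assms by (simp add: dfun_iff)
  show ?thesis
    unfolding companion_commuter_trans_def
    using assms by (auto simp: Let_def ttrans_id_simps[OF F.double_functor_axioms] intro!: F.B.has_companion_tid F.B.companion_commuter_vid)
qed

lemma companion_commuter_trans_vcmp:
  assumes "s \<in> cells2 Dbl" "t \<in> cells2 Dbl" "tsrc t = ttgt s" "companion_commuter_trans s" "companion_commuter_trans t"
  shows "companion_commuter_trans (ttrans_vcmp t s)"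
proof -
  let ?A = "ddom (tsrc s)" and ?B = "dcod (tsrc s)"
  interpret s: tight_transformation ?A ?B "tsrc s" "ttgt s" s using assms by (simp add: ttrans_iff)
  interpret t: tight_transformation ?A ?B "ttgt s" "ttgt t" t using assms by (simp add: ttrans_iff)
  show ?thesis
    unfolding companion_commuter_trans_def
    using assms by (auto simp: Let_def ttrans_vcmp_simps[OF s.tight_transformation_axioms] companion_commuter_trans_def
      intro!: s.F.B.has_companion_tcmp s.F.B.companion_commuter_vcmp)
qed

lemma companion_commuter_trans_whisker_left:
  assumes "s \<in> cells2 Dbl" "G \<in> cells1 Dbl" "ddom G = dcod (tsrc s)" "companion_commuter_trans s"
  shows "companion_commuter_trans (G *> s)"
proof -
  let ?A = "ddom (tsrc s)" and ?B = "dcod (tsrc s)"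
  interpret s: tight_transformation ?A ?B "tsrc s" "ttgt s" s using assms by (simp add: ttrans_iff)
  interpret G: double_functor ?B "dcod G" G using assms by (simp add: dfun_iff)
  show ?thesis
    unfolding companion_commuter_trans_def
    using assms by (auto simp: Let_def ttrans_whisker_left[OF s.tight_transformation_axioms G.double_functor_axioms]
      companion_commuter_trans_def intro!: G.has_companion_fun G.companion_commuter_fun)
qed

lemma companion_commuter_trans_whisker_right:
  assumes "s \<in> cells2 Dbl" "F \<in> cells1 Dbl" "dcod F = ddom (tsrc s)" "companion_commuter_trans s"
  shows "companion_commuter_trans (s <* F)"
proof -
  let ?A = "ddom (tsrc s)" and ?B = "dcod (tsrc s)"
  interpret s: tight_transformation ?A ?B "tsrc s" "ttgt s" s using assms by (simp add: ttrans_iff)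
  interpret F: double_functor "ddom F" ?A F using assms by (simp add: dfun_iff)
  show ?thesis
    unfolding companion_commuter_trans_def
    using assms by (auto simp: Let_def ttrans_whisker_right[OF F.double_functor_axioms s.tight_transformation_axioms]
      companion_commuter_trans_def)
qed

lemma companion_commuter_trans_paste:
  assumes "leg_sq a F f F' s" "leg_sq a' F' f' F'' s'" "companion_commuter_trans s" "companion_commuter_trans s'"
  shows "companion_commuter_trans (paste s' a' f s)"
  using leg_sqD[OF assms(1)] leg_sqD[OF assms(2)] assms(3,4) unfolding paste_def
  by (intro companion_commuter_trans_vcmp companion_commuter_trans_whisker_left companion_commuter_trans_whisker_right) simp_all

lemma product_reflects_companion_commuter_trans:
  fixes X :: "nat \<Rightarrow> 'u::infinite dbl"
  assumes P: "is_product Dbl n X y \<pi>" and t: "t \<in> cells2 Dbl" "dcod (tsrc t) = y"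
    and c: "\<And>j. j < n \<Longrightarrow> companion_commuter_trans (\<pi> j *> t)"
  shows "companion_commuter_trans t"
proof -
  let ?A = "ddom (tsrc t)"
  interpret t: tight_transformation ?A y "tsrc t" "ttgt t" t using t by (simp add: ttrans_iff)
  have p: "double_functor y (X j) (\<pi> j)" if "j < n" for j using is_productD(3)[OF P that] by (simp add: hom1_Dbl)
  have p': "\<pi> j \<in> cells1 Dbl" "ddom (\<pi> j) = y" "dcod (\<pi> j) = X j" if "j < n" for j
    using p[OF that] by (simp_all add: dfun_iff)
  have c': "(\<forall>x\<in>obs ?A. has_companion (X j) (tob (\<pi> j *> t) x)) \<and>
      (\<forall>l\<in>looses ?A. companion_commuter (X j) (tloose (\<pi> j *> t) l))" if j: "j < n" for j
    using c[OF j] t p'[OF j] unfolding companion_commuter_trans_def Let_def by simp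
  show ?thesis
    unfolding companion_commuter_trans_def Let_def t(2)
  proof (intro conjI ballI)
    fix x assume x: "x \<in> obs ?A"
    show "has_companion y (tob t x)"
    proof (rule product_reflects_has_companion[OF P])
      show "tob t x \<in> tights y" using x by simp
      show "has_companion (X j) (ftight (\<pi> j) (tob t x))" if j: "j < n" for j
        using bspec[OF conjunct1[OF c'[OF j]] x] ttrans_whisker_left(1)[OF t.tight_transformation_axioms p[OF j] x] by simp
    qed
  next
    fix l assume l: "l \<in> looses ?A"
    show "companion_commuter y (tloose t l)"
    proof (rule product_reflects_companion_commuter[OF P])
      show "tloose t l \<in> squares y" using l by simp
      show "companion_commuter (X j) (fsq (\<pi> j) (tloose t l))" if j: "j < n" for j
        using bspec[OF conjunct2[OF c'[OF j]] l] ttrans_whisker_left(2)[OF t.tight_transformation_axioms p[OF j] l] by simp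
    qed
  qed
qed

text \<open>For transformations between points the commuter condition on the loose component is automatic,
  because that component is isomorphic to a loose identity square.\<close>

definition point_commuter :: "'u::infinite ttrans \<Rightarrow> bool" where
  "point_commuter t \<longleftrightarrow> tight_iso (dcod (tsrc t)) (tob t (el 0)) \<and> has_conjoint (dcod (tsrc t)) (tob t (el 0))"

lemma point_commuter_iff:
  assumes "t \<in> cells2 Dbl" "ddom (tsrc t) = Pt"
  shows "(\<forall>x \<in> obs Pt. tight_iso (dcod (tsrc t)) (tob t x)) \<and> conjoint_commuter_trans t \<longleftrightarrow> point_commuter t"
proof -
  let ?B = "dcod (tsrc t)"
  interpret t: tight_transformation Pt ?B "tsrc t" "ttgt t" t using assms by (simp add: ttrans_iff)
  have "conjoint_commuter ?B (tloose t (el 0))" if h: "has_conjoint ?B (tob t (el 0))"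
  proof -
    let ?u = "funit (ttgt t) (el 0)" and ?v = "funit (tsrc t) (el 0)"
    obtain c b p where c: "conjoint ?B (tob t (el 0)) c b p" using h by (auto simp: has_conjoint_def)
    \<comment> \<open>The only loose arrow of \<open>Pt\<close> is the loose identity, so the unit
      axiom of a transformation governs the loose component. Solving it for that component uses
      invertibility of the unit comparison \<open>?v\<close>.\<close>
    have e: "tloose t (el 0) \<bullet>\<^bsub>?B\<^esub> ?v = ?u \<bullet>\<^bsub>?B\<^esub> hid ?B (tob t (el 0))" using t.tloose_id[of "el 0"] by simp
    have "tloose t (el 0) = (tloose t (el 0) \<bullet>\<^bsub>?B\<^esub> ?v) \<bullet>\<^bsub>?B\<^esub> sq_inv ?B ?v"
      by (simp add: t.F.B.sq_inv_cancel)
    also have "... = ?u \<bullet>\<^bsub>?B\<^esub> (hid ?B (tob t (el 0)) \<bullet>\<^bsub>?B\<^esub> sq_inv ?B ?v)"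
      unfolding e by (simp add: t.F.B.vcmp_assoc')
    also have "conjoint_commuter ?B ..."
      by (rule t.F.B.conjoint_commuter_hid[OF c]) (simp_all add: t.F.B.giso_intros)
    finally show ?thesis .
  qed
  then show ?thesis using assms by (auto simp: conjoint_commuter_trans_def point_commuter_def Let_def)
qed

lemma point_commuter_id:
  assumes "F \<in> cells1 Dbl" "ddom F = Pt"
  shows "point_commuter (ttrans_id F)"
proof -
  interpret F: double_functor Pt "dcod F" F using assms by (simp add: dfun_iff)
  show ?thesis
    using assms F.fob_in[of "el 0"] ttrans_id_simps(1)[OF F.double_functor_axioms, of "el 0"]
    by (simp add: point_commuter_def F.B.has_conjoint_tid)
qed

lemma point_commuter_vcmp:
  assumes "s \<in> cells2 Dbl" "t \<in> cells2 Dbl" "tsrc t = ttgt s" "ddom (tsrc s) = Pt" "point_commuter s" "point_commuter t"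
  shows "point_commuter (ttrans_vcmp t s)"
proof -
  let ?B = "dcod (tsrc s)"
  interpret s: tight_transformation Pt ?B "tsrc s" "ttgt s" s using assms by (simp add: ttrans_iff)
  interpret t: tight_transformation Pt ?B "ttgt s" "ttgt t" t using assms by (simp add: ttrans_iff)
  show ?thesis
    using assms s.F.B.tight_iso_tcmp[of "tob s (el 0)" "tob t (el 0)"] s.F.B.has_conjoint_tcmp[of "tob s (el 0)" "tob t (el 0)"]
      ttrans_vcmp_simps(1)[OF s.tight_transformation_axioms, of "el 0" t]
    by (simp add: point_commuter_def)
qed

lemma point_commuter_whisker:
  assumes "s \<in> cells2 Dbl" "G \<in> cells1 Dbl" "ddom G = dcod (tsrc s)" "ddom (tsrc s) = Pt" "point_commuter s"
  shows "point_commuter (G *> s)"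
proof -
  let ?B = "dcod (tsrc s)"
  interpret s: tight_transformation Pt ?B "tsrc s" "ttgt s" s using assms by (simp add: ttrans_iff)
  interpret G: double_functor ?B "dcod G" G using assms by (simp add: dfun_iff)
  show ?thesis
    using assms G.tight_iso_ftight[of "tob s (el 0)"] G.has_conjoint_fun[of "tob s (el 0)"]
      ttrans_whisker_left(1)[OF s.tight_transformation_axioms G.double_functor_axioms, of "el 0"]
    by (simp add: point_commuter_def)
qed

lemma product_reflects_point_commuter:
  fixes X :: "nat \<Rightarrow> 'u::infinite dbl"
  assumes P: "is_product Dbl n X y \<pi>" and t: "t \<in> cells2 Dbl" "dcod (tsrc t) = y" "ddom (tsrc t) = Pt"
    and c: "\<And>j. j < n \<Longrightarrow> point_commuter (\<pi> j *> t)"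
  shows "point_commuter t"
proof -
  interpret t: tight_transformation Pt y "tsrc t" "ttgt t" t using t by (simp add: ttrans_iff)
  have p: "double_functor y (X j) (\<pi> j)" if "j < n" for j using is_productD(3)[OF P that] by (simp add: hom1_Dbl)
  have "tight_iso (X j) (ftight (\<pi> j) (tob t (el 0)))" "has_conjoint (X j) (ftight (\<pi> j) (tob t (el 0)))" if j: "j < n" for j
    using c[OF j] t dfun_cats[OF p[OF j]] p[OF j] ttrans_whisker_left(1)[OF t.tight_transformation_axioms p[OF j], of "el 0"]
    by (simp_all add: point_commuter_def dfun_iff)
  then show ?thesis
    using product_reflects_tight_iso[OF P, of "tob t (el 0)"] product_reflects_has_conjoint[OF P, of "tob t (el 0)"] t(2)
    by (simp add: point_commuter_def)
qed

lemma point_commuter_paste: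
  assumes "leg_sq a F (dfun_id Pt) F' s" "leg_sq a' F' (dfun_id Pt) F'' s'" "point_commuter s" "point_commuter s'"
  shows "point_commuter (paste s' a' (dfun_id Pt) s)"
  using leg_sqD[OF assms(1)] leg_sqD[OF assms(2)] assms(3,4) unfolding paste_def
  by (auto intro!: point_commuter_vcmp point_commuter_whisker)

section \<open>The 2-category of pointed double categories\<close>

lemma is_pointed_iff: "is_pointed d \<longleftrightarrow> d \<in> cells1 Dbl \<and> ddom d = Pt"
  by (simp add: is_pointed_def)

lemma Pt_simps [simp]: "double_category Pt" "dfun_id Pt oo dfun_id Pt = dfun_id Pt"
  using double_category_Pt Dbl.cmp1_id(1)[OF dfun_id_cells1[OF double_category_Pt]] by simp_all

text \<open>A map of pointed double categories is a leg square over the identity of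
  \<open>Pt\<close> whose cell has an invertible component with a conjoint. The pasting calculus
  thereby covers these maps as well.\<close>

lemma is_point_map_iff:
  "is_point_map m \<longleftrightarrow> is_pointed (pdom m) \<and> is_pointed (pcod m) \<and>
    leg_sq (pmap m) (pdom m) (dfun_id Pt) (pcod m) (piso m) \<and> point_commuter (piso m)"
  using point_commuter_iff[of "piso m"]
  by (auto simp: is_point_map_def is_pointed_iff leg_sq_def hom1_def hom2_def)

lemma point_map_leg:
  "is_point_map m \<Longrightarrow> pdom m = d \<Longrightarrow> pcod m = e \<Longrightarrow> leg_sq (pmap m) d (dfun_id Pt) e (piso m)"
  by (auto simp: is_point_map_iff)

lemma is_point_cell_iff:
  "is_point_cell c \<longleftrightarrow> is_point_map (psrc c) \<and> is_point_map (ptgt c) \<and> pdom (ptgt c) = pdom (psrc c) \<and>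
    pcod (ptgt c) = pcod (psrc c) \<and> pcell c \<in> cells2 Dbl \<and> tsrc (pcell c) = pmap (psrc c) \<and> ttgt (pcell c) = pmap (ptgt c) \<and>
    leg_cell (pdom (psrc c)) (pcod (psrc c)) (piso (psrc c)) (piso (ptgt c)) (pcell c) (ttrans_id (dfun_id Pt))"
proof -
  have "ttrans_vcmp (ttrans_hcmp (ttrans_id (pcod m)) (ttrans_id (dfun_id Pt))) (piso m) = piso m" if "is_point_map m" for m
    using that by (auto simp: is_point_map_iff is_pointed_iff leg_sq_def)
  from this[of "psrc c"] show ?thesis
    by (auto simp: is_point_cell_def Let_def hom2_def leg_cell_def)
qed

text \<open>\<open>point_cmp\<close> has no whiskering with the identity functor of
  \<open>Pt\<close>; inserting it changes nothing and turns the composite into an instance of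
  \<open>paste\<close>.\<close>

lemma point_cmp_paste:
  assumes "is_point_map m" "is_point_map m'" "pdom m' = pcod m"
  shows "point_cmp m' m = \<lparr>pdom = pdom m, pcod = pcod m', pmap = pmap m' oo pmap m,
    piso = paste (piso m') (pmap m') (dfun_id Pt) (piso m)\<rparr>"
  using assms by (auto simp: point_cmp_def paste_def is_point_map_iff is_pointed_iff leg_sq_def)

lemma Dbl_pt_simps [simp]:
  "cells0 Dbl_pt = {d. is_pointed d}" "cells1 Dbl_pt = {m. is_point_map m}" "cells2 Dbl_pt = {c. is_point_cell c}"
  "dom1 Dbl_pt = pdom" "cod1 Dbl_pt = pcod" "src2 Dbl_pt = psrc" "tgt2 Dbl_pt = ptgt"
  "id1 Dbl_pt d = \<lparr>pdom = d, pcod = d, pmap = dfun_id (dcod d), piso = ttrans_id d\<rparr>"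
  "cmp1 Dbl_pt = point_cmp" "id2 Dbl_pt m = \<lparr>psrc = m, ptgt = m, pcell = ttrans_id (pmap m)\<rparr>"
  "vcmp2 Dbl_pt d' c' = \<lparr>psrc = psrc c', ptgt = ptgt d', pcell = ttrans_vcmp (pcell d') (pcell c')\<rparr>"
  "hcmp2 Dbl_pt d' c' = \<lparr>psrc = point_cmp (psrc d') (psrc c'), ptgt = point_cmp (ptgt d') (ptgt c'),
     pcell = ttrans_hcmp (pcell d') (pcell c')\<rparr>"
  by (simp_all add: Dbl_pt_def)

lemma is_point_map_cmp:
  assumes "is_point_map m" "is_point_map m'" "pdom m' = pcod m"
  shows "is_point_map (point_cmp m' m)"
  using assms leg_sq_paste[of "pmap m" "pdom m" "dfun_id Pt" "pcod m" "piso m" "pmap m'" "dfun_id Pt" "pcod m'" "piso m'"]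
    point_commuter_paste[of "pmap m" "pdom m" "pcod m" "piso m" "pmap m'" "pcod m'" "piso m'"]
  by (simp add: point_cmp_paste) (simp add: is_point_map_iff)

lemma point_cmp_assoc:
  assumes "is_point_map f" "is_point_map g" "is_point_map h" "pdom g = pcod f" "pdom h = pcod g"
  shows "point_cmp (point_cmp h g) f = point_cmp h (point_cmp g f)"
proof -
  have l: "leg_sq (pmap f) (pdom f) (dfun_id Pt) (pcod f) (piso f)" "leg_sq (pmap g) (pcod f) (dfun_id Pt) (pcod g) (piso g)"
    "leg_sq (pmap h) (pcod g) (dfun_id Pt) (pcod h) (piso h)"
    using assms by (simp_all add: is_point_map_iff)
  have gf: "is_point_map (point_cmp g f)" and hg: "is_point_map (point_cmp h g)" using assms by (simp_all add: is_point_map_cmp)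
  have "(pmap h oo pmap g) oo pmap f = pmap h oo pmap g oo pmap f"
    using leg_sqD[OF l(1)] leg_sqD[OF l(2)] leg_sqD[OF l(3)] by simp
  then show ?thesis
    using paste_assoc[OF l] assms point_cmp_paste[OF gf assms(3)] point_cmp_paste[OF assms(1) hg]
    by (simp add: point_cmp_paste)
qed

text \<open>Underlying functors and transformations satisfy the laws of \<open>Dbl\<close>, and
  structure cells those of \<open>paste\<close>. For 2-cells only membership needs an argument:
  \<open>leg_cell_vcmp\<close> and \<open>leg_cell_hcmp\<close>, with identities of
  \<open>Pt\<close> as the inner cells.\<close>

lemma two_category_Dbl_pt: "two_category (Dbl_pt :: ('u::infinite dfun, 'u point_map, 'u point_cell) twocat)"
proof (rule two_categoryI, unfold Dbl_pt_simps mem_Collect_eq, goal_cases)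
  case (1 f)
  then show ?case by (simp add: is_point_map_iff)
next
  case (2 f)
  then show ?case by (simp add: is_point_map_iff)
next
  case (3 x)
  then show ?case using leg_sq_id[of x] point_commuter_id[of x] by (simp add: is_point_map_iff is_pointed_iff)
next
  case (4 f g)
  then show ?case using is_point_map_cmp[of f g] by (simp add: point_cmp_def)
next
  case (5 f)
  then have "leg_sq (pmap f) (pdom f) (dfun_id Pt) (pcod f) (piso f)" by (simp add: is_point_map_iff)
  note leg_sqD[OF this]
  then show ?case by (intro point_map.equality) (simp_all add: point_cmp_def)
next
  case (6 f)
  then have "leg_sq (pmap f) (pdom f) (dfun_id Pt) (pcod f) (piso f)" "ddom (pcod f) = Pt" by (simp_all add: is_point_map_iff is_pointed_iff)
  note leg_sqD[OF this(1)] this(2)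
  then show ?case by (intro point_map.equality) (simp_all add: point_cmp_def)
next
  case (7 f g h)
  then show ?case by (intro point_cmp_assoc)
next
  case (8 a)
  then show ?case by (simp add: is_point_cell_iff)
next
  case (9 f)
  then show ?case using leg_cell_id[of "pmap f" "pdom f" "dfun_id Pt" "pcod f" "piso f"]
    by (simp add: is_point_cell_iff) (simp add: is_point_map_iff leg_sq_def)
next
  case (10 a b)
  have "leg_cell (pdom (psrc a)) (pcod (psrc a)) (piso (psrc a)) (piso (ptgt b)) (ttrans_vcmp (pcell b) (pcell a))
      (ttrans_vcmp (ttrans_id (dfun_id Pt)) (ttrans_id (dfun_id Pt)))"
    by (rule leg_cell_vcmp[OF point_map_leg point_map_leg point_map_leg, of "psrc a" _ _ "ptgt a" "ptgt b"])
      (use 10 in \<open>simp_all add: is_point_cell_iff\<close>)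
  then show ?case using 10 by (simp add: is_point_cell_iff)
next
  case (11 a)
  then show ?case by (simp add: is_point_cell_iff)
next
  case (12 a)
  then show ?case by (simp add: is_point_cell_iff)
next
  case (13 a b c)
  then show ?case by (simp add: is_point_cell_iff Dbl.vcmp2_assoc')
next
  case (14 a b)
  have m: "is_point_map (psrc a)" "is_point_map (ptgt a)" "is_point_map (psrc b)" "is_point_map (ptgt b)"
    "pdom (psrc b) = pcod (psrc a)" "pdom (ptgt b) = pcod (ptgt a)"
    using 14 by (simp_all add: is_point_cell_iff)
  have "leg_cell (pdom (psrc a)) (pcod (psrc b)) (paste (piso (psrc b)) (pmap (psrc b)) (dfun_id Pt) (piso (psrc a)))
      (paste (piso (ptgt b)) (pmap (ptgt b)) (dfun_id Pt) (piso (ptgt a))) (ttrans_hcmp (pcell b) (pcell a))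
      (ttrans_hcmp (ttrans_id (dfun_id Pt)) (ttrans_id (dfun_id Pt)))"
    by (rule leg_cell_hcmp[OF point_map_leg point_map_leg point_map_leg point_map_leg, of "psrc a" _ _ "ptgt a" "psrc b" _ "ptgt b"])
      (use 14 in \<open>auto simp: is_point_cell_iff\<close>)
  moreover have "ddom (tsrc (pcell b)) = dcod (tsrc (pcell a))"
    using 14 leg_sqD[of "pmap (psrc a)" "pdom (psrc a)" "dfun_id Pt" "pcod (psrc a)" "piso (psrc a)"]
      leg_sqD[of "pmap (psrc b)" "pdom (psrc b)" "dfun_id Pt" "pcod (psrc b)" "piso (psrc b)"]
    by (simp add: is_point_cell_iff is_point_map_iff)
  ultimately show ?case
    using 14 m is_point_map_cmp[OF m(1,3,5)] is_point_map_cmp[OF m(2,4,6)]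
    by (simp add: is_point_cell_iff point_cmp_paste[OF m(1,3,5)] point_cmp_paste[OF m(2,4,6)])
next
  case (15 f g)
  then have "leg_sq (pmap f) (pdom f) (dfun_id Pt) (pcod f) (piso f)" "leg_sq (pmap g) (pdom g) (dfun_id Pt) (pcod g) (piso g)"
    by (simp_all add: is_point_map_iff)
  note leg_sqD[OF this(1)] leg_sqD[OF this(2)]
  then show ?case using 15 by (simp add: point_cmp_def)
next
  case (16 a a' b b')
  then have "leg_sq (pmap (psrc a)) (pdom (psrc a)) (dfun_id Pt) (pcod (psrc a)) (piso (psrc a))"
    "leg_sq (pmap (psrc b)) (pdom (psrc b)) (dfun_id Pt) (pcod (psrc b)) (piso (psrc b))"
    by (simp_all add: is_point_map_iff is_point_cell_iff)
  note leg_sqD[OF this(1)] leg_sqD[OF this(2)]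
  then show ?case using 16 by (simp add: is_point_cell_iff Dbl.interchange')
next
  case (17 a)
  then have m: "is_point_map (psrc a)" "is_point_map (ptgt a)" "pcod (ptgt a) = pcod (psrc a)" by (simp_all add: is_point_cell_iff)
  have l: "leg_sq (pmap f) (pdom f) (dfun_id Pt) (pcod f) (piso f)" if "is_point_map f" for f using that by (simp add: is_point_map_iff)
  have "point_cmp \<lparr>pdom = pcod f, pcod = pcod f, pmap = dfun_id (dcod (pcod f)), piso = ttrans_id (pcod f)\<rparr> f = f"
    if "is_point_map f" for f :: "'u point_map"
    using leg_sqD[OF l[OF that]] by (intro point_map.equality) (simp_all add: point_cmp_def)
  from this[OF m(1)] this[OF m(2)] show ?case
    using 17 m leg_sqD[OF l[OF m(1)]] by (intro point_cell.equality) (simp_all add: is_point_cell_iff)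
next
  case (18 a)
  then have m: "is_point_map (psrc a)" "is_point_map (ptgt a)" "pdom (ptgt a) = pdom (psrc a)" by (simp_all add: is_point_cell_iff)
  have l: "leg_sq (pmap f) (pdom f) (dfun_id Pt) (pcod f) (piso f)" if "is_point_map f" for f using that by (simp add: is_point_map_iff)
  have "point_cmp f \<lparr>pdom = pdom f, pcod = pdom f, pmap = dfun_id (dcod (pdom f)), piso = ttrans_id (pdom f)\<rparr> = f"
    if "is_point_map f" for f :: "'u point_map"
    using leg_sqD[OF l[OF that]] that by (intro point_map.equality) (simp_all add: point_cmp_def is_point_map_iff is_pointed_iff)
  from this[OF m(1)] this[OF m(2)] show ?case
    using 18 m leg_sqD[OF l[OF m(1)]] by (intro point_cell.equality) (simp_all add: is_point_cell_iff)
next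
  case (19 a b c)
  then have m: "is_point_map (psrc a)" "is_point_map (ptgt a)" "is_point_map (psrc b)" "is_point_map (ptgt b)"
    "is_point_map (psrc c)" "is_point_map (ptgt c)" "pdom (psrc b) = pcod (psrc a)" "pdom (ptgt b) = pcod (ptgt a)"
    "pdom (psrc c) = pcod (psrc b)" "pdom (ptgt c) = pcod (ptgt b)"
    by (simp_all add: is_point_cell_iff)
  have l: "leg_sq (pmap f) (pdom f) (dfun_id Pt) (pcod f) (piso f)" if "is_point_map f" for f :: "'u point_map"
    using that by (simp add: is_point_map_iff)
  show ?case
    using 19 point_cmp_assoc[OF m(1,3,5,7,9)] point_cmp_assoc[OF m(2,4,6,8,10)] leg_sqD[OF l[OF m(1)]] leg_sqD[OF l[OF m(3)]] leg_sqD[OF l[OF m(5)]] m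
    by (simp add: is_point_cell_iff Dbl.hcmp2_assoc')
qed

section \<open>Strict cones of leg squares; products of pointed double categories\<close>

lemma leg_sq_strict_eq: "leg_sq p F' q G (ttrans_id (p oo F')) \<Longrightarrow> G oo q = p oo F'"
  using leg_sqD[of p F' q G "ttrans_id (p oo F')"] by simp

text \<open>When the second square is filled by an identity, pasting reduces to whiskering.
  Composition with a projection of a strict cone can then be computed by the universal property in
  \<open>Dbl\<close>.\<close>

lemma paste_strict:
  assumes "leg_sq a F f F' s" "leg_sq p F' q G (ttrans_id (p oo F'))"
  shows "paste (ttrans_id (p oo F')) p f s = p *> s"
proof -
  note [simp] = leg_sqD[OF assms(1)] leg_sqD(1)[OF assms(2)] leg_sqD(6)[OF assms(2)]
  have "ttrans_vcmp (ttrans_id (p oo F' oo f)) (p *> s) = p *> s"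
    by (rule Dbl.vcmp2_id) simp_all
  moreover have "F' \<in> cells1 Dbl" using leg_sqD(2)[OF assms(2)] .
  ultimately show ?thesis by (simp add: paste_def)
qed

text \<open>Since the cone commutes strictly with the legs, every \<open>s j\<close> runs between
  the images under \<open>p j\<close> of one and the same pair of functors into \<open>B\<close>.
  The two-dimensional part of the universal property assembles them into one cell.\<close>

lemma leg_product_map:
  assumes P: "is_product Dbl n X B p" and L: "\<And>j. j < n \<Longrightarrow> leg_sq (p j) F' (q j) (G j) (ttrans_id (p j oo F'))"
    and F: "F \<in> cells1 Dbl" and F': "F' \<in> cells1 Dbl" "dcod F' = B" and a: "a \<in> cells1 Dbl" "ddom a = dcod F" "dcod a = B"
    and f: "f \<in> cells1 Dbl" "ddom f = ddom F" "dcod f = ddom F'"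
    and s: "\<And>j. j < n \<Longrightarrow> leg_sq (p j oo a) F (q j oo f) (G j) (s j)"
  obtains t where "leg_sq a F f F' t" "\<And>j. j < n \<Longrightarrow> p j *> t = s j"
proof (rule product_cell[OF P two_category_Dbl, of "a oo F" "ddom F" "F' oo f" s])
  show "a oo F \<in> hom1 Dbl (ddom F) B" "F' oo f \<in> hom1 Dbl (ddom F) B"
    using F F' a f by (simp_all add: hom1_def)
  show "s j \<in> hom2 Dbl (cmp1 Dbl (p j) (a oo F)) (cmp1 Dbl (p j) (F' oo f))" if j: "j < n" for j
  proof -
    note S = leg_sqD[OF s[OF j]] and l = leg_sqD(1-9)[OF L[OF j]]
    have "ttgt (s j) = (G j oo q j) oo f" using S l f by simp
    then have "ttgt (s j) = p j oo F' oo f" unfolding leg_sq_strict_eq[OF L[OF j]] using l f by simp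
    moreover have "tsrc (s j) = p j oo a oo F" using S(10) l a F F' by simp
    ultimately show ?thesis using S(5) by (simp add: hom2_def)
  qed
next
  fix t assume t: "t \<in> hom2 Dbl (a oo F) (F' oo f)" "\<And>i. i < n \<Longrightarrow> hcmp2 Dbl (id2 Dbl (p i)) t = s i"
  show thesis by (rule that[of t]) (use t F F' a f in \<open>simp_all add: leg_sq_def hom2_def\<close>)
qed

lemma leg_product_unique:
  assumes P: "is_product Dbl n X B p" and L: "leg_sq a F f F' s" "leg_sq a F f F' t" "dcod a = B"
    and e: "\<And>j. j < n \<Longrightarrow> p j *> s = p j *> t"
  shows "s = t"
  by (rule product_cell_unique[OF P two_category_Dbl, of "a oo F" "ddom F" "F' oo f"])
    (use leg_sqD[OF L(1)] leg_sqD[OF L(2)] L(3) e in \<open>simp_all add: hom1_def hom2_def\<close>)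

text \<open>An equation between cells into \<open>B\<close> may be tested under each
  \<open>p j\<close>. Strictness of the cone turns \<open>p j *> F' *> \<phi>\<close> into
  \<open>G j *> q j *> \<phi>\<close>, which is the form of the conditions on the
  components.\<close>

lemma leg_product_cell:
  assumes P: "is_product Dbl n X B p" and L: "\<And>j. j < n \<Longrightarrow> leg_sq (p j) F' (q j) (G j) (ttrans_id (p j oo F'))"
    and s: "leg_sq a F f F' s" and t: "leg_sq b F g F' t" and B: "dcod F' = B"
    and \<alpha>: "\<alpha> \<in> cells2 Dbl" "tsrc \<alpha> = a" "ttgt \<alpha> = b" and \<phi>: "\<phi> \<in> cells2 Dbl" "tsrc \<phi> = f" "ttgt \<phi> = g"
    and c: "\<And>j. j < n \<Longrightarrow> leg_cell F (G j) (p j *> s) (p j *> t)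
      (p j *> \<alpha>) (q j *> \<phi>)"
  shows "leg_cell F F' s t \<alpha> \<phi>"
  unfolding leg_cell_def
proof (rule product_cell_unique[OF P two_category_Dbl, of "a oo F" "ddom F" "F' oo g"])
  note [simp] = leg_sqD[OF s] leg_sqD[OF t] \<alpha> \<phi> B[symmetric]
  show "a oo F \<in> hom1 Dbl (ddom F) B" "F' oo g \<in> hom1 Dbl (ddom F) B" by (simp_all add: hom1_def)
  show "ttrans_vcmp t (\<alpha> <* F) \<in> hom2 Dbl (a oo F) (F' oo g)"
    "ttrans_vcmp (F' *> \<phi>) s \<in> hom2 Dbl (a oo F) (F' oo g)"
    by (simp_all add: hom2_def)
  fix j assume j: "j < n"
  note l = leg_sqD(1-4,6-9)[OF L[OF j]]
  note [simp] = l(1-6) l(7)[simplified] l(8)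
  have "p j *> ttrans_vcmp t (\<alpha> <* F)
    = ttrans_vcmp (p j *> t) ((p j *> \<alpha>) <* F)"
    by (simp add: Dbl.whisker_vcmp2 Dbl.hcmp2_assoc')
  also have "... = ttrans_vcmp (G j *> q j *> \<phi>) (p j *> s)"
    by (rule c[OF j, unfolded leg_cell_def])
  also have "G j *> q j *> \<phi> = (G j oo q j) *> \<phi>"
    by (simp add: Dbl.whisker_cmp1)
  also have "... = p j *> F' *> \<phi>"
    unfolding leg_sq_strict_eq[OF L[OF j]] by (simp add: Dbl.whisker_cmp1)
  also have "ttrans_vcmp ... (p j *> s) = p j *> ttrans_vcmp (F' *> \<phi>) s"
    by (simp add: Dbl.whisker_vcmp2)
  finally show "hcmp2 Dbl (id2 Dbl (p j)) (ttrans_vcmp t (\<alpha> <* F))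
    = hcmp2 Dbl (id2 Dbl (p j)) (ttrans_vcmp (F' *> \<phi>) s)" by simp
qed

lemma hom1_Dbl_pt: "m \<in> hom1 Dbl_pt d e \<longleftrightarrow> is_point_map m \<and> pdom m = d \<and> pcod m = e"
  by (auto simp: hom1_def)

text \<open>The functor, the structure cell and the 2-cells into the product are all induced by
  \<open>P\<close> in \<open>Dbl\<close>. The structure cell so obtained is admissible by
  reflection: its component is invertible and has a conjoint because this holds after each
  projection.\<close>

lemma pointed_product:
  fixes X :: "nat \<Rightarrow> 'u::infinite dfun"
  assumes P: "is_product Dbl n (\<lambda>j. dcod (X j)) (dcod d) p" and d: "is_pointed d" and X: "\<And>j. j < n \<Longrightarrow> is_pointed (X j)"
    and pX: "\<And>j. j < n \<Longrightarrow> p j oo d = X j"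
  shows "is_product Dbl_pt n X d (\<lambda>j. \<lparr>pdom = d, pcod = X j, pmap = p j, piso = ttrans_id (X j)\<rparr>)"
    (is "is_product _ _ _ _ ?\<pi>")
proof (rule is_productI)
  have d': "d \<in> cells1 Dbl" "ddom d = Pt" using d by (simp_all add: is_pointed_iff)
  have p: "p j \<in> cells1 Dbl" "ddom (p j) = dcod d" "dcod (p j) = dcod (X j)" if "j < n" for j
    using is_productD(3)[OF P that] by (simp_all add: hom1_def)
  have L: "leg_sq (p j) d (dfun_id Pt) (X j) (ttrans_id (p j oo d))" if j: "j < n" for j
    using p[OF j] X[OF j] d' unfolding leg_sq_def pX[OF j] is_pointed_iff by simp
  have Li: "ttrans_id (X j) = ttrans_id (p j oo d)" if "j < n" for j using pX[OF that] by simp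
  show "d \<in> cells0 Dbl_pt" using d by simp
  show "X j \<in> cells0 Dbl_pt" if "j < n" for j using X[OF that] by simp
  have pm: "is_point_map (?\<pi> j)" if j: "j < n" for j
    using L[OF j] d X[OF j] point_commuter_id[of "X j"] unfolding Li[OF j, symmetric] by (simp add: is_point_map_iff is_pointed_iff)
  then show "?\<pi> j \<in> hom1 Dbl_pt d (X j)" if "j < n" for j using that by (simp add: hom1_Dbl_pt)
  have cmp: "point_cmp (?\<pi> j) m = \<lparr>pdom = z, pcod = X j, pmap = p j oo pmap m, piso = p j *> piso m\<rparr>"
    if j: "j < n" and m: "is_point_map m" "pdom m = z" "pcod m = d" for j z m
    using point_cmp_paste[OF m(1) pm[OF j]] m paste_strict[OF point_map_leg[OF m] L[OF j]] unfolding Li[OF j] by simp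
  {
    fix z f assume z: "z \<in> cells0 Dbl_pt" and f: "\<And>i. i < n \<Longrightarrow> f i \<in> hom1 Dbl_pt z (X i)"
    have z': "z \<in> cells1 Dbl" "ddom z = Pt" using z by (simp_all add: is_pointed_iff)
    have fm: "is_point_map (f i)" "pdom (f i) = z" "pcod (f i) = X i" if "i < n" for i
      using f[OF that] by (simp_all add: hom1_Dbl_pt)
    have fl: "leg_sq (pmap (f i)) z (dfun_id Pt) (X i) (piso (f i))" if "i < n" for i
      by (rule point_map_leg[OF fm[OF that]])
    obtain h where h: "h \<in> hom1 Dbl (dcod z) (dcod d)" "\<And>i. i < n \<Longrightarrow> cmp1 Dbl (p i) h = pmap (f i)"
    proof (rule product_map[OF P, of "dcod z" "\<lambda>i. pmap (f i)"])
      show "dcod z \<in> cells0 Dbl" using z' dfun_cats[of "ddom z" "dcod z" z] by (simp add: dfun_iff)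
      show "pmap (f i) \<in> hom1 Dbl (dcod z) (dcod (X i))" if "i < n" for i using leg_sqD[OF fl[OF that]] by (simp add: hom1_def)
    qed blast
    have h': "h \<in> cells1 Dbl" "ddom h = dcod z" "dcod h = dcod d" "\<And>i. i < n \<Longrightarrow> p i oo h = pmap (f i)"
      using h by (simp_all add: hom1_def)
    obtain t where t: "leg_sq h z (dfun_id Pt) d t" "\<And>j. j < n \<Longrightarrow> p j *> t = piso (f j)"
      by (rule leg_product_map[OF P L z'(1) d'(1) refl h'(1-3), of "dfun_id Pt" "\<lambda>j. piso (f j)"])
        (use z' d' h'(4) fl in simp_all)
    have "point_commuter t"
    proof (rule product_reflects_point_commuter[OF P])
      show "t \<in> cells2 Dbl" "dcod (tsrc t) = dcod d" "ddom (tsrc t) = Pt" using leg_sqD[OF t(1)] z' by simp_all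
      show "point_commuter (p j *> t)" if "j < n" for j
        using fm[OF that] unfolding t(2)[OF that] by (simp add: is_point_map_iff)
    qed
    then have m: "is_point_map \<lparr>pdom = z, pcod = d, pmap = h, piso = t\<rparr>" (is "is_point_map ?m")
      using t(1) z d by (simp add: is_point_map_iff)
    have "point_cmp (?\<pi> i) ?m = f i" if "i < n" for i
      unfolding cmp[OF that m, of z, simplified] using fm[OF that] t(2)[OF that] h'(4)[OF that]
      by (intro point_map.equality) simp_all
    then show "\<exists>h\<in>hom1 Dbl_pt z d. \<forall>i<n. cmp1 Dbl_pt (?\<pi> i) h = f i"
      using m by (intro bexI[of _ ?m]) (simp_all add: hom1_Dbl_pt)
  next
    fix z h k assume hk: "h \<in> hom1 Dbl_pt z d" "k \<in> hom1 Dbl_pt z d"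
      and e: "\<And>i. i < n \<Longrightarrow> cmp1 Dbl_pt (?\<pi> i) h = cmp1 Dbl_pt (?\<pi> i) k"
    have h: "is_point_map h" "pdom h = z" "pcod h = d" and k: "is_point_map k" "pdom k = z" "pcod k = d"
      using hk by (simp_all add: hom1_Dbl_pt)
    note hl = point_map_leg[OF h] and kl = point_map_leg[OF k]
    have e': "p i oo pmap h = p i oo pmap k"
      "p i *> piso h = p i *> piso k" if "i < n" for i
      using e[OF that] by (simp_all add: cmp[OF that h] cmp[OF that k])
    have pe: "pmap h = pmap k"
      by (rule product_map_unique[OF P two_category_Dbl, of "pmap h" "dcod z"])
        (use leg_sqD[OF hl] leg_sqD[OF kl] e'(1) in \<open>simp_all add: hom1_def\<close>)
    have "piso h = piso k"
      by (rule leg_product_unique[OF P hl kl[folded pe]]) (use leg_sqD[OF hl] e'(2) in simp_all)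
    then show "h = k" using pe h k by (intro point_map.equality) simp_all
  next
    fix z h k a assume hk: "h \<in> hom1 Dbl_pt z d" "k \<in> hom1 Dbl_pt z d"
      and a: "\<And>i. i < n \<Longrightarrow> a i \<in> hom2 Dbl_pt (cmp1 Dbl_pt (?\<pi> i) h) (cmp1 Dbl_pt (?\<pi> i) k)"
    have h: "is_point_map h" "pdom h = z" "pcod h = d" and k: "is_point_map k" "pdom k = z" "pcod k = d"
      using hk by (simp_all add: hom1_Dbl_pt)
    note hl = point_map_leg[OF h] and kl = point_map_leg[OF k]
    have a': "is_point_cell (a i)" "psrc (a i) = point_cmp (?\<pi> i) h" "ptgt (a i) = point_cmp (?\<pi> i) k" if "i < n" for i
      using a[OF that] by (simp_all add: hom2_def)
    obtain c where c: "c \<in> hom2 Dbl (pmap h) (pmap k)" "\<And>i. i < n \<Longrightarrow> hcmp2 Dbl (id2 Dbl (p i)) c = pcell (a i)"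
    proof (rule product_cell[OF P two_category_Dbl, of "pmap h" "dcod z" "pmap k" "\<lambda>i. pcell (a i)"])
      show "pmap h \<in> hom1 Dbl (dcod z) (dcod d)" "pmap k \<in> hom1 Dbl (dcod z) (dcod d)"
        using leg_sqD[OF hl] leg_sqD[OF kl] by (simp_all add: hom1_def)
      show "pcell (a i) \<in> hom2 Dbl (cmp1 Dbl (p i) (pmap h)) (cmp1 Dbl (p i) (pmap k))" if "i < n" for i
        using a'[OF that] by (simp add: is_point_cell_iff hom2_def cmp[OF that h] cmp[OF that k])
    qed blast
    have c': "c \<in> cells2 Dbl" "tsrc c = pmap h" "ttgt c = pmap k" "\<And>i. i < n \<Longrightarrow> p i *> c = pcell (a i)"
      using c by (simp_all add: hom2_def)
    have "leg_cell z d (piso h) (piso k) c (ttrans_id (dfun_id Pt))"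
    proof (rule leg_product_cell[OF P L hl kl refl c'(1-3)])
      fix j assume j: "j < n"
      show "leg_cell z (X j) (p j *> piso h) (p j *> piso k)
        (p j *> c) (ttrans_hcmp (ttrans_id (dfun_id Pt)) (ttrans_id (dfun_id Pt)))"
        using a'[OF j] unfolding c'(4)[OF j] by (simp add: is_point_cell_iff cmp[OF j h] cmp[OF j k])
    qed simp_all
    then have m: "is_point_cell \<lparr>psrc = h, ptgt = k, pcell = c\<rparr>" (is "is_point_cell ?c")
      using h k c' by (simp add: is_point_cell_iff)
    have "hcmp2 Dbl_pt (id2 Dbl_pt (?\<pi> i)) ?c = a i" if "i < n" for i
      using a'[OF that] c'(4)[OF that] by (intro point_cell.equality) simp_all
    then show "\<exists>c\<in>hom2 Dbl_pt h k. \<forall>i<n. hcmp2 Dbl_pt (id2 Dbl_pt (?\<pi> i)) c = a i"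
      using m by (intro bexI[of _ ?c]) (simp_all add: hom2_def)
  next
    fix z h k c e assume hk: "h \<in> hom1 Dbl_pt z d" "k \<in> hom1 Dbl_pt z d" and ce: "c \<in> hom2 Dbl_pt h k" "e \<in> hom2 Dbl_pt h k"
      and eq: "\<And>i. i < n \<Longrightarrow> hcmp2 Dbl_pt (id2 Dbl_pt (?\<pi> i)) c = hcmp2 Dbl_pt (id2 Dbl_pt (?\<pi> i)) e"
    have h: "is_point_map h" "pdom h = z" "pcod h = d" and k: "is_point_map k" "pdom k = z" "pcod k = d"
      using hk by (simp_all add: hom1_Dbl_pt)
    note hl = point_map_leg[OF h] and kl = point_map_leg[OF k]
    have c': "psrc c = h" "ptgt c = k" "psrc e = h" "ptgt e = k" using ce by (simp_all add: hom2_def)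
    have "pcell c = pcell e"
    proof (rule product_cell_unique[OF P two_category_Dbl, of "pmap h" "dcod z" "pmap k"])
      show "pmap h \<in> hom1 Dbl (dcod z) (dcod d)" "pmap k \<in> hom1 Dbl (dcod z) (dcod d)"
        using leg_sqD[OF hl] leg_sqD[OF kl] by (simp_all add: hom1_def)
      show "pcell c \<in> hom2 Dbl (pmap h) (pmap k)" "pcell e \<in> hom2 Dbl (pmap h) (pmap k)"
        using ce by (auto simp: hom2_def is_point_cell_iff)
      show "hcmp2 Dbl (id2 Dbl (p i)) (pcell c) = hcmp2 Dbl (id2 Dbl (p i)) (pcell e)" if "i < n" for i
        using eq[OF that] by simp
    qed
    then show "c = e" using c' by (intro point_cell.equality) simp_all
  }
qed

text \<open>A point is a functor out of \<open>Pt\<close>, so the points of the factors induce a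
  point of the product with which the projections commute on the nose.\<close>

lemma strict_pointed_cone:
  fixes X :: "nat \<Rightarrow> 'u::infinite dfun"
  assumes X: "\<And>j. j < n \<Longrightarrow> is_pointed (X j)"
  obtains d p where "is_pointed d" "is_product Dbl n (\<lambda>j. dcod (X j)) (dcod d) p" "\<And>j. j < n \<Longrightarrow> p j oo d = X j"
proof -
  have X': "X j \<in> cells1 Dbl" "ddom (X j) = Pt" if "j < n" for j using X[OF that] by (simp_all add: is_pointed_iff)
  have c: "dcod (X j) \<in> cells0 Dbl" if "j < n" for j
    using Dbl.cod1_in[OF X'(1)[OF that]] by simp
  then obtain B p where P: "is_product Dbl n (\<lambda>j. dcod (X j)) B p"
    using cartesian_Dbl[unfolded cartesian_two_category_def, THEN conjunct2, rule_format, of n "\<lambda>j. dcod (X j)"] by blast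
  obtain d where d: "d \<in> hom1 Dbl Pt B" "\<And>j. j < n \<Longrightarrow> cmp1 Dbl (p j) d = X j"
    by (rule product_map[OF P, of Pt X]) (use X' in \<open>simp_all add: hom1_def\<close>)
  show thesis by (rule that[of d p]) (use d P in \<open>auto simp: hom1_def is_pointed_iff\<close>)
qed

lemma cartesian_Dbl_pt: "cartesian_two_category (Dbl_pt :: ('u::infinite dfun, 'u point_map, 'u point_cell) twocat)"
  unfolding cartesian_two_category_def
proof (intro conjI allI impI two_category_Dbl_pt)
  fix n and X :: "nat \<Rightarrow> 'u dfun" assume "\<forall>i<n. X i \<in> cells0 Dbl_pt"
  then have X: "is_pointed (X j)" if "j < n" for j using that by simp
  obtain d p where d: "is_pointed d" "is_product Dbl n (\<lambda>j. dcod (X j)) (dcod d) p" "\<And>j. j < n \<Longrightarrow> p j oo d = X j"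
    by (rule strict_pointed_cone[of n X, OF X]; use that in simp)
  from pointed_product[OF d(2,1) X d(3)] show "\<exists>y \<pi>. is_product Dbl_pt n X y \<pi>" by blast
qed

section \<open>The 2-category of right niches\<close>

interpretation LB: two_category LBimod by (rule two_category_LBimod)

text \<open>\<open>ob1\<close> abbreviates \<open>el 1\<close>; rewriting \<open>1\<close> to
  \<open>Suc 0\<close> would make rules about \<open>ob1\<close> fail to match.\<close>

declare One_nat_def [simp del]

lemma ob_Loose [simp]: "ob0 \<in> obs (Loose :: 'u::infinite dbl)" "ob1 \<in> obs (Loose :: 'u dbl)"
  by (simp_all add: Loose_def Let_def)

lemmas fibre0_simps = two_functor.functor_simps[OF two_functor_fibre[OF ob_Loose(1)], unfolded twofun.simps Dbl_simps mem_Collect_eq]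

lemmas fibre1_simps = two_functor.functor_simps[OF two_functor_fibre[OF ob_Loose(2)], unfolded twofun.simps Dbl_simps mem_Collect_eq]

lemma is_right_niche_iff:
  "is_right_niche N \<longleftrightarrow> nbimod N \<in> cells0 LBimod \<and> is_pointed (nleg0 N) \<and> dcod (nleg0 N) = fibre (nbimod N) ob0 \<and>
     nleg1 N \<in> cells1 Dbl \<and> dcod (nleg1 N) = fibre (nbimod N) ob1"
  by (auto simp: is_right_niche_def is_niche_def is_pointed_iff)

text \<open>\<open>Pt\<close> is terminal, so \<open>nf0\<close> can only be its identity, and the
  two conditions on the left leg, being a niche map and being a map of points, merge into one leg
  square with a \<open>point_commuter\<close>. Both legs are now described by
  \<open>leg_sq\<close>.\<close>

lemma is_right_niche_map_iff:
  "is_right_niche_map m \<longleftrightarrow> is_right_niche (ndom m) \<and> is_right_niche (ncod m) \<and>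
     nmap m \<in> cells1 LBimod \<and> dom1 LBimod (nmap m) = nbimod (ndom m) \<and> cod1 LBimod (nmap m) = nbimod (ncod m) \<and>
     nf0 m = dfun_id Pt \<and>
     leg_sq (fibre_map ob0 (nmap m)) (nleg0 (ndom m)) (dfun_id Pt) (nleg0 (ncod m)) (nt0 m) \<and> point_commuter (nt0 m) \<and>
     leg_sq (fibre_map ob1 (nmap m)) (nleg1 (ndom m)) (nf1 m) (nleg1 (ncod m)) (nt1 m) \<and> companion_commuter_trans (nt1 m)"
  (is "?L \<longleftrightarrow> ?R")
proof
  assume L: ?L
  then have m: "is_niche_map m" "is_right_niche (ndom m)" "is_right_niche (ncod m)"
    "is_point_map \<lparr>pdom = nleg0 (ndom m), pcod = nleg0 (ncod m), pmap = fibre_map ob0 (nmap m), piso = nt0 m\<rparr>"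
    by (simp_all add: is_right_niche_map_def)
  have "double_functor Pt Pt (nf0 m)"
    using m(1-3) by (auto simp: is_niche_map_def Let_def is_right_niche_def hom1_Dbl)
  then have "nf0 m = dfun_id Pt" using dfun_Pt_eq dfun_id_in[OF double_category_Pt] by blast
  moreover have "leg_sq (fibre_map ob1 (nmap m)) (nleg1 (ndom m)) (nf1 m) (nleg1 (ncod m)) (nt1 m)"
    using m(1-3) unfolding is_right_niche_iff is_niche_map_def Let_def
    by (simp add: leg_sq_def hom1_def hom2_def fibre1_simps)
  moreover have "nmap m \<in> cells1 LBimod \<and> dom1 LBimod (nmap m) = nbimod (ndom m) \<and> cod1 LBimod (nmap m) = nbimod (ncod m)"
    "companion_commuter_trans (nt1 m)"
    using m(1) by (simp_all add: is_niche_map_def Let_def hom1_def)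
  ultimately show ?R using m(2-4) by (simp add: is_point_map_iff)
next
  assume R: ?R
  then have N: "is_right_niche (ndom m)" "is_right_niche (ncod m)"
    and l: "leg_sq (fibre_map ob0 (nmap m)) (nleg0 (ndom m)) (dfun_id Pt) (nleg0 (ncod m)) (nt0 m)"
      "leg_sq (fibre_map ob1 (nmap m)) (nleg1 (ndom m)) (nf1 m) (nleg1 (ncod m)) (nt1 m)"
    by simp_all
  have "conjoint_commuter_trans (nt0 m)"
    using R point_commuter_iff[of "nt0 m"] leg_sqD[OF l(1)] by (simp add: is_right_niche_iff is_pointed_iff)
  moreover have "nt0 m \<in> hom2 Dbl (fibre_map ob0 (nmap m) oo nleg0 (ndom m)) (nleg0 (ncod m) oo nf0 m)"
    "nt1 m \<in> hom2 Dbl (fibre_map ob1 (nmap m) oo nleg1 (ndom m)) (nleg1 (ncod m) oo nf1 m)"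
    "nf1 m \<in> hom1 Dbl (ddom (nleg1 (ndom m))) (ddom (nleg1 (ncod m)))"
    using R leg_sqD[OF l(1)] leg_sqD[OF l(2)] by (simp_all add: hom2_def hom1_def)
  moreover have "nf0 m \<in> hom1 Dbl (ddom (nleg0 (ndom m))) (ddom (nleg0 (ncod m)))"
    using R by (simp add: is_right_niche_iff is_pointed_iff hom1_def)
  ultimately have "is_niche_map m"
    using R by (simp add: is_niche_map_def Let_def is_right_niche_def hom1_def[of LBimod])
  then show ?L using R by (simp add: is_right_niche_map_def is_point_map_iff is_right_niche_iff)
qed

lemma rniche_map_simps:
  assumes "is_right_niche_map m" "ndom m = N" "ncod m = N'"
  shows "is_right_niche N" "is_right_niche N'" "nmap m \<in> cells1 LBimod" "dom1 LBimod (nmap m) = nbimod N"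
    "cod1 LBimod (nmap m) = nbimod N'" "nf0 m = dfun_id Pt"
    "leg_sq (fibre_map ob0 (nmap m)) (nleg0 N) (dfun_id Pt) (nleg0 N') (nt0 m)" "point_commuter (nt0 m)"
    "leg_sq (fibre_map ob1 (nmap m)) (nleg1 N) (nf1 m) (nleg1 N') (nt1 m)" "companion_commuter_trans (nt1 m)"
  using assms by (auto simp: is_right_niche_map_iff)

definition right_niche_cell :: "'u::infinite niche_cell \<Rightarrow> bool" where
  "right_niche_cell c \<longleftrightarrow> is_niche_cell c \<and> is_right_niche_map (nsrc c) \<and> is_right_niche_map (ntgt c)"

text \<open>Terminality of \<open>Pt\<close> in dimension two forces \<open>nc0\<close> to be an
  identity. The left condition is then a \<open>leg_cell\<close> of the same form as in
  \<open>Dbl_pt\<close>, the right one a general \<open>leg_cell\<close>.\<close>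

lemma rniche_cell_iff:
  fixes c :: "'u::infinite niche_cell"
  shows "right_niche_cell c \<longleftrightarrow> is_right_niche_map (nsrc c) \<and> is_right_niche_map (ntgt c) \<and>
     ndom (ntgt c) = ndom (nsrc c) \<and> ncod (ntgt c) = ncod (nsrc c) \<and>
     ncell c \<in> cells2 LBimod \<and> src2 LBimod (ncell c) = nmap (nsrc c) \<and> tgt2 LBimod (ncell c) = nmap (ntgt c) \<and>
     nc0 c = ttrans_id (dfun_id Pt) \<and> nc1 c \<in> cells2 Dbl \<and> tsrc (nc1 c) = nf1 (nsrc c) \<and> ttgt (nc1 c) = nf1 (ntgt c) \<and>
     leg_cell (nleg0 (ndom (nsrc c))) (nleg0 (ncod (nsrc c))) (nt0 (nsrc c)) (nt0 (ntgt c)) (fibre_trans ob0 (ncell c))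
       (ttrans_id (dfun_id Pt)) \<and>
     leg_cell (nleg1 (ndom (nsrc c))) (nleg1 (ncod (nsrc c))) (nt1 (nsrc c)) (nt1 (ntgt c)) (fibre_trans ob1 (ncell c)) (nc1 c)"
proof -
  have "nc0 c = ttrans_id (dfun_id Pt) \<longleftrightarrow> nc0 c \<in> hom2 Dbl (nf0 (nsrc c)) (nf0 (ntgt c))"
    if "is_right_niche_map (nsrc c)" "is_right_niche_map (ntgt c)"
  proof -
    have f: "nf0 (nsrc c) = dfun_id Pt" "nf0 (ntgt c) = dfun_id Pt" using that by (simp_all add: is_right_niche_map_iff)
    have "t = ttrans_id (dfun_id Pt)" if "t \<in> hom2 Dbl (dfun_id Pt) (dfun_id Pt)" for t :: "'u ttrans"
      by (rule ttrans_Pt_eq[OF _ ttrans_id_in[OF dfun_id_in[OF double_category_Pt]]])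
        (use that in \<open>simp add: hom2_def ttrans_iff\<close>)
    moreover have "ttrans_id (dfun_id Pt) \<in> hom2 Dbl (dfun_id Pt) (dfun_id (Pt :: 'u dbl))" by (simp add: hom2_def)
    ultimately show ?thesis unfolding f by (metis (no_types))
  qed
  moreover have "is_niche_map m" if "is_right_niche_map m" for m :: "'u niche_map" using that by (simp add: is_right_niche_map_def)
  ultimately show ?thesis
    unfolding right_niche_cell_def is_niche_cell_def leg_cell_def Let_def hom2_def by auto
qed

lemma RNiche_simps [simp]:
  "cells0 RNiche = {N. is_right_niche N}" "cells1 RNiche = {m. is_right_niche_map m}" "cells2 RNiche = {c. right_niche_cell c}"
  "dom1 RNiche = ndom" "cod1 RNiche = ncod" "src2 RNiche = nsrc" "tgt2 RNiche = ntgt"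
  "id1 RNiche N = \<lparr>ndom = N, ncod = N, nmap = id1 LBimod (nbimod N), nf0 = dfun_id (ddom (nleg0 N)),
     nf1 = dfun_id (ddom (nleg1 N)), nt0 = ttrans_id (nleg0 N), nt1 = ttrans_id (nleg1 N)\<rparr>"
  "cmp1 RNiche = niche_cmp"
  "id2 RNiche m = \<lparr>nsrc = m, ntgt = m, ncell = id2 LBimod (nmap m), nc0 = ttrans_id (nf0 m), nc1 = ttrans_id (nf1 m)\<rparr>"
  "vcmp2 RNiche d c = \<lparr>nsrc = nsrc c, ntgt = ntgt d, ncell = vcmp2 LBimod (ncell d) (ncell c),
     nc0 = ttrans_vcmp (nc0 d) (nc0 c), nc1 = ttrans_vcmp (nc1 d) (nc1 c)\<rparr>"
  "hcmp2 RNiche d c = \<lparr>nsrc = niche_cmp (nsrc d) (nsrc c), ntgt = niche_cmp (ntgt d) (ntgt c),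
     ncell = hcmp2 LBimod (ncell d) (ncell c), nc0 = ttrans_hcmp (nc0 d) (nc0 c), nc1 = ttrans_hcmp (nc1 d) (nc1 c)\<rparr>"
  by (simp_all add: RNiche_def Niche_def right_niche_cell_def)

lemma niche_cmp_eq:
  assumes "is_right_niche_map m" "is_right_niche_map m'" "ndom m' = ncod m"
  shows "niche_cmp m' m = \<lparr>ndom = ndom m, ncod = ncod m', nmap = cmp1 LBimod (nmap m') (nmap m), nf0 = dfun_id Pt,
    nf1 = nf1 m' oo nf1 m, nt0 = paste (nt0 m') (fibre_map ob0 (nmap m')) (dfun_id Pt) (nt0 m),
    nt1 = paste (nt1 m') (fibre_map ob1 (nmap m')) (nf1 m) (nt1 m)\<rparr>"
  using assms by (simp add: niche_cmp_def is_right_niche_map_iff)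

lemma is_right_niche_map_cmp:
  assumes m: "is_right_niche_map m" "is_right_niche_map m'" "ndom m' = ncod m"
  shows "is_right_niche_map (niche_cmp m' m)"
proof -
  note a = rniche_map_simps[OF m(1) refl refl] and b = rniche_map_simps[OF m(2,3) refl]
  have f: "fibre_map ob0 (cmp1 LBimod (nmap m') (nmap m)) = fibre_map ob0 (nmap m') oo fibre_map ob0 (nmap m)"
    "fibre_map ob1 (cmp1 LBimod (nmap m') (nmap m)) = fibre_map ob1 (nmap m') oo fibre_map ob1 (nmap m)"
    using a b by (simp_all add: fibre0_simps fibre1_simps)
  show ?thesis
    unfolding niche_cmp_eq[OF m] is_right_niche_map_iff
    using a(1,3-5) b(2-5) leg_sq_paste[OF a(7) b(7)] leg_sq_paste[OF a(9) b(9)]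
      point_commuter_paste[OF a(7) b(7) a(8) b(8)] companion_commuter_trans_paste[OF a(9) b(9) a(10) b(10)]
    by (simp add: f)
qed

lemma niche_cmp_assoc:
  assumes m: "is_right_niche_map f" "is_right_niche_map g" "is_right_niche_map h" "ndom g = ncod f" "ndom h = ncod g"
  shows "niche_cmp (niche_cmp h g) f = niche_cmp h (niche_cmp g f)"
proof -
  note a = rniche_map_simps[OF m(1) refl refl] and b = rniche_map_simps[OF m(2,4) refl]
    and c = rniche_map_simps[OF m(3,5) refl]
  have gf: "is_right_niche_map (niche_cmp g f)" and hg: "is_right_niche_map (niche_cmp h g)"
    using m by (simp_all add: is_right_niche_map_cmp)
  have f: "fibre_map ob0 (cmp1 LBimod (nmap h) (nmap g)) = fibre_map ob0 (nmap h) oo fibre_map ob0 (nmap g)"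
    "fibre_map ob1 (cmp1 LBimod (nmap h) (nmap g)) = fibre_map ob1 (nmap h) oo fibre_map ob1 (nmap g)"
    using b c by (simp_all add: fibre0_simps fibre1_simps)
  have e: "cmp1 LBimod (cmp1 LBimod (nmap h) (nmap g)) (nmap f) = cmp1 LBimod (nmap h) (cmp1 LBimod (nmap g) (nmap f))"
    by (rule LB.cmp1_assoc') (use a b c in simp_all)
  have e': "(nf1 h oo nf1 g) oo nf1 f = nf1 h oo nf1 g oo nf1 f"
    by (rule Dbl.cmp1_assoc') (use leg_sqD[OF a(9)] leg_sqD[OF b(9)] leg_sqD[OF c(9)] in simp_all)
  show ?thesis
    using paste_assoc[OF a(7) b(7) c(7)] paste_assoc[OF a(9) b(9) c(9)] e e' f m niche_cmp_eq[OF gf m(3)] niche_cmp_eq[OF m(1) hg]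
    by (simp add: niche_cmp_eq)
qed

lemma niche_cmp_id:
  assumes "is_right_niche_map f" "ndom f = N" "ncod f = N'"
  shows "niche_cmp (id1 RNiche N') f = f" "niche_cmp f (id1 RNiche N) = f"
proof -
  note a = rniche_map_simps[OF assms]
  note N = a(1,2)[unfolded is_right_niche_iff is_pointed_iff]
  have "fibre_map ob0 (id1 LBimod (nbimod N')) = dfun_id (dcod (nleg0 N'))"
    "fibre_map ob1 (id1 LBimod (nbimod N')) = dfun_id (dcod (nleg1 N'))"
    using N(2) by (simp_all add: fibre0_simps fibre1_simps del: LBimod_simps)
  then show "niche_cmp (id1 RNiche N') f = f"
    using a(3-6) N assms paste_id_left[OF a(7)] paste_id_left[OF a(9)] leg_sqD(3,9)[OF a(9)]
    by (intro niche_map.equality) (simp_all add: niche_cmp_def del: LBimod_simps)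
  show "niche_cmp f (id1 RNiche N) = f"
    using a(3-6) N assms paste_id_right[OF a(7)] paste_id_right[OF a(9)] leg_sqD(3,8)[OF a(9)]
    by (intro niche_map.equality) (simp_all add: niche_cmp_def del: LBimod_simps)
qed

text \<open>Each axiom splits into one in \<open>LBimod\<close>, one in \<open>Dbl\<close> for the
  functors and cells between the domains of the right legs, and the pasting laws for two leg
  squares. Functoriality of the fibres moves composition of bimodule maps to the outer functors of
  these squares.\<close>

lemma two_category_RNiche: "two_category (RNiche :: ('u::infinite niche, 'u niche_map, 'u niche_cell) twocat)"
proof (rule two_categoryI, goal_cases)
  case (3 x)
  then have N: "is_right_niche x" by simp
  note N' = N[unfolded is_right_niche_iff is_pointed_iff]
  have f: "fibre_map ob0 (id1 LBimod (nbimod x)) = dfun_id (dcod (nleg0 x))"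
    "fibre_map ob1 (id1 LBimod (nbimod x)) = dfun_id (dcod (nleg1 x))"
    using N' by (simp_all add: fibre0_simps fibre1_simps del: LBimod_simps)
  show ?case
    using N N' f leg_sq_id[of "nleg0 x"] leg_sq_id[of "nleg1 x"] point_commuter_id[of "nleg0 x"] companion_commuter_trans_id[of "nleg1 x"]
    by (simp add: is_right_niche_map_iff del: LBimod_simps)
next
  case (4 f g)
  then show ?case using is_right_niche_map_cmp[of f g] by (simp add: niche_cmp_def)
next
  case (5 f)
  then show ?case using niche_cmp_id(1)[of f _ "ncod f"] by simp
next
  case (6 f)
  then show ?case using niche_cmp_id(2)[of f "ndom f"] by simp
next
  case (7 f g h)
  then show ?case by (simp add: niche_cmp_assoc)
next
  case (8 a)
  then show ?case by (simp add: rniche_cell_iff)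
next
  case (9 f)
  then have m: "is_right_niche_map f" by simp
  note a = rniche_map_simps[OF m refl refl]
  show ?case
    using m a(3,6) leg_cell_id[OF a(7)] leg_cell_id[OF a(9)] leg_sqD(3)[OF a(9)]
    by (simp add: rniche_cell_iff fibre0_simps fibre1_simps del: LBimod_simps)
next
  case (10 a b)
  then have c: "right_niche_cell a" "right_niche_cell b" "nsrc b = ntgt a" by simp_all
  note A = c(1)[unfolded rniche_cell_iff] and B = c(2)[unfolded rniche_cell_iff c(3)]
  have m: "is_right_niche_map (nsrc a)" "is_right_niche_map (ntgt a)" "ndom (ntgt a) = ndom (nsrc a)" "ncod (ntgt a) = ncod (nsrc a)"
    "is_right_niche_map (ntgt b)" "ndom (ntgt b) = ndom (nsrc a)" "ncod (ntgt b) = ncod (nsrc a)" using A B by simp_all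
  note p = rniche_map_simps[OF m(1) refl refl] and q = rniche_map_simps[OF m(2-4)] and r = rniche_map_simps[OF m(5-7)]
  have t: "leg_cell (nleg0 (ndom (nsrc a))) (nleg0 (ncod (nsrc a))) (nt0 (nsrc a)) (nt0 (ntgt b))
      (ttrans_vcmp (fibre_trans ob0 (ncell b)) (fibre_trans ob0 (ncell a))) (ttrans_vcmp (ttrans_id (dfun_id Pt)) (ttrans_id (dfun_id Pt)))"
    by (rule leg_cell_vcmp[OF p(7) q(7) r(7)]) (use A B in \<open>simp_all add: fibre0_simps del: LBimod_simps\<close>)
  have u: "leg_cell (nleg1 (ndom (nsrc a))) (nleg1 (ncod (nsrc a))) (nt1 (nsrc a)) (nt1 (ntgt b))
      (ttrans_vcmp (fibre_trans ob1 (ncell b)) (fibre_trans ob1 (ncell a))) (ttrans_vcmp (nc1 b) (nc1 a))"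
    by (rule leg_cell_vcmp[OF p(9) q(9) r(9)]) (use A B in \<open>simp_all add: fibre1_simps del: LBimod_simps\<close>)
  show ?case using t u A B c(3) by (simp add: rniche_cell_iff fibre0_simps fibre1_simps del: LBimod_simps)
next
  case (11 a)
  then show ?case
    by (intro niche_cell.equality) (simp_all add: rniche_cell_iff is_right_niche_map_iff del: LBimod_simps)
next
  case (12 a)
  then show ?case
    by (intro niche_cell.equality) (simp_all add: rniche_cell_iff is_right_niche_map_iff del: LBimod_simps)
next
  case (13 a b c)
  then show ?case by (simp add: rniche_cell_iff Dbl.vcmp2_assoc' LB.vcmp2_assoc' del: LBimod_simps)
next
  case (14 a b)
  then have c: "right_niche_cell a" "right_niche_cell b" "ndom (nsrc b) = ncod (nsrc a)" by simp_all
  note A = c(1)[unfolded rniche_cell_iff] and B = c(2)[unfolded rniche_cell_iff c(3)]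
  have m: "is_right_niche_map (nsrc a)" "is_right_niche_map (ntgt a)" "ndom (ntgt a) = ndom (nsrc a)" "ncod (ntgt a) = ncod (nsrc a)"
    "is_right_niche_map (nsrc b)" "is_right_niche_map (ntgt b)" "ndom (ntgt b) = ncod (nsrc a)" "ncod (ntgt b) = ncod (nsrc b)"
    "ndom (ntgt b) = ncod (ntgt a)"
    using A B by simp_all
  note p = rniche_map_simps[OF m(1) refl refl] and q = rniche_map_simps[OF m(2-4)]
    and p' = rniche_map_simps[OF m(5) c(3) refl] and q' = rniche_map_simps[OF m(6-8)]
  have t: "leg_cell (nleg0 (ndom (nsrc a))) (nleg0 (ncod (nsrc b)))
      (paste (nt0 (nsrc b)) (fibre_map ob0 (nmap (nsrc b))) (dfun_id Pt) (nt0 (nsrc a)))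
      (paste (nt0 (ntgt b)) (fibre_map ob0 (nmap (ntgt b))) (dfun_id Pt) (nt0 (ntgt a)))
      (ttrans_hcmp (fibre_trans ob0 (ncell b)) (fibre_trans ob0 (ncell a))) (ttrans_hcmp (ttrans_id (dfun_id Pt)) (ttrans_id (dfun_id Pt)))"
    by (rule leg_cell_hcmp[OF p(7) q(7) p'(7) q'(7)]) (use A B in \<open>simp_all add: fibre0_simps del: LBimod_simps\<close>)
  have u: "leg_cell (nleg1 (ndom (nsrc a))) (nleg1 (ncod (nsrc b)))
      (paste (nt1 (nsrc b)) (fibre_map ob1 (nmap (nsrc b))) (nf1 (nsrc a)) (nt1 (nsrc a)))
      (paste (nt1 (ntgt b)) (fibre_map ob1 (nmap (ntgt b))) (nf1 (ntgt a)) (nt1 (ntgt a)))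
      (ttrans_hcmp (fibre_trans ob1 (ncell b)) (fibre_trans ob1 (ncell a))) (ttrans_hcmp (nc1 b) (nc1 a))"
    by (rule leg_cell_hcmp[OF p(9) q(9) p'(9) q'(9)]) (use A B in \<open>simp_all add: fibre1_simps del: LBimod_simps\<close>)
  have d: "ddom (nf1 (nsrc b)) = dcod (nf1 (nsrc a))" using leg_sqD[OF p(9)] leg_sqD[OF p'(9)] by simp
  have f: "fibre_trans ob0 (hcmp2 LBimod (ncell b) (ncell a)) = ttrans_hcmp (fibre_trans ob0 (ncell b)) (fibre_trans ob0 (ncell a))"
    "fibre_trans ob1 (hcmp2 LBimod (ncell b) (ncell a)) = ttrans_hcmp (fibre_trans ob1 (ncell b)) (fibre_trans ob1 (ncell a))"
    using A B p(5) p'(4) by (simp_all add: fibre0_simps fibre1_simps del: LBimod_simps)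
  show ?case
    using t u A B p(5) p'(4) d is_right_niche_map_cmp[OF m(1,5) c(3)] is_right_niche_map_cmp[OF m(2,6,9)]
    by (simp add: rniche_cell_iff niche_cmp_eq[OF m(1,5) c(3)] niche_cmp_eq[OF m(2,6,9)] f del: LBimod_simps)
next
  case (15 f g)
  then have m: "is_right_niche_map f" "is_right_niche_map g" "ndom g = ncod f" by simp_all
  note p = rniche_map_simps[OF m(1) refl refl] and q = rniche_map_simps[OF m(2,3) refl]
  show ?case using p(3-6) q(3-6) leg_sqD[OF p(9)] leg_sqD[OF q(9)] by (simp add: niche_cmp_def del: LBimod_simps)
next
  case (16 a a' b b')
  then have c: "right_niche_cell a" "right_niche_cell a'" "right_niche_cell b" "right_niche_cell b'"
    "nsrc a' = ntgt a" "nsrc b' = ntgt b" "ndom (nsrc b) = ncod (nsrc a)" by simp_all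
  have m: "is_right_niche_map (nsrc a)" "is_right_niche_map (nsrc b)" using c by (simp_all add: rniche_cell_iff)
  note p = rniche_map_simps[OF m(1) refl refl] and q = rniche_map_simps[OF m(2) c(7) refl]
  have d: "ddom (nf1 (nsrc b)) = dcod (nf1 (nsrc a))" using leg_sqD[OF p(9)] leg_sqD[OF q(9)] by simp
  show ?case
    using c d p(5) q(4) by (intro niche_cell.equality)
      (simp_all add: rniche_cell_iff Dbl.interchange' LB.interchange' del: LBimod_simps)
next
  case (17 a)
  then have a: "right_niche_cell a" by simp
  then have m: "is_right_niche_map (nsrc a)" "is_right_niche_map (ntgt a)" "ncod (ntgt a) = ncod (nsrc a)"
    by (simp_all add: rniche_cell_iff)
  note p = rniche_map_simps[OF m(1) refl refl]
  have N: "ddom (nleg0 (ncod (nsrc a))) = Pt" using p(2) by (simp add: is_right_niche_iff is_pointed_iff)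
  show ?case
    using a niche_cmp_id(1)[OF m(1) refl refl] niche_cmp_id(1)[OF m(2) refl m(3)] N p(2,5) leg_sqD(3,9)[OF p(9)]
    by (intro niche_cell.equality) (simp_all add: rniche_cell_iff is_right_niche_iff del: LBimod_simps)
next
  case (18 a)
  then have a: "right_niche_cell a" by simp
  then have m: "is_right_niche_map (nsrc a)" "is_right_niche_map (ntgt a)" "ndom (ntgt a) = ndom (nsrc a)"
    by (simp_all add: rniche_cell_iff)
  note p = rniche_map_simps[OF m(1) refl refl]
  have N: "ddom (nleg0 (ndom (nsrc a))) = Pt" using p(1) by (simp add: is_right_niche_iff is_pointed_iff)
  show ?case
    using a niche_cmp_id(2)[OF m(1) refl refl] niche_cmp_id(2)[OF m(2) m(3) refl] N p(1,4) leg_sqD(3,8)[OF p(9)]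
    by (intro niche_cell.equality) (simp_all add: rniche_cell_iff is_right_niche_iff del: LBimod_simps)
next
  case (19 a b c)
  then have c: "right_niche_cell a" "right_niche_cell b" "right_niche_cell c" "ndom (nsrc b) = ncod (nsrc a)" "ndom (nsrc c) = ncod (nsrc b)"
    by simp_all
  then have m: "is_right_niche_map (nsrc a)" "is_right_niche_map (ntgt a)" "is_right_niche_map (nsrc b)" "is_right_niche_map (ntgt b)"
    "is_right_niche_map (nsrc c)" "is_right_niche_map (ntgt c)" "ndom (ntgt b) = ncod (ntgt a)" "ndom (ntgt c) = ncod (ntgt b)"
    by (simp_all add: rniche_cell_iff)
  note p = rniche_map_simps[OF m(1) refl refl] and q = rniche_map_simps[OF m(3) c(4) refl]
    and r = rniche_map_simps[OF m(5) c(5) refl]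
  have d: "ddom (nf1 (nsrc b)) = dcod (nf1 (nsrc a))" "ddom (nf1 (nsrc c)) = dcod (nf1 (nsrc b))"
    using leg_sqD[OF p(9)] leg_sqD[OF q(9)] leg_sqD[OF r(9)] by simp_all
  show ?case
    using c d p(5) q(4,5) r(4) niche_cmp_assoc[OF m(1,3,5) c(4,5)] niche_cmp_assoc[OF m(2,4,6,7,8)]
    by (intro niche_cell.equality) (simp_all add: rniche_cell_iff Dbl.hcmp2_assoc' LB.hcmp2_assoc' del: LBimod_simps)
qed (simp_all add: is_right_niche_map_iff rniche_cell_iff del: LBimod_simps)

section \<open>Products of right niches\<close>

lemma hom1_RNiche: "m \<in> hom1 RNiche N N' \<longleftrightarrow> is_right_niche_map m \<and> ndom m = N \<and> ncod m = N'"
  by (auto simp: hom1_def)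

lemma hom2_RNiche: "c \<in> hom2 RNiche m m' \<longleftrightarrow> right_niche_cell c \<and> nsrc c = m \<and> ntgt c = m'"
  by (auto simp: hom2_def)

text \<open>Bimodule parts are induced by \<open>PL\<close>, functors on the domains of the right
  legs by \<open>PD\<close>. Structure cells live in the fibres, which are again products, and
  \<open>s0\<close> and \<open>s1\<close> make the cone strict on both legs, so the lemmas on strict
  cones apply to each leg separately.\<close>

lemma niche_product:
  fixes X :: "nat \<Rightarrow> 'u::infinite niche"
  assumes Y: "is_right_niche Y" and X: "\<And>j. j < n \<Longrightarrow> is_right_niche (X j)"
    and PL: "is_product LBimod n (\<lambda>j. nbimod (X j)) (nbimod Y) p"
    and PD: "is_product Dbl n (\<lambda>j. ddom (nleg1 (X j))) (ddom (nleg1 Y)) q"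
    and s0: "\<And>j. j < n \<Longrightarrow> fibre_map ob0 (p j) oo nleg0 Y = nleg0 (X j)"
    and s1: "\<And>j. j < n \<Longrightarrow> fibre_map ob1 (p j) oo nleg1 Y = nleg1 (X j) oo q j"
  shows "is_product RNiche n X Y (\<lambda>j. \<lparr>ndom = Y, ncod = X j, nmap = p j, nf0 = dfun_id Pt, nf1 = q j,
    nt0 = ttrans_id (nleg0 (X j)), nt1 = ttrans_id (nleg1 (X j) oo q j)\<rparr>)"
    (is "is_product _ _ _ _ ?\<pi>")
proof (rule is_productI)
  note Y' = Y[unfolded is_right_niche_iff is_pointed_iff]
  have X': "nbimod (X j) \<in> cells0 LBimod" "nleg0 (X j) \<in> cells1 Dbl" "ddom (nleg0 (X j)) = Pt"
    "dcod (nleg0 (X j)) = fibre (nbimod (X j)) ob0" "nleg1 (X j) \<in> cells1 Dbl" "dcod (nleg1 (X j)) = fibre (nbimod (X j)) ob1"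
    if "j < n" for j using X[OF that] unfolding is_right_niche_iff is_pointed_iff by blast+
  have p: "p j \<in> cells1 LBimod" "dom1 LBimod (p j) = nbimod Y" "cod1 LBimod (p j) = nbimod (X j)" if "j < n" for j
    using is_productD(3)[OF PL that] by (simp_all add: hom1_def)
  have q: "q j \<in> cells1 Dbl" "ddom (q j) = ddom (nleg1 Y)" "dcod (q j) = ddom (nleg1 (X j))" if "j < n" for j
    using is_productD(3)[OF PD that] by (simp_all add: hom1_def)
  let ?p0 = "\<lambda>j. fibre_map ob0 (p j)" and ?p1 = "\<lambda>j. fibre_map ob1 (p j)"
  \<comment> \<open>The legs end in fibres, so the product of bimodules enters here through its
    images under the two fibre functors. Reflection of the commuter conditions is applied to these
    same cones.\<close>
  have P0: "is_product Dbl n (\<lambda>j. fibre (nbimod (X j)) ob0) (fibre (nbimod Y) ob0) ?p0"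
    and P1: "is_product Dbl n (\<lambda>j. fibre (nbimod (X j)) ob1) (fibre (nbimod Y) ob1) ?p1"
    by (simp_all add: fibre_preserves_product[OF _ PL])
  have L0: "leg_sq (?p0 j) (nleg0 Y) (dfun_id Pt) (nleg0 (X j)) (ttrans_id (?p0 j oo nleg0 Y))" if j: "j < n" for j
    using X'[OF j] p[OF j] Y' unfolding leg_sq_def s0[OF j] by (simp add: fibre0_simps del: LBimod_simps)
  have L1: "leg_sq (?p1 j) (nleg1 Y) (q j) (nleg1 (X j)) (ttrans_id (?p1 j oo nleg1 Y))" if j: "j < n" for j
    using X'[OF j] p[OF j] q[OF j] Y' unfolding leg_sq_def s1[OF j] by (simp add: fibre1_simps del: LBimod_simps)
  show "Y \<in> cells0 RNiche" using Y by simp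
  show "X j \<in> cells0 RNiche" if "j < n" for j using X[OF that] by simp
  have pm: "is_right_niche_map (?\<pi> j)" if j: "j < n" for j
    using Y X[OF j] p[OF j] L0[OF j] L1[OF j] X'[OF j] q[OF j] point_commuter_id[of "nleg0 (X j)"]
      companion_commuter_trans_id[of "nleg1 (X j) oo q j"]
    unfolding s0[OF j] s1[OF j] by (simp add: is_right_niche_map_iff del: LBimod_simps)
  then show "?\<pi> j \<in> hom1 RNiche Y (X j)" if "j < n" for j using that by (simp add: hom1_RNiche)
  have cmp: "niche_cmp (?\<pi> j) m = \<lparr>ndom = Z, ncod = X j, nmap = cmp1 LBimod (p j) (nmap m), nf0 = dfun_id Pt,
      nf1 = q j oo nf1 m, nt0 = ?p0 j *> nt0 m, nt1 = ?p1 j *> nt1 m\<rparr>"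
    if j: "j < n" and m: "is_right_niche_map m" "ndom m = Z" "ncod m = Y" for j Z m
    using niche_cmp_eq[OF m(1) pm[OF j]] m paste_strict[OF rniche_map_simps(7)[OF m] L0[OF j]]
      paste_strict[OF rniche_map_simps(9)[OF m] L1[OF j]]
    unfolding s0[OF j] s1[OF j] by simp
  {
    fix Z f assume Z: "Z \<in> cells0 RNiche" and f: "\<And>i. i < n \<Longrightarrow> f i \<in> hom1 RNiche Z (X i)"
    have Z0: "is_right_niche Z" using Z by simp
    note Z' = Z0[unfolded is_right_niche_iff is_pointed_iff]
    have fm: "is_right_niche_map (f i)" "ndom (f i) = Z" "ncod (f i) = X i" if "i < n" for i
      using f[OF that] by (simp_all add: hom1_RNiche)
    note fs = rniche_map_simps[OF fm]
    obtain h where h: "h \<in> hom1 LBimod (nbimod Z) (nbimod Y)" "\<And>i. i < n \<Longrightarrow> cmp1 LBimod (p i) h = nmap (f i)"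
    proof (rule product_map[OF PL, of "nbimod Z" "\<lambda>i. nmap (f i)"])
      show "nbimod Z \<in> cells0 LBimod" using Z' by blast
      show "nmap (f i) \<in> hom1 LBimod (nbimod Z) (nbimod (X i))" if "i < n" for i using fs(3-5)[OF that that that] by (simp add: hom1_def)
    qed blast
    have h': "h \<in> cells1 LBimod" "dom1 LBimod h = nbimod Z" "cod1 LBimod h = nbimod Y" using h(1) by (simp_all add: hom1_def)
    obtain g where g: "g \<in> hom1 Dbl (ddom (nleg1 Z)) (ddom (nleg1 Y))" "\<And>i. i < n \<Longrightarrow> cmp1 Dbl (q i) g = nf1 (f i)"
    proof (rule product_map[OF PD, of "ddom (nleg1 Z)" "\<lambda>i. nf1 (f i)"])
      show "ddom (nleg1 Z) \<in> cells0 Dbl" using Dbl.dom1_in[of "nleg1 Z"] Z' by simp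
      show "nf1 (f i) \<in> hom1 Dbl (ddom (nleg1 Z)) (ddom (nleg1 (X i)))" if "i < n" for i
        using leg_sqD(3,8,9)[OF fs(9)[OF that that that]] by (simp add: hom1_def)
    qed blast
    have g': "g \<in> cells1 Dbl" "ddom g = ddom (nleg1 Z)" "dcod g = ddom (nleg1 Y)" "\<And>i. i < n \<Longrightarrow> q i oo g = nf1 (f i)"
      using g by (simp_all add: hom1_def)
    have hp: "fibre_map ob0 (nmap (f j)) = ?p0 j oo fibre_map ob0 h"
      "fibre_map ob1 (nmap (f j)) = ?p1 j oo fibre_map ob1 h" if "j < n" for j
      using h'(1,3) p[OF that] unfolding h(2)[OF that, symmetric] by (simp_all add: fibre0_simps fibre1_simps)
    have hf: "fibre_map ob0 h \<in> cells1 Dbl" "ddom (fibre_map ob0 h) = dcod (nleg0 Z)" "dcod (fibre_map ob0 h) = fibre (nbimod Y) ob0"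
      "fibre_map ob1 h \<in> cells1 Dbl" "ddom (fibre_map ob1 h) = dcod (nleg1 Z)" "dcod (fibre_map ob1 h) = fibre (nbimod Y) ob1"
      using h' Z' by (simp_all add: fibre0_simps fibre1_simps del: LBimod_simps)
    have y: "nleg0 Y \<in> cells1 Dbl" "dcod (nleg0 Y) = fibre (nbimod Y) ob0" "nleg1 Y \<in> cells1 Dbl" "dcod (nleg1 Y) = fibre (nbimod Y) ob1"
      "nleg0 Z \<in> cells1 Dbl" "nleg1 Z \<in> cells1 Dbl" "ddom (nleg0 Z) = Pt" "ddom (nleg0 Y) = Pt"
      using Y' Z' by blast+
    obtain t where t: "leg_sq (fibre_map ob0 h) (nleg0 Z) (dfun_id Pt) (nleg0 Y) t"
      "\<And>j. j < n \<Longrightarrow> ?p0 j *> t = nt0 (f j)"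
      by (rule leg_product_map[OF P0 L0 y(5,1,2) hf(1-3), of "dfun_id Pt" "\<lambda>j. nt0 (f j)"])
        (use y fs(7) hp(1) in simp_all)
    obtain u where u: "leg_sq (fibre_map ob1 h) (nleg1 Z) g (nleg1 Y) u"
      "\<And>j. j < n \<Longrightarrow> ?p1 j *> u = nt1 (f j)"
      by (rule leg_product_map[OF P1 L1 y(6,3,4) hf(4-6) g'(1-3), of "\<lambda>j. nt1 (f j)"])
        (use fs(9) hp(2) g'(4) in simp_all)
    have "point_commuter t"
    proof (rule product_reflects_point_commuter[OF P0])
      show "t \<in> cells2 Dbl" "dcod (tsrc t) = fibre (nbimod Y) ob0" "ddom (tsrc t) = Pt" using leg_sqD[OF t(1)] y by simp_all
      show "point_commuter (?p0 j *> t)" if "j < n" for j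
        using fs(8)[OF that that that] unfolding t(2)[OF that] .
    qed
    moreover have "companion_commuter_trans u"
    proof (rule product_reflects_companion_commuter_trans[OF P1])
      show "u \<in> cells2 Dbl" "dcod (tsrc u) = fibre (nbimod Y) ob1" using leg_sqD[OF u(1)] y by simp_all
      show "companion_commuter_trans (?p1 j *> u)" if "j < n" for j
        using fs(10)[OF that that that] unfolding u(2)[OF that] .
    qed
    ultimately have m: "is_right_niche_map \<lparr>ndom = Z, ncod = Y, nmap = h, nf0 = dfun_id Pt, nf1 = g, nt0 = t, nt1 = u\<rparr>"
      (is "is_right_niche_map ?m")
      using t(1) u(1) Z0 Y h' by (simp add: is_right_niche_map_iff)
    have "niche_cmp (?\<pi> i) ?m = f i" if "i < n" for i
      unfolding cmp[OF that m, of Z, simplified] using fm[OF that] t(2)[OF that] u(2)[OF that] h(2)[OF that] g'(4)[OF that]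
        fs(6)[OF that that that]
      by (intro niche_map.equality) simp_all
    then show "\<exists>h\<in>hom1 RNiche Z Y. \<forall>i<n. cmp1 RNiche (?\<pi> i) h = f i"
      using m by (intro bexI[of _ ?m]) (simp_all add: hom1_RNiche)
  next
    fix Z h k assume hk: "h \<in> hom1 RNiche Z Y" "k \<in> hom1 RNiche Z Y"
      and e: "\<And>i. i < n \<Longrightarrow> cmp1 RNiche (?\<pi> i) h = cmp1 RNiche (?\<pi> i) k"
    have h: "is_right_niche_map h" "ndom h = Z" "ncod h = Y" and k: "is_right_niche_map k" "ndom k = Z" "ncod k = Y"
      using hk by (simp_all add: hom1_RNiche)
    note hs = rniche_map_simps[OF h] and ks = rniche_map_simps[OF k]
    have e': "cmp1 LBimod (p i) (nmap h) = cmp1 LBimod (p i) (nmap k)" "q i oo nf1 h = q i oo nf1 k"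
      "?p0 i *> nt0 h = ?p0 i *> nt0 k"
      "?p1 i *> nt1 h = ?p1 i *> nt1 k" if "i < n" for i
      using e[OF that] by (simp_all add: cmp[OF that h] cmp[OF that k])
    have pe: "nmap h = nmap k"
      by (rule product_map_unique[OF PL two_category_LBimod, of "nmap h" "nbimod Z"])
        (use hs ks e'(1) in \<open>simp_all add: hom1_def\<close>)
    have qe: "nf1 h = nf1 k"
      by (rule product_map_unique[OF PD two_category_Dbl, of "nf1 h" "ddom (nleg1 Z)"])
        (use leg_sqD[OF hs(9)] leg_sqD[OF ks(9)] e'(2) in \<open>simp_all add: hom1_def\<close>)
    have "nt0 h = nt0 k"
      by (rule leg_product_unique[OF P0 hs(7) ks(7)[folded pe]]) (use leg_sqD(7)[OF hs(7)] Y' e'(3) in simp_all)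
    moreover have "nt1 h = nt1 k"
      by (rule leg_product_unique[OF P1 hs(9) ks(9)[folded pe qe]]) (use leg_sqD(7)[OF hs(9)] Y' e'(4) in simp_all)
    ultimately show "h = k" using pe qe h k hs(6) ks(6) by (intro niche_map.equality) simp_all
  next
    fix Z h k a assume hk: "h \<in> hom1 RNiche Z Y" "k \<in> hom1 RNiche Z Y"
      and a: "\<And>i. i < n \<Longrightarrow> a i \<in> hom2 RNiche (cmp1 RNiche (?\<pi> i) h) (cmp1 RNiche (?\<pi> i) k)"
    have h: "is_right_niche_map h" "ndom h = Z" "ncod h = Y" and k: "is_right_niche_map k" "ndom k = Z" "ncod k = Y"
      using hk by (simp_all add: hom1_RNiche)
    note hs = rniche_map_simps[OF h] and ks = rniche_map_simps[OF k]
    have a0: "right_niche_cell (a i)" "nsrc (a i) = niche_cmp (?\<pi> i) h" "ntgt (a i) = niche_cmp (?\<pi> i) k" if "i < n" for i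
      using a[OF that] by (simp_all add: hom2_RNiche)
    have a': "ncell (a i) \<in> cells2 LBimod" "src2 LBimod (ncell (a i)) = cmp1 LBimod (p i) (nmap h)"
      "tgt2 LBimod (ncell (a i)) = cmp1 LBimod (p i) (nmap k)" "nc0 (a i) = ttrans_id (dfun_id Pt)" "nc1 (a i) \<in> cells2 Dbl"
      "tsrc (nc1 (a i)) = q i oo nf1 h" "ttgt (nc1 (a i)) = q i oo nf1 k"
      "leg_cell (nleg0 Z) (nleg0 (X i)) (?p0 i *> nt0 h) (?p0 i *> nt0 k)
        (fibre_trans ob0 (ncell (a i))) (ttrans_id (dfun_id Pt))"
      "leg_cell (nleg1 Z) (nleg1 (X i)) (?p1 i *> nt1 h) (?p1 i *> nt1 k)
        (fibre_trans ob1 (ncell (a i))) (nc1 (a i))" if i: "i < n" for i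
      using a0(1)[OF i] unfolding rniche_cell_iff a0(2,3)[OF i] cmp[OF i h] cmp[OF i k] by simp_all
    obtain c where c: "c \<in> hom2 LBimod (nmap h) (nmap k)" "\<And>i. i < n \<Longrightarrow> hcmp2 LBimod (id2 LBimod (p i)) c = ncell (a i)"
    proof (rule product_cell[OF PL two_category_LBimod, of "nmap h" "nbimod Z" "nmap k" "\<lambda>i. ncell (a i)"])
      show "nmap h \<in> hom1 LBimod (nbimod Z) (nbimod Y)" "nmap k \<in> hom1 LBimod (nbimod Z) (nbimod Y)"
        using hs(3-5) ks(3-5) by (simp_all add: hom1_def)
      show "ncell (a i) \<in> hom2 LBimod (cmp1 LBimod (p i) (nmap h)) (cmp1 LBimod (p i) (nmap k))" if "i < n" for i
        using a'(1-3)[OF that] by (simp add: hom2_def)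
    qed blast
    have c': "c \<in> cells2 LBimod" "src2 LBimod c = nmap h" "tgt2 LBimod c = nmap k" using c(1) by (simp_all add: hom2_def)
    obtain d where d: "d \<in> hom2 Dbl (nf1 h) (nf1 k)" "\<And>i. i < n \<Longrightarrow> hcmp2 Dbl (id2 Dbl (q i)) d = nc1 (a i)"
    proof (rule product_cell[OF PD two_category_Dbl, of "nf1 h" "ddom (nleg1 Z)" "nf1 k" "\<lambda>i. nc1 (a i)"])
      show "nf1 h \<in> hom1 Dbl (ddom (nleg1 Z)) (ddom (nleg1 Y))" "nf1 k \<in> hom1 Dbl (ddom (nleg1 Z)) (ddom (nleg1 Y))"
        using leg_sqD[OF hs(9)] leg_sqD[OF ks(9)] by (simp_all add: hom1_def)
      show "nc1 (a i) \<in> hom2 Dbl (cmp1 Dbl (q i) (nf1 h)) (cmp1 Dbl (q i) (nf1 k))" if "i < n" for i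
        using a'(5-7)[OF that] by (simp add: hom2_def)
    qed blast
    have d': "d \<in> cells2 Dbl" "tsrc d = nf1 h" "ttgt d = nf1 k" "\<And>i. i < n \<Longrightarrow> q i *> d = nc1 (a i)"
      using d by (simp_all add: hom2_def)
    \<comment> \<open>Functoriality of the fibres carries the equations \<open>c(2)\<close> between
      bimodule cells over to the cells that occur in the leg conditions.\<close>
    have ft: "?p0 j *> fibre_trans ob0 c = fibre_trans ob0 (ncell (a j))"
      "?p1 j *> fibre_trans ob1 c = fibre_trans ob1 (ncell (a j))" if "j < n" for j
      using c'(1,2) p[OF that] hs(5) unfolding c(2)[OF that, symmetric] by (simp_all add: fibre0_simps fibre1_simps)
    have fc: "fibre_trans ob0 c \<in> cells2 Dbl" "tsrc (fibre_trans ob0 c) = fibre_map ob0 (nmap h)"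
      "ttgt (fibre_trans ob0 c) = fibre_map ob0 (nmap k)" "fibre_trans ob1 c \<in> cells2 Dbl"
      "tsrc (fibre_trans ob1 c) = fibre_map ob1 (nmap h)" "ttgt (fibre_trans ob1 c) = fibre_map ob1 (nmap k)"
      using c' by (simp_all add: fibre0_simps fibre1_simps)
    have y: "dcod (nleg0 Y) = fibre (nbimod Y) ob0" "dcod (nleg1 Y) = fibre (nbimod Y) ob1" using Y' by blast+
    have "leg_cell (nleg0 Z) (nleg0 Y) (nt0 h) (nt0 k) (fibre_trans ob0 c) (ttrans_id (dfun_id Pt))"
    proof (rule leg_product_cell[OF P0 L0 hs(7) ks(7) y(1) fc(1-3)])
      fix j assume j: "j < n"
      show "leg_cell (nleg0 Z) (nleg0 (X j)) (?p0 j *> nt0 h) (?p0 j *> nt0 k)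
        (?p0 j *> fibre_trans ob0 c) (ttrans_hcmp (ttrans_id (dfun_id Pt)) (ttrans_id (dfun_id Pt)))"
        using a'(8)[OF j] unfolding ft(1)[OF j] by simp
    qed simp_all
    moreover have "leg_cell (nleg1 Z) (nleg1 Y) (nt1 h) (nt1 k) (fibre_trans ob1 c) d"
    proof (rule leg_product_cell[OF P1 L1 hs(9) ks(9) y(2) fc(4-6) d'(1-3)])
      fix j assume j: "j < n"
      show "leg_cell (nleg1 Z) (nleg1 (X j)) (?p1 j *> nt1 h) (?p1 j *> nt1 k)
        (?p1 j *> fibre_trans ob1 c) (q j *> d)"
        using a'(9)[OF j] unfolding ft(2)[OF j] d'(4)[OF j] .
    qed simp_all
    ultimately have m: "right_niche_cell \<lparr>nsrc = h, ntgt = k, ncell = c, nc0 = ttrans_id (dfun_id Pt), nc1 = d\<rparr>"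
      (is "right_niche_cell ?c")
      using h k c' d' by (simp add: rniche_cell_iff)
    have "hcmp2 RNiche (id2 RNiche (?\<pi> i)) ?c = a i" if "i < n" for i
      using a0[OF that] a'(4)[OF that] c(2)[OF that] d'(4)[OF that] by (intro niche_cell.equality) simp_all
    then show "\<exists>c\<in>hom2 RNiche h k. \<forall>i<n. hcmp2 RNiche (id2 RNiche (?\<pi> i)) c = a i"
      using m by (intro bexI[of _ ?c]) (simp_all add: hom2_RNiche)
  next
    fix Z h k c e assume hk: "h \<in> hom1 RNiche Z Y" "k \<in> hom1 RNiche Z Y" and ce: "c \<in> hom2 RNiche h k" "e \<in> hom2 RNiche h k"
      and eq: "\<And>i. i < n \<Longrightarrow> hcmp2 RNiche (id2 RNiche (?\<pi> i)) c = hcmp2 RNiche (id2 RNiche (?\<pi> i)) e"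
    have h: "is_right_niche_map h" "ndom h = Z" "ncod h = Y" and k: "is_right_niche_map k" "ndom k = Z" "ncod k = Y"
      using hk by (simp_all add: hom1_RNiche)
    note hs = rniche_map_simps[OF h] and ks = rniche_map_simps[OF k]
    have c': "right_niche_cell c" "right_niche_cell e" "nsrc c = h" "ntgt c = k" "nsrc e = h" "ntgt e = k"
      using ce by (simp_all add: hom2_RNiche)
    have c1: "ncell c \<in> hom2 LBimod (nmap h) (nmap k)" "ncell e \<in> hom2 LBimod (nmap h) (nmap k)"
      "nc1 c \<in> hom2 Dbl (nf1 h) (nf1 k)" "nc1 e \<in> hom2 Dbl (nf1 h) (nf1 k)" "nc0 c = nc0 e"
      using c' by (simp_all add: hom2_def rniche_cell_iff)
    have "ncell c = ncell e"
    proof (rule product_cell_unique[OF PL two_category_LBimod _ _ c1(1,2)])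
      show "nmap h \<in> hom1 LBimod (nbimod Z) (nbimod Y)" "nmap k \<in> hom1 LBimod (nbimod Z) (nbimod Y)"
        using hs(3-5) ks(3-5) by (simp_all add: hom1_def)
      show "hcmp2 LBimod (id2 LBimod (p i)) (ncell c) = hcmp2 LBimod (id2 LBimod (p i)) (ncell e)" if "i < n" for i
        using eq[OF that] by simp
    qed
    moreover have "nc1 c = nc1 e"
    proof (rule product_cell_unique[OF PD two_category_Dbl _ _ c1(3,4)])
      show "nf1 h \<in> hom1 Dbl (ddom (nleg1 Z)) (ddom (nleg1 Y))" "nf1 k \<in> hom1 Dbl (ddom (nleg1 Z)) (ddom (nleg1 Y))"
        using leg_sqD[OF hs(9)] leg_sqD[OF ks(9)] by (simp_all add: hom1_def)
      show "hcmp2 Dbl (id2 Dbl (q i)) (nc1 c) = hcmp2 Dbl (id2 Dbl (q i)) (nc1 e)" if "i < n" for i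
        using eq[OF that] by simp
    qed
    ultimately show "c = e" using c' c1(5) by (intro niche_cell.equality) simp_all
  }
qed

lemma cartesian_RNiche: "cartesian_two_category (RNiche :: ('u::infinite niche, 'u niche_map, 'u niche_cell) twocat)"
  unfolding cartesian_two_category_def
proof (intro conjI allI impI two_category_RNiche)
  fix n and X :: "nat \<Rightarrow> 'u niche" assume "\<forall>i<n. X i \<in> cells0 RNiche"
  then have X: "is_right_niche (X j)" if "j < n" for j using that by simp
  have X': "nbimod (X j) \<in> cells0 LBimod" "nleg0 (X j) \<in> cells1 Dbl" "ddom (nleg0 (X j)) = Pt"
    "dcod (nleg0 (X j)) = fibre (nbimod (X j)) ob0" "nleg1 (X j) \<in> cells1 Dbl" "dcod (nleg1 (X j)) = fibre (nbimod (X j)) ob1"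
    if "j < n" for j using X[OF that] unfolding is_right_niche_iff is_pointed_iff by blast+
  obtain M p where PL: "is_product LBimod n (\<lambda>j. nbimod (X j)) M p"
    using cartesian_LBimod[unfolded cartesian_two_category_def, THEN conjunct2, rule_format, of n "\<lambda>j. nbimod (X j)"] X'(1) by blast
  have "ddom (nleg1 (X j)) \<in> cells0 Dbl" if "j < n" for j using Dbl.dom1_in[OF X'(5)[OF that]] by simp
  then obtain E q where PD: "is_product Dbl n (\<lambda>j. ddom (nleg1 (X j))) E q"
    using cartesian_Dbl[unfolded cartesian_two_category_def, THEN conjunct2, rule_format, of n "\<lambda>j. ddom (nleg1 (X j))"] by blast
  have q: "q j \<in> cells1 Dbl" "ddom (q j) = E" "dcod (q j) = ddom (nleg1 (X j))" if "j < n" for j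
    using is_productD(3)[OF PD that] by (simp_all add: hom1_def)
  have P0: "is_product Dbl n (\<lambda>j. fibre (nbimod (X j)) ob0) (fibre M ob0) (\<lambda>j. fibre_map ob0 (p j))"
    and P1: "is_product Dbl n (\<lambda>j. fibre (nbimod (X j)) ob1) (fibre M ob1) (\<lambda>j. fibre_map ob1 (p j))"
    by (simp_all add: fibre_preserves_product[OF _ PL])
  \<comment> \<open>The legs of the product niche are induced from those of the factors by the
    products of fibres; hence the projections commute strictly with the legs.\<close>
  obtain d where d: "d \<in> hom1 Dbl Pt (fibre M ob0)" "\<And>j. j < n \<Longrightarrow> cmp1 Dbl (fibre_map ob0 (p j)) d = nleg0 (X j)"
    by (rule product_map[OF P0, of Pt "\<lambda>j. nleg0 (X j)"]) (use X' in \<open>simp_all add: hom1_def\<close>)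
  obtain e where e: "e \<in> hom1 Dbl E (fibre M ob1)" "\<And>j. j < n \<Longrightarrow> cmp1 Dbl (fibre_map ob1 (p j)) e = nleg1 (X j) oo q j"
  proof (rule product_map[OF P1, of E "\<lambda>j. nleg1 (X j) oo q j"])
    show "E \<in> cells0 Dbl" by (rule is_productD(1)[OF PD])
    show "nleg1 (X j) oo q j \<in> hom1 Dbl E (fibre (nbimod (X j)) ob1)" if "j < n" for j
      using q[OF that] X'[OF that] by (simp add: hom1_def)
  qed blast
  let ?Y = "\<lparr>nbimod = M, nleg0 = d, nleg1 = e\<rparr>"
  have Y: "is_right_niche ?Y"
    using d e is_productD(1)[OF PL] by (simp add: is_right_niche_iff is_pointed_iff hom1_def del: LBimod_simps)
  have "is_product RNiche n X ?Y (\<lambda>j. \<lparr>ndom = ?Y, ncod = X j, nmap = p j, nf0 = dfun_id Pt, nf1 = q j,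
    nt0 = ttrans_id (nleg0 (X j)), nt1 = ttrans_id (nleg1 (X j) oo q j)\<rparr>)"
    by (rule niche_product[OF Y X]) (use PL PD d e in \<open>simp_all add: hom1_def\<close>)
  then show "\<exists>y \<pi>. is_product RNiche n X y \<pi>" by blast
qed

section \<open>The 2-functor to right niches and its preservation of products\<close>

lemmas HomL_functor_simps = two_functor.functor_simps[OF two_functor_HomL, unfolded twofun.simps Dbl_simps mem_Collect_eq]

text \<open>By naturality of the legs, \<open>HomL_leg ob1 E oo pmap m\<close> is also the
  restriction of \<open>HomL_map (pmap m)\<close> to the target fibre composed with the right leg of
  the domain. This makes its identity a structure cell of the right leg.\<close>

definition hom_niche_map :: "'u::infinite point_map \<Rightarrow> 'u niche_map" where
  "hom_niche_map m = (let E = dcod (pcod m) in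
     \<lparr>ndom = hom_niche (pdom m), ncod = hom_niche (pcod m), nmap = HomL_map (pmap m), nf0 = dfun_id Pt, nf1 = pmap m,
      nt0 = HomL_leg ob0 E *> piso m, nt1 = ttrans_id (HomL_leg ob1 E oo pmap m)\<rparr>)"

definition hom_niche_cell :: "'u::infinite point_cell \<Rightarrow> 'u niche_cell" where
  "hom_niche_cell c = \<lparr>nsrc = hom_niche_map (psrc c), ntgt = hom_niche_map (ptgt c), ncell = HomL_cell (pcell c),
     nc0 = ttrans_id (dfun_id Pt), nc1 = pcell c\<rparr>"

lemma hom_niche_simps:
  assumes "is_pointed d"
  shows "nbimod (hom_niche d) = HomL (dcod d)" "nleg0 (hom_niche d) = HomL_leg ob0 (dcod d) oo d"
    "nleg1 (hom_niche d) = HomL_leg ob1 (dcod d)" "is_right_niche (hom_niche d)"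
    "double_category (dcod d)" "d \<in> cells1 Dbl" "ddom d = Pt"
proof -
  show d: "d \<in> cells1 Dbl" "ddom d = Pt" and D: "double_category (dcod d)"
    using assms Dbl.cod1_in[of d] by (simp_all add: is_pointed_iff)
  show s: "nbimod (hom_niche d) = HomL (dcod d)" "nleg0 (hom_niche d) = HomL_leg ob0 (dcod d) oo d"
    "nleg1 (hom_niche d) = HomL_leg ob1 (dcod d)"
    using D by (simp_all add: hom_niche_def Let_def)
  show "is_right_niche (hom_niche d)" using d D by (simp add: is_right_niche_iff is_pointed_iff s)
qed

lemma point_mapD:
  assumes "is_point_map m"
  shows "is_pointed (pdom m)" "is_pointed (pcod m)" "pmap m \<in> cells1 Dbl" "ddom (pmap m) = dcod (pdom m)"
    "dcod (pmap m) = dcod (pcod m)" "piso m \<in> cells2 Dbl" "tsrc (piso m) = pmap m oo pdom m" "ttgt (piso m) = pcod m"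
    "point_commuter (piso m)"
proof -
  have l: "leg_sq (pmap m) (pdom m) (dfun_id Pt) (pcod m) (piso m)" by (rule point_map_leg[OF assms refl refl])
  show "is_pointed (pdom m)" "is_pointed (pcod m)" "point_commuter (piso m)" using assms by (simp_all add: is_point_map_iff)
  then show "pmap m \<in> cells1 Dbl" "ddom (pmap m) = dcod (pdom m)" "dcod (pmap m) = dcod (pcod m)" "piso m \<in> cells2 Dbl"
    "tsrc (piso m) = pmap m oo pdom m" "ttgt (piso m) = pcod m"
    using leg_sqD[OF l] by (simp_all add: is_pointed_iff)
qed

lemma HomL_leg_natural':
  assumes "f \<in> cells1 Dbl" "ddom f = D" "dcod f = E"
  shows "fibre_map ob0 (HomL_map f) oo HomL_leg ob0 D = HomL_leg ob0 E oo f"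
    "fibre_map ob1 (HomL_map f) oo HomL_leg ob1 D = HomL_leg ob1 E oo f"
  using HomL_leg_natural[OF ob_Loose(1) assms(1)] HomL_leg_natural[OF ob_Loose(2) assms(1)] assms by simp_all

lemma is_right_niche_map_hom_niche_map:
  assumes "is_point_map m"
  shows "is_right_niche_map (hom_niche_map m)"
proof -
  note m = point_mapD[OF assms] and N = hom_niche_simps[OF point_mapD(1)[OF assms]] and N' = hom_niche_simps[OF point_mapD(2)[OF assms]]
  let ?D = "dcod (pdom m)" and ?E = "dcod (pcod m)"
  have f: "fibre_map ob0 (HomL_map (pmap m)) \<in> cells1 Dbl" "ddom (fibre_map ob0 (HomL_map (pmap m))) = fibre (HomL ?D) ob0"
    "dcod (fibre_map ob0 (HomL_map (pmap m))) = fibre (HomL ?E) ob0"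
    "fibre_map ob1 (HomL_map (pmap m)) \<in> cells1 Dbl" "ddom (fibre_map ob1 (HomL_map (pmap m))) = fibre (HomL ?D) ob1"
    "dcod (fibre_map ob1 (HomL_map (pmap m))) = fibre (HomL ?E) ob1"
    using m(3-5) by simp_all
  note nat = HomL_leg_natural'[OF m(3-5)]
  have "fibre_map ob0 (HomL_map (pmap m)) oo HomL_leg ob0 ?D oo pdom m
    = (fibre_map ob0 (HomL_map (pmap m)) oo HomL_leg ob0 ?D) oo pdom m"
    using f N by simp
  also have "... = HomL_leg ob0 ?E oo pmap m oo pdom m" unfolding nat using m N N' by simp
  finally have e: "fibre_map ob0 (HomL_map (pmap m)) oo HomL_leg ob0 ?D oo pdom m
    = HomL_leg ob0 ?E oo pmap m oo pdom m" .
  have "leg_sq (fibre_map ob0 (HomL_map (pmap m))) (nleg0 (hom_niche (pdom m))) (dfun_id Pt) (nleg0 (hom_niche (pcod m)))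
    (HomL_leg ob0 ?E *> piso m)"
    unfolding leg_sq_def N(2) N'(2) e using m(3-8) f N(5-7) N'(5-7) by simp
  moreover have "leg_sq (fibre_map ob1 (HomL_map (pmap m))) (nleg1 (hom_niche (pdom m))) (pmap m) (nleg1 (hom_niche (pcod m)))
    (ttrans_id (HomL_leg ob1 ?E oo pmap m))"
    unfolding leg_sq_def N(3) N'(3) nat using m(3-5) f N(5-7) N'(5-7) by simp
  moreover have "point_commuter (HomL_leg ob0 ?E *> piso m)"
    by (rule point_commuter_whisker) (use m N N' in simp_all)
  moreover have "companion_commuter_trans (ttrans_id (HomL_leg ob1 ?E oo pmap m))"
    by (rule companion_commuter_trans_id) (use m N' in simp)
  ultimately show ?thesis
    using m(3-5) N(1,4) N'(1,4) by (simp add: is_right_niche_map_iff hom_niche_map_def Let_def HomL_functor_simps)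
qed

text \<open>Naturality of the legs for 2-cells replaces \<open>fibre_trans\<close> whiskered with a
  leg by the leg whiskered with \<open>pcell c\<close>. On the left this reduces the condition to
  that of \<open>c\<close>, whiskered with \<open>HomL_leg\<close>; on the right only identities
  remain beside it.\<close>

lemma right_niche_cell_hom_niche_cell:
  assumes c: "is_point_cell c"
  shows "right_niche_cell (hom_niche_cell c)"
proof -
  have m: "is_point_map (psrc c)" "is_point_map (ptgt c)" and e: "pdom (ptgt c) = pdom (psrc c)" "pcod (ptgt c) = pcod (psrc c)"
    and a: "pcell c \<in> cells2 Dbl" "tsrc (pcell c) = pmap (psrc c)" "ttgt (pcell c) = pmap (ptgt c)"
    and l: "leg_cell (pdom (psrc c)) (pcod (psrc c)) (piso (psrc c)) (piso (ptgt c)) (pcell c) (ttrans_id (dfun_id Pt))"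
    using c by (simp_all add: is_point_cell_iff)
  let ?d = "pdom (psrc c)" and ?e = "pcod (psrc c)" and ?f = "pmap (psrc c)" and ?g = "pmap (ptgt c)" and ?a = "pcell c"
    and ?s = "piso (psrc c)" and ?t = "piso (ptgt c)"
  let ?D = "dcod ?d" and ?E = "dcod ?e"
  let ?H = "\<lambda>X. ttrans_id (HomL_leg ob0 X)" and ?K = "\<lambda>X. ttrans_id (HomL_leg ob1 X)"
  note s = point_mapD[OF m(1)] and t = point_mapD[OF m(2), unfolded e]
  note N = hom_niche_simps[OF s(1)] and N' = hom_niche_simps[OF s(2)]
  have F: "fibre_trans ob0 (HomL_cell ?a) \<in> cells2 Dbl" "tsrc (fibre_trans ob0 (HomL_cell ?a)) = fibre_map ob0 (HomL_map ?f)"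
    "fibre_trans ob1 (HomL_cell ?a) \<in> cells2 Dbl" "tsrc (fibre_trans ob1 (HomL_cell ?a)) = fibre_map ob1 (HomL_map ?f)"
    "ddom (fibre_map ob0 (HomL_map ?f)) = fibre (HomL ?D) ob0" "ddom (fibre_map ob1 (HomL_map ?f)) = fibre (HomL ?D) ob1"
    using a s by simp_all
  have n0: "ttrans_hcmp (fibre_trans ob0 (HomL_cell ?a)) (?H ?D) = ttrans_hcmp (?H ?E) ?a"
    using HomL_leg_natural_cell[OF ob_Loose(1) a(1)] a s by simp
  have n1: "ttrans_hcmp (fibre_trans ob1 (HomL_cell ?a)) (?K ?D) = ttrans_hcmp (?K ?E) ?a"
    using HomL_leg_natural_cell[OF ob_Loose(2) a(1)] a s by simp
  have "fibre_trans ob0 (HomL_cell ?a) <* (HomL_leg ob0 ?D oo ?d)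
    = ttrans_hcmp (fibre_trans ob0 (HomL_cell ?a)) (?H ?D) <* ?d"
    using Dbl.hcmp2_assoc'[of "ttrans_id ?d" "?H ?D" "fibre_trans ob0 (HomL_cell ?a)"] F N by simp
  also have "... = ttrans_hcmp (?H ?E) (?a <* ?d)"
    unfolding n0 by (rule Dbl.hcmp2_assoc') (use a s N N' in simp_all)
  finally have "ttrans_vcmp (ttrans_hcmp (?H ?E) ?t) (fibre_trans ob0 (HomL_cell ?a) <* (HomL_leg ob0 ?D oo ?d))
    = ttrans_hcmp (?H ?E) (ttrans_vcmp ?t (?a <* ?d))"
    using a s t N N' by (simp add: Dbl.whisker_vcmp2)
  also have "... = ttrans_hcmp (?H ?E) ?s"
    unfolding l[unfolded leg_cell_def] using s N' by simp
  finally have 0: "leg_cell (nleg0 (hom_niche ?d)) (nleg0 (hom_niche ?e)) (ttrans_hcmp (?H ?E) ?s) (ttrans_hcmp (?H ?E) ?t)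
    (fibre_trans ob0 (HomL_cell ?a)) (ttrans_id (dfun_id Pt))"
    unfolding leg_cell_def N N' using s N' by simp
  have 1: "leg_cell (nleg1 (hom_niche ?d)) (nleg1 (hom_niche ?e)) (ttrans_id (HomL_leg ob1 ?E oo ?f))
    (ttrans_id (HomL_leg ob1 ?E oo ?g)) (fibre_trans ob1 (HomL_cell ?a)) ?a"
    unfolding leg_cell_def N(3) N'(3) n1 using a s t N' by simp
  show ?thesis
    using is_right_niche_map_hom_niche_map[OF m(1)] is_right_niche_map_hom_niche_map[OF m(2)] a s t 0 1 e
    by (simp add: rniche_cell_iff hom_niche_cell_def hom_niche_map_def Let_def HomL_functor_simps)
qed

lemma hom_niche_map_id:
  assumes "is_pointed d"
  shows "hom_niche_map (id1 Dbl_pt d) = id1 RNiche (hom_niche d)"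
  using hom_niche_simps[OF assms] by (simp add: hom_niche_map_def Let_def HomL_functor_simps del: LBimod_simps)

text \<open>Naturality of the legs moves the restrictions of \<open>HomL_map (pmap g)\<close> past
  the legs. On the left the pasting then becomes the whiskering of the composite \<open>piso\<close>
  with the leg, on the right a composite of identities.\<close>

lemma hom_niche_map_cmp:
  assumes m: "is_point_map f" "is_point_map g" "pdom g = pcod f"
  shows "hom_niche_map (point_cmp g f) = niche_cmp (hom_niche_map g) (hom_niche_map f)"
proof -
  let ?d = "pdom f" and ?e = "pcod f" and ?k = "pcod g"
  let ?D = "dcod ?d" and ?E = "dcod ?e" and ?K = "dcod ?k"
  note a = point_mapD[OF m(1)] and b = point_mapD[OF m(2), unfolded m(3)]
  note N = hom_niche_simps[OF a(1)] and N' = hom_niche_simps[OF a(2)] and N'' = hom_niche_simps[OF b(2)]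
  note nat = HomL_leg_natural'[OF b(3-5)]
  let ?p0 = "fibre_map ob0 (HomL_map (pmap g))" and ?p1 = "fibre_map ob1 (HomL_map (pmap g))"
  have F: "?p0 \<in> cells1 Dbl" "ddom ?p0 = fibre (HomL ?E) ob0" "?p1 \<in> cells1 Dbl" "ddom ?p1 = fibre (HomL ?E) ob1"
    using b by simp_all
  have "?p0 *> HomL_leg ob0 ?E *> piso f
    = (?p0 oo HomL_leg ob0 ?E) *> piso f"
    using F a N' by (simp add: Dbl.whisker_cmp1)
  also have "... = HomL_leg ob0 ?K *> pmap g *> piso f"
    unfolding nat using a b N'' by (simp add: Dbl.whisker_cmp1)
  finally have 0: "paste (HomL_leg ob0 ?K *> piso g) ?p0 (dfun_id Pt)
      (HomL_leg ob0 ?E *> piso f)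
    = HomL_leg ob0 ?K *> ttrans_vcmp (piso g) (pmap g *> piso f)"
    using a b N' N'' by (simp add: paste_def Dbl.whisker_vcmp2)
  have "?p1 oo HomL_leg ob1 ?E oo pmap f = (?p1 oo HomL_leg ob1 ?E) oo pmap f"
    using F a N' by simp
  also have "... = HomL_leg ob1 ?K oo pmap g oo pmap f" unfolding nat using a b N'' by simp
  finally have 1: "paste (ttrans_id (HomL_leg ob1 ?K oo pmap g)) ?p1 (pmap f) (ttrans_id (HomL_leg ob1 ?E oo pmap f))
    = ttrans_id (HomL_leg ob1 ?K oo pmap g oo pmap f)"
    using F a b N' N'' by (simp add: paste_def)
  show ?thesis
    using a(3-5) b(3-5) m(3) 0 1 by (simp add: hom_niche_map_def Let_def niche_cmp_def point_cmp_def HomL_functor_simps)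
qed

lemma two_functor_hom_niche:
  "two_functor Dbl_pt RNiche \<lparr>on0 = hom_niche, on1 = hom_niche_map, on2 = hom_niche_cell\<rparr>"
proof (rule two_functor.intro[OF two_category_Dbl_pt two_category_RNiche], rule two_functor_axioms.intro, unfold twofun.simps,
    goal_cases)
  case (1 x)
  then show ?case by (simp add: hom_niche_simps)
next
  case (2 f x y)
  then show ?case using is_right_niche_map_hom_niche_map[of f] by (auto simp: hom1_Dbl_pt hom1_RNiche hom_niche_map_def Let_def)
next
  case (3 a f g)
  then show ?case using right_niche_cell_hom_niche_cell[of a] by (auto simp: hom2_def hom_niche_cell_def)
next
  case (4 x)
  then show ?case using hom_niche_map_id[of x] by simp
next
  case (5 f x y g z)
  then show ?case using hom_niche_map_cmp[of f g] by (simp add: hom1_Dbl_pt)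
next
  case (6 f)
  then show ?case using point_mapD(3)[of f] by (simp add: hom_niche_cell_def hom_niche_map_def Let_def HomL_functor_simps)
next
  case (7 a f g b h)
  then show ?case by (auto simp: hom2_def hom_niche_cell_def is_point_cell_iff HomL_functor_simps)
next
  case (8 a f f' b g g')
  then have c: "is_point_cell a" "is_point_cell b" "psrc a = f" "ptgt a = f'" "psrc b = g" "ptgt b = g'" "pdom g = pcod f"
    by (simp_all add: hom2_def)
  then have m: "is_point_map f" "is_point_map g" "is_point_map f'" "is_point_map g'" "pdom g' = pcod f'"
    by (auto simp: is_point_cell_iff)
  have "ddom (pmap g) = dcod (pmap f)" using point_mapD(5)[OF m(1)] point_mapD(4)[OF m(2)] c(7) by simp
  then show ?case
    using c hom_niche_map_cmp[OF m(1,2) c(7)] hom_niche_map_cmp[OF m(3,4,5)]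
    by (simp add: hom_niche_cell_def is_point_cell_iff HomL_functor_simps)
qed

text \<open>The image of a strict cone is strict: whiskering an identity with a leg gives an
  identity, and both leg equations follow from naturality of the legs together with
  \<open>p j oo d = X j\<close>. Since \<open>HomL\<close> preserves the underlying product,
  \<open>niche_product\<close> applies.\<close>

lemma hom_niche_preserves_product:
  fixes X :: "nat \<Rightarrow> 'u::infinite dfun"
  assumes P: "is_product Dbl n (\<lambda>j. dcod (X j)) (dcod d) p" and d: "is_pointed d" and X: "\<And>j. j < n \<Longrightarrow> is_pointed (X j)"
    and pX: "\<And>j. j < n \<Longrightarrow> p j oo d = X j"
  shows "is_product RNiche n (\<lambda>j. hom_niche (X j)) (hom_niche d)
    (\<lambda>j. hom_niche_map \<lparr>pdom = d, pcod = X j, pmap = p j, piso = ttrans_id (X j)\<rparr>)"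
proof -
  note N = hom_niche_simps[OF d] and N' = hom_niche_simps[OF X]
  have p: "p j \<in> cells1 Dbl" "ddom (p j) = dcod d" "dcod (p j) = dcod (X j)" if "j < n" for j
    using is_productD(3)[OF P that] by (simp_all add: hom1_def)
  have s0: "fibre_map ob0 (HomL_map (p j)) oo nleg0 (hom_niche d) = nleg0 (hom_niche (X j))" if j: "j < n" for j
  proof -
    have "fibre_map ob0 (HomL_map (p j)) oo nleg0 (hom_niche d)
      = (fibre_map ob0 (HomL_map (p j)) oo HomL_leg ob0 (dcod d)) oo d"
      unfolding N(2) by (rule Dbl.cmp1_assoc'[symmetric]) (use N p[OF j] in simp_all)
    also have "... = HomL_leg ob0 (dcod (X j)) oo p j oo d"
      unfolding HomL_leg_natural'[OF p[OF j]] by (rule Dbl.cmp1_assoc') (use N N'(5)[OF j] p[OF j] in simp_all)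
    finally show ?thesis unfolding pX[OF j] N'(2)[OF j] .
  qed
  have "is_product RNiche n (\<lambda>j. hom_niche (X j)) (hom_niche d) (\<lambda>j. \<lparr>ndom = hom_niche d, ncod = hom_niche (X j),
    nmap = HomL_map (p j), nf0 = dfun_id Pt, nf1 = p j, nt0 = ttrans_id (nleg0 (hom_niche (X j))),
    nt1 = ttrans_id (nleg1 (hom_niche (X j)) oo p j)\<rparr>)"
  proof (rule niche_product[OF N(4) N'(4)])
    show "is_product LBimod n (\<lambda>j. nbimod (hom_niche (X j))) (nbimod (hom_niche d)) (\<lambda>j. HomL_map (p j))"
      unfolding N(1) by (rule is_product_cong[OF HomL_preserves_product[OF P]]) (simp_all add: N'(1))
    show "is_product Dbl n (\<lambda>j. ddom (nleg1 (hom_niche (X j)))) (ddom (nleg1 (hom_niche d))) p"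
      using is_product_cong[OF P, of "\<lambda>j. ddom (nleg1 (hom_niche (X j)))" p] N(3,5) N'(3,5) by simp
    show "fibre_map ob1 (HomL_map (p j)) oo nleg1 (hom_niche d) = nleg1 (hom_niche (X j)) oo p j"
      if "j < n" for j unfolding N(3) N'(3)[OF that] by (rule HomL_leg_natural'(2)[OF p[OF that]])
  qed (use s0 in simp_all)
  then show ?thesis
    by (rule is_product_cong) (use N' in \<open>simp_all add: hom_niche_map_def Let_def\<close>)
qed

theorem proposition5p9:
  shows "\<exists>p :: ('u::infinite dfun, 'u point_map, 'u point_cell,
                 'u niche, 'u niche_map, 'u niche_cell) twofun.
           cartesian_two_functor Dbl_pt RNiche p \<and>
           (\<forall>d \<in> cells0 Dbl_pt. on0 p d = hom_niche d)"
proof -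
  let ?p = "\<lparr>on0 = hom_niche, on1 = hom_niche_map, on2 = hom_niche_cell\<rparr> ::
    ('u dfun, 'u point_map, 'u point_cell, 'u niche, 'u niche_map, 'u niche_cell) twofun"
  interpret two_functor Dbl_pt RNiche ?p by (rule two_functor_hom_niche)
  have "is_product RNiche n (on0 ?p \<circ> X) (on0 ?p y) (on1 ?p \<circ> \<pi>)" if P: "is_product Dbl_pt n X y \<pi>" for n X y \<pi>
  proof -
    have X: "is_pointed (X j)" if "j < n" for j using is_productD(2)[OF P that] by simp
    obtain d p where d: "is_pointed d" "is_product Dbl n (\<lambda>j. dcod (X j)) (dcod d) p" "\<And>j. j < n \<Longrightarrow> p j oo d = X j"
      by (rule strict_pointed_cone[of n X, OF X]; use that in simp)
    show ?thesis
      by (rule preserves_product[OF P pointed_product[OF d(2,1) X d(3)]])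
        (use hom_niche_preserves_product[OF d(2,1) X d(3)] in \<open>simp_all add: comp_def\<close>)
  qed
  then have "cartesian_two_functor Dbl_pt RNiche ?p"
    unfolding cartesian_two_functor_def using cartesian_Dbl_pt cartesian_RNiche two_functor_axioms by blast
  then show ?thesis by (intro exI[of _ ?p]) simp
qed

end
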